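(* Let $G$ be a finite group. Let $\alpha \colon G \to \mathrm{Aut}(\mathcal{O}_{\infty})$ be a quasifree action. Then $\alpha$ is equivariantly semiprojective.
   Context: For a topological group $G$ (finite groups are discrete), a unital $G$-algebra $(G, A, \alpha)$ is a unital C*-algebra $A$ with a continuous action $\alpha \colon G \to \mathrm{Aut}(A)$. Ideals are closed and two-sided, homomorphisms are $*$-homomorphisms, and quotients by $G$-invariant ideals carry the induced actions. Equivariantly semiprojective: a unital $G$-algebra $(G, A, \alpha)$ (or the action $\alpha$) is equivariantly semiprojective if whenever $(G, C, \gamma)$ is a unital $G$-algebra, $J_0 \subset J_1 \subset \cdots$ are $G$-invariant ideals in $C$, $J = \overline{\bigcup_{n=0}^{\infty} J_n}$, $\pi_n \colon C/J_n \to C/J$ are the quotient maps, and $\varphi \colon A \to C/J$ is a unital equivariant homomorphism, then there exist $n$ and a unital equivariant homomorphism $\psi \colon A \to C/J_n$ such that $\pi_n \circ \psi = \varphi$. $\mathcal{O}_{\infty}$ is the universal unital C*-algebra generated by isometries $s_1, s_2, \ldots$ with pairwise orthogonal range projections. Quasifree actions on $\mathcal{O}_\infty$: let $U_{\infty}$ be the group of unitary operators on $l^2(\mathbb{Z}_{>0})$ with the strong operator topology. There is a unique continuous action $\gamma^{(\infty)} \colon U_{\infty} \to \mathrm{Aut}(\mathcal{O}_{\infty})$ such that, for a unitary $u$ with matrix $(u_{j,k})_{j,k=1}^{\infty}$ in the standard basis, $\gamma^{(\infty)}_u(s_k) = \sum_{j=1}^{\infty} u_{j,k} s_j$ (norm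 convergent) for all $k$. A quasifree action of $G$ on $\mathcal{O}_{\infty}$ is an action of the form $\gamma^{(\infty)} \circ \rho$ for some continuous homomorphism $\rho \colon G \to U_{\infty}$, i.e. some unitary representation of $G$ on $l^2(\mathbb{Z}_{>0})$. *)

theory Defs
  imports "HOL-Analysis.Analysis" "HOL-Algebra.Algebra" "HOL-Algebra.Algebraic_Closure_Type"
begin

section \<open>Unital C*-algebras on carrier sets\<close>

abbreviation complex_ring :: "complex ring" where
  "complex_ring \<equiv> ring_of_type_algebra"

record 'a cstar = "(complex, 'a) module" +
  star :: "'a \<Rightarrow> 'a"
  nrm :: "'a \<Rightarrow> real"

text \<open>Outside the carrier the distance is 0, because \<^locale>\<open>Metric_space\<close> requires a distance
  that is nonnegative and symmetric on the whole type.\<close>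

definition cdist :: "'a cstar \<Rightarrow> 'a \<Rightarrow> 'a \<Rightarrow> real" where
  "cdist A x y =
     (if x \<in> carrier A \<and> y \<in> carrier A then nrm A (x \<ominus>\<^bsub>A\<^esub> y) else 0)"

definition cstar_top :: "'a cstar \<Rightarrow> 'a topology" where
  "cstar_top A = Metric_space.mtopology (carrier A) (cdist A)"

text \<open>The zero algebra is allowed.\<close>

locale unital_cstar = Module.module complex_ring A + ring A
  for A :: "'a cstar" (structure) +
  assumes smult_mult_left:
      "\<lbrakk>x \<in> carrier A; y \<in> carrier A\<rbrakk> \<Longrightarrow> (c \<odot> x) \<otimes> y = c \<odot> (x \<otimes> y)"
    and smult_mult_right:
      "\<lbrakk>x \<in> carrier A; y \<in> carrier A\<rbrakk> \<Longrightarrow> x \<otimes> (c \<odot> y) = c \<odot> (x \<otimes> y)"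
    and star_closed: "x \<in> carrier A \<Longrightarrow> star A x \<in> carrier A"
    and star_star: "x \<in> carrier A \<Longrightarrow> star A (star A x) = x"
    and star_add: "\<lbrakk>x \<in> carrier A; y \<in> carrier A\<rbrakk> \<Longrightarrow> star A (x \<oplus> y) = star A x \<oplus> star A y"
    and star_smult: "x \<in> carrier A \<Longrightarrow> star A (c \<odot> x) = cnj c \<odot> star A x"
    and star_mult: "\<lbrakk>x \<in> carrier A; y \<in> carrier A\<rbrakk> \<Longrightarrow> star A (x \<otimes> y) = star A y \<otimes> star A x"
    and nrm_nonneg: "x \<in> carrier A \<Longrightarrow> 0 \<le> nrm A x"
    and nrm_eq_0: "x \<in> carrier A \<Longrightarrow> nrm A x = 0 \<longleftrightarrow> x = \<zero>"
    and nrm_add: "\<lbrakk>x \<in> carrier A; y \<in> carrier A\<rbrakk> \<Longrightarrow> nrm A (x \<oplus> y) \<le> nrm A x + nrm A y"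
    and nrm_smult: "x \<in> carrier A \<Longrightarrow> nrm A (c \<odot> x) = cmod c * nrm A x"
    and nrm_mult: "\<lbrakk>x \<in> carrier A; y \<in> carrier A\<rbrakk> \<Longrightarrow> nrm A (x \<otimes> y) \<le> nrm A x * nrm A y"
    and nrm_star_mult: "x \<in> carrier A \<Longrightarrow> nrm A (star A x \<otimes> x) = (nrm A x)\<^sup>2"
    and complete: "Metric_space.mcomplete (carrier A) (cdist A)"

definition cstar_hom :: "'a cstar \<Rightarrow> 'b cstar \<Rightarrow> ('a \<Rightarrow> 'b) set" where
  "cstar_hom A B = {h \<in> ring_hom A B.
     (\<forall>c. \<forall>x\<in>carrier A. h (c \<odot>\<^bsub>A\<^esub> x) = c \<odot>\<^bsub>B\<^esub> h x) \<and>
     (\<forall>x\<in>carrier A. h (star A x) = star B (h x))}"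

definition cstar_Aut :: "'a cstar \<Rightarrow> ('a \<Rightarrow> 'a) monoid" where
  "cstar_Aut A = BijGroup (carrier A) \<lparr>carrier := Bij (carrier A) \<inter> cstar_hom A A\<rparr>"

definition closed_ideal :: "'a cstar \<Rightarrow> 'a set \<Rightarrow> bool" where
  "closed_ideal A J \<longleftrightarrow> ideal J A \<and> closedin (cstar_top A) J"

definition unital_cstar_subalgebra :: "'a cstar \<Rightarrow> 'a set \<Rightarrow> bool" where
  "unital_cstar_subalgebra A S \<longleftrightarrow>
     subring S A \<and> (\<forall>c. \<forall>x\<in>S. c \<odot>\<^bsub>A\<^esub> x \<in> S) \<and> (\<forall>x\<in>S. star A x \<in> S) \<and>
     closedin (cstar_top A) S"

text \<open>The ring part is the quotient ring of cosets from HOL-Algebra. Scalar multiplication uses the same union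
  of cosets as \<^const>\<open>rcoset_mult\<close>, so that multiplication by 0 gives \<open>J\<close>.\<close>

definition cstar_Quot :: "'a cstar \<Rightarrow> 'a set \<Rightarrow> 'a set cstar" where
  "cstar_Quot A J =
     \<lparr>carrier = carrier (A Quot J), mult = monoid.mult (A Quot J), one = \<one>\<^bsub>A Quot J\<^esub>,
      ring.zero = \<zero>\<^bsub>A Quot J\<^esub>, add = ring.add (A Quot J),
      smult = (\<lambda>c P. (\<Union>x\<in>P. J +>\<^bsub>A\<^esub> (c \<odot>\<^bsub>A\<^esub> x))),
      star = (\<lambda>P. (\<Union>x\<in>P. J +>\<^bsub>A\<^esub> star A x)),
      nrm = (\<lambda>P. Inf (nrm A ` P))\<rparr>"

definition quotient_map :: "'a cstar \<Rightarrow> 'a set \<Rightarrow> 'a set \<Rightarrow> 'a set" where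
  "quotient_map A J P = (\<Union>x\<in>P. J +>\<^bsub>A\<^esub> x)"

section \<open>Group actions and equivariant semiprojectivity\<close>

text \<open>Groups carry no topology here, i.e. they are discrete, so continuity of an action
  or of a unitary representation is automatic.\<close>

definition unital_G_algebra ::
    "('g, 'm) monoid_scheme \<Rightarrow> 'a cstar \<Rightarrow> ('g \<Rightarrow> 'a \<Rightarrow> 'a) \<Rightarrow> bool" where
  "unital_G_algebra G A \<alpha> \<longleftrightarrow> group G \<and> unital_cstar A \<and> \<alpha> \<in> hom G (cstar_Aut A)"

definition invariant ::
    "('g, 'm) monoid_scheme \<Rightarrow> ('g \<Rightarrow> 'a \<Rightarrow> 'a) \<Rightarrow> 'a set \<Rightarrow> bool" where
  "invariant G \<alpha> J \<longleftrightarrow> (\<forall>g\<in>carrier G. \<alpha> g ` J \<subseteq> J)"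

definition quotient_action ::
    "'a cstar \<Rightarrow> 'a set \<Rightarrow> ('g \<Rightarrow> 'a \<Rightarrow> 'a) \<Rightarrow> 'g \<Rightarrow> 'a set \<Rightarrow> 'a set" where
  "quotient_action A J \<alpha> g = (\<lambda>P\<in>carrier (cstar_Quot A J). \<Union>x\<in>P. J +>\<^bsub>A\<^esub> \<alpha> g x)"

definition equivariant_hom ::
    "('g, 'm) monoid_scheme \<Rightarrow> 'a cstar \<Rightarrow> ('g \<Rightarrow> 'a \<Rightarrow> 'a) \<Rightarrow>
     'b cstar \<Rightarrow> ('g \<Rightarrow> 'b \<Rightarrow> 'b) \<Rightarrow> ('a \<Rightarrow> 'b) set" where
  "equivariant_hom G A \<alpha> B \<beta> =
     {h \<in> cstar_hom A B. \<forall>g\<in>carrier G. \<forall>a\<in>carrier A. h (\<alpha> g a) = \<beta> g (h a)}"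

text \<open>The type argument only fixes the type carrying the test algebras; a theorem
  with a free type variable there covers all test algebras.\<close>

definition equivariantly_semiprojective ::
    "'c itself \<Rightarrow> ('g, 'm) monoid_scheme \<Rightarrow> 'a cstar \<Rightarrow> ('g \<Rightarrow> 'a \<Rightarrow> 'a) \<Rightarrow> bool" where
  "equivariantly_semiprojective _ G A \<alpha> \<longleftrightarrow>
     unital_G_algebra G A \<alpha> \<and>
     (\<forall>(C :: 'c cstar) \<gamma> (Jn :: nat \<Rightarrow> 'c set) J \<phi>.
        unital_G_algebra G C \<gamma> \<longrightarrow>
        (\<forall>n. closed_ideal C (Jn n) \<and> invariant G \<gamma> (Jn n)) \<longrightarrow>
        (\<forall>n. Jn n \<subseteq> Jn (Suc n)) \<longrightarrow>
        J = cstar_top C closure_of (\<Union>n. Jn n) \<longrightarrow>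
        \<phi> \<in> equivariant_hom G A \<alpha> (cstar_Quot C J) (quotient_action C J \<gamma>) \<longrightarrow>
        (\<exists>n. \<exists>\<psi> \<in> equivariant_hom G A \<alpha> (cstar_Quot C (Jn n)) (quotient_action C (Jn n) \<gamma>).
           \<forall>a\<in>carrier A. quotient_map C J (\<psi> a) = \<phi> a))"

section \<open>The Cuntz algebra on infinitely many generators\<close>

text \<open>The generators are indexed from 0.\<close>

definition isometries_orthogonal_ranges :: "'a cstar \<Rightarrow> (nat \<Rightarrow> 'a) \<Rightarrow> bool" where
  "isometries_orthogonal_ranges A s \<longleftrightarrow>
     (\<forall>j. s j \<in> carrier A \<and> star A (s j) \<otimes>\<^bsub>A\<^esub> s j = \<one>\<^bsub>A\<^esub>) \<and>
     (\<forall>i j. i \<noteq> j \<longrightarrow>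
        (s i \<otimes>\<^bsub>A\<^esub> star A (s i)) \<otimes>\<^bsub>A\<^esub> (s j \<otimes>\<^bsub>A\<^esub> star A (s j)) = \<zero>\<^bsub>A\<^esub>)"

definition generates_cstar :: "'a cstar \<Rightarrow> 'a set \<Rightarrow> bool" where
  "generates_cstar A P \<longleftrightarrow> P \<subseteq> carrier A \<and>
     (\<forall>S. unital_cstar_subalgebra A S \<longrightarrow> P \<subseteq> S \<longrightarrow> S = carrier A)"

text \<open>A definition cannot quantify over all types, so the universal property is stated for
  test algebras carried by a set of functions from \<^typ>\<open>nat\<close> to \<^typ>\<open>nat\<close>. Nothing is lost: a
  C*-algebra generated by a sequence is separable and hence has at most continuum cardinality.
  The fact \<open>Cuntz_infinity_universal\<close> below recovers the property for test algebras on
  arbitrary types.\<close>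

definition Cuntz_infinity :: "'a cstar \<Rightarrow> (nat \<Rightarrow> 'a) \<Rightarrow> bool" where
  "Cuntz_infinity A s \<longleftrightarrow>
     unital_cstar A \<and> isometries_orthogonal_ranges A s \<and> generates_cstar A (range s) \<and>
     (\<forall>(B :: (nat \<Rightarrow> nat) cstar) t. unital_cstar B \<longrightarrow> isometries_orthogonal_ranges B t \<longrightarrow>
        (\<exists>\<phi>\<in>cstar_hom A B. \<forall>j. \<phi> (s j) = t j))"

section \<open>Quasifree actions\<close>

definition l2 :: "(nat \<Rightarrow> complex) set" where
  "l2 = {x. summable (\<lambda>n. (cmod (x n))\<^sup>2)}"

definition l2_inner :: "(nat \<Rightarrow> complex) \<Rightarrow> (nat \<Rightarrow> complex) \<Rightarrow> complex" where
  "l2_inner x y = suminf (\<lambda>n. x n * cnj (y n))"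

definition l2_basis :: "nat \<Rightarrow> nat \<Rightarrow> complex" where
  "l2_basis k = (\<lambda>n. if n = k then 1 else 0)"

definition l2_unitaries :: "((nat \<Rightarrow> complex) \<Rightarrow> nat \<Rightarrow> complex) set" where
  "l2_unitaries = {u \<in> Bij l2.
     (\<forall>x\<in>l2. \<forall>y\<in>l2. u (\<lambda>n. x n + y n) = (\<lambda>n. u x n + u y n)) \<and>
     (\<forall>c. \<forall>x\<in>l2. u (\<lambda>n. c * x n) = (\<lambda>n. c * u x n)) \<and>
     (\<forall>x\<in>l2. \<forall>y\<in>l2. l2_inner (u x) (u y) = l2_inner x y)}"

definition U_infinity :: "((nat \<Rightarrow> complex) \<Rightarrow> nat \<Rightarrow> complex) monoid" where
  "U_infinity = BijGroup l2 \<lparr>carrier := l2_unitaries\<rparr>"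

text \<open>\<open>u (l2_basis k) j\<close> is the matrix entry of \<open>u\<close> in row \<open>j\<close> and column \<open>k\<close>. The automorphism is unique because the generators determine it.\<close>

definition gamma_infinity ::
    "'a cstar \<Rightarrow> (nat \<Rightarrow> 'a) \<Rightarrow> ((nat \<Rightarrow> complex) \<Rightarrow> nat \<Rightarrow> complex) \<Rightarrow> 'a \<Rightarrow> 'a" where
  "gamma_infinity A s u = (THE \<phi>. \<phi> \<in> carrier (cstar_Aut A) \<and>
     (\<forall>k. limitin (cstar_top A) (\<lambda>n. \<Oplus>\<^bsub>A\<^esub>j\<in>{..<n}. u (l2_basis k) j \<odot>\<^bsub>A\<^esub> s j)
        (\<phi> (s k)) sequentially))"

definition quasifree_action ::
    "('g, 'm) monoid_scheme \<Rightarrow> 'a cstar \<Rightarrow> (nat \<Rightarrow> 'a) \<Rightarrow> ('g \<Rightarrow> 'a \<Rightarrow> 'a) \<Rightarrow> bool" where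
  "quasifree_action G A s \<alpha> \<longleftrightarrow> unital_G_algebra G A \<alpha> \<and>
     (\<exists>\<rho>\<in>hom G U_infinity. \<forall>g\<in>carrier G. \<alpha> g = gamma_infinity A s (\<rho> g))"

section \<open>The universal property on arbitrary types\<close>

lemma carrier_complex_ring [simp]: "c \<in> carrier complex_ring"
  "x \<otimes>\<^bsub>complex_ring\<^esub> y = x * y" "x \<oplus>\<^bsub>complex_ring\<^esub> y = x + y"
  "\<one>\<^bsub>complex_ring\<^esub> = 1" "\<zero>\<^bsub>complex_ring\<^esub> = 0"
  by (simp_all add: ring_of_type_algebra_def)

context unital_cstar
begin

lemma scale_closed [simp]: "x \<in> carrier A \<Longrightarrow> c \<odot> x \<in> carrier A"
  using smult_closed[of c x] by simp

lemma scale_minus1: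
  assumes "x \<in> carrier A" shows "(- 1) \<odot> x = \<ominus> x"
proof -
  have "(-1) \<odot> x \<oplus> x = ((-1) + 1) \<odot> x"
    using smult_l_distr[of "-1" 1 x] smult_one[of x] assms by simp
  also have "\<dots> = \<zero>" using smult_l_null[of x] assms by simp
  finally show ?thesis using assms by (simp add: minus_equality)
qed

lemma nrm_zero [simp]: "nrm A \<zero> = 0" by (simp add: nrm_eq_0)

lemma nrm_minus [simp]: "x \<in> carrier A \<Longrightarrow> nrm A (\<ominus> x) = nrm A x"
  using nrm_smult[of x "-1"] by (simp add: scale_minus1)

lemma nrm_minus_commute:
  assumes "x \<in> carrier A" "y \<in> carrier A" shows "nrm A (x \<ominus> y) = nrm A (y \<ominus> x)"
proof -
  have "y \<ominus> x = \<ominus> (x \<ominus> y)" using assms by (simp add: minus_eq minus_add a_comm)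
  then show ?thesis using assms by simp
qed

lemma nrm_star_le:
  assumes "x \<in> carrier A" shows "nrm A x \<le> nrm A (star A x)"
proof (cases "nrm A x = 0")
  case False
  have "(nrm A x)\<^sup>2 \<le> nrm A (star A x) * nrm A x"
    using nrm_star_mult[of x] nrm_mult[of "star A x" x] star_closed assms by simp
  then show ?thesis using False nrm_nonneg[OF assms] by (simp add: power2_eq_square)
qed (simp add: nrm_nonneg star_closed assms)

lemma nrm_star: "x \<in> carrier A \<Longrightarrow> nrm A (star A x) = nrm A x"
  using nrm_star_le[of x] nrm_star_le[of "star A x"] by (simp add: star_closed star_star)

lemma metric: "Metric_space (carrier A) (cdist A)"
proof
  show "0 \<le> cdist A x y" for x y by (simp add: cdist_def nrm_nonneg)
  show "cdist A x y = cdist A y x" for x y by (simp add: cdist_def nrm_minus_commute)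
  show "cdist A x y = 0 \<longleftrightarrow> x = y" if "x \<in> carrier A" "y \<in> carrier A" for x y
    using that by (simp add: cdist_def nrm_eq_0)
  show "cdist A x z \<le> cdist A x y + cdist A y z"
    if "x \<in> carrier A" "y \<in> carrier A" "z \<in> carrier A" for x y z
  proof -
    have "x \<ominus> z = (x \<ominus> y) \<oplus> (y \<ominus> z)"
      using that by (simp add: minus_eq a_assoc r_neg1)
    then show ?thesis
      using that nrm_add[of "x \<ominus> y" "y \<ominus> z"] by (simp add: cdist_def)
  qed
qed

end

sublocale unital_cstar \<subseteq> met: Metric_space "carrier A" "cdist A"
  by (rule metric)


definition transport :: "'a cstar \<Rightarrow> 'a set \<Rightarrow> ('a \<Rightarrow> 'b) \<Rightarrow> 'b cstar" where
  "transport A S f = (let g = the_inv_into S f in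
     \<lparr>carrier = f ` S, monoid.mult = (\<lambda>u v. f (g u \<otimes>\<^bsub>A\<^esub> g v)), one = f \<one>\<^bsub>A\<^esub>,
      ring.zero = f \<zero>\<^bsub>A\<^esub>, add = (\<lambda>u v. f (g u \<oplus>\<^bsub>A\<^esub> g v)),
      smult = (\<lambda>c u. f (c \<odot>\<^bsub>A\<^esub> g u)), star = (\<lambda>u. f (star A (g u))),
      nrm = (\<lambda>u. nrm A (g u))\<rparr>)"

lemma (in unital_cstar) transport:
  assumes S: "unital_cstar_subalgebra A S" and f: "inj_on f S"
  shows "unital_cstar (transport A S f)"
    and "the_inv_into S f \<in> cstar_hom (transport A S f) A"
proof -
  interpret S: subring S A using S by (simp add: unital_cstar_subalgebra_def)
  let ?B = "transport A S f"
  let ?g = "the_inv_into S f"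
  have Sc: "closedin met.mtopology S"
    and Ssc: "\<And>c x. x \<in> S \<Longrightarrow> c \<odot> x \<in> S" and Sst: "\<And>x. x \<in> S \<Longrightarrow> star A x \<in> S"
    using S by (auto simp: unital_cstar_subalgebra_def cstar_top_def)
  have SA: "\<And>x. x \<in> S \<Longrightarrow> x \<in> carrier A" using S.subset by auto
  have g[simp]: "\<And>x. x \<in> S \<Longrightarrow> ?g (f x) = x" using the_inv_into_f_f[OF f] .
  have cB: "carrier ?B = f ` S" by (simp add: transport_def Let_def)
  have ops: "\<one>\<^bsub>?B\<^esub> = f \<one>" "\<zero>\<^bsub>?B\<^esub> = f \<zero>"
    "\<And>x y. x \<in> S \<Longrightarrow> y \<in> S \<Longrightarrow> f x \<otimes>\<^bsub>?B\<^esub> f y = f (x \<otimes> y)"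
    "\<And>x y. x \<in> S \<Longrightarrow> y \<in> S \<Longrightarrow> f x \<oplus>\<^bsub>?B\<^esub> f y = f (x \<oplus> y)"
    "\<And>x c. x \<in> S \<Longrightarrow> c \<odot>\<^bsub>?B\<^esub> f x = f (c \<odot> x)"
    "\<And>x. x \<in> S \<Longrightarrow> star ?B (f x) = f (star A x)"
    "\<And>x. x \<in> S \<Longrightarrow> nrm ?B (f x) = nrm A x"
    by (simp_all add: transport_def Let_def)
  have cl: "\<one> \<in> S" "\<zero> \<in> S" "\<And>x y. x \<in> S \<Longrightarrow> y \<in> S \<Longrightarrow> x \<otimes> y \<in> S"
    "\<And>x y. x \<in> S \<Longrightarrow> y \<in> S \<Longrightarrow> x \<oplus> y \<in> S" "\<And>x. x \<in> S \<Longrightarrow> \<ominus> x \<in> S"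
    using S.one_closed S.m_closed subringE[OF S.subring_axioms] by auto
  have finj: "\<And>x y. x \<in> S \<Longrightarrow> y \<in> S \<Longrightarrow> f x = f y \<longleftrightarrow> x = y"
    using f by (auto simp: inj_on_def)
  have ab: "abelian_group ?B"
  proof (rule abelian_groupI)
    fix x assume "x \<in> carrier ?B"
    then obtain a where a: "a \<in> S" "x = f a" by (auto simp: cB)
    then have "f (\<ominus> a) \<oplus>\<^bsub>?B\<^esub> x = \<zero>\<^bsub>?B\<^esub>"
      by (simp add: ops cl SA l_neg)
    then show "\<exists>y\<in>carrier ?B. y \<oplus>\<^bsub>?B\<^esub> x = \<zero>\<^bsub>?B\<^esub>" using a cl by (auto simp: cB)
  qed (auto simp: cB ops cl SA a_assoc a_comm a_lcomm)
  have rB: "Ring.ring ?B"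
    by (rule ringI[OF ab monoidI]) (auto simp: cB ops cl SA m_assoc l_distr r_distr)
  interpret B: Ring.ring ?B by (fact rB)
  have mB: "Module.module complex_ring ?B"
  proof (rule Module.moduleI[OF _ ab])
    show "cring complex_ring" by unfold_locales
  next
    fix x a b assume x: "x \<in> carrier ?B" "a \<in> carrier complex_ring" "b \<in> carrier complex_ring"
    show "(a \<oplus>\<^bsub>complex_ring\<^esub> b) \<odot>\<^bsub>?B\<^esub> x = a \<odot>\<^bsub>?B\<^esub> x \<oplus>\<^bsub>?B\<^esub> b \<odot>\<^bsub>?B\<^esub> x"
      using x smult_l_distr[of a b] by (auto simp: cB ops cl Ssc SA)
    show "(a \<otimes>\<^bsub>complex_ring\<^esub> b) \<odot>\<^bsub>?B\<^esub> x = a \<odot>\<^bsub>?B\<^esub> (b \<odot>\<^bsub>?B\<^esub> x)"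
      using x smult_assoc1[of a b] by (auto simp: cB ops cl Ssc SA)
  next
    fix x assume x: "x \<in> carrier ?B"
    show "\<one>\<^bsub>complex_ring\<^esub> \<odot>\<^bsub>?B\<^esub> x = x"
      using x smult_one by (auto simp: cB ops cl Ssc SA)
  qed (auto simp: cB ops cl Ssc SA smult_r_distr)
  have minusB: "f x \<ominus>\<^bsub>?B\<^esub> f y = f (x \<ominus> y)" if "x \<in> S" "y \<in> S" for x y
  proof -
    have "\<ominus>\<^bsub>?B\<^esub> f y = f (\<ominus> y)"
      by (rule B.minus_equality) (use that in \<open>simp_all add: ops cl SA l_neg cB\<close>)
    then show ?thesis using that by (simp add: a_minus_def ops cl)
  qed
  have dB: "cdist ?B (f x) (f y) = cdist A x y" if "x \<in> S" "y \<in> S" for x y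
  proof -
    have "x \<ominus> y \<in> S" using that cl by (simp add: a_minus_def)
    then show ?thesis using that by (simp add: cdist_def minusB ops cl SA cB)
  qed
  have doff: "cdist ?B x y = 0" if "x \<notin> f ` S \<or> y \<notin> f ` S" for x y
    using that by (auto simp: cdist_def cB)
  have metB: "Metric_space (carrier ?B) (cdist ?B)"
  proof
    show "0 \<le> cdist ?B x y" for x y
      by (cases "x \<in> carrier ?B \<and> y \<in> carrier ?B") (auto simp: cB dB doff)
    show "cdist ?B x y = cdist ?B y x" for x y
      by (cases "x \<in> carrier ?B \<and> y \<in> carrier ?B") (auto simp: cB dB doff met.commute)
    show "cdist ?B x y = 0 \<longleftrightarrow> x = y" if "x \<in> carrier ?B" "y \<in> carrier ?B" for x y
      using that by (auto simp: cB dB SA)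
    show "cdist ?B x z \<le> cdist ?B x y + cdist ?B y z"
      if "x \<in> carrier ?B" "y \<in> carrier ?B" "z \<in> carrier ?B" for x y z
      using that by (auto simp: cB dB SA intro: met.triangle[OF SA SA SA])
  qed
  interpret MB: Metric_space "carrier ?B" "cdist ?B" by (fact metB)
  have comp: "MB.mcomplete"
    unfolding MB.mcomplete_def
  proof (intro allI impI)
    fix \<sigma> assume \<sigma>: "MB.MCauchy \<sigma>"
    then have "range \<sigma> \<subseteq> carrier ?B" by (simp add: MB.MCauchy_def)
    then have "\<forall>n. \<exists>x\<in>S. \<sigma> n = f x" unfolding cB by blast
    then obtain \<tau> where \<tau>: "\<And>n. \<tau> n \<in> S" "\<And>n. \<sigma> n = f (\<tau> n)" by metis
    have "met.MCauchy \<tau>" using \<sigma> \<tau> SA by (auto simp: MB.MCauchy_def met.MCauchy_def dB)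
    then obtain l where l: "limitin met.mtopology \<tau> l sequentially"
      using complete by (auto simp: met.mcomplete_def)
    have lS: "l \<in> S" by (rule limitin_closedin[OF l Sc]) (use \<tau> in auto)
    have mem: "f x \<in> carrier ?B" if "x \<in> S" for x using that by (simp add: cB)
    have "limitin MB.mtopology \<sigma> (f l) sequentially"
      using l lS \<tau> mem by (simp add: met.limitin_metric_dist_null MB.limitin_metric_dist_null dB)
    then show "\<exists>x. limitin MB.mtopology \<sigma> x sequentially" ..
  qed
  show "unital_cstar ?B"
  proof (intro unital_cstar.intro unital_cstar_axioms.intro mB rB comp)
    fix x y assume "x \<in> carrier ?B" "y \<in> carrier ?B"
    then obtain a b where ab: "a \<in> S" "x = f a" "b \<in> S" "y = f b" by (auto simp: cB)
    note simps = ab cB ops cl Ssc Sst SA finj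
    show "(c \<odot>\<^bsub>?B\<^esub> x) \<otimes>\<^bsub>?B\<^esub> y = c \<odot>\<^bsub>?B\<^esub> (x \<otimes>\<^bsub>?B\<^esub> y)" for c
      using smult_mult_left by (simp add: simps)
    show "x \<otimes>\<^bsub>?B\<^esub> (c \<odot>\<^bsub>?B\<^esub> y) = c \<odot>\<^bsub>?B\<^esub> (x \<otimes>\<^bsub>?B\<^esub> y)" for c
      using smult_mult_right by (simp add: simps)
    show "star ?B (x \<oplus>\<^bsub>?B\<^esub> y) = star ?B x \<oplus>\<^bsub>?B\<^esub> star ?B y" by (simp add: simps star_add)
    show "star ?B (x \<otimes>\<^bsub>?B\<^esub> y) = star ?B y \<otimes>\<^bsub>?B\<^esub> star ?B x" by (simp add: simps star_mult)
    show "nrm ?B (x \<oplus>\<^bsub>?B\<^esub> y) \<le> nrm ?B x + nrm ?B y" by (simp add: simps nrm_add)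
    show "nrm ?B (x \<otimes>\<^bsub>?B\<^esub> y) \<le> nrm ?B x * nrm ?B y" by (simp add: simps nrm_mult)
  next
    fix x assume "x \<in> carrier ?B"
    then obtain a where ab: "a \<in> S" "x = f a" by (auto simp: cB)
    note simps = ab cB ops cl Ssc Sst SA finj
    show "star ?B x \<in> carrier ?B" by (simp add: simps)
    show "star ?B (star ?B x) = x" by (simp add: simps star_star)
    show "star ?B (c \<odot>\<^bsub>?B\<^esub> x) = cnj c \<odot>\<^bsub>?B\<^esub> star ?B x" for c by (simp add: simps star_smult)
    show "0 \<le> nrm ?B x" by (simp add: simps nrm_nonneg)
    show "nrm ?B x = 0 \<longleftrightarrow> x = \<zero>\<^bsub>?B\<^esub>" by (simp add: simps nrm_eq_0)
    show "nrm ?B (c \<odot>\<^bsub>?B\<^esub> x) = cmod c * nrm ?B x" for c by (simp add: simps nrm_smult)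
    show "nrm ?B (star ?B x \<otimes>\<^bsub>?B\<^esub> x) = (nrm ?B x)\<^sup>2" by (simp add: simps nrm_star_mult)
  qed
  show "?g \<in> cstar_hom ?B A"
    by (auto simp: cstar_hom_def cB ops cl Ssc Sst SA intro!: ring_hom_memI)
qed


datatype cexpr = One | Gen nat | Plus cexpr cexpr | Times cexpr cexpr | Adj cexpr | Scale nat cexpr

instance cexpr :: countable by countable_datatype

primrec ceval :: "'a cstar \<Rightarrow> (nat \<Rightarrow> complex) \<Rightarrow> (nat \<Rightarrow> 'a) \<Rightarrow> cexpr \<Rightarrow> 'a" where
  "ceval A q t One = \<one>\<^bsub>A\<^esub>"
| "ceval A q t (Gen j) = t j"
| "ceval A q t (Plus e e') = ceval A q t e \<oplus>\<^bsub>A\<^esub> ceval A q t e'"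
| "ceval A q t (Times e e') = ceval A q t e \<otimes>\<^bsub>A\<^esub> ceval A q t e'"
| "ceval A q t (Adj e) = star A (ceval A q t e)"
| "ceval A q t (Scale n e) = q n \<odot>\<^bsub>A\<^esub> ceval A q t e"

lemma dense_complex_sequence:
  obtains q :: "nat \<Rightarrow> complex" where "\<And>c \<epsilon>. \<epsilon> > 0 \<Longrightarrow> \<exists>n. cmod (q n - c) < \<epsilon>"
proof -
  obtain D :: "complex set" where D: "countable D"
    "\<And>P. open P \<Longrightarrow> P \<noteq> {} \<Longrightarrow> \<exists>d\<in>D. d \<in> P"
    using countable_dense_exists by blast
  have "D \<noteq> {}" using D(2)[of UNIV] by auto
  then obtain q :: "nat \<Rightarrow> complex" where q: "D = range q"
    using D(1) uncountable_def by blast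
  have "\<exists>n. cmod (q n - c) < \<epsilon>" if "\<epsilon> > 0" for c \<epsilon>
    using D(2)[of "ball c \<epsilon>"] that by (auto simp: q dist_norm norm_minus_commute)
  then show thesis by (rule that)
qed

lemma (in unital_cstar) separable_subalgebra:
  fixes t :: "nat \<Rightarrow> 'a"
  assumes t: "\<And>j. t j \<in> carrier A"
  obtains S and f :: "'a \<Rightarrow> nat \<Rightarrow> nat"
  where "unital_cstar_subalgebra A S" "range t \<subseteq> S" "inj_on f S"
proof -
  obtain q :: "nat \<Rightarrow> complex" where q: "\<And>c \<epsilon>. \<epsilon> > 0 \<Longrightarrow> \<exists>n. cmod (q n - c) < \<epsilon>"
    using dense_complex_sequence by blast
  let ?e = "ceval A q t"
  have eA [simp]: "?e x \<in> carrier A" for x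
    by (induction x) (auto simp: t star_closed)
  define lim where "lim = (\<lambda>\<sigma> x. ((\<lambda>n. nrm A (?e (\<sigma> n) \<ominus> x)) \<longlongrightarrow> 0) sequentially)"
  define S where "S = {x \<in> carrier A. \<exists>\<sigma>. lim \<sigma> x}"
  have SI: "x \<in> S" if "x \<in> carrier A" "lim \<sigma> x" for x \<sigma>
    using that by (auto simp: S_def)
  have SI_bound: "x \<in> S"
    if "x \<in> carrier A" "b \<longlonglongrightarrow> 0" "\<And>n. nrm A (?e (\<sigma> n) \<ominus> x) \<le> b n" for x b \<sigma>
    by (rule SI[OF that(1), of \<sigma>], unfold lim_def)
      (rule tendsto_sandwich[OF _ _ tendsto_const that(2)], use that in \<open>auto simp: nrm_nonneg\<close>)
  have SE: "\<exists>\<sigma>. lim \<sigma> x" if "x \<in> S" for x using that by (auto simp: S_def)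
  have SA: "x \<in> carrier A" if "x \<in> S" for x using that by (auto simp: S_def)
  have eS: "?e x \<in> S" for x
    by (rule SI_bound[of _ "\<lambda>_. 0" "\<lambda>_. x"]) (simp_all add: minus_eq r_neg)
  have add: "x \<oplus> y \<in> S" if xyS: "x \<in> S" "y \<in> S" for x y
  proof -
    obtain \<sigma> \<tau> where st: "lim \<sigma> x" "lim \<tau> y"
      using SE[OF xyS(1)] SE[OF xyS(2)] by blast
    have "nrm A (?e (Plus (\<sigma> n) (\<tau> n)) \<ominus> (x \<oplus> y))
        \<le> nrm A (?e (\<sigma> n) \<ominus> x) + nrm A (?e (\<tau> n) \<ominus> y)" for n
    proof -
      have "?e (Plus (\<sigma> n) (\<tau> n)) \<ominus> (x \<oplus> y) = (?e (\<sigma> n) \<ominus> x) \<oplus> (?e (\<tau> n) \<ominus> y)"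
        using that SA by (simp add: minus_eq minus_add a_ac)
      then show ?thesis using that SA by (simp add: nrm_add)
    qed
    moreover have "(\<lambda>n. nrm A (?e (\<sigma> n) \<ominus> x) + nrm A (?e (\<tau> n) \<ominus> y)) \<longlonglongrightarrow> 0"
      using tendsto_add[OF st[unfolded lim_def]] by simp
    ultimately show ?thesis
      using SI_bound[of "x \<oplus> y" _ "\<lambda>n. Plus (\<sigma> n) (\<tau> n)"] SA[OF xyS(1)] SA[OF xyS(2)] by simp
  qed
  have mult: "x \<otimes> y \<in> S" if xyS: "x \<in> S" "y \<in> S" for x y
  proof -
    obtain \<sigma> \<tau> where st: "lim \<sigma> x" "lim \<tau> y"
      using SE[OF xyS(1)] SE[OF xyS(2)] by blast
    have xy: "x \<in> carrier A" "y \<in> carrier A" using that SA by auto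
    let ?a = "\<lambda>n. nrm A (?e (\<sigma> n) \<ominus> x)" and ?b = "\<lambda>n. nrm A (?e (\<tau> n) \<ominus> y)"
    have "nrm A (?e (Times (\<sigma> n) (\<tau> n)) \<ominus> (x \<otimes> y)) \<le> (?a n + nrm A x) * ?b n + ?a n * nrm A y" for n
    proof -
      let ?u = "?e (\<sigma> n)" and ?v = "?e (\<tau> n)"
      have "?u = (?u \<ominus> x) \<oplus> x" using xy by (simp add: minus_eq a_assoc l_neg)
      then have u: "nrm A ?u \<le> ?a n + nrm A x"
        using nrm_add[of "?u \<ominus> x" x] xy by simp
      have "?u \<otimes> ?v \<ominus> x \<otimes> y = ?u \<otimes> (?v \<ominus> y) \<oplus> (?u \<ominus> x) \<otimes> y"
        using xy eA[of "\<sigma> n"] eA[of "\<tau> n"] by algebra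
      then have "nrm A (?u \<otimes> ?v \<ominus> x \<otimes> y) \<le> nrm A (?u \<otimes> (?v \<ominus> y)) + nrm A ((?u \<ominus> x) \<otimes> y)"
        using xy by (simp add: nrm_add)
      also have "\<dots> \<le> nrm A ?u * ?b n + ?a n * nrm A y"
        using xy by (intro add_mono nrm_mult) auto
      also have "\<dots> \<le> (?a n + nrm A x) * ?b n + ?a n * nrm A y"
        using u xy by (intro add_mono mult_right_mono) (auto simp: nrm_nonneg)
      finally show ?thesis by simp
    qed
    moreover have "(\<lambda>n. (?a n + nrm A x) * ?b n + ?a n * nrm A y) \<longlonglongrightarrow> (0 + nrm A x) * 0 + 0 * nrm A y"
      using st unfolding lim_def by (intro tendsto_intros)
    ultimately show ?thesis
      using SI_bound[of "x \<otimes> y" _ "\<lambda>n. Times (\<sigma> n) (\<tau> n)"] xy by simp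
  qed
  have star: "star A x \<in> S" if xS: "x \<in> S" for x
  proof -
    obtain \<sigma> where st: "lim \<sigma> x" using SE[OF xS] by blast
    have "nrm A (?e (Adj (\<sigma> n)) \<ominus> star A x) \<le> nrm A (?e (\<sigma> n) \<ominus> x)" for n
    proof -
      have m: "\<ominus> star A x = star A (\<ominus> x)"
        using star_smult[of x "-1"] SA[OF that] by (simp add: scale_minus1 star_closed)
      have "?e (Adj (\<sigma> n)) \<ominus> star A x = star A (?e (\<sigma> n) \<ominus> x)"
        using SA[OF that] by (simp add: minus_eq star_add m)
      then show ?thesis using SA[OF that] by (simp add: nrm_star)
    qed
    then show ?thesis
      using SI_bound[of "star A x" _ "\<lambda>n. Adj (\<sigma> n)", OF star_closed[OF SA[OF xS]] st[unfolded lim_def]]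
      by simp
  qed
  have scale: "c \<odot> x \<in> S" if xS: "x \<in> S" for c x
  proof -
    obtain \<sigma> where st: "lim \<sigma> x" using SE[OF xS] by blast
    have "\<forall>n. \<exists>k. cmod (q k - c) < 1 / Suc n" using q by simp
    then obtain k where k: "\<And>n. cmod (q (k n) - c) < 1 / Suc n" by metis
    have "(\<lambda>n. cmod (q (k n) - c)) \<longlonglongrightarrow> 0"
      by (rule tendsto_sandwich[OF _ _ tendsto_const LIMSEQ_inverse_real_of_nat])
        (use k in \<open>auto intro!: always_eventually less_imp_le simp: inverse_eq_divide\<close>)
    then have "(\<lambda>n. cmod (q (k n) - c) * (nrm A (?e (\<sigma> n) \<ominus> x) + nrm A x)
        + cmod c * nrm A (?e (\<sigma> n) \<ominus> x)) \<longlonglongrightarrow> 0 * (0 + nrm A x) + cmod c * 0"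
      using st unfolding lim_def by (intro tendsto_intros)
    moreover have "nrm A (?e (Scale (k n) (\<sigma> n)) \<ominus> c \<odot> x)
        \<le> cmod (q (k n) - c) * (nrm A (?e (\<sigma> n) \<ominus> x) + nrm A x)
          + cmod c * nrm A (?e (\<sigma> n) \<ominus> x)" for n
    proof -
      let ?u = "?e (\<sigma> n)"
      note x = SA[OF that]
      have "?u = (?u \<ominus> x) \<oplus> x" using x by (simp add: minus_eq a_assoc l_neg)
      then have u: "nrm A ?u \<le> nrm A (?u \<ominus> x) + nrm A x"
        using nrm_add[of "?u \<ominus> x" x] x by simp
      have mm: "\<ominus> (d \<odot> y) = (- d) \<odot> y" if "y \<in> carrier A" for d y
        using smult_assoc1[of "-1" d y] that by (simp add: scale_minus1)
      have 1: "(q (k n) - c) \<odot> ?u = q (k n) \<odot> ?u \<ominus> c \<odot> ?u"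
        using smult_l_distr[of "q (k n)" "-c" ?u] by (simp add: minus_eq mm)
      have 2: "c \<odot> (?u \<ominus> x) = c \<odot> ?u \<ominus> c \<odot> x"
        using smult_r_distr[of c ?u "\<ominus> x"] x smult_assoc1[of c "-1" x]
        by (simp add: minus_eq mm scale_minus1)
      have "q (k n) \<odot> ?u \<ominus> c \<odot> x = (q (k n) - c) \<odot> ?u \<oplus> c \<odot> (?u \<ominus> x)"
        unfolding 1 2 using x by (simp add: minus_eq a_assoc r_neg1)
      then have "nrm A (q (k n) \<odot> ?u \<ominus> c \<odot> x)
          \<le> nrm A ((q (k n) - c) \<odot> ?u) + nrm A (c \<odot> (?u \<ominus> x))"
        using x by (simp add: nrm_add)
      also have "\<dots> = cmod (q (k n) - c) * nrm A ?u + cmod c * nrm A (?u \<ominus> x)"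
        using x by (simp add: nrm_smult)
      also have "\<dots> \<le> cmod (q (k n) - c) * (nrm A (?u \<ominus> x) + nrm A x) + cmod c * nrm A (?u \<ominus> x)"
        using u by (intro add_mono mult_left_mono) auto
      finally show ?thesis by simp
    qed
    ultimately show ?thesis using SI_bound[of "c \<odot> x" _ "\<lambda>n. Scale (k n) (\<sigma> n)"] SA[OF that] by simp
  qed
  have neg: "\<ominus> x \<in> S" if "x \<in> S" for x
    using scale[OF that, of "-1"] SA[OF that] by (simp add: scale_minus1)
  have one: "\<one> \<in> S" using eS[of One] by simp
  have zero: "\<zero> \<in> S" using add[OF one neg[OF one]] by (simp add: r_neg)
  have sub: "subring S A"
    by (rule subringI) (auto simp: SA one neg mult add)
  have closed: "closedin met.mtopology S"
    unfolding met.metric_closedin_iff_sequentially_closed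
  proof (intro conjI allI impI)
    show "S \<subseteq> carrier A" using SA by auto
    fix \<tau> l assume tl: "range \<tau> \<subseteq> S \<and> limitin met.mtopology \<tau> l sequentially"
    then have l: "l \<in> carrier A" and c: "(\<lambda>n. cdist A (\<tau> n) l) \<longlonglongrightarrow> 0"
      by (auto simp: met.limitin_metric_dist_null)
    have \<tau>: "\<tau> n \<in> S" for n using tl by auto
    have "\<exists>e. nrm A (?e e \<ominus> \<tau> n) < 1 / Suc n" for n
    proof -
      obtain \<sigma> where "lim \<sigma> (\<tau> n)" using SE[OF \<tau>] by blast
      then have "\<forall>\<^sub>F m in sequentially. nrm A (?e (\<sigma> m) \<ominus> \<tau> n) < 1 / Suc n"
        unfolding lim_def by (rule order_tendstoD(2)) simp
      then obtain m where "nrm A (?e (\<sigma> m) \<ominus> \<tau> n) < 1 / Suc n"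
        using eventually_happens'[OF sequentially_bot] by blast
      then show ?thesis ..
    qed
    then obtain \<sigma> where \<sigma>: "\<And>n. nrm A (?e (\<sigma> n) \<ominus> \<tau> n) < 1 / Suc n" by metis
    have "nrm A (?e (\<sigma> n) \<ominus> l) \<le> inverse (Suc n) + cdist A (\<tau> n) l" for n
      using met.triangle[of "?e (\<sigma> n)" "\<tau> n" l] \<sigma>[of n] l SA[OF \<tau>]
      by (simp add: cdist_def inverse_eq_divide)
    moreover have "(\<lambda>n. inverse (Suc n) + cdist A (\<tau> n) l) \<longlonglongrightarrow> 0"
      using tendsto_add[OF LIMSEQ_inverse_real_of_nat c] by simp
    ultimately show "l \<in> S" using SI_bound[OF l] by blast
  qed
  define F where "F x = (SOME \<sigma>. lim \<sigma> x)" for x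
  have F: "lim (F x) x" if "x \<in> S" for x unfolding F_def by (rule someI_ex[OF SE[OF that]])
  have injF: "x = y" if "x \<in> S" "y \<in> S" "F x = F y" for x y
  proof -
    have L: "limitin met.mtopology (\<lambda>n. ?e (F z n)) z sequentially" if "z \<in> S" for z
      using F[OF that] SA[OF that] by (simp add: met.limitin_metric_dist_null lim_def cdist_def)
    show ?thesis
      using met.limitin_metric_unique[OF L[OF that(1)]] L[OF that(2)] that(3) by auto
  qed
  show thesis
  proof (rule that[of S "\<lambda>x. to_nat \<circ> F x"])
    show "unital_cstar_subalgebra A S"
      using sub scale star closed by (simp add: unital_cstar_subalgebra_def cstar_top_def)
    show "range t \<subseteq> S" using eS[of "Gen _"] by auto
    show "inj_on (\<lambda>x. to_nat \<circ> F x) S"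
    proof (rule inj_onI)
      fix x y assume *: "x \<in> S" "y \<in> S" "to_nat \<circ> F x = to_nat \<circ> F y"
      then have "F x = F y" by (auto simp: fun_eq_iff)
      then show "x = y" using injF * by blast
    qed
  qed
qed

lemma cstar_hom_comp:
  assumes "h \<in> cstar_hom A B" "k \<in> cstar_hom B C"
  shows "k \<circ> h \<in> cstar_hom A C"
proof -
  have "h x \<in> carrier B" if "x \<in> carrier A" for x
    using assms that by (auto simp: cstar_hom_def ring_hom_def)
  then show ?thesis
    using assms by (auto simp: cstar_hom_def ring_hom_trans)
qed

theorem Cuntz_infinity_universal:
  fixes B :: "'b cstar"
  assumes A: "Cuntz_infinity A s" and B: "unital_cstar B" and t: "isometries_orthogonal_ranges B t"
  shows "\<exists>\<phi>\<in>cstar_hom A B. \<forall>j. \<phi> (s j) = t j"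
proof -
  interpret B: unital_cstar B by (fact B)
  obtain S and f :: "'b \<Rightarrow> nat \<Rightarrow> nat" where
    S: "unital_cstar_subalgebra B S" "range t \<subseteq> S" and f: "inj_on f S"
    using B.separable_subalgebra[of t] t by (auto simp: isometries_orthogonal_ranges_def)
  interpret S: subring S B using S by (simp add: unital_cstar_subalgebra_def)
  let ?T = "transport B S f" and ?g = "the_inv_into S f"
  note T = B.transport[OF S(1) f]
  have g: "?g (f x) = x" if "x \<in> S" for x using the_inv_into_f_f[OF f that] .
  have tS: "t j \<in> S" for j using S by auto
  have stS: "star B x \<in> S" if "x \<in> S" for x using S(1) that by (auto simp: unital_cstar_subalgebra_def)
  have "isometries_orthogonal_ranges ?T (\<lambda>j. f (t j))"
    using t by (auto simp: isometries_orthogonal_ranges_def transport_def Let_def g tS stS)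
  then obtain \<phi> where \<phi>: "\<phi> \<in> cstar_hom A ?T" "\<And>j. \<phi> (s j) = f (t j)"
    using A T(1) unfolding Cuntz_infinity_def by blast
  then have "?g \<circ> \<phi> \<in> cstar_hom A B" "\<forall>j. (?g \<circ> \<phi>) (s j) = t j"
    using cstar_hom_comp T(2) by (auto simp: g tS)
  then show ?thesis by blast
qed

end

theory Submission
  imports Defs
begin

text \<open>The generators and their translates span a space \<open>H\<close> in which \<open>x\<^sup>* y\<close> is always a scalar, and \<open>H\<close> is
  exhausted by finite-dimensional invariant subspaces. Some element of \<open>A\<close> has pairwise orthogonal
  translates under the distinct automorphisms \<open>\<alpha> g\<close>; multiplying it by unit vectors of \<open>H\<close> and summing
  the translates gives fixed isometries. Families that are orthonormal in \<open>C/J\<close> are almost orthonormal at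
  some finite stage \<open>C/J\<^sub>n\<close> and can be perturbed equivariantly, so finitely many of these isometries lift
  to one stage. No further change of \<open>n\<close> is needed: a fixed isometry \<open>w\<close> orthogonal to what has been lifted
  makes room for a copy of the next block of \<open>H\<close> at the same stage, except that its image in \<open>C/J\<close> is wrong.
  The symmetry of \<open>C/J\<close> that exchanges this image with the desired one lifts, on the complement
  of what has been lifted, to a fixed isometry of \<open>C/J\<^sub>n\<close>, and multiplying by it corrects the image. In the
  limit over the blocks one obtains a lift on \<open>H\<close>, hence on \<open>A\<close> by the universal property.\<close>

section \<open>Elementary functional calculus\<close>

text \<open>The obstacle is that infinitely many generators have to be lifted to one
  \<open>n\<close>. Perturbing an almost orthonormal family handles finitely many elements, and
  every use of it for lifting may force \<open>n\<close> up; so it is used for lifting exactly once,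
  on the translates of two vectors. The translates of the first give a reserved isometry with known
  image. Those of the second carry the regular representation of the group of automorphisms \<alpha>
  g, and this representation absorbs every other one: an equivariant copy of any block can therefore
  be written down inside \<open>C/J\<^sub>n\<close>, with nothing left to lift but the correction of
  its image. That correction needs a unitary of \<open>C/J\<close> that lifts. Arbitrary unitaries
  of a quotient do not, but a symmetry has an explicit square root up to a scalar; hence each block
  is exchanged with an orthogonal copy instead of being moved by a general unitary. Spectral theory
  is avoided throughout: positivity, square roots and the contractivity of homomorphisms are drawn
  from contraction fixed points and the C*-identity.\<close>

context unital_cstar
begin

section \<open>Scalars, adjoints and norms\<close>

declare star_closed [simp] star_star [simp]

lemma smult_smult [simp]: "x \<in> carrier A \<Longrightarrow> c \<odot> (d \<odot> x) = (c * d) \<odot> x"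
  using smult_assoc1[of c d x] by simp

lemma smult_1 [simp]: "x \<in> carrier A \<Longrightarrow> 1 \<odot> x = x"
  using smult_one[of x] by simp

lemma smult_0 [simp]: "x \<in> carrier A \<Longrightarrow> 0 \<odot> x = \<zero>"
  using smult_l_null[of x] by simp

lemma smult_zero [simp]: "c \<odot> \<zero> = \<zero>"
  using smult_r_null[of c] by simp

lemma smult_add_right: "\<lbrakk>x \<in> carrier A; y \<in> carrier A\<rbrakk> \<Longrightarrow> c \<odot> (x \<oplus> y) = c \<odot> x \<oplus> c \<odot> y"
  using smult_r_distr[of c x y] by simp

lemma smult_add_left: "x \<in> carrier A \<Longrightarrow> (c + d) \<odot> x = c \<odot> x \<oplus> d \<odot> x"
  using smult_l_distr[of c d x] by simp

lemma minus_smult: "x \<in> carrier A \<Longrightarrow> \<ominus> (c \<odot> x) = (- c) \<odot> x"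
  using scale_minus1[of "c \<odot> x"] by simp

lemma smult_minus: "x \<in> carrier A \<Longrightarrow> c \<odot> (\<ominus> x) = (- c) \<odot> x"
  using scale_minus1[of x, symmetric] by simp

lemma smult_diff_right: "\<lbrakk>x \<in> carrier A; y \<in> carrier A\<rbrakk> \<Longrightarrow> c \<odot> (x \<ominus> y) = c \<odot> x \<ominus> c \<odot> y"
  by (simp add: minus_eq smult_add_right minus_smult smult_minus)

lemma smult_diff_left: "x \<in> carrier A \<Longrightarrow> (c - d) \<odot> x = c \<odot> x \<ominus> d \<odot> x"
  using smult_add_left[of x c "- d"] by (simp add: minus_eq minus_smult)

lemma star_zero [simp]: "star A \<zero> = \<zero>"
  using star_smult[of \<zero> 0] by simp

lemma star_one [simp]: "star A \<one> = \<one>"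
  using star_mult[of \<one> "star A \<one>"] by simp

lemma star_minus: "x \<in> carrier A \<Longrightarrow> star A (\<ominus> x) = \<ominus> star A x"
  using star_smult[of x "-1"] by (simp add: scale_minus1)

lemma star_diff: "\<lbrakk>x \<in> carrier A; y \<in> carrier A\<rbrakk> \<Longrightarrow> star A (x \<ominus> y) = star A x \<ominus> star A y"
  by (simp add: minus_eq star_add star_minus)

lemma nrm_diff: "\<lbrakk>x \<in> carrier A; y \<in> carrier A\<rbrakk> \<Longrightarrow> nrm A (x \<ominus> y) \<le> nrm A x + nrm A y"
  using nrm_add[of x "\<ominus> y"] by (simp add: minus_eq)

lemma nrm_diff_triangle:
  assumes "x \<in> carrier A" "y \<in> carrier A" "z \<in> carrier A"
  shows "nrm A (x \<ominus> z) \<le> nrm A (x \<ominus> y) + nrm A (y \<ominus> z)"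
  using met.triangle[of x y z] assms by (simp add: cdist_def)

lemmas ring_nf = minus_eq l_distr r_distr l_minus r_minus minus_add a_ac m_assoc r_neg r_neg1 r_neg2

lemma nrm_one_le: "nrm A \<one> \<le> 1"
proof -
  have "nrm A \<one> = (nrm A \<one>)\<^sup>2" using nrm_star_mult[of \<one>] by simp
  then have "nrm A \<one> * (nrm A \<one> - 1) = 0" by (simp add: power2_eq_square algebra_simps)
  then show ?thesis by auto
qed

lemma nrm_one: "\<one> \<noteq> \<zero> \<Longrightarrow> nrm A \<one> = 1"
proof -
  assume "\<one> \<noteq> \<zero>"
  moreover have "nrm A \<one> = (nrm A \<one>)\<^sup>2" using nrm_star_mult[of \<one>] by simp
  ultimately show ?thesis by (simp add: power2_eq_square nrm_eq_0)
qed

lemma nrm_isometry: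
  assumes "x \<in> carrier A" "star A x \<otimes> x = \<one>" shows "nrm A x \<le> 1"
proof -
  have "(nrm A x)\<^sup>2 \<le> 1" using nrm_star_mult[of x] nrm_one_le assms by simp
  then show ?thesis using power2_le_imp_le[of "nrm A x" 1] by simp
qed

lemma nrm_projection:
  assumes "p \<in> carrier A" "star A p = p" "p \<otimes> p = p" shows "nrm A p \<le> 1"
proof -
  have "(nrm A p)\<^sup>2 = nrm A p" using nrm_star_mult[of p] assms by simp
  then have "nrm A p * (nrm A p - 1) = 0" by (simp add: power2_eq_square algebra_simps)
  then show ?thesis by auto
qed

lemma nrm_eq_of_star_mult_eq:
  assumes "x \<in> carrier A" "y \<in> carrier A" "star A x \<otimes> x = star A y \<otimes> y"
  shows "nrm A x = nrm A y"
proof -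
  have "(nrm A x)\<^sup>2 = (nrm A y)\<^sup>2" using nrm_star_mult[of x] nrm_star_mult[of y] assms by simp
  then show ?thesis using nrm_nonneg assms by (simp add: power2_eq_iff_nonneg)
qed

lemma eq_zero_of_star_mult:
  assumes "x \<in> carrier A" "star A x \<otimes> x = \<zero>" shows "x = \<zero>"
  using nrm_star_mult[of x] assms by (simp add: nrm_eq_0)

section \<open>Fixed points of contractions and square roots\<close>

lemma contraction_fixpoint:
  assumes b: "0 \<le> b" and r: "r < 1"
    and f: "\<And>y. y \<in> carrier A \<Longrightarrow> nrm A y \<le> b \<Longrightarrow> f y \<in> carrier A \<and> nrm A (f y) \<le> b"
    and con: "\<And>y z. \<lbrakk>y \<in> carrier A; nrm A y \<le> b; z \<in> carrier A; nrm A z \<le> b\<rbrakk>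
      \<Longrightarrow> nrm A (f y \<ominus> f z) \<le> r * nrm A (y \<ominus> z)"
  obtains y where "y \<in> carrier A" "nrm A y \<le> b" "f y = y"
proof -
  \<comment> \<open>Banach's theorem is applied to the closed ball of radius \<open>b\<close>, which
    inherits completeness. Square roots and inverses are obtained below as such fixed points instead
    of power series.\<close>
  define S where "S = met.mcball \<zero> b"
  have S: "y \<in> S \<longleftrightarrow> y \<in> carrier A \<and> nrm A y \<le> b" for y
    by (auto simp: S_def cdist_def minus_eq)
  interpret S: Submetric "carrier A" "cdist A" S
    by unfold_locales (auto simp: S)
  have comp: "S.sub.mcomplete"
    by (rule S.closedin_mcomplete_imp_mcomplete[OF _ complete]) (simp add: S_def)
  have "\<zero> \<in> S" using b by (simp add: S)
  then have ne: "S \<noteq> {}" by auto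
  obtain y where "y \<in> S" "f y = y"
    by (rule S.sub.Banach_fixedpoint_thm[OF comp ne, of f r])
      (use f con r in \<open>auto simp: S cdist_def\<close>)
  then show thesis using that by (auto simp: S)
qed

text \<open>Plays the part of uniqueness in Banach's theorem, but also serves for errors that are
  not differences of two fixed points, such as commutators and eigenvector defects.\<close>

lemma contracted_eq_zero:
  assumes "x \<in> carrier A" "nrm A x \<le> r * nrm A x" "r < 1" shows "x = \<zero>"
proof -
  have "(1 - r) * nrm A x \<le> 0" using assms(2) by (simp add: algebra_simps)
  then have "nrm A x \<le> 0" using assms(3) by (simp add: mult_le_0_iff)
  then show ?thesis using assms(1) nrm_nonneg[of x] by (simp add: nrm_eq_0)
qed

text \<open>If \<open>y\<close> solves \<open>y = (x + y\<^sup>2) / 2\<close>, then \<open>(1 - y)\<^sup>2 = 1 - x\<close>. For \<open>\<parallel>x\<parallel> < 1\<close> the equation is a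
  contraction, so self-adjointness and commutation of \<open>y\<close> follow from uniqueness.\<close>

definition one_minus_sqrt :: "'a \<Rightarrow> 'a \<Rightarrow> bool" where
  "one_minus_sqrt x y \<longleftrightarrow> y \<in> carrier A \<and> nrm A y < 1 \<and> y = (1/2) \<odot> (x \<oplus> y \<otimes> y)"

lemma one_minus_sqrt_exists:
  assumes x: "x \<in> carrier A" "nrm A x < 1"
  obtains y where "one_minus_sqrt x y"
proof -
  let ?r = "nrm A x"
  have r: "0 \<le> ?r" using nrm_nonneg x by simp
  obtain y where "y \<in> carrier A" "nrm A y \<le> ?r" "(1/2) \<odot> (x \<oplus> y \<otimes> y) = y"
  \<comment> \<open>The norm of \<open>x\<close> is both the radius and the contraction constant:
    \<open>(r + r^2) / 2 \<le> r\<close>, and \<open>y^2 - z^2 = y (y - z) + (y - z) z\<close> gives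
    \<open>(r + r) / 2 = r\<close>.\<close>
  proof (rule contraction_fixpoint[of ?r ?r "\<lambda>y. (1/2) \<odot> (x \<oplus> y \<otimes> y)"])
    fix y assume y: "y \<in> carrier A" "nrm A y \<le> ?r"
    have "nrm A (x \<oplus> y \<otimes> y) \<le> ?r + nrm A y * nrm A y"
      using nrm_add[of x "y \<otimes> y"] nrm_mult[of y y] x y by simp
    also have "\<dots> \<le> ?r + ?r * 1"
      using x y r nrm_nonneg[of y] by (intro add_left_mono mult_mono) auto
    finally show "(1/2) \<odot> (x \<oplus> y \<otimes> y) \<in> carrier A \<and> nrm A ((1/2) \<odot> (x \<oplus> y \<otimes> y)) \<le> ?r"
      using x y by (simp add: nrm_smult norm_divide)
  next
    fix y z assume y: "y \<in> carrier A" "nrm A y \<le> ?r" "z \<in> carrier A" "nrm A z \<le> ?r"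
    have "(1/2) \<odot> (x \<oplus> y \<otimes> y) \<ominus> (1/2) \<odot> (x \<oplus> z \<otimes> z) = (1/2) \<odot> ((x \<oplus> y \<otimes> y) \<ominus> (x \<oplus> z \<otimes> z))"
      using x y by (simp add: smult_diff_right)
    also have "(x \<oplus> y \<otimes> y) \<ominus> (x \<oplus> z \<otimes> z) = y \<otimes> (y \<ominus> z) \<oplus> (y \<ominus> z) \<otimes> z"
      using x y by algebra
    also have "nrm A ((1/2) \<odot> \<dots>) \<le> 1/2 * (nrm A y * nrm A (y \<ominus> z) + nrm A (y \<ominus> z) * nrm A z)"
      using nrm_add[of "y \<otimes> (y \<ominus> z)" "(y \<ominus> z) \<otimes> z"] nrm_mult[of y "y \<ominus> z"] nrm_mult[of "y \<ominus> z" z] y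
      by (simp add: nrm_smult norm_divide)
    also have "\<dots> \<le> 1/2 * (?r * nrm A (y \<ominus> z) + nrm A (y \<ominus> z) * ?r)"
      using y nrm_nonneg[of "y \<ominus> z"] by (intro mult_left_mono add_mono mult_right_mono) auto
    finally show "nrm A ((1/2) \<odot> (x \<oplus> y \<otimes> y) \<ominus> (1/2) \<odot> (x \<oplus> z \<otimes> z)) \<le> ?r * nrm A (y \<ominus> z)"
      by simp
  qed (use r x in auto)
  then show thesis using that[of y] x by (simp add: one_minus_sqrt_def)
qed

lemma one_minus_sqrt_square:
  assumes x: "x \<in> carrier A" and y: "one_minus_sqrt x y"
  shows "(\<one> \<ominus> y) \<otimes> (\<one> \<ominus> y) = \<one> \<ominus> x"
proof -
  have yc: "y \<in> carrier A" using y by (simp add: one_minus_sqrt_def)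
  have "y \<oplus> y = 2 \<odot> y" using smult_add_left[of y 1 1] yc by simp
  also have "\<dots> = 2 \<odot> ((1/2) \<odot> (x \<oplus> y \<otimes> y))" using y by (simp add: one_minus_sqrt_def)
  also have "\<dots> = x \<oplus> y \<otimes> y" using x yc by simp
  finally have yy: "y \<oplus> y = x \<oplus> y \<otimes> y" .
  have "(\<one> \<ominus> y) \<otimes> (\<one> \<ominus> y) = \<one> \<oplus> y \<otimes> y \<ominus> (y \<oplus> y)" using yc by (simp add: ring_nf)
  also have "\<dots> = \<one> \<ominus> x" unfolding yy using x yc by algebra
  finally show ?thesis .
qed

text \<open>The commutator \<open>d\<close> of \<open>y\<close> and \<open>z\<close> satisfies
  \<open>d = (y d + d y) / 2\<close>, so it is contracted by \<open>nrm A y < 1\<close> and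
  vanishes.\<close>

lemma one_minus_sqrt_commute:
  assumes x: "x \<in> carrier A" and y: "one_minus_sqrt x y" and z: "z \<in> carrier A" "x \<otimes> z = z \<otimes> x"
  shows "y \<otimes> z = z \<otimes> y"
proof -
  have yc: "y \<in> carrier A" "nrm A y < 1" and ye: "y = (1/2) \<odot> (x \<oplus> y \<otimes> y)"
    using y by (auto simp: one_minus_sqrt_def)
  let ?d = "y \<otimes> z \<ominus> z \<otimes> y"
  have "?d = (1/2) \<odot> (x \<oplus> y \<otimes> y) \<otimes> z \<ominus> z \<otimes> ((1/2) \<odot> (x \<oplus> y \<otimes> y))" using ye by simp
  also have "\<dots> = (1/2) \<odot> ((x \<oplus> y \<otimes> y) \<otimes> z \<ominus> z \<otimes> (x \<oplus> y \<otimes> y))"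
    using x yc z by (simp add: smult_diff_right smult_mult_left smult_mult_right)
  also have "(x \<oplus> y \<otimes> y) \<otimes> z \<ominus> z \<otimes> (x \<oplus> y \<otimes> y) = (x \<otimes> z \<ominus> z \<otimes> x) \<oplus> (y \<otimes> ?d \<oplus> ?d \<otimes> y)"
    using x yc(1) z(1) by algebra
  also have "\<dots> = y \<otimes> ?d \<oplus> ?d \<otimes> y" using x yc z by (simp add: minus_eq r_neg)
  finally have de: "?d = (1/2) \<odot> (y \<otimes> ?d \<oplus> ?d \<otimes> y)" .
  have "nrm A ?d = 1/2 * nrm A (y \<otimes> ?d \<oplus> ?d \<otimes> y)"
    by (subst de) (use yc z in \<open>simp add: nrm_smult norm_divide\<close>)
  also have "\<dots> \<le> nrm A y * nrm A ?d"
    using nrm_add[of "y \<otimes> ?d" "?d \<otimes> y"] nrm_mult[of y ?d] nrm_mult[of ?d y] yc z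
    by (simp add: mult.commute)
  finally have "?d = \<zero>" using contracted_eq_zero[of ?d "nrm A y"] yc z by simp
  then show ?thesis using yc z by simp
qed

text \<open>The difference \<open>d\<close> satisfies \<open>d = (y d + d z) / 2\<close> with both
  norms below 1. Unlike uniqueness in Banach's theorem this does not refer to a common ball.\<close>

lemma one_minus_sqrt_unique:
  assumes x: "x \<in> carrier A" and y: "one_minus_sqrt x y" and z: "one_minus_sqrt x z"
  shows "y = z"
proof -
  have yc: "y \<in> carrier A" "nrm A y < 1" and ye: "y = (1/2) \<odot> (x \<oplus> y \<otimes> y)"
    using y by (auto simp: one_minus_sqrt_def)
  have zc: "z \<in> carrier A" "nrm A z < 1" and ze: "z = (1/2) \<odot> (x \<oplus> z \<otimes> z)"
    using z by (auto simp: one_minus_sqrt_def)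
  let ?d = "y \<ominus> z"
  have "?d = (1/2) \<odot> (x \<oplus> y \<otimes> y) \<ominus> (1/2) \<odot> (x \<oplus> z \<otimes> z)" using ye ze by simp
  also have "\<dots> = (1/2) \<odot> ((x \<oplus> y \<otimes> y) \<ominus> (x \<oplus> z \<otimes> z))"
    using x yc zc by (simp add: smult_diff_right)
  also have "(x \<oplus> y \<otimes> y) \<ominus> (x \<oplus> z \<otimes> z) = y \<otimes> ?d \<oplus> ?d \<otimes> z" using x yc(1) zc(1) by algebra
  finally have de: "?d = (1/2) \<odot> (y \<otimes> ?d \<oplus> ?d \<otimes> z)" .
  have "nrm A ?d = 1/2 * nrm A (y \<otimes> ?d \<oplus> ?d \<otimes> z)"
    by (subst de) (use yc zc in \<open>simp add: nrm_smult norm_divide\<close>)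
  also have "\<dots> \<le> (nrm A y + nrm A z) / 2 * nrm A ?d"
    using nrm_add[of "y \<otimes> ?d" "?d \<otimes> z"] nrm_mult[of y ?d] nrm_mult[of ?d z] yc zc
    by (simp add: algebra_simps)
  finally have "?d = \<zero>" by (rule contracted_eq_zero[rotated]) (use yc zc in auto)
  then show ?thesis using yc zc by simp
qed

text \<open>\<open>star A y\<close> solves the same equation and has the same norm, so uniqueness
  applies.\<close>

lemma one_minus_sqrt_selfadjoint:
  assumes x: "x \<in> carrier A" "star A x = x" and y: "one_minus_sqrt x y"
  shows "star A y = y"
proof (rule one_minus_sqrt_unique[OF x(1) _ y])
  have yc: "y \<in> carrier A" "nrm A y < 1" and ye: "y = (1/2) \<odot> (x \<oplus> y \<otimes> y)"
    using y by (auto simp: one_minus_sqrt_def)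
  have "star A y = star A ((1/2) \<odot> (x \<oplus> y \<otimes> y))" using ye by simp
  also have "\<dots> = (1/2) \<odot> (x \<oplus> star A y \<otimes> star A y)"
    using x yc by (simp add: star_smult star_add star_mult)
  finally show "one_minus_sqrt x (star A y)"
    using yc by (simp add: one_minus_sqrt_def nrm_star)
qed

text \<open>Functional calculus on an eigenvector. The number \<open>m = 1 - sqrt (1 - l)\<close> is
  the scalar solution of the same fixed-point equation, and the error \<open>y t - m t\<close> is
  contracted by \<open>(nrm A y + m) / 2 < 1\<close>. It is applied with \<open>l = 1/2\<close> on a
  corner of a quotient.\<close>

lemma one_minus_sqrt_scalar:
  assumes x: "x \<in> carrier A" and y: "one_minus_sqrt x y"
    and t: "t \<in> carrier A" "x \<otimes> t = complex_of_real l \<odot> t" and l: "0 \<le> l" "l \<le> 1"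
  shows "(\<one> \<ominus> y) \<otimes> t = complex_of_real (sqrt (1 - l)) \<odot> t"
proof -
  have yc: "y \<in> carrier A" "nrm A y < 1" and ye: "y = (1/2) \<odot> (x \<oplus> y \<otimes> y)"
    using y by (auto simp: one_minus_sqrt_def)
  define m where "m = 1 - sqrt (1 - l)"
  have m: "0 \<le> m" "m \<le> 1" using l by (auto simp: m_def)
  have lm: "l + m * m = 2 * m"
  proof -
    have "sqrt (1 - l) * sqrt (1 - l) = 1 - l" using l by simp
    then show ?thesis unfolding m_def by (simp add: algebra_simps)
  qed
  let ?m = "complex_of_real m"
  let ?d = "y \<otimes> t \<ominus> ?m \<odot> t"
  have "y \<otimes> t = (1/2) \<odot> (x \<oplus> y \<otimes> y) \<otimes> t" using ye by simp
  also have "\<dots> = (1/2) \<odot> (complex_of_real l \<odot> t \<oplus> y \<otimes> (y \<otimes> t))"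
    using x yc t by (simp add: smult_mult_left l_distr m_assoc)
  finally have 1: "y \<otimes> t = (1/2) \<odot> (complex_of_real l \<odot> t \<oplus> y \<otimes> (y \<otimes> t))" .
  have "?m \<odot> t = (1/2) \<odot> ((complex_of_real (l + m * m)) \<odot> t)" using t(1) lm by simp
  also have "\<dots> = (1/2) \<odot> (complex_of_real l \<odot> t \<oplus> ?m \<odot> (?m \<odot> t))"
    using t(1) by (simp add: smult_add_left)
  finally have 2: "?m \<odot> t = (1/2) \<odot> (complex_of_real l \<odot> t \<oplus> ?m \<odot> (?m \<odot> t))" .
  have "?d = (1/2) \<odot> (complex_of_real l \<odot> t \<oplus> y \<otimes> (y \<otimes> t)) \<ominus> (1/2) \<odot> (complex_of_real l \<odot> t \<oplus> ?m \<odot> (?m \<odot> t))"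
    by (rule arg_cong2[where f="\<lambda>a b. a \<ominus> b", OF 1 2])
  also have "\<dots> = (1/2) \<odot> ((complex_of_real l \<odot> t \<oplus> y \<otimes> (y \<otimes> t)) \<ominus> (complex_of_real l \<odot> t \<oplus> ?m \<odot> (?m \<odot> t)))"
    by (rule smult_diff_right[symmetric]) (use yc t in auto)
  also have "(complex_of_real l \<odot> t \<oplus> y \<otimes> (y \<otimes> t)) \<ominus> (complex_of_real l \<odot> t \<oplus> ?m \<odot> (?m \<odot> t))
      = (y \<otimes> (y \<otimes> t) \<ominus> ?m \<odot> (y \<otimes> t)) \<oplus> (?m \<odot> (y \<otimes> t) \<ominus> ?m \<odot> (?m \<odot> t))"
    (is "?L = ?R")
  proof -
    have c: "complex_of_real l \<odot> t \<in> carrier A" "y \<otimes> (y \<otimes> t) \<in> carrier A"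
      "?m \<odot> (?m \<odot> t) \<in> carrier A" "?m \<odot> (y \<otimes> t) \<in> carrier A" using yc t by auto
    show ?thesis using c by algebra
  qed
  also have "\<dots> = y \<otimes> ?d \<oplus> ?m \<odot> ?d"
  proof -
    have "y \<otimes> ?d = y \<otimes> (y \<otimes> t) \<ominus> y \<otimes> (?m \<odot> t)"
      using yc t by (simp add: minus_eq r_distr r_minus)
    then show ?thesis using yc t by (simp add: smult_diff_right smult_mult_right)
  qed
  finally have de: "?d = (1/2) \<odot> (y \<otimes> ?d \<oplus> ?m \<odot> ?d)" .
  have "nrm A ?d = 1/2 * nrm A (y \<otimes> ?d \<oplus> ?m \<odot> ?d)"
    by (subst de) (use yc t in \<open>simp add: nrm_smult norm_divide\<close>)
  also have "\<dots> \<le> (nrm A y + m) / 2 * nrm A ?d"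
    using nrm_add[of "y \<otimes> ?d" "?m \<odot> ?d"] nrm_mult[of y ?d] nrm_smult[of ?d ?m] yc t m
    by (simp add: algebra_simps)
  finally have "?d = \<zero>" by (rule contracted_eq_zero[rotated]) (use yc t m in auto)
  then have "y \<otimes> t = ?m \<odot> t" using yc t by simp
  then have "(\<one> \<ominus> y) \<otimes> t = 1 \<odot> t \<ominus> ?m \<odot> t"
    using yc t by (simp add: minus_eq l_distr l_minus)
  also have "\<dots> = (1 - ?m) \<odot> t" using t by (simp only: smult_diff_left)
  finally show ?thesis by (simp add: m_def)
qed

lemma half_add_half: "x \<in> carrier A \<Longrightarrow> (1/2) \<odot> (x \<oplus> x) = x"
  using smult_add_left[of x "1/2" "1/2"] by (simp add: smult_add_right)

text \<open>The unitary \<open>u = a + i sqrt (1 - a^2)\<close> of elementary functional calculus.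
  Writing \<open>a\<close> as its real part bounds norms without spectra, because unitaries have
  norm at most 1. The root is returned as well, since the lifting of symmetries computes with
  it.\<close>

lemma selfadjoint_real_part_unitary:
  assumes a: "a \<in> carrier A" "star A a = a" "nrm A a < 1"
  obtains s u where "s \<in> carrier A" "star A s = s" "s \<otimes> s = \<one> \<ominus> a \<otimes> a" "a \<otimes> s = s \<otimes> a"
    "u = a \<oplus> \<i> \<odot> s" "u \<in> carrier A" "star A u \<otimes> u = \<one>" "u \<otimes> star A u = \<one>"
    "a = (1/2) \<odot> (u \<oplus> star A u)" "one_minus_sqrt (a \<otimes> a) (\<one> \<ominus> s)"
proof -
  have "nrm A (a \<otimes> a) = (nrm A a)\<^sup>2" using nrm_star_mult[of a] a by simp
  moreover have "(nrm A a)\<^sup>2 < 1" using a nrm_nonneg[of a] by (simp add: abs_square_less_1)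
  ultimately obtain y where y: "one_minus_sqrt (a \<otimes> a) y"
    using one_minus_sqrt_exists[of "a \<otimes> a"] a by auto
  then have yc: "y \<in> carrier A" by (simp add: one_minus_sqrt_def)
  define s where "s = \<one> \<ominus> y"
  define u where "u = a \<oplus> \<i> \<odot> s"
  have sc: "s \<in> carrier A" using yc by (simp add: s_def)
  have ss: "s \<otimes> s = \<one> \<ominus> a \<otimes> a" unfolding s_def using one_minus_sqrt_square[OF _ y] a by simp
  have "star A y = y" using one_minus_sqrt_selfadjoint[OF _ _ y] a by (simp add: star_mult)
  then have sst: "star A s = s" using yc by (simp add: s_def star_diff)
  have "y \<otimes> a = a \<otimes> y" using one_minus_sqrt_commute[OF _ y, of a] a by (simp add: m_assoc)
  then have as: "a \<otimes> s = s \<otimes> a"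
    unfolding s_def using a yc by (simp add: minus_eq l_distr r_distr l_minus r_minus)
  have uc: "u \<in> carrier A" using a sc by (simp add: u_def)
  have us: "star A u = a \<ominus> \<i> \<odot> s"
    using a sc sst by (simp add: u_def star_add star_smult minus_eq minus_smult)
  have iss: "(\<i> \<odot> s) \<otimes> (\<i> \<odot> s) = \<ominus> (s \<otimes> s)" "a \<otimes> (\<i> \<odot> s) = (\<i> \<odot> s) \<otimes> a"
    using sc a as by (simp_all add: smult_mult_left smult_mult_right scale_minus1)
  have c: "a \<in> carrier A" "\<i> \<odot> s \<in> carrier A" "s \<in> carrier A" using a sc by auto
  have "star A u \<otimes> u = a \<otimes> a \<oplus> (a \<otimes> (\<i> \<odot> s) \<ominus> (\<i> \<odot> s) \<otimes> a) \<ominus> (\<i> \<odot> s) \<otimes> (\<i> \<odot> s)"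
    unfolding us unfolding u_def using c by algebra
  also have "\<dots> = a \<otimes> a \<oplus> s \<otimes> s" unfolding iss using c by algebra
  also have "\<dots> = \<one>" unfolding ss using c by algebra
  finally have u1: "star A u \<otimes> u = \<one>" .
  have "u \<otimes> star A u = a \<otimes> a \<oplus> ((\<i> \<odot> s) \<otimes> a \<ominus> a \<otimes> (\<i> \<odot> s)) \<ominus> (\<i> \<odot> s) \<otimes> (\<i> \<odot> s)"
    unfolding us unfolding u_def using c by algebra
  also have "\<dots> = a \<otimes> a \<oplus> s \<otimes> s" unfolding iss using c by algebra
  also have "\<dots> = \<one>" unfolding ss using c by algebra
  finally have u2: "u \<otimes> star A u = \<one>" .
  have "u \<oplus> star A u = a \<oplus> a" unfolding us unfolding u_def using c by algebra
  then have ua: "a = (1/2) \<odot> (u \<oplus> star A u)" using half_add_half c by simp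
  have "\<one> \<ominus> s = y" unfolding s_def using yc by algebra
  then show thesis using that[OF sc sst ss as u_def uc u1 u2 ua] y by simp
qed

text \<open>\<open>\<one> \<ominus> a \<otimes> a\<close> is the square of \<open>s\<close>, the
  imaginary part of the unitary \<open>u\<close>, so \<open>nrm A s \<le> 1\<close>. This replaces
  positivity of \<open>a^2\<close>; the triangle inequality alone would give the bound 2.\<close>

lemma nrm_one_minus_square_le:
  assumes a: "a \<in> carrier A" "star A a = a" "nrm A a < 1"
  shows "nrm A (\<one> \<ominus> a \<otimes> a) \<le> 1"
proof -
  obtain s u where s: "s \<in> carrier A" "star A s = s" "s \<otimes> s = \<one> \<ominus> a \<otimes> a" "a \<otimes> s = s \<otimes> a"
    and u: "u = a \<oplus> \<i> \<odot> s" "u \<in> carrier A" "star A u \<otimes> u = \<one>" "u \<otimes> star A u = \<one>"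
    using selfadjoint_real_part_unitary[OF a] by metis
  have "\<i> \<odot> s \<oplus> \<i> \<odot> s = u \<ominus> star A u"
  proof -
    have "star A u = a \<ominus> \<i> \<odot> s"
      using a s by (simp add: u star_add star_smult minus_eq minus_smult)
    moreover have "\<i> \<odot> s \<in> carrier A" using s by simp
    ultimately show ?thesis unfolding u(1) using a(1) by algebra
  qed
  then have "nrm A (\<i> \<odot> s) = 1/2 * nrm A (u \<ominus> star A u)"
    using arg_cong[OF half_add_half[of "\<i> \<odot> s"], of "nrm A"] nrm_smult[of "u \<ominus> star A u" "1/2"] s u(2)
    by (simp add: norm_divide)
  also have "\<dots> \<le> 1"
    using nrm_diff[of u "star A u"] nrm_isometry[of u] u by (simp add: nrm_star)
  finally have "nrm A s \<le> 1" using s by (simp add: nrm_smult)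
  moreover have "nrm A (s \<otimes> s) = (nrm A s)\<^sup>2" using nrm_star_mult[of s] s by simp
  ultimately show ?thesis using s nrm_nonneg[of s] by (simp add: power_le_one)
qed

text \<open>The fixed point of \<open>w = 1 + x w\<close> is a right inverse; as \<open>x\<close> is
  self-adjoint, its adjoint is a left inverse, and the two coincide. The ball of radius
  \<open>1 / (1 - r)\<close> is invariant because
  \<open>1 + r / (1 - r) = 1 / (1 - r)\<close>.\<close>

lemma neumann:
  assumes x: "x \<in> carrier A" "nrm A x < 1" "star A x = x"
  obtains w where "w \<in> carrier A" "star A w = w" "w \<otimes> (\<one> \<ominus> x) = \<one>" "(\<one> \<ominus> x) \<otimes> w = \<one>"
    "nrm A w \<le> 1 / (1 - nrm A x)"
proof -
  let ?r = "nrm A x"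
  have r: "0 \<le> ?r" using nrm_nonneg x by simp
  obtain w where w: "w \<in> carrier A" "nrm A w \<le> 1 / (1 - ?r)" "\<one> \<oplus> x \<otimes> w = w"
  proof (rule contraction_fixpoint[of "1 / (1 - ?r)" ?r "\<lambda>w. \<one> \<oplus> x \<otimes> w"])
    fix y assume y: "y \<in> carrier A" "nrm A y \<le> 1 / (1 - ?r)"
    have "nrm A (\<one> \<oplus> x \<otimes> y) \<le> 1 + ?r * nrm A y"
      using nrm_add[of \<one> "x \<otimes> y"] nrm_mult[of x y] nrm_one_le x y by simp
    also have "\<dots> \<le> 1 + ?r * (1 / (1 - ?r))"
      using y r by (intro add_left_mono mult_left_mono) auto
    also have "\<dots> = 1 / (1 - ?r)" using x by (simp add: field_simps)
    finally show "\<one> \<oplus> x \<otimes> y \<in> carrier A \<and> nrm A (\<one> \<oplus> x \<otimes> y) \<le> 1 / (1 - ?r)" using x y by simp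
  next
    fix y z assume y: "y \<in> carrier A" "z \<in> carrier A"
    have "(\<one> \<oplus> x \<otimes> y) \<ominus> (\<one> \<oplus> x \<otimes> z) = x \<otimes> (y \<ominus> z)" using x(1) y by algebra
    then show "nrm A ((\<one> \<oplus> x \<otimes> y) \<ominus> (\<one> \<oplus> x \<otimes> z)) \<le> ?r * nrm A (y \<ominus> z)"
      using nrm_mult x y by simp
  qed (use x in auto)
  have xw: "(\<one> \<ominus> x) \<otimes> w = \<one>"
  proof -
    have "(\<one> \<ominus> x) \<otimes> w = w \<ominus> x \<otimes> w" using x(1) w(1) by algebra
    also have "\<dots> = (\<one> \<oplus> x \<otimes> w) \<ominus> x \<otimes> w" using w(3) by simp
    also have "\<dots> = \<one>" using x(1) w(1) by algebra
    finally show ?thesis .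
  qed
  have sxw: "star A w \<otimes> (\<one> \<ominus> x) = \<one>"
    using arg_cong[OF xw, of "star A"] x w by (simp add: star_mult star_diff)
  have "star A w = star A w \<otimes> ((\<one> \<ominus> x) \<otimes> w)" using xw w by simp
  also have "\<dots> = (star A w \<otimes> (\<one> \<ominus> x)) \<otimes> w" using x w by (simp add: m_assoc)
  also have "\<dots> = w" using sxw w by simp
  finally have sw: "star A w = w" .
  show thesis by (rule that[OF w(1) sw _ xw w(2)]) (use sxw sw in simp)
qed

text \<open>Here \<open>R\<close> is the inverse of \<open>1 + n k\<^sup>2\<close>.\<close>

lemma resolvent:
  assumes k: "k \<in> carrier A" "star A k = k" "nrm A k < 1" and n: "n > (0::nat)"
  obtains R where "R \<in> carrier A" "star A R = R" "nrm A R \<le> 1"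
    "(nrm A (k \<otimes> R))\<^sup>2 \<le> 2 / n" "\<one> \<ominus> R = of_nat n \<odot> (R \<otimes> (k \<otimes> k))"
proof -
  \<comment> \<open>\<open>1 + n k^2 = (n + 1) (1 - x)\<close>, and the bound on
    \<open>1 - k^2\<close> gives \<open>nrm A x \<le> n / (n + 1) < 1\<close>. So a Neumann inverse
    exists for every \<open>n\<close>, although \<open>n k^2\<close> may have large norm.\<close>
  define x where "x = complex_of_real (n / (n + 1)) \<odot> (\<one> \<ominus> k \<otimes> k)"
  have xc: "x \<in> carrier A" using k by (simp add: x_def)
  have xn: "nrm A x \<le> n / (n + 1)"
  proof -
    have "nrm A x = n / (n + 1) * nrm A (\<one> \<ominus> k \<otimes> k)"
      unfolding x_def by (subst nrm_smult) (use k in \<open>simp_all del: of_real_divide\<close>)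
    also have "\<dots> \<le> n / (n + 1) * 1"
      using nrm_one_minus_square_le[OF k] by (intro mult_left_mono) auto
    finally show ?thesis by simp
  qed
  have n1: "real n / (n + 1) < 1" by simp
  have xs: "star A x = x" using k by (simp add: x_def star_smult star_diff star_mult)
  obtain w where w: "w \<in> carrier A" "star A w = w" "w \<otimes> (\<one> \<ominus> x) = \<one>" "(\<one> \<ominus> x) \<otimes> w = \<one>"
    "nrm A w \<le> 1 / (1 - nrm A x)"
    by (rule neumann[OF xc le_less_trans[OF xn n1] xs])
  define R where "R = complex_of_real (1 / (n + 1)) \<odot> w"
  have Rc: "R \<in> carrier A" using w by (simp add: R_def)
  have Rs: "star A R = R" using w by (simp add: R_def star_smult)
  have "nrm A w \<le> n + 1"
  proof -
    have "1 / (1 - nrm A x) \<le> 1 / (1 - n / (n + 1))"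
      using xn n1 by (intro divide_left_mono mult_pos_pos) (simp, simp, linarith, simp)
    also have "\<dots> = n + 1" by (simp add: field_simps)
    finally show ?thesis using w by simp
  qed
  then have Rn: "nrm A R \<le> 1"
    unfolding R_def using w nrm_smult[of w "complex_of_real (1 / (n + 1))"]
    by (simp add: norm_divide divide_le_eq del: of_real_divide)
  have e: "\<one> \<ominus> x = complex_of_real (1 / (n + 1)) \<odot> (\<one> \<oplus> of_nat n \<odot> (k \<otimes> k))"
  proof -
    let ?a = "complex_of_real (n / (n + 1))"
    have nz: "complex_of_nat n + 1 \<noteq> 0"
      by (metis of_nat_Suc of_nat_neq_0 add.commute)
    have "\<one> \<ominus> x = (1 \<odot> \<one> \<ominus> ?a \<odot> \<one>) \<oplus> ?a \<odot> (k \<otimes> k)"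
    proof -
      have c: "?a \<odot> \<one> \<in> carrier A" "?a \<odot> (k \<otimes> k) \<in> carrier A" using k by auto
      have "x = ?a \<odot> \<one> \<ominus> ?a \<odot> (k \<otimes> k)" unfolding x_def using k by (simp add: smult_diff_right)
      then show ?thesis using c by (simp add: ring_nf)
    qed
    also have "1 \<odot> \<one> \<ominus> ?a \<odot> \<one> = (1 - ?a) \<odot> \<one>" by (subst smult_diff_left) auto
    also have "1 - ?a = complex_of_real (1 / (n + 1))" using nz by (simp add: field_simps)
    also have "?a = complex_of_real (1 / (n + 1)) * of_nat n" by simp
    finally show ?thesis using k by (simp add: smult_add_right)
  qed
  have RR: "R \<otimes> (\<one> \<oplus> of_nat n \<odot> (k \<otimes> k)) = \<one>" "(\<one> \<oplus> of_nat n \<odot> (k \<otimes> k)) \<otimes> R = \<one>"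
    using w(3,4) k w(1) unfolding R_def e by (simp_all add: smult_mult_left smult_mult_right)
  have 1: "\<one> \<ominus> R = of_nat n \<odot> (R \<otimes> (k \<otimes> k))"
  proof -
    have c: "of_nat n \<odot> (k \<otimes> k) \<in> carrier A" using k by auto
    have "\<one> \<ominus> R = R \<otimes> (\<one> \<oplus> of_nat n \<odot> (k \<otimes> k)) \<ominus> R" using RR by simp
    also have "\<dots> = R \<otimes> (of_nat n \<odot> (k \<otimes> k))" using c Rc by (simp add: ring_nf)
    finally show ?thesis using k Rc by (simp add: smult_mult_right)
  qed
  \<comment> \<open>The C*-identity for \<open>k R\<close> together with
    \<open>n R k^2 R = (1 - R) R\<close>, whose right side has norm at most 2.\<close>
  have "star A (k \<otimes> R) \<otimes> (k \<otimes> R) = (R \<otimes> (k \<otimes> k)) \<otimes> R"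
    using k Rc Rs by (simp add: star_mult m_assoc)
  then have "of_nat n \<odot> (star A (k \<otimes> R) \<otimes> (k \<otimes> R)) = (\<one> \<ominus> R) \<otimes> R"
    using 1 k Rc by (simp add: smult_mult_left)
  then have "real n * (nrm A (k \<otimes> R))\<^sup>2 = nrm A ((\<one> \<ominus> R) \<otimes> R)"
    using nrm_smult[of "star A (k \<otimes> R) \<otimes> (k \<otimes> R)" "of_nat n"] nrm_star_mult[of "k \<otimes> R"] k Rc by simp
  also have "\<dots> \<le> nrm A (\<one> \<ominus> R) * nrm A R" using nrm_mult Rc by simp
  also have "\<dots> \<le> 2 * 1"
    using nrm_diff[of \<one> R] nrm_one_le Rn Rc nrm_nonneg by (intro mult_mono) auto
  finally have 2: "(nrm A (k \<otimes> R))\<^sup>2 \<le> 2 / n" using n by (simp add: field_simps)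
  show thesis by (rule that[OF Rc Rs Rn 2 1])
qed

lemma smult_one_inj:
  assumes "\<one> \<noteq> \<zero>" shows "c \<odot> \<one> = d \<odot> \<one> \<longleftrightarrow> c = d"
proof
  assume "c \<odot> \<one> = d \<odot> \<one>"
  then have "(c - d) \<odot> \<one> = \<zero>" by (simp add: smult_diff_left)
  then have "cmod (c - d) * nrm A \<one> = 0" using nrm_smult[of \<one> "c - d"] by simp
  then show "c = d" using nrm_one[OF assms] by simp
qed simp

text \<open>The scalar case of positivity of \<open>star A x \<otimes> x\<close>. A negative value
  \<open>- m\<close>, after rescaling, makes \<open>q = y \<otimes> star A y\<close> satisfy
  \<open>(2 - a^2 - b^2) q = (2 + m) q\<close>, where \<open>a\<close> and \<open>b\<close> are up
  to sign the real and imaginary parts of \<open>y\<close>. But \<open>2 - a^2 - b^2\<close> has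
  norm at most 2, so \<open>q\<close> and then \<open>y\<close> vanish.\<close>

lemma star_mult_scalar_nonneg:
  assumes x: "x \<in> carrier A" "star A x \<otimes> x = c \<odot> \<one>" and nz: "\<one> \<noteq> \<zero>"
  shows "Im c = 0 \<and> 0 \<le> Re c"
proof -
  note inj = smult_one_inj[OF nz, THEN iffD1]
  have "star A (star A x \<otimes> x) = star A x \<otimes> x" using x(1) by (simp add: star_mult)
  then have "cnj c \<odot> \<one> = c \<odot> \<one>" unfolding x(2) by (simp add: star_smult)
  then have "cnj c = c" by (rule inj)
  then have im: "Im c = 0" by (metis Reals_cnj_iff complex_is_Real_iff)
  moreover have "\<not> Re c < 0"
  proof
    assume neg: "Re c < 0"
    \<comment> \<open>The summand 1 makes \<open>y\<close> strictly contractive, as the bounds on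
      \<open>1 - a^2\<close> and \<open>1 - b^2\<close> require, and excludes division by
      zero.\<close>
    define N where "N = 1 + nrm A x"
    have N: "N > nrm A x" "N > 0" using nrm_nonneg[of x] x by (auto simp: N_def)
    define y where "y = complex_of_real (1 / N) \<odot> x"
    define m where "m = - Re c / N\<^sup>2"
    have m: "m > 0" using neg N by (simp add: m_def divide_neg_pos)
    have yc: "y \<in> carrier A" using x by (simp add: y_def)
    have yn: "nrm A y < 1"
      unfolding y_def using x N by (subst nrm_smult) (auto simp: norm_divide divide_simps)
    have "c = complex_of_real (Re c)" using im by (simp add: complex_eq_iff)
    then have yy: "star A y \<otimes> y = (- complex_of_real m) \<odot> \<one>"
      using x N unfolding y_def m_def
      by (simp add: star_smult smult_mult_left smult_mult_right power2_eq_square)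
    define q where "q = y \<otimes> star A y"
    have qc: "q \<in> carrier A" using yc by (simp add: q_def)
    have qs: "star A q = q" using yc by (simp add: q_def star_mult)
    have qq: "q \<otimes> q = (- complex_of_real m) \<odot> q"
    proof -
      have "q \<otimes> q = y \<otimes> (star A y \<otimes> y) \<otimes> star A y" using yc by (simp add: q_def m_assoc)
      then show ?thesis using yc by (simp add: yy q_def smult_mult_left smult_mult_right)
    qed
    define a where "a = (1/2) \<odot> (y \<oplus> star A y)"
    define b where "b = (\<i>/2) \<odot> (y \<ominus> star A y)"
    have ab: "a \<in> carrier A" "star A a = a" "b \<in> carrier A" "star A b = b"
      unfolding a_def b_def using yc
      by (simp_all add: star_smult star_add star_diff a_comm smult_diff_right minus_eq minus_smult
        smult_add_right smult_minus)
    have an: "nrm A a < 1" "nrm A b < 1"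
      unfolding a_def b_def
      using nrm_add[of y "star A y"] nrm_diff[of y "star A y"] yc yn
      by (simp_all add: nrm_smult nrm_star norm_divide norm_mult)
    have sq: "a \<otimes> a \<oplus> b \<otimes> b = (1/2) \<odot> (star A y \<otimes> y \<oplus> y \<otimes> star A y)"
    proof -
      let ?s = "star A y"
      have aa: "a \<otimes> a = (1/4) \<odot> ((y \<oplus> ?s) \<otimes> (y \<oplus> ?s))"
        unfolding a_def using yc by (simp add: smult_mult_left smult_mult_right)
      have bb: "b \<otimes> b = (- (1/4)) \<odot> ((y \<ominus> ?s) \<otimes> (y \<ominus> ?s))"
        unfolding b_def using yc by (simp add: smult_mult_left smult_mult_right)
      have "a \<otimes> a \<oplus> b \<otimes> b = (1/4) \<odot> ((y \<oplus> ?s) \<otimes> (y \<oplus> ?s) \<ominus> (y \<ominus> ?s) \<otimes> (y \<ominus> ?s))"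
        unfolding aa bb using yc by (simp add: smult_diff_right) (simp add: minus_eq minus_smult)
      also have "(y \<oplus> ?s) \<otimes> (y \<oplus> ?s) \<ominus> (y \<ominus> ?s) \<otimes> (y \<ominus> ?s) = (?s \<otimes> y \<oplus> y \<otimes> ?s) \<oplus> (?s \<otimes> y \<oplus> y \<otimes> ?s)"
        using yc star_closed[OF yc] by algebra
      also have "\<dots> = 2 \<odot> (?s \<otimes> y \<oplus> y \<otimes> ?s)"
        using smult_add_left[of "?s \<otimes> y \<oplus> y \<otimes> ?s" 1 1] yc by simp
      finally show ?thesis using yc by simp
    qed
    have "nrm A ((\<one> \<ominus> a \<otimes> a) \<oplus> (\<one> \<ominus> b \<otimes> b)) \<le> 2"
      using nrm_add[of "\<one> \<ominus> a \<otimes> a" "\<one> \<ominus> b \<otimes> b"] ab an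
        nrm_one_minus_square_le[of a] nrm_one_minus_square_le[of b] by simp
    moreover have "((\<one> \<ominus> a \<otimes> a) \<oplus> (\<one> \<ominus> b \<otimes> b)) \<otimes> q = complex_of_real (2 + m) \<odot> q"
    proof -
      have "((\<one> \<ominus> a \<otimes> a) \<oplus> (\<one> \<ominus> b \<otimes> b)) \<otimes> q = (q \<oplus> q) \<ominus> (a \<otimes> a \<oplus> b \<otimes> b) \<otimes> q"
        using ab qc by algebra
      also have "(a \<otimes> a \<oplus> b \<otimes> b) \<otimes> q = (1/2) \<odot> ((- complex_of_real m) \<odot> q \<oplus> q \<otimes> q)"
        unfolding sq yy using qc by (simp add: smult_mult_left l_distr flip: q_def)
      also have "\<dots> = (- complex_of_real m) \<odot> q"
        unfolding qq using half_add_half qc by simp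
      also have "(q \<oplus> q) \<ominus> (- complex_of_real m) \<odot> q = 1 \<odot> q \<oplus> 1 \<odot> q \<oplus> complex_of_real m \<odot> q"
        using qc by (simp add: minus_eq minus_smult)
      also have "\<dots> = complex_of_real (2 + m) \<odot> q"
        using qc by (simp flip: smult_add_left del: smult_1)
      finally show ?thesis .
    qed
    moreover have "nrm A (((\<one> \<ominus> a \<otimes> a) \<oplus> (\<one> \<ominus> b \<otimes> b)) \<otimes> q)
        \<le> nrm A ((\<one> \<ominus> a \<otimes> a) \<oplus> (\<one> \<ominus> b \<otimes> b)) * nrm A q"
      by (rule nrm_mult) (use ab qc in auto)
    moreover have "nrm A (complex_of_real (2 + m) \<odot> q) = (2 + m) * nrm A q"
      using nrm_smult[OF qc, of "complex_of_real (2 + m)"] m by (simp del: of_real_add)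
    moreover have "nrm A ((\<one> \<ominus> a \<otimes> a) \<oplus> (\<one> \<ominus> b \<otimes> b)) * nrm A q \<le> 2 * nrm A q"
      by (rule mult_right_mono) (use calculation(1) nrm_nonneg[OF qc] in auto)
    ultimately have "(2 + m) * nrm A q \<le> 2 * nrm A q" by simp
    then have "m * nrm A q \<le> 0" by (simp add: algebra_simps)
    then have "nrm A q \<le> 0" using m by (simp add: mult_le_0_iff)
    then have "q = \<zero>" using nrm_nonneg[OF qc] by (simp flip: nrm_eq_0[OF qc])
    have "star A (star A y) \<otimes> star A y = \<zero>" using \<open>q = \<zero>\<close> yc by (simp add: q_def)
    then have "star A y = \<zero>" by (rule eq_zero_of_star_mult[rotated]) (use yc in simp)
    then have "(- complex_of_real m) \<odot> \<one> = 0 \<odot> \<one>" using yy yc by simp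
    then have "- complex_of_real m = 0" by (rule inj)
    then show False using m by simp
  qed
  ultimately show ?thesis by simp
qed

end

section \<open>Homomorphisms and their contractivity\<close>

lemma cstar_homD:
  assumes "h \<in> cstar_hom A B"
  shows "x \<in> carrier A \<Longrightarrow> h x \<in> carrier B"
    and "\<lbrakk>x \<in> carrier A; y \<in> carrier A\<rbrakk> \<Longrightarrow> h (x \<otimes>\<^bsub>A\<^esub> y) = h x \<otimes>\<^bsub>B\<^esub> h y"
    and "\<lbrakk>x \<in> carrier A; y \<in> carrier A\<rbrakk> \<Longrightarrow> h (x \<oplus>\<^bsub>A\<^esub> y) = h x \<oplus>\<^bsub>B\<^esub> h y"
    and "h \<one>\<^bsub>A\<^esub> = \<one>\<^bsub>B\<^esub>"
    and "x \<in> carrier A \<Longrightarrow> h (c \<odot>\<^bsub>A\<^esub> x) = c \<odot>\<^bsub>B\<^esub> h x"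
    and "x \<in> carrier A \<Longrightarrow> h (star A x) = star B (h x)"
  using assms by (auto simp: cstar_hom_def ring_hom_def)

locale unital_cstar_hom = A: unital_cstar A + B: unital_cstar B
  for A :: "'a cstar" and B :: "'b cstar" +
  fixes h :: "'a \<Rightarrow> 'b"
  assumes hom: "h \<in> cstar_hom A B"
begin

lemmas closed [simp] = cstar_homD(1)[OF hom]
  and mult = cstar_homD(2)[OF hom]
  and add = cstar_homD(3)[OF hom]
  and one [simp] = cstar_homD(4)[OF hom]
  and smult = cstar_homD(5)[OF hom]
  and star = cstar_homD(6)[OF hom]

lemma zero [simp]: "h \<zero>\<^bsub>A\<^esub> = \<zero>\<^bsub>B\<^esub>"
  using smult[of "\<one>\<^bsub>A\<^esub>" 0] by simp

lemma minus: "x \<in> carrier A \<Longrightarrow> h (\<ominus>\<^bsub>A\<^esub> x) = \<ominus>\<^bsub>B\<^esub> h x"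
  using smult[of x "-1"] by (simp add: A.scale_minus1 B.scale_minus1)

lemma diff: "\<lbrakk>x \<in> carrier A; y \<in> carrier A\<rbrakk> \<Longrightarrow> h (x \<ominus>\<^bsub>A\<^esub> y) = h x \<ominus>\<^bsub>B\<^esub> h y"
  by (simp add: A.minus_eq B.minus_eq add minus)

lemma finsum:
  assumes "finite I" "\<And>i. i \<in> I \<Longrightarrow> f i \<in> carrier A"
  shows "h (\<Oplus>\<^bsub>A\<^esub>i\<in>I. f i) = (\<Oplus>\<^bsub>B\<^esub>i\<in>I. h (f i))"
  using assms by (induction I rule: finite_induct) (simp_all add: add A.finsum_closed Pi_def)

text \<open>A self-adjoint element of norm below 1 is the real part of a unitary, whose image is an
  isometry of norm at most 1. Rescaling gives all self-adjoint elements, and the C*-identity for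
  \<open>star A x \<otimes> x\<close> gives the rest.\<close>

lemma contractive:
  assumes x: "x \<in> carrier A" shows "nrm B (h x) \<le> nrm A x"
proof -
  have 1: "nrm B (h a) \<le> 1" if a: "a \<in> carrier A" "star A a = a" "nrm A a < 1" for a
  proof -
    obtain u where u: "u \<in> carrier A" "star A u \<otimes>\<^bsub>A\<^esub> u = \<one>\<^bsub>A\<^esub>" "a = (1/2) \<odot>\<^bsub>A\<^esub> (u \<oplus>\<^bsub>A\<^esub> star A u)"
      using A.selfadjoint_real_part_unitary[OF a] by metis
    have "star B (h u) \<otimes>\<^bsub>B\<^esub> h u = \<one>\<^bsub>B\<^esub>"
      using u mult[of "star A u" u] by (simp add: star)
    then have "nrm B (h u) \<le> 1" using u B.nrm_isometry by simp
    moreover have "h a = (1/2) \<odot>\<^bsub>B\<^esub> (h u \<oplus>\<^bsub>B\<^esub> star B (h u))"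
      using u by (simp add: smult add star)
    ultimately show ?thesis
      using B.nrm_add[of "h u" "star B (h u)"] u by (simp add: B.nrm_smult B.nrm_star norm_divide)
  qed
  have 2: "nrm B (h a) \<le> nrm A a" if a: "a \<in> carrier A" "star A a = a" for a
  proof (rule ccontr)
    assume "\<not> ?thesis"
    then obtain t where t: "nrm A a < t" "t < nrm B (h a)" using dense not_le by metis
    have t0: "t > 0" using t A.nrm_nonneg[OF a(1)] by simp
    let ?b = "complex_of_real (1 / t) \<odot>\<^bsub>A\<^esub> a"
    have "nrm A ?b < 1" using a t t0 by (subst A.nrm_smult) (auto simp: norm_divide)
    then have "nrm B (h ?b) \<le> 1" using 1[of ?b] a by (simp add: A.star_smult)
    moreover have "nrm B (h ?b) = 1 / t * nrm B (h a)"
      using smult[OF a(1), of "complex_of_real (1 / t)"] B.nrm_smult[of "h a" "complex_of_real (1 / t)"] a t0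
      by (simp add: norm_divide)
    ultimately show False using t t0 by (simp add: divide_le_eq)
  qed
  have "(nrm B (h x))\<^sup>2 = nrm B (h (star A x \<otimes>\<^bsub>A\<^esub> x))"
    using B.nrm_star_mult[of "h x"] x by (simp add: mult star)
  also have "\<dots> \<le> nrm A (star A x \<otimes>\<^bsub>A\<^esub> x)" using 2[of "star A x \<otimes>\<^bsub>A\<^esub> x"] x by (simp add: A.star_mult)
  also have "\<dots> = (nrm A x)\<^sup>2" using A.nrm_star_mult[of x] x by simp
  finally show ?thesis using A.nrm_nonneg[OF x] by (rule power2_le_imp_le)
qed

end

section \<open>Convergence\<close>

context unital_cstar
begin

text \<open>Norm convergence with all terms in the carrier, so that the rules below need no
  membership side conditions.\<close>

definition conv :: "(nat \<Rightarrow> 'a) \<Rightarrow> 'a \<Rightarrow> bool" where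
  "conv u x \<longleftrightarrow> (\<forall>n. u n \<in> carrier A) \<and> x \<in> carrier A \<and> (\<lambda>n. nrm A (u n \<ominus> x)) \<longlonglongrightarrow> 0"

lemma conv_iff_limitin:
  assumes "\<And>n. u n \<in> carrier A"
  shows "conv u x \<longleftrightarrow> limitin (cstar_top A) u x sequentially"
proof -
  have "(\<lambda>n. cdist A (u n) x) = (\<lambda>n. nrm A (u n \<ominus> x))" if "x \<in> carrier A"
    using that assms by (auto simp: cdist_def)
  then show ?thesis using assms
    by (auto simp: conv_def cstar_top_def met.limitin_metric_dist_null)
qed

lemma conv_bound:
  assumes "\<And>n. u n \<in> carrier A" "x \<in> carrier A" "b \<longlonglongrightarrow> 0" "\<And>n. nrm A (u n \<ominus> x) \<le> b n"
  shows "conv u x"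
proof -
  have "(\<lambda>n. nrm A (u n \<ominus> x)) \<longlonglongrightarrow> 0"
    by (rule tendsto_sandwich[OF _ _ tendsto_const assms(3)]) (use assms in \<open>auto simp: nrm_nonneg\<close>)
  then show ?thesis using assms by (auto simp: conv_def)
qed

lemma conv_const: "x \<in> carrier A \<Longrightarrow> conv (\<lambda>_. x) x"
  by (rule conv_bound[of _ _ "\<lambda>_. 0"]) (simp_all add: minus_eq r_neg)

lemma conv_unique: assumes "conv u x" "conv u y" shows "x = y"
proof -
  have "limitin met.mtopology u x sequentially" "limitin met.mtopology u y sequentially"
    using assms by (simp_all add: conv_iff_limitin[unfolded cstar_top_def, symmetric] conv_def)
  then show ?thesis by (rule met.limitin_metric_unique) simp
qed

lemma conv_eventually_const:
  assumes "conv u x" "\<And>n. n \<ge> N \<Longrightarrow> u n = y" shows "x = y"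
proof -
  have c: "x \<in> carrier A" "y \<in> carrier A" using assms(1) assms(2)[of N] by (auto simp: conv_def)
  have "(\<lambda>n. nrm A (u n \<ominus> x)) \<longlonglongrightarrow> 0" using assms(1) by (simp add: conv_def)
  moreover have "\<forall>\<^sub>F n in sequentially. nrm A (u n \<ominus> x) = nrm A (y \<ominus> x)"
    using assms(2) by (auto simp: eventually_sequentially)
  ultimately have "(\<lambda>n::nat. nrm A (y \<ominus> x)) \<longlonglongrightarrow> 0" by (rule Lim_transform_eventually)
  then have "nrm A (y \<ominus> x) = 0" by (simp add: LIMSEQ_const_iff)
  then show ?thesis using c by (simp add: nrm_eq_0)
qed

lemma conv_add:
  assumes "conv u x" "conv v y" shows "conv (\<lambda>n. u n \<oplus> v n) (x \<oplus> y)"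
proof (rule conv_bound)
  have c: "x \<in> carrier A" "y \<in> carrier A" "u n \<in> carrier A" "v n \<in> carrier A" for n
    using assms by (auto simp: conv_def)
  show "nrm A ((u n \<oplus> v n) \<ominus> (x \<oplus> y)) \<le> nrm A (u n \<ominus> x) + nrm A (v n \<ominus> y)" for n
  proof -
    have "(u n \<oplus> v n) \<ominus> (x \<oplus> y) = (u n \<ominus> x) \<oplus> (v n \<ominus> y)"
      using c by (simp add: minus_eq minus_add a_ac)
    then show ?thesis using c by (simp add: nrm_add)
  qed
  show "(\<lambda>n. nrm A (u n \<ominus> x) + nrm A (v n \<ominus> y)) \<longlonglongrightarrow> 0"
    using assms unfolding conv_def by (intro tendsto_add_zero) auto
qed (use assms in \<open>auto simp: conv_def\<close>)

lemma conv_smult: assumes "conv u x" shows "conv (\<lambda>n. c \<odot> u n) (c \<odot> x)"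
proof (rule conv_bound)
  have c: "x \<in> carrier A" "u n \<in> carrier A" for n
    using assms by (auto simp: conv_def)
  show "nrm A (c \<odot> u n \<ominus> c \<odot> x) \<le> cmod c * nrm A (u n \<ominus> x)" for n
    using c by (simp flip: smult_diff_right add: nrm_smult)
  show "(\<lambda>n. cmod c * nrm A (u n \<ominus> x)) \<longlonglongrightarrow> 0"
    using assms unfolding conv_def by (intro tendsto_mult_right_zero) auto
qed (use assms in \<open>auto simp: conv_def\<close>)

lemma conv_star: assumes "conv u x" shows "conv (\<lambda>n. star A (u n)) (star A x)"
proof -
  have c: "x \<in> carrier A" "u n \<in> carrier A" for n
    using assms by (auto simp: conv_def)
  have "nrm A (star A (u n) \<ominus> star A x) = nrm A (u n \<ominus> x)" for n
    using c by (simp flip: star_diff add: nrm_star)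
  then show ?thesis using assms by (auto simp: conv_def)
qed

lemma conv_mult_left:
  assumes "conv u x" "a \<in> carrier A" shows "conv (\<lambda>n. a \<otimes> u n) (a \<otimes> x)"
proof (rule conv_bound)
  have c: "x \<in> carrier A" "u n \<in> carrier A" for n
    using assms by (auto simp: conv_def)
  show "nrm A (a \<otimes> u n \<ominus> a \<otimes> x) \<le> nrm A a * nrm A (u n \<ominus> x)" for n
  proof -
    have "a \<otimes> u n \<ominus> a \<otimes> x = a \<otimes> (u n \<ominus> x)"
      using c assms(2) by (simp add: minus_eq r_distr r_minus)
    then show ?thesis using c assms(2) by (simp add: nrm_mult)
  qed
  show "(\<lambda>n. nrm A a * nrm A (u n \<ominus> x)) \<longlonglongrightarrow> 0"
    using assms unfolding conv_def by (intro tendsto_mult_right_zero) auto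
qed (use assms in \<open>auto simp: conv_def\<close>)

lemma conv_mult:
  assumes "conv u x" "conv v y" shows "conv (\<lambda>n. u n \<otimes> v n) (x \<otimes> y)"
proof (rule conv_bound)
  have c: "x \<in> carrier A" "y \<in> carrier A" "u n \<in> carrier A" "v n \<in> carrier A" for n
    using assms by (auto simp: conv_def)
  let ?a = "\<lambda>n. nrm A (u n \<ominus> x)" and ?b = "\<lambda>n. nrm A (v n \<ominus> y)"
  show "nrm A (u n \<otimes> v n \<ominus> x \<otimes> y) \<le> (?a n + nrm A x) * ?b n + ?a n * nrm A y" for n
  proof -
    have "u n = (u n \<ominus> x) \<oplus> x" using c by (simp add: minus_eq a_assoc l_neg)
    then have u: "nrm A (u n) \<le> ?a n + nrm A x"
      using nrm_add[of "u n \<ominus> x" x] c by simp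
    have "u n \<otimes> v n \<ominus> x \<otimes> y = u n \<otimes> (v n \<ominus> y) \<oplus> (u n \<ominus> x) \<otimes> y"
      using c(1,2) c(3,4)[of n] by algebra
    then have "nrm A (u n \<otimes> v n \<ominus> x \<otimes> y) \<le> nrm A (u n \<otimes> (v n \<ominus> y)) + nrm A ((u n \<ominus> x) \<otimes> y)"
      using c by (simp add: nrm_add)
    also have "\<dots> \<le> nrm A (u n) * ?b n + ?a n * nrm A y"
      using c by (intro add_mono nrm_mult) auto
    also have "\<dots> \<le> (?a n + nrm A x) * ?b n + ?a n * nrm A y"
      using u c by (intro add_mono mult_right_mono) (auto simp: nrm_nonneg)
    finally show ?thesis .
  qed
  have "(\<lambda>n. (?a n + nrm A x) * ?b n + ?a n * nrm A y) \<longlonglongrightarrow> (0 + nrm A x) * 0 + 0 * nrm A y"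
    using assms unfolding conv_def by (intro tendsto_intros) auto
  then show "(\<lambda>n. (?a n + nrm A x) * ?b n + ?a n * nrm A y) \<longlonglongrightarrow> 0" by simp
qed (use assms in \<open>auto simp: conv_def\<close>)

lemma conv_closed:
  assumes "closedin (cstar_top A) S" "conv u x" "\<And>n. u n \<in> S" shows "x \<in> S"
proof (rule limitin_closedin[OF _ assms(1)])
  show "limitin (cstar_top A) u x sequentially"
    using assms(2) by (subst conv_iff_limitin[symmetric]) (auto simp: conv_def)
qed (use assms in auto)

lemma closedin_iff_conv:
  "closedin (cstar_top A) S \<longleftrightarrow> S \<subseteq> carrier A \<and> (\<forall>u x. range u \<subseteq> S \<longrightarrow> conv u x \<longrightarrow> x \<in> S)"
proof
  show "closedin (cstar_top A) S \<Longrightarrow> S \<subseteq> carrier A \<and> (\<forall>u x. range u \<subseteq> S \<longrightarrow> conv u x \<longrightarrow> x \<in> S)"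
    using conv_closed[of S] closedin_subset[of "cstar_top A" S] by (auto simp: cstar_top_def image_subset_iff)
next
  assume *: "S \<subseteq> carrier A \<and> (\<forall>u x. range u \<subseteq> S \<longrightarrow> conv u x \<longrightarrow> x \<in> S)"
  show "closedin (cstar_top A) S"
    unfolding cstar_top_def met.metric_closedin_iff_sequentially_closed
  proof (intro conjI allI impI)
    fix u l assume l: "range u \<subseteq> S \<and> limitin met.mtopology u l sequentially"
    then have "u n \<in> carrier A" for n using * by auto
    then have "conv u l" using l by (simp add: conv_iff_limitin cstar_top_def)
    then show "l \<in> S" using * l by blast
  qed (use * in auto)
qed

lemma closed_approx:
  assumes S: "closedin (cstar_top A) S" and x: "x \<in> carrier A"
    and approx: "\<And>e. e > 0 \<Longrightarrow> \<exists>y\<in>S. nrm A (y \<ominus> x) < e"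
  shows "x \<in> S"
proof -
  have "\<forall>n. \<exists>y\<in>S. nrm A (y \<ominus> x) < inverse (Suc n)" using approx by simp
  then obtain u where u: "\<And>n. u n \<in> S" "\<And>n. nrm A (u n \<ominus> x) < inverse (Suc n)" by metis
  have SA: "S \<subseteq> carrier A" using S by (simp add: closedin_iff_conv)
  have "conv u x"
    by (rule conv_bound[OF _ x LIMSEQ_inverse_real_of_nat]) (use u SA in \<open>auto intro: less_imp_le\<close>)
  then show ?thesis using conv_closed[OF S] u by blast
qed

text \<open>The ratio 1/2 is what both the Newton iteration and the choice of representatives in a
  quotient produce; \<open>2 * B\<close> is the sum of the series.\<close>

lemma geometric_conv:
  assumes s: "\<And>n. u n \<in> carrier A" and b: "\<And>n. nrm A (u (Suc n) \<ominus> u n) \<le> B * (1/2) ^ n"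
  obtains x where "conv u x" "nrm A (x \<ominus> u 0) \<le> 2 * B"
proof -
  \<comment> \<open>Keeping the exact telescoped bound, with its subtracted term, is what lets the
    induction close.\<close>
  have tele: "nrm A (u (n + k) \<ominus> u n) \<le> 2 * B * (1/2) ^ n - 2 * B * (1/2) ^ (n + k)" for n k
  proof (induction k)
    case 0 then show ?case using s by (simp add: minus_eq r_neg)
  next
    case (Suc k)
    have "nrm A (u (n + Suc k) \<ominus> u n)
        \<le> nrm A (u (Suc (n + k)) \<ominus> u (n + k)) + nrm A (u (n + k) \<ominus> u n)"
      using nrm_diff_triangle s by simp
    also have "\<dots> \<le> B * (1/2) ^ (n + k) + (2 * B * (1/2) ^ n - 2 * B * (1/2) ^ (n + k))"
      using b[of "n + k"] Suc by simp
    finally show ?case by simp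
  qed
  have B: "0 \<le> B" using b[of 0] nrm_nonneg[of "u (Suc 0) \<ominus> u 0"] s by simp
  have "met.MCauchy u"
    unfolding met.MCauchy_def
  proof (intro conjI allI impI)
    fix e :: real assume e: "e > 0"
    have "(\<lambda>n. 2 * B * (1/2::real) ^ n) \<longlonglongrightarrow> 2 * B * 0"
      by (intro tendsto_mult tendsto_const LIMSEQ_power_zero) auto
    then have "\<forall>\<^sub>F n in sequentially. 2 * B * (1/2::real) ^ n < e / 2"
      by (rule order_tendstoD(2)) (use e in simp)
    then obtain N where N: "2 * B * (1/2::real) ^ N < e / 2"
      by (auto simp: eventually_sequentially)
    have near: "nrm A (u n \<ominus> u N) < e / 2" if "n \<ge> N" for n
    proof -
      have "0 \<le> 2 * B * (1/2) ^ n" using B by simp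
      then show ?thesis using tele[of N "n - N"] that N by simp
    qed
    show "\<exists>N. \<forall>n n'. N \<le> n \<longrightarrow> N \<le> n' \<longrightarrow> cdist A (u n) (u n') < e"
    proof (intro exI[of _ N] allI impI)
      fix n n' assume n: "N \<le> n" "N \<le> n'"
      have "nrm A (u n \<ominus> u n') \<le> nrm A (u n \<ominus> u N) + nrm A (u N \<ominus> u n')"
        by (rule nrm_diff_triangle) (use s in auto)
      also have "nrm A (u N \<ominus> u n') = nrm A (u n' \<ominus> u N)"
        by (rule nrm_minus_commute) (use s in auto)
      also have "nrm A (u n \<ominus> u N) + nrm A (u n' \<ominus> u N) < e"
        using near[OF n(1)] near[OF n(2)] by linarith
      finally show "cdist A (u n) (u n') < e" using s by (simp add: cdist_def)
    qed
  qed (use s in auto)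
  then obtain x where "limitin met.mtopology u x sequentially"
    using complete by (auto simp: met.mcomplete_def)
  then have x: "conv u x" using s by (simp add: conv_iff_limitin cstar_top_def)
  then have xc: "x \<in> carrier A" by (simp add: conv_def)
  have "nrm A (x \<ominus> u 0) \<le> 2 * B + 0"
  proof (rule LIMSEQ_le_const[of "\<lambda>n. 2 * B + nrm A (u n \<ominus> x)"])
    show "(\<lambda>n. 2 * B + nrm A (u n \<ominus> x)) \<longlonglongrightarrow> 2 * B + 0"
      using x unfolding conv_def by (intro tendsto_intros) auto
    have "nrm A (x \<ominus> u 0) \<le> 2 * B + nrm A (u n \<ominus> x)" for n
    proof -
      have "nrm A (x \<ominus> u 0) \<le> nrm A (x \<ominus> u n) + nrm A (u n \<ominus> u 0)"
        by (rule nrm_diff_triangle) (use s xc in auto)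
      moreover have "nrm A (u n \<ominus> u 0) \<le> 2 * B"
      proof -
        have "0 \<le> 2 * B * (1/2) ^ n" using B by simp
        then show ?thesis using tele[of 0 n] by simp
      qed
      ultimately show ?thesis using nrm_minus_commute[of x "u n"] s xc by simp
    qed
    then show "\<exists>N. \<forall>n\<ge>N. nrm A (x \<ominus> u 0) \<le> 2 * B + nrm A (u n \<ominus> x)" by blast
  qed
  then show thesis using that x by simp
qed

end

lemma (in unital_cstar_hom) conv:
  assumes "A.conv u x" shows "B.conv (\<lambda>n. h (u n)) (h x)"
proof (rule B.conv_bound)
  have c: "x \<in> carrier A" "u n \<in> carrier A" for n
    using assms by (auto simp: A.conv_def)
  show "nrm B (h (u n) \<ominus>\<^bsub>B\<^esub> h x) \<le> nrm A (u n \<ominus>\<^bsub>A\<^esub> x)" for n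
    using contractive[of "u n \<ominus>\<^bsub>A\<^esub> x"] c by (simp add: diff)
qed (use assms in \<open>auto simp: A.conv_def\<close>)

section \<open>Quotients by closed ideals\<close>

text \<open>Stability of \<open>J\<close> under \<open>star\<close> is not part of
  \<open>closed_ideal\<close>; it is derived from approximate units.\<close>

locale cstar_ideal = unital_cstar C for C :: "'c cstar" (structure) +
  fixes J assumes J: "closed_ideal C J"
begin

sublocale ideal J C using J by (simp add: closed_ideal_def)

lemma J_closedin: "closedin (cstar_top C) J" using J by (simp add: closed_ideal_def)

lemma J_smult: "x \<in> J \<Longrightarrow> c \<odot> x \<in> J"
  using I_l_closed[of x "c \<odot> \<one>"] Icarr[of x] by (simp add: smult_mult_left)

text \<open>\<open>\<one> \<ominus> R\<close> acts as an approximate unit for the single element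
  \<open>j\<close>. Let \<open>i\<close> be \<open>j\<close> rescaled to norm below 1. Then
  \<open>k = star C i \<otimes> i\<close> lies in \<open>J\<close> by the left ideal property alone,
  and for the inverse \<open>R\<close> of \<open>1 + n k^2\<close> the C*-identity bounds the square
  of \<open>nrm C (i \<otimes> R)\<close> by \<open>nrm C (k \<otimes> R)\<close>, which tends to 0
  as \<open>n\<close> grows.\<close>

lemma approximate_unit:
  assumes j: "j \<in> J" and e: "e > 0"
  obtains R where "R \<in> carrier C" "star C R = R" "nrm C R \<le> 1" "\<one> \<ominus> R \<in> J" "nrm C (j \<otimes> R) \<le> e"
proof -
  have jc: "j \<in> carrier C" using j Icarr by auto
  define N where "N = 1 + nrm C j"
  have N: "N > nrm C j" "N > 0" using nrm_nonneg[of j] jc by (auto simp: N_def)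
  define i where "i = complex_of_real (1 / N) \<odot> j"
  have iJ: "i \<in> J" "i \<in> carrier C" using j jc by (auto simp: i_def J_smult)
  have i_n: "nrm C i < 1"
    unfolding i_def using jc N by (subst nrm_smult) (auto simp: norm_divide divide_simps)
  define k where "k = star C i \<otimes> i"
  have k: "k \<in> J" "k \<in> carrier C" "star C k = k"
    using iJ by (auto simp: k_def star_mult intro: I_l_closed)
  have kn: "nrm C k < 1"
    using nrm_star_mult[of i] iJ i_n nrm_nonneg[of i] by (simp add: k_def abs_square_less_1)
  \<comment> \<open>The choice propagates backwards: \<open>2 / n \<le> d^2\<close> bounds
    \<open>k R\<close> by \<open>d\<close>, hence \<open>i R\<close> by
    \<open>sqrt d = e / N\<close>, hence \<open>j R\<close> by \<open>e\<close>.\<close>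
  define d where "d = (e / N) ^ 2"
  have d: "d > 0" using e N by (simp add: d_def)
  obtain n :: nat where n: "n > 0" "2 / d\<^sup>2 < n"
    using reals_Archimedean2[of "max 1 (2 / d\<^sup>2)"] by (auto simp: max_def split: if_splits)
  obtain R where R: "R \<in> carrier C" "star C R = R" "nrm C R \<le> 1"
    "(nrm C (k \<otimes> R))\<^sup>2 \<le> 2 / n" "\<one> \<ominus> R = of_nat n \<odot> (R \<otimes> (k \<otimes> k))"
    using resolvent[OF k(2,3) kn n(1)] by metis
  have "2 / real n \<le> d\<^sup>2" using n d by (simp add: pos_divide_less_eq pos_divide_le_eq mult.commute less_imp_le)
  then have "(nrm C (k \<otimes> R))\<^sup>2 \<le> d\<^sup>2" by (rule order_trans[OF R(4)])
  then have "nrm C (k \<otimes> R) \<le> d" by (rule power2_le_imp_le) (use d in simp)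
  moreover have "(nrm C (i \<otimes> R))\<^sup>2 = nrm C (R \<otimes> (k \<otimes> R))"
    using nrm_star_mult[of "i \<otimes> R"] iJ R by (simp add: star_mult k_def m_assoc)
  moreover have "nrm C (R \<otimes> (k \<otimes> R)) \<le> 1 * nrm C (k \<otimes> R)"
    by (rule order_trans[OF nrm_mult mult_right_mono]) (use R k nrm_nonneg in auto)
  ultimately have "(nrm C (i \<otimes> R))\<^sup>2 \<le> (e / N)\<^sup>2" by (simp add: d_def)
  then have "nrm C (i \<otimes> R) \<le> e / N" by (rule power2_le_imp_le) (use e N in simp)
  moreover have "nrm C (i \<otimes> R) = nrm C (j \<otimes> R) / N"
    unfolding i_def using jc R N nrm_smult[of "j \<otimes> R" "complex_of_real (1 / N)"]
    by (simp add: smult_mult_left norm_divide)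
  ultimately have "nrm C (j \<otimes> R) \<le> e" using N by (simp add: divide_le_cancel)
  moreover have "\<one> \<ominus> R \<in> J" unfolding R(5) using k R by (intro J_smult I_l_closed) auto
  ultimately show thesis using that R by blast
qed

text \<open>\<open>(\<one> \<ominus> R) \<otimes> star C j\<close> lies in \<open>J\<close> because
  its left factor does, and it differs from \<open>star C j\<close> by the adjoint of
  \<open>j \<otimes> R\<close>, up to sign, which is small; closedness finishes.\<close>

lemma J_star: assumes j: "j \<in> J" shows "star C j \<in> J"
proof (rule closed_approx[OF J_closedin])
  have jc: "j \<in> carrier C" using j Icarr by auto
  then show "star C j \<in> carrier C" by simp
  fix e :: real assume e: "e > 0"
  then obtain R where R: "R \<in> carrier C" "star C R = R" "\<one> \<ominus> R \<in> J" "nrm C (j \<otimes> R) \<le> e / 2"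
    using approximate_unit[OF j, of "e/2"] by auto
  have "(\<one> \<ominus> R) \<otimes> star C j \<ominus> star C j = \<ominus> (R \<otimes> star C j)"
    using R jc by (simp add: ring_nf)
  also have "R \<otimes> star C j = star C (j \<otimes> R)" using R jc by (simp add: star_mult)
  finally have "nrm C ((\<one> \<ominus> R) \<otimes> star C j \<ominus> star C j) < e" using R jc e by (simp add: nrm_star)
  then show "\<exists>y\<in>J. nrm C (y \<ominus> star C j) < e" using R jc by (meson I_r_closed star_closed)
qed

abbreviation cls :: "'c \<Rightarrow> 'c set" where "cls x \<equiv> J +> x"

abbreviation Q :: "'c set cstar" where "Q \<equiv> cstar_Quot C J"

lemma mem_cls: "x \<in> carrier C \<Longrightarrow> y \<in> cls x \<longleftrightarrow> y \<in> carrier C \<and> y \<ominus> x \<in> J"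
  using a_rcos_module_minus[OF ring_axioms, of x y] a_elemrcos_carrier[of x y] by auto

lemma self_mem_cls: "x \<in> carrier C \<Longrightarrow> x \<in> cls x"
  by (simp add: mem_cls minus_eq r_neg)

lemma cls_eq_iff: "\<lbrakk>x \<in> carrier C; y \<in> carrier C\<rbrakk> \<Longrightarrow> cls x = cls y \<longleftrightarrow> x \<ominus> y \<in> J"
  using quotient_eq_iff_same_a_r_cos[OF is_ideal] by simp

lemma cls_eq_of_mem: "\<lbrakk>x \<in> carrier C; y \<in> cls x\<rbrakk> \<Longrightarrow> cls y = cls x"
  by (auto simp: mem_cls cls_eq_iff)

lemma carrier_Q: "carrier Q = cls ` carrier C"
  by (auto simp: cstar_Quot_def FactRing_def A_RCOSETS_defs a_r_coset_def)

lemma cls_closed [simp]: "x \<in> carrier C \<Longrightarrow> cls x \<in> carrier Q"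
  by (auto simp: carrier_Q)

text \<open>Scalar multiplication and \<open>star\<close> in \<open>cstar_Quot\<close>, as well as
  the quotient actions, are unions over representatives. Once a map respects classes, such a union
  collapses to a single class.\<close>

lemma Union_cls:
  assumes "x \<in> carrier C" "\<And>y. y \<in> cls x \<Longrightarrow> cls (f y) = cls (f x)"
  shows "(\<Union>y\<in>cls x. cls (f y)) = cls (f x)"
proof
  show "(\<Union>y\<in>cls x. cls (f y)) \<subseteq> cls (f x)" using assms(2) by blast
  show "cls (f x) \<subseteq> (\<Union>y\<in>cls x. cls (f y))" using self_mem_cls[OF assms(1)] by blast
qed

lemma Q_mult: "\<lbrakk>x \<in> carrier C; y \<in> carrier C\<rbrakk> \<Longrightarrow> cls x \<otimes>\<^bsub>Q\<^esub> cls y = cls (x \<otimes> y)"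
  by (simp add: cstar_Quot_def FactRing_def rcoset_mult_add)

lemma Q_add: "\<lbrakk>x \<in> carrier C; y \<in> carrier C\<rbrakk> \<Longrightarrow> cls x \<oplus>\<^bsub>Q\<^esub> cls y = cls (x \<oplus> y)"
  by (simp add: cstar_Quot_def FactRing_def a_rcos_sum)

lemma Q_one: "\<one>\<^bsub>Q\<^esub> = cls \<one>"
  by (simp add: cstar_Quot_def FactRing_def)

lemma Q_zero: "\<zero>\<^bsub>Q\<^esub> = cls \<zero>"
  using a_coset_add_zero[OF a_subset] by (simp add: cstar_Quot_def FactRing_def)

lemma Q_smult: "x \<in> carrier C \<Longrightarrow> c \<odot>\<^bsub>Q\<^esub> cls x = cls (c \<odot> x)"
proof -
  assume x: "x \<in> carrier C"
  have "cls (c \<odot> y) = cls (c \<odot> x)" if "y \<in> cls x" for y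
    using that x by (simp add: mem_cls cls_eq_iff J_smult flip: smult_diff_right)
  then show ?thesis using Union_cls[OF x] by (simp add: cstar_Quot_def)
qed

lemma Q_star: "x \<in> carrier C \<Longrightarrow> star Q (cls x) = cls (star C x)"
proof -
  assume x: "x \<in> carrier C"
  have "cls (star C y) = cls (star C x)" if "y \<in> cls x" for y
    using that x by (simp add: mem_cls cls_eq_iff J_star flip: star_diff)
  then show ?thesis using Union_cls[OF x] by (simp add: cstar_Quot_def)
qed

lemma Q_nrm: "nrm Q (cls x) = Inf (nrm C ` cls x)"
  by (simp add: cstar_Quot_def)

lemma Q_nrm_le: "\<lbrakk>x \<in> carrier C; y \<in> cls x\<rbrakk> \<Longrightarrow> nrm Q (cls x) \<le> nrm C y"
  unfolding Q_nrm by (rule cInf_lower) (auto intro!: bdd_belowI2[of _ 0] nrm_nonneg simp: mem_cls)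

lemma Q_nrm_le_self: "x \<in> carrier C \<Longrightarrow> nrm Q (cls x) \<le> nrm C x"
  by (rule Q_nrm_le) (auto simp: self_mem_cls)

lemma Q_nrm_approx:
  assumes "x \<in> carrier C" "nrm Q (cls x) < e"
  obtains y where "y \<in> carrier C" "cls y = cls x" "nrm C y < e"
proof -
  have "\<exists>t\<in>nrm C ` cls x. t < e"
    using assms self_mem_cls[OF assms(1)] unfolding Q_nrm by (intro cInf_lessD) auto
  then obtain y where y: "y \<in> cls x" "nrm C y < e" by auto
  show thesis
    by (rule that[OF _ cls_eq_of_mem[OF assms(1) y(1)] y(2)]) (use y(1) assms(1) in \<open>simp add: mem_cls\<close>)
qed

lemma Q_nrm_nonneg: "x \<in> carrier C \<Longrightarrow> 0 \<le> nrm Q (cls x)"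
  unfolding Q_nrm
proof (rule cInf_greatest)
  assume "x \<in> carrier C"
  then show "nrm C ` cls x \<noteq> {}" using self_mem_cls by blast
qed (auto simp: mem_cls nrm_nonneg)

text \<open>Norm 0 yields elements of \<open>J\<close> arbitrarily close to \<open>x\<close>, so
  closedness of \<open>J\<close> makes the quotient norm definite.\<close>

lemma Q_nrm_eq_0: assumes x: "x \<in> carrier C" "nrm Q (cls x) = 0" shows "cls x = \<zero>\<^bsub>Q\<^esub>"
proof -
  have "x \<in> J"
  proof (rule closed_approx[OF J_closedin x(1)])
    fix e :: real assume "e > 0"
    then have "nrm Q (cls x) < e" using x(2) by simp
    then obtain y where y: "y \<in> carrier C" "cls y = cls x" "nrm C y < e"
      by (rule Q_nrm_approx[OF x(1)])
    then have "x \<ominus> y \<in> J" using cls_eq_iff[OF x(1) y(1)] by simp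
    have "(x \<ominus> y) \<ominus> x = \<ominus> y" using x(1) y(1) by (simp add: ring_nf)
    then have "nrm C ((x \<ominus> y) \<ominus> x) < e" using y by simp
    with \<open>x \<ominus> y \<in> J\<close> show "\<exists>z\<in>J. nrm C (z \<ominus> x) < e" by blast
  qed
  then have "x \<ominus> \<zero> \<in> J" using x(1) by (simp add: minus_eq)
  then show ?thesis unfolding Q_zero using x(1) cls_eq_iff by blast
qed

end

text \<open>Passes from estimates for near-optimal representatives to the infimum that defines the
  quotient norm.\<close>

lemma le_mult_of_approx:
  fixes z a b :: real
  assumes "\<And>e. e > 0 \<Longrightarrow> z \<le> (a + e) * (b + e)" shows "z \<le> a * b"
proof -
  have "(\<lambda>n. (a + inverse (real (Suc n))) * (b + inverse (real (Suc n)))) \<longlonglongrightarrow> (a + 0) * (b + 0)"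
    by (intro tendsto_intros LIMSEQ_inverse_real_of_nat)
  then have "z \<le> (a + 0) * (b + 0)"
    by (rule LIMSEQ_le_const) (use assms in auto)
  then show ?thesis by simp
qed

section \<open>The quotient norm and completeness of the quotient\<close>

context cstar_ideal
begin

lemma Q_nrm_add:
  assumes x: "x \<in> carrier C" and y: "y \<in> carrier C"
  shows "nrm Q (cls (x \<oplus> y)) \<le> nrm Q (cls x) + nrm Q (cls y)"
proof (rule field_le_epsilon)
  fix e :: real assume e: "e > 0"
  have ex: "nrm Q (cls x) < nrm Q (cls x) + e/2" and ey: "nrm Q (cls y) < nrm Q (cls y) + e/2"
    using e by auto
  obtain x' where x': "x' \<in> carrier C" "cls x' = cls x" "nrm C x' < nrm Q (cls x) + e/2"
    by (rule Q_nrm_approx[OF x ex])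
  obtain y' where y': "y' \<in> carrier C" "cls y' = cls y" "nrm C y' < nrm Q (cls y) + e/2"
    by (rule Q_nrm_approx[OF y ey])
  have "cls (x \<oplus> y) = cls (x' \<oplus> y')"
    using Q_add[OF x y] Q_add[OF x'(1) y'(1)] x'(2) y'(2) by simp
  then have "nrm Q (cls (x \<oplus> y)) \<le> nrm C (x' \<oplus> y')" using Q_nrm_le_self x' y' by simp
  also have "\<dots> \<le> nrm C x' + nrm C y'" using nrm_add x' y' by simp
  finally show "nrm Q (cls (x \<oplus> y)) \<le> nrm Q (cls x) + nrm Q (cls y) + e"
    using x' y' by simp
qed

lemma Q_nrm_mult:
  assumes x: "x \<in> carrier C" and y: "y \<in> carrier C"
  shows "nrm Q (cls (x \<otimes> y)) \<le> nrm Q (cls x) * nrm Q (cls y)"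
proof (rule le_mult_of_approx)
  fix e :: real assume e: "e > 0"
  have ex: "nrm Q (cls x) < nrm Q (cls x) + e" and ey: "nrm Q (cls y) < nrm Q (cls y) + e"
    using e by auto
  obtain x' where x': "x' \<in> carrier C" "cls x' = cls x" "nrm C x' < nrm Q (cls x) + e"
    by (rule Q_nrm_approx[OF x ex])
  obtain y' where y': "y' \<in> carrier C" "cls y' = cls y" "nrm C y' < nrm Q (cls y) + e"
    by (rule Q_nrm_approx[OF y ey])
  have "cls (x \<otimes> y) = cls (x' \<otimes> y')"
    using Q_mult[OF x y] Q_mult[OF x'(1) y'(1)] x'(2) y'(2) by simp
  then have "nrm Q (cls (x \<otimes> y)) \<le> nrm C (x' \<otimes> y')" using Q_nrm_le_self x' y' by simp
  also have "\<dots> \<le> nrm C x' * nrm C y'" using nrm_mult x' y' by simp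
  also have "\<dots> \<le> (nrm Q (cls x) + e) * (nrm Q (cls y) + e)"
    using x' y' nrm_nonneg[OF x'(1)] nrm_nonneg[OF y'(1)] by (intro mult_mono) auto
  finally show "nrm Q (cls (x \<otimes> y)) \<le> (nrm Q (cls x) + e) * (nrm Q (cls y) + e)" .
qed

lemma Q_nrm_smult_le:
  assumes x: "x \<in> carrier C" shows "nrm Q (cls (c \<odot> x)) \<le> cmod c * nrm Q (cls x)"
proof (cases "c = 0")
  case True
  then show ?thesis using x Q_nrm_le_self[of \<zero>] by simp
next
  case False
  show ?thesis
  proof (rule field_le_epsilon)
    fix e :: real assume e: "e > 0"
    have ex: "nrm Q (cls x) < nrm Q (cls x) + e / cmod c" using e False by simp
    obtain x' where x': "x' \<in> carrier C" "cls x' = cls x" "nrm C x' < nrm Q (cls x) + e / cmod c"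
      by (rule Q_nrm_approx[OF x ex])
    have "cls (c \<odot> x) = cls (c \<odot> x')" using Q_smult[OF x, of c] Q_smult[OF x'(1), of c] x'(2) by simp
    then have "nrm Q (cls (c \<odot> x)) \<le> cmod c * nrm C x'"
      using Q_nrm_le_self[of "c \<odot> x'"] x' by (simp add: nrm_smult)
    also have "\<dots> \<le> cmod c * (nrm Q (cls x) + e / cmod c)"
      using x' by (intro mult_left_mono) auto
    also have "\<dots> = cmod c * nrm Q (cls x) + e" using False by (simp add: distrib_left)
    finally show "nrm Q (cls (c \<odot> x)) \<le> cmod c * nrm Q (cls x) + e" .
  qed
qed

lemma Q_nrm_smult:
  assumes x: "x \<in> carrier C" shows "nrm Q (cls (c \<odot> x)) = cmod c * nrm Q (cls x)"
proof (rule antisym[OF Q_nrm_smult_le[OF x]])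
  show "cmod c * nrm Q (cls x) \<le> nrm Q (cls (c \<odot> x))"
  proof (cases "c = 0")
    case True then show ?thesis using Q_nrm_nonneg[of \<zero>] x by simp
  next
    case False
    have "nrm Q (cls x) \<le> cmod (1/c) * nrm Q (cls (c \<odot> x))"
      using Q_nrm_smult_le[of "c \<odot> x" "1/c"] x False by simp
    then have "cmod c * nrm Q (cls x) \<le> cmod c * (cmod (1/c) * nrm Q (cls (c \<odot> x)))"
      by (rule mult_left_mono) simp
    also have "\<dots> = nrm Q (cls (c \<odot> x))" using False by (simp add: norm_divide)
    finally show ?thesis .
  qed
qed

text \<open>The inequality \<open>\<ge>\<close> needs approximate units. If \<open>y\<close>
  represents \<open>star C x \<otimes> x\<close> with error \<open>j\<close> in \<open>J\<close>,
  then \<open>x\<close> and \<open>x \<otimes> R\<close> have the same class, and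
  \<open>R (star C x) x R = R y R - R j R\<close> has norm at most
  \<open>nrm C y + e\<close>.\<close>

lemma Q_nrm_star_mult:
  assumes x: "x \<in> carrier C" shows "nrm Q (cls (star C x \<otimes> x)) = (nrm Q (cls x))\<^sup>2"
proof (rule antisym)
  show "nrm Q (cls (star C x \<otimes> x)) \<le> (nrm Q (cls x))\<^sup>2"
    unfolding power2_eq_square
  proof (rule le_mult_of_approx)
    fix e :: real assume e: "e > 0"
    have ex: "nrm Q (cls x) < nrm Q (cls x) + e" using e by auto
    obtain x' where x': "x' \<in> carrier C" "cls x' = cls x" "nrm C x' < nrm Q (cls x) + e"
      by (rule Q_nrm_approx[OF x ex])
    have "cls (star C x \<otimes> x) = cls (star C x' \<otimes> x')"
      using Q_mult[OF star_closed[OF x] x] Q_mult[OF star_closed[OF x'(1)] x'(1)]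
        Q_star[OF x] Q_star[OF x'(1)] x'(2) by simp
    then have "nrm Q (cls (star C x \<otimes> x)) \<le> nrm C x' * nrm C x'"
      using Q_nrm_le_self[of "star C x' \<otimes> x'"] nrm_star_mult[of x'] x' by (simp add: power2_eq_square)
    also have "\<dots> \<le> (nrm Q (cls x) + e) * (nrm Q (cls x) + e)"
      using x' nrm_nonneg[OF x'(1)] by (intro mult_mono) auto
    finally show "nrm Q (cls (star C x \<otimes> x)) \<le> (nrm Q (cls x) + e) * (nrm Q (cls x) + e)" .
  qed
next
  show "(nrm Q (cls x))\<^sup>2 \<le> nrm Q (cls (star C x \<otimes> x))"
    unfolding Q_nrm[of "star C x \<otimes> x"]
  proof (rule cInf_greatest)
    show "nrm C ` cls (star C x \<otimes> x) \<noteq> {}" using self_mem_cls[of "star C x \<otimes> x"] x by auto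
    fix t assume "t \<in> nrm C ` cls (star C x \<otimes> x)"
    then obtain y where y: "y \<in> carrier C" "y \<ominus> star C x \<otimes> x \<in> J" "t = nrm C y"
      using x by (auto simp: mem_cls)
    define j where "j = y \<ominus> star C x \<otimes> x"
    have j: "j \<in> J" "j \<in> carrier C" using y x by (auto simp: j_def)
    show "(nrm Q (cls x))\<^sup>2 \<le> t"
    proof (rule field_le_epsilon)
      fix e :: real assume e: "e > 0"
      obtain R where R: "R \<in> carrier C" "star C R = R" "nrm C R \<le> 1" "\<one> \<ominus> R \<in> J" "nrm C (j \<otimes> R) \<le> e"
        by (rule approximate_unit[OF j(1) e])
      have "x \<ominus> x \<otimes> R = x \<otimes> (\<one> \<ominus> R)" using x R by (simp add: ring_nf)
      then have "cls x = cls (x \<otimes> R)" using x R I_l_closed[of "\<one> \<ominus> R" x] by (simp add: cls_eq_iff)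
      then have "nrm Q (cls x) \<le> nrm C (x \<otimes> R)" using Q_nrm_le_self x R by simp
      then have "(nrm Q (cls x))\<^sup>2 \<le> (nrm C (x \<otimes> R))\<^sup>2"
        by (rule power_mono) (rule Q_nrm_nonneg[OF x])
      also have "\<dots> = nrm C (R \<otimes> (star C x \<otimes> x) \<otimes> R)"
        using nrm_star_mult[of "x \<otimes> R"] x R by (simp add: star_mult m_assoc)
      also have "R \<otimes> (star C x \<otimes> x) \<otimes> R = R \<otimes> y \<otimes> R \<ominus> R \<otimes> (j \<otimes> R)"
        unfolding j_def using x y R by (simp add: ring_nf)
      also have "nrm C \<dots> \<le> nrm C (R \<otimes> y \<otimes> R) + nrm C (R \<otimes> (j \<otimes> R))"
        by (rule nrm_diff) (use R y j in auto)
      also have "nrm C (R \<otimes> y \<otimes> R) \<le> (1 * nrm C y) * 1"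
      proof (rule order_trans[OF nrm_mult mult_mono])
        show "nrm C (R \<otimes> y) \<le> 1 * nrm C y"
          by (rule order_trans[OF nrm_mult mult_right_mono]) (use R y nrm_nonneg in auto)
      qed (use R y nrm_nonneg in auto)
      also have "nrm C (R \<otimes> (j \<otimes> R)) \<le> 1 * e"
        by (rule order_trans[OF nrm_mult mult_mono]) (use R j nrm_nonneg in auto)
      finally show "(nrm Q (cls x))\<^sup>2 \<le> t + e" using y by simp
    qed
  qed
qed

lemma Q_neg: "x \<in> carrier C \<Longrightarrow> cls (\<ominus> x) \<oplus>\<^bsub>Q\<^esub> cls x = \<zero>\<^bsub>Q\<^esub>"
  by (simp add: Q_add Q_zero l_neg)

lemma Q_ring: "Ring.ring Q"
proof (rule ringI)
  show "abelian_group Q"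
  proof (rule abelian_groupI)
    fix P assume "P \<in> carrier Q"
    then show "\<exists>P'\<in>carrier Q. P' \<oplus>\<^bsub>Q\<^esub> P = \<zero>\<^bsub>Q\<^esub>"
      using Q_neg cls_closed by (auto simp: carrier_Q)
  qed (auto simp: carrier_Q Q_add Q_zero a_ac)
  show "Group.monoid Q"
    by (rule monoidI) (auto simp: carrier_Q Q_mult Q_one m_assoc)
qed (auto simp: carrier_Q Q_mult Q_add l_distr r_distr)

lemma Q_module: "Module.module complex_ring Q"
proof (rule Module.moduleI)
  interpret Q: Ring.ring Q by (rule Q_ring)
  show "abelian_group Q" by (rule Q.is_abelian_group)
  show "cring complex_ring" by unfold_locales
qed (auto simp: carrier_Q Q_add Q_smult smult_add_right smult_add_left)

lemma Q_diff: "\<lbrakk>x \<in> carrier C; y \<in> carrier C\<rbrakk> \<Longrightarrow> cls x \<ominus>\<^bsub>Q\<^esub> cls y = cls (x \<ominus> y)"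
proof -
  interpret Q: Ring.ring Q by (rule Q_ring)
  assume xy: "x \<in> carrier C" "y \<in> carrier C"
  have "\<ominus>\<^bsub>Q\<^esub> cls y = cls (\<ominus> y)"
    by (rule Q.minus_equality) (use xy Q_neg in auto)
  then show ?thesis using xy by (simp add: a_minus_def Q_add)
qed

lemma Q_cdist: "\<lbrakk>x \<in> carrier C; y \<in> carrier C\<rbrakk> \<Longrightarrow> cdist Q (cls x) (cls y) = nrm Q (cls (x \<ominus> y))"
  by (simp add: cdist_def Q_diff)

lemma Q_metric: "Metric_space (carrier Q) (cdist Q)"
proof
  show nonneg: "0 \<le> cdist Q P P'" for P P'
  proof (cases "P \<in> carrier Q \<and> P' \<in> carrier Q")
    case True then show ?thesis by (auto simp: carrier_Q Q_cdist Q_nrm_nonneg)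
  qed (auto simp: cdist_def)
  show "cdist Q P P' = cdist Q P' P" for P P'
  proof (cases "P \<in> carrier Q \<and> P' \<in> carrier Q")
    case True
    then obtain x y where xy: "x \<in> carrier C" "y \<in> carrier C" "P = cls x" "P' = cls y"
      by (auto simp: carrier_Q)
    have "y \<ominus> x = (-1) \<odot> (x \<ominus> y)"
      using xy by (simp add: scale_minus1 minus_eq minus_add a_comm)
    then show ?thesis using xy by (simp add: Q_cdist Q_nrm_smult)
  qed (auto simp: cdist_def)
  show "cdist Q P P' = 0 \<longleftrightarrow> P = P'" if PP: "P \<in> carrier Q" "P' \<in> carrier Q" for P P'
  proof -
    obtain x y where xy: "x \<in> carrier C" "y \<in> carrier C" "P = cls x" "P' = cls y"
      using PP by (auto simp: carrier_Q)
    have "nrm Q (cls \<zero>) = 0"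
      using Q_nrm_le_self[of \<zero>] Q_nrm_nonneg[of \<zero>] by simp
    moreover have "cls (x \<ominus> y) = cls \<zero> \<longleftrightarrow> cls x = cls y"
      using xy by (simp add: cls_eq_iff minus_eq)
    ultimately show ?thesis
      using xy Q_nrm_eq_0[of "x \<ominus> y"] by (auto simp: Q_cdist Q_zero)
  qed
  show "cdist Q P P'' \<le> cdist Q P P' + cdist Q P' P''"
    if PP: "P \<in> carrier Q" "P' \<in> carrier Q" "P'' \<in> carrier Q" for P P' P''
  proof -
    obtain x y z where xyz: "x \<in> carrier C" "y \<in> carrier C" "z \<in> carrier C"
      "P = cls x" "P' = cls y" "P'' = cls z"
      using PP by (auto simp: carrier_Q)
    have "x \<ominus> z = (x \<ominus> y) \<oplus> (y \<ominus> z)"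
      using xyz by (simp add: minus_eq a_assoc r_neg1)
    then show ?thesis using xyz Q_nrm_add[of "x \<ominus> y" "y \<ominus> z"] by (simp add: Q_cdist)
  qed
qed

text \<open>A rapidly Cauchy subsequence is lifted to representatives whose steps are at most
  \<open>(1/2)^k\<close>. Their limit in \<open>C\<close> represents the limit of the subsequence,
  and a Cauchy sequence with a convergent subsequence converges.\<close>

lemma Q_complete: "Metric_space.mcomplete (carrier Q) (cdist Q)"
proof -
  interpret M: Metric_space "carrier Q" "cdist Q" by (rule Q_metric)
  show ?thesis
    unfolding M.mcomplete_def
  proof (intro allI impI)
    fix u assume u: "M.MCauchy u"
    then have uQ: "u n \<in> carrier Q" for n by (auto simp: M.MCauchy_def)
    have "\<forall>k. \<exists>N. \<forall>m n. N \<le> m \<longrightarrow> N \<le> n \<longrightarrow> cdist Q (u m) (u n) < (1/2) ^ k"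
    proof
      fix k :: nat
      have "(1/2::real) ^ k > 0" by simp
      then show "\<exists>N. \<forall>m n. N \<le> m \<longrightarrow> N \<le> n \<longrightarrow> cdist Q (u m) (u n) < (1/2) ^ k"
        using u unfolding M.MCauchy_def by blast
    qed
    then obtain N where N: "\<And>k m n. N k \<le> m \<Longrightarrow> N k \<le> n \<Longrightarrow> cdist Q (u m) (u n) < (1/2) ^ k"
      by metis
    \<comment> \<open>The maximum with \<open>Suc q\<close> keeps the subsequence strictly
      increasing.\<close>
    define r where "r = rec_nat (N 0) (\<lambda>k q. max (N (Suc k)) (Suc q))"
    have r: "N k \<le> r k" "r k < r (Suc k)" for k
      by (cases k; simp add: r_def) (simp add: r_def)
    have mono: "strict_mono r" using r(2) by (simp add: strict_mono_Suc_iff)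
    have step: "\<exists>x'. (x' \<in> carrier C \<and> cls x' = u (r (Suc k))) \<and> nrm C (x' \<ominus> x) \<le> (1/2) ^ k"
      if x: "x \<in> carrier C \<and> cls x = u (r k)" for x k
    proof -
      obtain y where y: "y \<in> carrier C" "u (r (Suc k)) = cls y" using uQ[of "r (Suc k)"] by (auto simp: carrier_Q)
      have "cdist Q (u (r (Suc k))) (u (r k)) < (1/2) ^ k"
        by (rule N) (use r[of k] in auto)
      then have "nrm Q (cls (y \<ominus> x)) < (1/2) ^ k"
        using Q_cdist[OF y(1), of x] x y(2) by simp
      then obtain z where z: "z \<in> carrier C" "cls z = cls (y \<ominus> x)" "nrm C z < (1/2) ^ k"
        by (rule Q_nrm_approx[rotated]) (use x y in auto)
      have "cls (z \<oplus> x) = cls y"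
      proof -
        have "cls (z \<oplus> x) = cls ((y \<ominus> x) \<oplus> x)"
          using z x y Q_add[of z x] Q_add[of "y \<ominus> x" x] by simp
        also have "(y \<ominus> x) \<oplus> x = y" using x y by (simp add: minus_eq a_assoc l_neg)
        finally show ?thesis .
      qed
      moreover have "(z \<oplus> x) \<ominus> x = z" using x z by (simp add: minus_eq a_assoc r_neg)
      ultimately show ?thesis using x y z by (intro exI[of _ "z \<oplus> x"]) simp
    qed
    obtain x0 where "x0 \<in> carrier C" "u (r 0) = cls x0" using uQ[of "r 0"] by (auto simp: carrier_Q)
    then have "\<exists>x. x \<in> carrier C \<and> cls x = u (r 0)" by auto
    then have "\<exists>x. \<forall>k. (x k \<in> carrier C \<and> cls (x k) = u (r k)) \<and> nrm C (x (Suc k) \<ominus> x k) \<le> (1/2) ^ k"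
      by (rule dependent_nat_choice) (rule step)
    then obtain x where x: "\<And>k. x k \<in> carrier C \<and> cls (x k) = u (r k)"
        "\<And>k. nrm C (x (Suc k) \<ominus> x k) \<le> (1/2) ^ k" by blast
    obtain l where l: "conv x l" by (rule geometric_conv[of x 1]) (use x in auto)
    then have lc: "l \<in> carrier C" by (simp add: conv_def)
    have "limitin M.mtopology (u \<circ> r) (cls l) sequentially"
      unfolding M.limitin_metric_dist_null
    proof (intro conjI)
      have "cdist Q (u (r n)) (cls l) \<le> nrm C (x n \<ominus> l)" for n
        using Q_cdist[of "x n" l] Q_nrm_le_self[of "x n \<ominus> l"] x(1)[of n] lc by simp
      then have "\<And>n. cdist Q ((u \<circ> r) n) (cls l) \<le> nrm C (x n \<ominus> l)" by simp
      then show "(\<lambda>n. cdist Q ((u \<circ> r) n) (cls l)) \<longlonglongrightarrow> 0"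
        by (intro tendsto_sandwich[OF _ _ tendsto_const l[unfolded conv_def, THEN conjunct2, THEN conjunct2]])
          auto
    qed (use uQ lc in auto)
    then show "\<exists>x. limitin M.mtopology u x sequentially"
      using M.MCauchy_convergent_subsequence[OF u mono] by blast
  qed
qed

theorem Q_cstar: "unital_cstar Q"
proof (intro unital_cstar.intro unital_cstar_axioms.intro Q_module Q_ring Q_complete)
  fix P P' c assume "P \<in> carrier Q" "P' \<in> carrier Q"
  then obtain x y where xy: "x \<in> carrier C" "y \<in> carrier C" "P = cls x" "P' = cls y"
    by (auto simp: carrier_Q)
  note s = xy Q_mult Q_add Q_smult Q_star
  show "(c \<odot>\<^bsub>Q\<^esub> P) \<otimes>\<^bsub>Q\<^esub> P' = c \<odot>\<^bsub>Q\<^esub> (P \<otimes>\<^bsub>Q\<^esub> P')" by (simp add: s smult_mult_left)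
  show "P \<otimes>\<^bsub>Q\<^esub> (c \<odot>\<^bsub>Q\<^esub> P') = c \<odot>\<^bsub>Q\<^esub> (P \<otimes>\<^bsub>Q\<^esub> P')" by (simp add: s smult_mult_right)
  show "star Q (P \<oplus>\<^bsub>Q\<^esub> P') = star Q P \<oplus>\<^bsub>Q\<^esub> star Q P'" by (simp add: s star_add)
  show "star Q (P \<otimes>\<^bsub>Q\<^esub> P') = star Q P' \<otimes>\<^bsub>Q\<^esub> star Q P" by (simp add: s star_mult)
  show "nrm Q (P \<oplus>\<^bsub>Q\<^esub> P') \<le> nrm Q P + nrm Q P'" by (simp add: s Q_nrm_add)
  show "nrm Q (P \<otimes>\<^bsub>Q\<^esub> P') \<le> nrm Q P * nrm Q P'" by (simp add: s Q_nrm_mult)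
next
  fix P c assume "P \<in> carrier Q"
  then obtain x where x: "x \<in> carrier C" "P = cls x"
    by (auto simp: carrier_Q)
  note s = x Q_mult Q_add Q_smult Q_star
  show "star Q P \<in> carrier Q" by (simp add: s)
  show "star Q (star Q P) = P" by (simp add: s)
  show "star Q (c \<odot>\<^bsub>Q\<^esub> P) = cnj c \<odot>\<^bsub>Q\<^esub> star Q P" by (simp add: s star_smult)
  show "0 \<le> nrm Q P" by (simp add: s Q_nrm_nonneg)
  show "nrm Q P = 0 \<longleftrightarrow> P = \<zero>\<^bsub>Q\<^esub>"
    using Q_nrm_eq_0[of x] Q_nrm_le_self[of \<zero>] Q_nrm_nonneg[of \<zero>] x by (auto simp: Q_zero)
  show "nrm Q (c \<odot>\<^bsub>Q\<^esub> P) = cmod c * nrm Q P" by (simp add: s Q_nrm_smult)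
  show "nrm Q (star Q P \<otimes>\<^bsub>Q\<^esub> P) = (nrm Q P)\<^sup>2" by (simp add: s Q_nrm_star_mult)
qed

lemma cls_hom: "unital_cstar_hom C Q cls"
proof (intro unital_cstar_hom.intro unital_cstar_hom_axioms.intro Q_cstar)
  show "unital_cstar C" by (rule unital_cstar_axioms)
  show "cls \<in> cstar_hom C Q"
    by (auto simp: cstar_hom_def Q_mult Q_add Q_smult Q_star Q_one intro!: ring_hom_memI)
qed

lemma quotient_map_cls:
  assumes I: "closed_ideal C I" "I \<subseteq> J" and x: "x \<in> carrier C"
  shows "quotient_map C J (I +> x) = cls x"
proof -
  interpret I: cstar_ideal C I by unfold_locales (rule I(1))
  have "cls y = cls x" if "y \<in> I +> x" for y
    using that x I by (auto simp: I.mem_cls cls_eq_iff)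
  then show ?thesis using I.self_mem_cls[OF x] unfolding quotient_map_def by blast
qed

lemma quotient_map_hom:
  assumes I: "closed_ideal C I" "I \<subseteq> J"
  shows "unital_cstar_hom (cstar_Quot C I) Q (quotient_map C J)"
proof -
  interpret I: cstar_ideal C I by unfold_locales (rule I(1))
  show ?thesis
  proof (intro unital_cstar_hom.intro unital_cstar_hom_axioms.intro Q_cstar I.Q_cstar)
    show "quotient_map C J \<in> cstar_hom (cstar_Quot C I) Q"
      by (auto simp: cstar_hom_def I.carrier_Q quotient_map_cls[OF I] Q_mult Q_add Q_smult Q_star Q_one
          I.Q_mult I.Q_add I.Q_smult I.Q_star I.Q_one intro!: ring_hom_memI)
  qed
qed

end

section \<open>Finite sums and approximately orthonormal families\<close>

context unital_cstar
begin

lemma star_finsum: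
  assumes "finite I" "\<And>i. i \<in> I \<Longrightarrow> f i \<in> carrier A"
  shows "star A (\<Oplus>i\<in>I. f i) = (\<Oplus>i\<in>I. star A (f i))"
  using assms by (induction I rule: finite_induct) (simp_all add: star_add finsum_closed Pi_def)

lemma smult_finsum:
  assumes "finite I" "\<And>i. i \<in> I \<Longrightarrow> f i \<in> carrier A"
  shows "c \<odot> (\<Oplus>i\<in>I. f i) = (\<Oplus>i\<in>I. c \<odot> f i)"
  using assms by (induction I rule: finite_induct) (simp_all add: smult_add_right finsum_closed Pi_def)

lemma mult_finsum:
  assumes "finite I" "a \<in> carrier A" "\<And>i. i \<in> I \<Longrightarrow> f i \<in> carrier A"
  shows "a \<otimes> (\<Oplus>i\<in>I. f i) = (\<Oplus>i\<in>I. a \<otimes> f i)"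
  using assms by (intro finsum_rdistr) auto

lemma finsum_mult:
  assumes "finite I" "a \<in> carrier A" "\<And>i. i \<in> I \<Longrightarrow> f i \<in> carrier A"
  shows "(\<Oplus>i\<in>I. f i) \<otimes> a = (\<Oplus>i\<in>I. f i \<otimes> a)"
  using assms by (intro finsum_ldistr) auto

lemma finsum_add:
  assumes "\<And>i. i \<in> I \<Longrightarrow> f i \<in> carrier A" "\<And>i. i \<in> I \<Longrightarrow> g i \<in> carrier A"
  shows "(\<Oplus>i\<in>I. f i \<oplus> g i) = (\<Oplus>i\<in>I. f i) \<oplus> (\<Oplus>i\<in>I. g i)"
  using assms by (intro finsum_addf) auto

lemma finsum_closed': "(\<And>i. i \<in> I \<Longrightarrow> f i \<in> carrier A) \<Longrightarrow> (\<Oplus>i\<in>I. f i) \<in> carrier A"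
  by (intro finsum_closed) auto

lemma finsum_cong_simp:
  assumes "\<And>i. i \<in> I \<Longrightarrow> f i = g i" "\<And>i. i \<in> I \<Longrightarrow> g i \<in> carrier A"
  shows "(\<Oplus>i\<in>I. f i) = (\<Oplus>i\<in>I. g i)"
  using assms by (intro finsum_cong') auto

lemma finsum_diff:
  assumes "finite I" "\<And>i. i \<in> I \<Longrightarrow> f i \<in> carrier A" "\<And>i. i \<in> I \<Longrightarrow> g i \<in> carrier A"
  shows "(\<Oplus>i\<in>I. f i \<ominus> g i) = (\<Oplus>i\<in>I. f i) \<ominus> (\<Oplus>i\<in>I. g i)"
proof -
  have "(\<Oplus>i\<in>I. f i \<ominus> g i) = (\<Oplus>i\<in>I. f i \<oplus> (-1) \<odot> g i)"
    using assms by (intro finsum_cong_simp) (simp_all add: minus_eq scale_minus1)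
  also have "\<dots> = (\<Oplus>i\<in>I. f i) \<oplus> (-1) \<odot> (\<Oplus>i\<in>I. g i)"
    using assms by (simp add: finsum_add smult_finsum)
  finally show ?thesis using assms by (simp add: minus_eq scale_minus1 finsum_closed')
qed

lemma finsum_zero': "(\<And>i. i \<in> I \<Longrightarrow> f i = \<zero>) \<Longrightarrow> (\<Oplus>i\<in>I. f i) = \<zero>"
  using finsum_cong_simp[of I f "\<lambda>_. \<zero>"] finsum_zero[of I] by simp

lemma finsum_delta:
  assumes "finite I" "i \<in> I" "\<And>j. j \<in> I \<Longrightarrow> f j \<in> carrier A" "\<And>j. j \<in> I \<Longrightarrow> j \<noteq> i \<Longrightarrow> f j = \<zero>"
  shows "(\<Oplus>j\<in>I. f j) = f i"
proof -
  have "(\<Oplus>j\<in>I. f j) = (\<Oplus>j\<in>insert i (I - {i}). f j)" using assms(2) by (simp add: insert_absorb)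
  also have "\<dots> = f i \<oplus> (\<Oplus>j\<in>I - {i}. f j)"
    using assms by (subst finsum_insert) auto
  also have "(\<Oplus>j\<in>I - {i}. f j) = \<zero>" using assms by (intro finsum_zero') auto
  finally show ?thesis using assms by simp
qed

lemma finsum_const_smult:
  assumes "finite I" "x \<in> carrier A"
  shows "(\<Oplus>i\<in>I. x) = of_nat (card I) \<odot> x"
  using assms by (induction I rule: finite_induct) (simp_all add: smult_add_left)

lemma nrm_finsum_le:
  assumes "finite I" "\<And>i. i \<in> I \<Longrightarrow> f i \<in> carrier A"
  shows "nrm A (\<Oplus>i\<in>I. f i) \<le> (\<Sum>i\<in>I. nrm A (f i))"
  using assms
proof (induction I rule: finite_induct)
  case (insert i I)
  have "nrm A (f i \<oplus> (\<Oplus>i\<in>I. f i)) \<le> nrm A (f i) + nrm A (\<Oplus>i\<in>I. f i)"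
    using insert by (intro nrm_add) (auto simp: finsum_closed')
  then show ?case using insert by (simp add: Pi_def)
qed simp

section \<open>Newton iteration towards orthonormal families\<close>

definition defect :: "('i \<Rightarrow> 'a) \<Rightarrow> 'i \<Rightarrow> 'i \<Rightarrow> 'a" where
  "defect y i j = (if i = j then \<one> else \<zero>) \<ominus> star A (y i) \<otimes> y j"

text \<open>The Newton-Schulz step \<open>Y (1 + E/2)\<close> towards the isometric part of a row
  \<open>Y\<close>, where \<open>E = 1 - star Y Y\<close> is the matrix of defects and
  \<open>1 + E/2\<close> approximates the inverse square root of \<open>1 - E\<close>. Being a
  polynomial formula symmetric in the indices, it commutes with homomorphisms and with permutations
  of the family. Equivariance and the unchanged image in a quotient both rest on this.\<close>

definition newton :: "'i set \<Rightarrow> ('i \<Rightarrow> 'a) \<Rightarrow> 'i \<Rightarrow> 'a" where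
  "newton I y i = y i \<oplus> (1/2) \<odot> (\<Oplus>j\<in>I. y j \<otimes> defect y j i)"

definition orthonormal :: "'i set \<Rightarrow> ('i \<Rightarrow> 'a) \<Rightarrow> bool" where
  "orthonormal I y \<longleftrightarrow> (\<forall>i\<in>I. y i \<in> carrier A) \<and>
     (\<forall>i\<in>I. \<forall>j\<in>I. star A (y i) \<otimes> y j = (if i = j then \<one> else \<zero>))"

lemma defect_closed [simp]: "\<lbrakk>y i \<in> carrier A; y j \<in> carrier A\<rbrakk> \<Longrightarrow> defect y i j \<in> carrier A"
  by (simp add: defect_def)

lemma newton_closed:
  "\<lbrakk>\<And>j. j \<in> I \<Longrightarrow> y j \<in> carrier A; i \<in> I\<rbrakk> \<Longrightarrow> newton I y i \<in> carrier A"
  by (simp add: newton_def finsum_closed')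

lemma defect_eq_zero_iff:
  assumes "\<And>i. i \<in> I \<Longrightarrow> y i \<in> carrier A"
  shows "orthonormal I y \<longleftrightarrow> (\<forall>i\<in>I. \<forall>j\<in>I. defect y i j = \<zero>)"
  using assms by (auto simp: orthonormal_def defect_def)

lemma newton_orthonormal:
  assumes "orthonormal I y" "i \<in> I" shows "newton I y i = y i"
proof -
  have yc: "\<And>j. j \<in> I \<Longrightarrow> y j \<in> carrier A" using assms by (simp add: orthonormal_def)
  have "\<forall>i\<in>I. \<forall>j\<in>I. defect y i j = \<zero>"
    using assms(1) defect_eq_zero_iff[of I y] yc by blast
  then have "(\<Oplus>j\<in>I. y j \<otimes> defect y j i) = \<zero>"
    using assms(2) yc by (intro finsum_zero') simp
  then show ?thesis using yc assms(2) by (simp add: newton_def)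
qed

text \<open>In matrix notation the new defect is \<open>(3 E^2 + E^3) / 4\<close>. The condition
  \<open>card I * e \<le> 1/2\<close> turns this quadratic decay into a factor 1/2.\<close>

lemma newton_step:
  fixes e :: real
  assumes fin: "finite I" and y: "\<And>i. i \<in> I \<Longrightarrow> y i \<in> carrier A"
    and e: "\<And>i j. \<lbrakk>i \<in> I; j \<in> I\<rbrakk> \<Longrightarrow> nrm A (defect y i j) \<le> e" "0 \<le> e" "card I * e \<le> 1/2"
    and k: "k \<in> I" and i: "i \<in> I"
  shows "nrm A (defect (newton I y) k i) \<le> e / 2"
    and "nrm A (newton I y i \<ominus> y i) \<le> card I * e"
proof -
  let ?n = "real (card I)"
  define E where "E = defect y"
  define a where "a i = (\<Oplus>j\<in>I. y j \<otimes> E j i)" for i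
  define E2 where "E2 k i = (\<Oplus>j\<in>I. E k j \<otimes> E j i)" for k i
  define E3 where "E3 k i = (\<Oplus>j\<in>I. E k j \<otimes> E2 j i)" for k i
  have n1: "1 \<le> ?n" using fin k by (simp add: card_gt_0_iff Suc_le_eq) blast
  have Ec: "E i j \<in> carrier A" if "i \<in> I" "j \<in> I" for i j using that y by (simp add: E_def)
  have ac: "a i \<in> carrier A" if "i \<in> I" for i using that y Ec by (simp add: a_def finsum_closed')
  have E2c: "E2 k i \<in> carrier A" if "k \<in> I" "i \<in> I" for k i using that Ec by (simp add: E2_def finsum_closed')
  have E3c: "E3 k i \<in> carrier A" if "k \<in> I" "i \<in> I" for k i using that Ec E2c by (simp add: E3_def finsum_closed')
  have Es: "star A (E i j) = E j i" if "i \<in> I" "j \<in> I" for i j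
    using that y by (simp add: E_def defect_def star_diff star_mult)
  have yy: "star A (y k) \<otimes> y j = (if k = j then \<one> else \<zero>) \<ominus> E k j" if "k \<in> I" "j \<in> I" for k j
    using that y by (simp add: E_def defect_def ring_nf)
  have ya: "star A (y k) \<otimes> a i = E k i \<ominus> E2 k i" if "k \<in> I" "i \<in> I" for k i
  proof -
    have "star A (y k) \<otimes> a i = (\<Oplus>j\<in>I. star A (y k) \<otimes> (y j \<otimes> E j i))"
      unfolding a_def using that y Ec fin by (intro mult_finsum) auto
    also have "\<dots> = (\<Oplus>j\<in>I. (if k = j then E j i else \<zero>) \<ominus> E k j \<otimes> E j i)"
    proof (rule finsum_cong_simp)
      fix j assume j: "j \<in> I"
      have "star A (y k) \<otimes> (y j \<otimes> E j i) = (star A (y k) \<otimes> y j) \<otimes> E j i"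
        using that y Ec j by (simp add: m_assoc)
      also have "\<dots> = (if k = j then E j i else \<zero>) \<ominus> E k j \<otimes> E j i"
        unfolding yy[OF that(1) j] using that Ec j by (simp add: ring_nf)
      finally show "star A (y k) \<otimes> (y j \<otimes> E j i) = (if k = j then E j i else \<zero>) \<ominus> E k j \<otimes> E j i" .
    qed (use that Ec in auto)
    also have "\<dots> = (\<Oplus>j\<in>I. if k = j then E j i else \<zero>) \<ominus> E2 k i"
      unfolding E2_def using that Ec fin by (intro finsum_diff) auto
    also have "(\<Oplus>j\<in>I. if k = j then E j i else \<zero>) = E k i"
      using finsum_delta[OF fin that(1), of "\<lambda>j. if k = j then E j i else \<zero>"] that Ec by auto
    finally show ?thesis .
  qed
  have E2s: "star A (E2 i k) = E2 k i" if "k \<in> I" "i \<in> I" for k i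
  proof -
    have "star A (E2 i k) = (\<Oplus>j\<in>I. star A (E i j \<otimes> E j k))"
      unfolding E2_def using that Ec fin by (intro star_finsum) auto
    also have "\<dots> = E2 k i"
      unfolding E2_def using that Ec Es by (intro finsum_cong_simp) (auto simp: star_mult)
    finally show ?thesis .
  qed
  have ay: "star A (a k) \<otimes> y i = E k i \<ominus> E2 k i" if "k \<in> I" "i \<in> I" for k i
  proof -
    have "star A (a k) \<otimes> y i = star A (star A (y i) \<otimes> a k)"
      using that y ac by (simp add: star_mult)
    also have "\<dots> = E k i \<ominus> E2 k i"
      using ya[OF that(2,1)] that Ec E2c by (simp add: star_diff Es E2s)
    finally show ?thesis .
  qed
  have aa: "star A (a k) \<otimes> a i = E2 k i \<ominus> E3 k i" if "k \<in> I" "i \<in> I" for k i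
  proof -
    have "star A (a k) = (\<Oplus>j\<in>I. star A (y j \<otimes> E j k))"
      unfolding a_def using that y Ec fin by (intro star_finsum) auto
    then have "star A (a k) \<otimes> a i = (\<Oplus>j\<in>I. star A (y j \<otimes> E j k) \<otimes> a i)"
      using that y Ec ac fin by (simp add: finsum_mult)
    also have "\<dots> = (\<Oplus>j\<in>I. E k j \<otimes> E j i \<ominus> E k j \<otimes> E2 j i)"
    proof (rule finsum_cong_simp)
      fix j assume j: "j \<in> I"
      have "star A (y j \<otimes> E j k) \<otimes> a i = E k j \<otimes> (star A (y j) \<otimes> a i)"
        using that y Ec ac j by (simp add: star_mult Es m_assoc)
      also have "\<dots> = E k j \<otimes> E j i \<ominus> E k j \<otimes> E2 j i"
        unfolding ya[OF j that(2)] using that Ec E2c j by (simp add: ring_nf)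
      finally show "star A (y j \<otimes> E j k) \<otimes> a i = E k j \<otimes> E j i \<ominus> E k j \<otimes> E2 j i" .
    qed (use that Ec E2c in auto)
    also have "\<dots> = E2 k i \<ominus> E3 k i"
      unfolding E3_def using that Ec E2c fin by (subst finsum_diff) (auto simp: E2_def)
    finally show ?thesis .
  qed
  have ny: "newton I y i = y i \<oplus> (1/2) \<odot> a i" for i by (simp add: newton_def a_def E_def)
  have def': "defect (newton I y) k i = (1/4) \<odot> (E2 k i \<oplus> E2 k i \<oplus> E2 k i \<oplus> E3 k i)"
  proof -
    have c: "E k i \<in> carrier A" "E2 k i \<in> carrier A" "E3 k i \<in> carrier A"
      using k i Ec E2c E3c by auto
    have "star A (newton I y k) \<otimes> newton I y i
      = star A (y k) \<otimes> y i \<oplus> (1/2) \<odot> (star A (y k) \<otimes> a i)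
        \<oplus> ((1/2) \<odot> (star A (a k) \<otimes> y i) \<oplus> (1/4) \<odot> (star A (a k) \<otimes> a i))"
      using k i y ac by (simp add: ny star_add star_smult l_distr r_distr smult_mult_left smult_mult_right
        smult_add_right a_ac)
    also have "\<dots> = ((if k = i then \<one> else \<zero>) \<ominus> E k i) \<oplus> (1/2) \<odot> (E k i \<ominus> E2 k i)
        \<oplus> ((1/2) \<odot> (E k i \<ominus> E2 k i) \<oplus> (1/4) \<odot> (E2 k i \<ominus> E3 k i))"
      using yy ya ay aa k i by simp
    also have "\<dots> = ((if k = i then \<one> else \<zero>) \<ominus> E k i)
        \<oplus> (((1/2) \<odot> (E k i \<ominus> E2 k i) \<oplus> (1/2) \<odot> (E k i \<ominus> E2 k i)) \<oplus> (1/4) \<odot> (E2 k i \<ominus> E3 k i))"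
      using c by (simp add: a_assoc)
    also have "(1/2) \<odot> (E k i \<ominus> E2 k i) \<oplus> (1/2) \<odot> (E k i \<ominus> E2 k i) = E k i \<ominus> E2 k i"
      using half_add_half[of "E k i \<ominus> E2 k i"] c by (simp add: smult_add_right)
    finally have 1: "star A (newton I y k) \<otimes> newton I y i
        = ((if k = i then \<one> else \<zero>) \<ominus> E k i) \<oplus> ((E k i \<ominus> E2 k i) \<oplus> (1/4) \<odot> (E2 k i \<ominus> E3 k i))" .
    have 2: "defect (newton I y) k i = E2 k i \<ominus> (1/4) \<odot> (E2 k i \<ominus> E3 k i)"
      unfolding defect_def 1 using c by (simp add: ring_nf)
    have "E2 k i = (1/4) \<odot> (E2 k i \<oplus> E2 k i \<oplus> E2 k i \<oplus> E2 k i)"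
      using half_add_half[of "(1/2) \<odot> (E2 k i \<oplus> E2 k i)"] half_add_half[of "E2 k i"] c
      by (simp add: smult_add_right a_ac)
    then have "defect (newton I y) k i = (1/4) \<odot> ((E2 k i \<oplus> E2 k i \<oplus> E2 k i \<oplus> E2 k i) \<ominus> (E2 k i \<ominus> E3 k i))"
      unfolding 2 using c by (simp only: smult_diff_right a_closed minus_closed)
    also have "(E2 k i \<oplus> E2 k i \<oplus> E2 k i \<oplus> E2 k i) \<ominus> (E2 k i \<ominus> E3 k i) = E2 k i \<oplus> E2 k i \<oplus> E2 k i \<oplus> E3 k i"
      using c by (simp add: ring_nf)
    finally show ?thesis .
  qed
  have E2n: "nrm A (E2 k i) \<le> ?n * (e * e)" if "k \<in> I" "i \<in> I" for k i
  proof -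
    have "nrm A (E2 k i) \<le> (\<Sum>j\<in>I. nrm A (E k j \<otimes> E j i))"
      unfolding E2_def using that Ec fin by (intro nrm_finsum_le) auto
    also have "\<dots> \<le> (\<Sum>j\<in>I. e * e)"
    proof (rule sum_mono)
      fix j assume j: "j \<in> I"
      show "nrm A (E k j \<otimes> E j i) \<le> e * e"
        by (rule order_trans[OF nrm_mult mult_mono]) (use that Ec j e in \<open>auto simp: E_def nrm_nonneg y\<close>)
    qed
    finally show ?thesis by simp
  qed
  have E3n: "nrm A (E3 k i) \<le> ?n * (e * (?n * (e * e)))" if "k \<in> I" "i \<in> I" for k i
  proof -
    have "nrm A (E3 k i) \<le> (\<Sum>j\<in>I. nrm A (E k j \<otimes> E2 j i))"
      unfolding E3_def using that Ec E2c fin by (intro nrm_finsum_le) auto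
    also have "\<dots> \<le> (\<Sum>j\<in>I. e * (?n * (e * e)))"
    proof (rule sum_mono)
      fix j assume j: "j \<in> I"
      show "nrm A (E k j \<otimes> E2 j i) \<le> e * (?n * (e * e))"
        by (rule order_trans[OF nrm_mult mult_mono])
          (use that Ec E2c E2n j e in \<open>auto simp: nrm_nonneg y E_def\<close>)
    qed
    finally show ?thesis by simp
  qed
  \<comment> \<open>With \<open>n e \<le> 1/2\<close> the entries of \<open>E^2\<close> and of
    \<open>E^3\<close> are at most \<open>e / 2\<close>, so the sum of four terms is at most
    \<open>2 e\<close>, and the factor 1/4 leaves \<open>e / 2\<close>.\<close>
  have ne: "?n * (e * e) \<le> e / 2"
    using mult_right_mono[OF e(3,2)] by (simp add: mult.assoc)
  have ne3: "?n * (e * (?n * (e * e))) \<le> e / 2"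
  proof -
    have "?n * (e * (?n * (e * e))) = (?n * e) * (?n * (e * e))" by simp
    also have "\<dots> \<le> 1/2 * (e / 2)" using e ne by (intro mult_mono) auto
    finally show ?thesis using e(2) by simp
  qed
  have c: "E2 k i \<in> carrier A" "E3 k i \<in> carrier A" using k i E2c E3c by auto
  have "nrm A (E2 k i \<oplus> E2 k i \<oplus> E2 k i \<oplus> E3 k i)
      \<le> nrm A (E2 k i) + nrm A (E2 k i) + nrm A (E2 k i) + nrm A (E3 k i)"
    using c nrm_add[of "E2 k i \<oplus> E2 k i \<oplus> E2 k i" "E3 k i"] nrm_add[of "E2 k i \<oplus> E2 k i" "E2 k i"]
      nrm_add[of "E2 k i" "E2 k i"] by simp
  also have "\<dots> \<le> e/2 + e/2 + e/2 + e/2"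
    using E2n[OF k i] E3n[OF k i] ne ne3 by linarith
  finally show "nrm A (defect (newton I y) k i) \<le> e / 2"
    unfolding def' using c by (simp add: nrm_smult norm_divide)
  have e1: "e \<le> 1/2" using e(2,3) n1 mult_right_mono[of 1 ?n e] by simp
  \<comment> \<open>From \<open>star A (y j) \<otimes> y j = \<one> \<ominus> E j j\<close> and
    \<open>e \<le> 1/2\<close> the square of the norm is at most 3/2; the rounder bound 2
    suffices.\<close>
  have yn: "nrm A (y j) \<le> 2" if "j \<in> I" for j
  proof -
    have "star A (y j) \<otimes> y j = \<one> \<ominus> E j j" using yy[OF that that] by simp
    then have "(nrm A (y j))\<^sup>2 \<le> nrm A \<one> + nrm A (E j j)"
      using nrm_star_mult[of "y j"] nrm_diff[of \<one> "E j j"] y Ec that by simp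
    also have "\<dots> \<le> 2\<^sup>2" using nrm_one_le e(1)[OF that that] e1 by (simp add: E_def)
    finally show ?thesis by (rule power2_le_imp_le) simp
  qed
  have "nrm A (a i) \<le> (\<Sum>j\<in>I. nrm A (y j \<otimes> E j i))"
    unfolding a_def using i y Ec fin by (intro nrm_finsum_le) auto
  also have "\<dots> \<le> (\<Sum>j\<in>I. 2 * e)"
  proof (rule sum_mono)
    fix j assume j: "j \<in> I"
    show "nrm A (y j \<otimes> E j i) \<le> 2 * e"
      by (rule order_trans[OF nrm_mult mult_mono]) (use i y yn Ec j e in \<open>auto simp: E_def nrm_nonneg\<close>)
  qed
  finally have "nrm A (a i) \<le> 2 * (?n * e)" by simp
  moreover have "newton I y i \<ominus> y i = (1/2) \<odot> a i"
    using y ac i by (simp add: ny ring_nf)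
  ultimately show "nrm A (newton I y i \<ominus> y i) \<le> ?n * e"
    using ac i by (simp add: nrm_smult norm_divide)
qed

text \<open>Defects at least halve with each step and bound the size of the steps, so the iterates
  converge geometrically, and in the limit all defects vanish.\<close>

lemma newton_conv:
  fixes e :: real
  assumes fin: "finite I" and y: "\<And>i. i \<in> I \<Longrightarrow> y i \<in> carrier A"
    and e: "\<And>i j. \<lbrakk>i \<in> I; j \<in> I\<rbrakk> \<Longrightarrow> nrm A (defect y i j) \<le> e" "0 \<le> e" "card I * e \<le> 1/2"
  obtains r where "orthonormal I r" "\<And>i. i \<in> I \<Longrightarrow> conv (\<lambda>m. (newton I ^^ m) y i) (r i)"
proof -
  let ?z = "\<lambda>m. (newton I ^^ m) y"
  have zc: "?z m i \<in> carrier A" if "i \<in> I" for m i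
    using that by (induction m arbitrary: i) (auto simp: y newton_closed)
  have zd: "nrm A (defect (?z m) i j) \<le> e * (1/2) ^ m" if "i \<in> I" "j \<in> I" for m i j
    using that
  proof (induction m arbitrary: i j)
    case 0 then show ?case using e by simp
  next
    case (Suc m)
    have "e * (1/2) ^ m \<le> e * 1" using e(2) by (intro mult_left_mono) (simp_all add: power_le_one)
    then have "card I * (e * (1/2) ^ m) \<le> card I * e"
      by (intro mult_left_mono) simp_all
    then have "nrm A (defect (newton I (?z m)) i j) \<le> e * (1/2) ^ m / 2"
      using Suc zc e by (intro newton_step(1)[OF fin]) auto
    then show ?case by simp
  qed
  have zs: "nrm A (?z (Suc m) i \<ominus> ?z m i) \<le> 1/2 * (1/2) ^ m" if "i \<in> I" for m i
  proof -
    have *: "card I * (e * (1/2) ^ m) \<le> 1/2 * (1/2) ^ m"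
      using mult_right_mono[OF e(3), of "(1/2) ^ m"] by (simp add: mult.assoc)
    have "(1/2::real) ^ m \<le> 1" by (simp add: power_le_one)
    with * have "card I * (e * (1/2) ^ m) \<le> 1/2" by linarith
    then have "nrm A (newton I (?z m) i \<ominus> ?z m i) \<le> card I * (e * (1/2) ^ m)"
      using zd zc e that by (intro newton_step(2)[OF fin]) auto
    from order_trans[OF this *] show ?thesis by simp
  qed
  have "\<forall>i\<in>I. \<exists>x. conv (\<lambda>m. ?z m i) x"
  proof
    fix i assume i: "i \<in> I"
    show "\<exists>x. conv (\<lambda>m. ?z m i) x"
      by (rule geometric_conv[of "\<lambda>m. ?z m i" "1/2", OF zc[OF i] zs[OF i]]) (rule exI)
  qed
  then obtain r where r: "\<And>i. i \<in> I \<Longrightarrow> conv (\<lambda>m. ?z m i) (r i)" by metis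
  have rc: "r i \<in> carrier A" if "i \<in> I" for i using r[OF that] by (simp add: conv_def)
  have "star A (r i) \<otimes> r j = (if i = j then \<one> else \<zero>)" if "i \<in> I" "j \<in> I" for i j
  proof (rule conv_unique)
    show "conv (\<lambda>m. star A (?z m i) \<otimes> ?z m j) (star A (r i) \<otimes> r j)"
      using r that by (intro conv_mult conv_star) auto
    show "conv (\<lambda>m. star A (?z m i) \<otimes> ?z m j) (if i = j then \<one> else \<zero>)"
    proof (rule conv_bound)
      have "(\<lambda>m. e * (1/2::real) ^ m) \<longlonglongrightarrow> e * 0"
        by (intro tendsto_mult tendsto_const LIMSEQ_power_zero) auto
      then show "(\<lambda>m. e * (1/2::real) ^ m) \<longlonglongrightarrow> 0" by simp
      show "nrm A (star A (?z m i) \<otimes> ?z m j \<ominus> (if i = j then \<one> else \<zero>)) \<le> e * (1/2) ^ m" for m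
        using zd[OF that, of m] zc that
        by (subst nrm_minus_commute) (auto simp: defect_def)
    qed (use zc that in auto)
  qed
  then show thesis using that[of r] r rc by (auto simp: orthonormal_def)
qed

text \<open>A permutation of the indices only permutes the summands of the correction term.
  Equivariance comes from here, since the group acts on the families by permuting them.\<close>

lemma newton_reindex:
  assumes fin: "finite I" and y: "\<And>i. i \<in> I \<Longrightarrow> y i \<in> carrier A"
    and p: "bij_betw p I I" and i: "i \<in> I"
  shows "newton I (\<lambda>i. y (p i)) i = newton I y (p i)"
proof -
  have pI: "p j \<in> I" if "j \<in> I" for j using p that by (auto simp: bij_betw_def)
  have inj: "inj_on p I" and img: "p ` I = I" using p by (auto simp: bij_betw_def)
  have "defect (\<lambda>i. y (p i)) j i = defect y (p j) (p i)" if "j \<in> I" for j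
    using inj that i by (auto simp: defect_def inj_on_def)
  then have "(\<Oplus>j\<in>I. y (p j) \<otimes> defect (\<lambda>i. y (p i)) j i) = (\<Oplus>j\<in>I. y (p j) \<otimes> defect y (p j) (p i))"
    using y pI i by (intro finsum_cong_simp) auto
  also have "\<dots> = (\<Oplus>j\<in>p ` I. y j \<otimes> defect y j (p i))"
    using y pI i inj img by (intro finsum_reindex[symmetric]) auto
  finally show ?thesis by (simp add: newton_def img)
qed

lemma newton_cong:
  assumes "\<And>j. j \<in> I \<Longrightarrow> y j = z j" "\<And>j. j \<in> I \<Longrightarrow> z j \<in> carrier A" "i \<in> I"
  shows "newton I y i = newton I z i"
proof -
  have "(\<Oplus>j\<in>I. y j \<otimes> defect y j i) = (\<Oplus>j\<in>I. z j \<otimes> defect z j i)"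
    using assms by (intro finsum_cong_simp) (auto simp: defect_def)
  then show ?thesis using assms by (simp add: newton_def)
qed

end

context unital_cstar_hom
begin

lemma newton:
  assumes "finite I" "\<And>j. j \<in> I \<Longrightarrow> y j \<in> carrier A" "i \<in> I"
  shows "h (A.newton I y i) = B.newton I (\<lambda>i. h (y i)) i"
proof -
  have d: "h (A.defect y j i) = B.defect (\<lambda>i. h (y i)) j i" if "j \<in> I" for j
    using assms that by (simp add: A.defect_def B.defect_def diff mult star)
  have "h (\<Oplus>\<^bsub>A\<^esub>j\<in>I. y j \<otimes>\<^bsub>A\<^esub> A.defect y j i) = (\<Oplus>\<^bsub>B\<^esub>j\<in>I. h (y j \<otimes>\<^bsub>A\<^esub> A.defect y j i))"
    using assms by (intro finsum) auto
  also have "\<dots> = (\<Oplus>\<^bsub>B\<^esub>j\<in>I. h (y j) \<otimes>\<^bsub>B\<^esub> B.defect (\<lambda>i. h (y i)) j i)"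
    using assms d by (intro B.finsum_cong_simp) (auto simp: mult)
  finally show ?thesis
    using assms by (simp add: A.newton_def B.newton_def add smult A.finsum_closed')
qed

lemma newton_iterate:
  assumes "finite I" "\<And>j. j \<in> I \<Longrightarrow> y j \<in> carrier A" "i \<in> I"
  shows "h ((A.newton I ^^ m) y i) = (B.newton I ^^ m) (\<lambda>i. h (y i)) i"
  using assms(3)
proof (induction m arbitrary: i)
  case (Suc m)
  have c: "(A.newton I ^^ m) y j \<in> carrier A" if "j \<in> I" for j
    using that by (induction m arbitrary: j) (auto simp: assms(2) A.newton_closed)
  have "h ((A.newton I ^^ Suc m) y i) = B.newton I (\<lambda>i. h ((A.newton I ^^ m) y i)) i"
    using newton[OF assms(1) c Suc.prems] by simp
  also have "\<dots> = B.newton I ((B.newton I ^^ m) (\<lambda>i. h (y i))) i"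
    by (rule B.newton_cong) (use Suc c in \<open>auto simp flip: Suc.IH\<close>)
  finally show ?case by simp
qed simp

end

section \<open>Actions of finite groups\<close>

locale finite_G_algebra = unital_cstar A + G: group G
  for A :: "'a cstar" (structure) and G :: "('g, 'm) monoid_scheme" +
  fixes \<alpha> :: "'g \<Rightarrow> 'a \<Rightarrow> 'a"
  assumes action: "\<alpha> \<in> hom G (cstar_Aut A)" and finite_G: "finite (carrier G)"
begin

lemma act_Bij: "g \<in> carrier G \<Longrightarrow> \<alpha> g \<in> Bij (carrier A)"
  using action by (auto simp: hom_def cstar_Aut_def)

lemma act_hom: "g \<in> carrier G \<Longrightarrow> unital_cstar_hom A A (\<alpha> g)"
  using action
  by (auto simp: hom_def cstar_Aut_def intro!: unital_cstar_hom.intro unital_cstar_hom_axioms.intro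
    unital_cstar_axioms)

lemma act_mult_group:
  assumes "g \<in> carrier G" "h \<in> carrier G" "x \<in> carrier A"
  shows "\<alpha> (g \<otimes>\<^bsub>G\<^esub> h) x = \<alpha> g (\<alpha> h x)"
proof -
  have "\<alpha> (g \<otimes>\<^bsub>G\<^esub> h) = compose (carrier A) (\<alpha> g) (\<alpha> h)"
    using action act_Bij assms by (simp add: hom_def cstar_Aut_def BijGroup_def)
  then show ?thesis using assms by (simp add: compose_def)
qed

lemmas act_closed [simp] = unital_cstar_hom.closed[OF act_hom]
  and act_mult = unital_cstar_hom.mult[OF act_hom]
  and act_add = unital_cstar_hom.add[OF act_hom]
  and act_diff = unital_cstar_hom.diff[OF act_hom]
  and act_smult = unital_cstar_hom.smult[OF act_hom]
  and act_star = unital_cstar_hom.star[OF act_hom]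
  and act_unit [simp] = unital_cstar_hom.one[OF act_hom]
  and act_zero [simp] = unital_cstar_hom.zero[OF act_hom]
  and act_finsum = unital_cstar_hom.finsum[OF act_hom]
  and act_conv = unital_cstar_hom.conv[OF act_hom]
  and act_contractive = unital_cstar_hom.contractive[OF act_hom]

text \<open>The identity element acts as an injective idempotent map.\<close>

lemma act_one: assumes "x \<in> carrier A" shows "\<alpha> \<one>\<^bsub>G\<^esub> x = x"
proof -
  have "\<alpha> \<one>\<^bsub>G\<^esub> (\<alpha> \<one>\<^bsub>G\<^esub> x) = \<alpha> \<one>\<^bsub>G\<^esub> x"
    using act_mult_group[of "\<one>\<^bsub>G\<^esub>" "\<one>\<^bsub>G\<^esub>" x] assms by simp
  moreover have "inj_on (\<alpha> \<one>\<^bsub>G\<^esub>) (carrier A)"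
    using act_Bij[of "\<one>\<^bsub>G\<^esub>"] by (simp add: Bij_def bij_betw_def)
  ultimately show ?thesis using assms by (simp add: inj_on_def)
qed

lemma act_inv: "\<lbrakk>g \<in> carrier G; x \<in> carrier A\<rbrakk> \<Longrightarrow> \<alpha> (inv\<^bsub>G\<^esub> g) (\<alpha> g x) = x"
  using act_mult_group[of "inv\<^bsub>G\<^esub> g" g x] by (simp add: act_one)

lemma act_inv': "\<lbrakk>g \<in> carrier G; x \<in> carrier A\<rbrakk> \<Longrightarrow> \<alpha> g (\<alpha> (inv\<^bsub>G\<^esub> g) x) = x"
  using act_mult_group[of g "inv\<^bsub>G\<^esub> g" x] by (simp add: act_one)

definition fixed :: "'a \<Rightarrow> bool" where
  "fixed x \<longleftrightarrow> x \<in> carrier A \<and> (\<forall>g\<in>carrier G. \<alpha> g x = x)"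

lemma newton_equivariant:
  assumes fin: "finite I" and y: "\<And>i. i \<in> I \<Longrightarrow> y i \<in> carrier A"
    and g: "g \<in> carrier G" and p: "bij_betw p I I" and eq: "\<And>i. i \<in> I \<Longrightarrow> \<alpha> g (y i) = y (p i)"
    and i: "i \<in> I"
  shows "\<alpha> g ((newton I ^^ m) y i) = (newton I ^^ m) y (p i)"
  using i
proof (induction m arbitrary: i)
  case (Suc m)
  have pI: "p j \<in> I" if "j \<in> I" for j using p that by (auto simp: bij_betw_def)
  have c: "(newton I ^^ m) y j \<in> carrier A" if "j \<in> I" for j
    using that by (induction m arbitrary: j) (auto simp: y newton_closed)
  have "\<alpha> g ((newton I ^^ Suc m) y i) = newton I (\<lambda>i. \<alpha> g ((newton I ^^ m) y i)) i"
    using unital_cstar_hom.newton[OF act_hom[OF g] fin c Suc.prems] by simp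
  also have "\<dots> = newton I (\<lambda>i. (newton I ^^ m) y (p i)) i"
    by (rule newton_cong) (use Suc c pI in auto)
  also have "\<dots> = newton I ((newton I ^^ m) y) (p i)"
    by (rule newton_reindex[OF fin c p Suc.prems])
  finally show ?case by simp
qed (simp add: eq)

end

text \<open>The defining equation is algebraic, and the norm condition survives because
  homomorphisms are contractive.\<close>

lemma (in unital_cstar) cstar_hom_one_minus_sqrt:
  assumes "unital_cstar_hom A B h" "x \<in> carrier A" "one_minus_sqrt x y"
  shows "unital_cstar.one_minus_sqrt B (h x) (h y)"
proof -
  interpret h: unital_cstar_hom A B h by (rule assms(1))
  have y: "y \<in> carrier A" "nrm A y < 1" and ye: "y = (1/2) \<odot> (x \<oplus> y \<otimes> y)"
    using assms(3) by (auto simp: one_minus_sqrt_def)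
  have "h y = h ((1/2) \<odot> (x \<oplus> y \<otimes> y))" using ye by simp
  also have "\<dots> = (1/2) \<odot>\<^bsub>B\<^esub> (h x \<oplus>\<^bsub>B\<^esub> h y \<otimes>\<^bsub>B\<^esub> h y)"
    using y assms(2) by (simp add: h.smult h.add h.mult)
  finally have "h y = (1/2) \<odot>\<^bsub>B\<^esub> (h x \<oplus>\<^bsub>B\<^esub> h y \<otimes>\<^bsub>B\<^esub> h y)" .
  then show ?thesis
    using y h.contractive[OF y(1)] by (simp add: h.B.one_minus_sqrt_def)
qed

section \<open>Averaging over the group and fixed elements\<close>

context finite_G_algebra
begin

definition avg :: "'a \<Rightarrow> 'a" where
  "avg x = (1 / of_nat (card (carrier G))) \<odot> (\<Oplus>g\<in>carrier G. \<alpha> g x)"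

lemma card_G: "card (carrier G) > 0"
  using finite_G G.one_closed by (auto simp: card_gt_0_iff)

lemma avg_closed [simp]: "x \<in> carrier A \<Longrightarrow> avg x \<in> carrier A"
  by (simp add: avg_def finsum_closed')

lemma translate_bij:
  assumes "h \<in> carrier G" shows "inj_on ((\<otimes>\<^bsub>G\<^esub>) h) (carrier G)" "((\<otimes>\<^bsub>G\<^esub>) h) ` carrier G = carrier G"
  using G.inj_on_multc assms by (auto simp: inj_on_def G.surj_const_mult)

lemma sum_translate:
  assumes "h \<in> carrier G" "\<And>g. g \<in> carrier G \<Longrightarrow> f g \<in> carrier A"
  shows "(\<Oplus>g\<in>carrier G. f (h \<otimes>\<^bsub>G\<^esub> g)) = (\<Oplus>g\<in>carrier G. f g)"
  using finsum_reindex[OF _ translate_bij(1)[OF assms(1)], of f] translate_bij(2)[OF assms(1)] assms by auto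

lemma sum_G_scale: "x \<in> carrier A \<Longrightarrow> (1 / of_nat (card (carrier G))) \<odot> (\<Oplus>g\<in>carrier G. x) = x"
  using finite_G G.one_closed by (simp add: finsum_const_smult) blast

lemma avg_fixed: assumes "x \<in> carrier A" shows "fixed (avg x)"
  unfolding fixed_def
proof (intro conjI ballI)
  fix h assume h: "h \<in> carrier G"
  have "\<alpha> h (avg x) = (1 / of_nat (card (carrier G))) \<odot> (\<Oplus>g\<in>carrier G. \<alpha> h (\<alpha> g x))"
    using h assms finite_G by (simp add: avg_def act_smult act_finsum finsum_closed')
  also have "(\<Oplus>g\<in>carrier G. \<alpha> h (\<alpha> g x)) = (\<Oplus>g\<in>carrier G. \<alpha> (h \<otimes>\<^bsub>G\<^esub> g) x)"
    using h assms by (intro finsum_cong_simp) (auto simp: act_mult_group)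
  also have "\<dots> = (\<Oplus>g\<in>carrier G. \<alpha> g x)" using h assms by (intro sum_translate) auto
  finally show "\<alpha> h (avg x) = avg x" by (simp add: avg_def)
qed (use assms in simp)

lemma avg_of_fixed: assumes "fixed x" shows "avg x = x"
proof -
  have x: "x \<in> carrier A" using assms by (simp add: fixed_def)
  have "(\<Oplus>g\<in>carrier G. \<alpha> g x) = (\<Oplus>g\<in>carrier G. x)"
    using assms x by (intro finsum_cong_simp) (auto simp: fixed_def)
  then show ?thesis using sum_G_scale[OF x] by (simp add: avg_def)
qed

lemma avg_star: assumes "x \<in> carrier A" "star A x = x" shows "star A (avg x) = avg x"
proof -
  have "star A (\<Oplus>g\<in>carrier G. \<alpha> g x) = (\<Oplus>g\<in>carrier G. star A (\<alpha> g x))"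
    using assms finite_G by (intro star_finsum) auto
  also have "\<dots> = (\<Oplus>g\<in>carrier G. \<alpha> g x)"
    using assms by (intro finsum_cong_simp) (auto simp flip: act_star)
  finally show ?thesis using assms by (simp add: avg_def star_smult finsum_closed')
qed

lemma avg_nrm: assumes "x \<in> carrier A" shows "nrm A (avg x) \<le> nrm A x"
proof -
  let ?n = "real (card (carrier G))"
  have "nrm A (\<Oplus>g\<in>carrier G. \<alpha> g x) \<le> (\<Sum>g\<in>carrier G. nrm A (\<alpha> g x))"
    using assms finite_G by (intro nrm_finsum_le) auto
  also have "\<dots> \<le> (\<Sum>g\<in>carrier G. nrm A x)" using assms act_contractive by (intro sum_mono) auto
  finally have "nrm A (\<Oplus>g\<in>carrier G. \<alpha> g x) \<le> ?n * nrm A x" by simp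
  moreover have "nrm A (avg x) = nrm A (\<Oplus>g\<in>carrier G. \<alpha> g x) / ?n"
    unfolding avg_def using assms by (subst nrm_smult) (auto simp: finsum_closed' norm_divide)
  ultimately show ?thesis using card_G by (simp add: divide_le_eq mult.commute)
qed

lemma fixedI: "x \<in> carrier A \<Longrightarrow> (\<And>g. g \<in> carrier G \<Longrightarrow> \<alpha> g x = x) \<Longrightarrow> fixed x"
  by (simp add: fixed_def)

lemma fixedD: "fixed x \<Longrightarrow> x \<in> carrier A" "fixed x \<Longrightarrow> g \<in> carrier G \<Longrightarrow> \<alpha> g x = x"
  by (auto simp: fixed_def)

lemma fixed_add: "fixed x \<Longrightarrow> fixed y \<Longrightarrow> fixed (x \<oplus> y)"
  and fixed_diff: "fixed x \<Longrightarrow> fixed y \<Longrightarrow> fixed (x \<ominus> y)"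
  and fixed_mult: "fixed x \<Longrightarrow> fixed y \<Longrightarrow> fixed (x \<otimes> y)"
  and fixed_smult: "fixed x \<Longrightarrow> fixed (c \<odot> x)"
  and fixed_one: "fixed \<one>"
  and fixed_zero: "fixed \<zero>"
  by (simp_all add: fixed_def act_add act_diff act_mult act_smult act_star)

text \<open>The translates of \<open>y\<close> solve the equation for the same \<open>x\<close>, so
  uniqueness makes them equal to \<open>y\<close>.\<close>

lemma fixed_one_minus_sqrt:
  assumes "fixed x" "one_minus_sqrt x y" shows "fixed y"
proof (rule fixedI)
  show "y \<in> carrier A" using assms(2) by (simp add: one_minus_sqrt_def)
  fix g assume g: "g \<in> carrier G"
  have "one_minus_sqrt (\<alpha> g x) (\<alpha> g y)"
    using cstar_hom_one_minus_sqrt[OF act_hom[OF g] fixedD(1)[OF assms(1)] assms(2)] .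
  then have "one_minus_sqrt x (\<alpha> g y)" unfolding fixedD(2)[OF assms(1) g] .
  then show "\<alpha> g y = y" by (rule one_minus_sqrt_unique[OF fixedD(1)[OF assms(1)] _ assms(2)])
qed

end

text \<open>Covers both the map from \<open>C\<close> to \<open>C/J\<close> and the maps between
  quotients of \<open>C\<close>. The strict bound in \<open>lift\<close> comes directly from the
  infimum in the quotient norm; it keeps lifts inside the domain of the square root.\<close>

locale equivariant_quotient =
  D: finite_G_algebra D G \<beta> + Q: finite_G_algebra Q G \<kappa> + p: unital_cstar_hom D Q p
  for D :: "'d cstar" and G :: "('g, 'm) monoid_scheme" and \<beta> and Q :: "'q cstar" and \<kappa> and p +
  assumes equivariant: "\<lbrakk>g \<in> carrier G; x \<in> carrier D\<rbrakk> \<Longrightarrow> p (\<beta> g x) = \<kappa> g (p x)"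
    and lift: "\<lbrakk>y \<in> carrier Q; nrm Q y < e\<rbrakk> \<Longrightarrow> \<exists>x\<in>carrier D. p x = y \<and> nrm D x < e"
begin

lemma p_avg: "x \<in> carrier D \<Longrightarrow> p (D.avg x) = Q.avg (p x)"
proof -
  assume x: "x \<in> carrier D"
  have "p (\<Oplus>\<^bsub>D\<^esub>g\<in>carrier G. \<beta> g x) = (\<Oplus>\<^bsub>Q\<^esub>g\<in>carrier G. p (\<beta> g x))"
    using x D.finite_G by (intro p.finsum) auto
  also have "\<dots> = (\<Oplus>\<^bsub>Q\<^esub>g\<in>carrier G. \<kappa> g (p x))"
    using x by (intro Q.finsum_cong_simp) (auto simp: equivariant)
  finally show ?thesis using x by (simp add: D.avg_def Q.avg_def p.smult D.finsum_closed')
qed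

text \<open>Taking the real part and averaging over the group do not increase the norm, and they do
  not move the image, which already is self-adjoint and fixed.\<close>

lemma lift_fixed_selfadjoint:
  assumes y: "Q.fixed y" "star Q y = y" "nrm Q y < e"
  obtains x where "D.fixed x" "star D x = x" "p x = y" "nrm D x < e"
proof -
  have yc: "y \<in> carrier Q" using y by (simp add: Q.fixed_def)
  obtain z where z: "z \<in> carrier D" "p z = y" "nrm D z < e" using lift[OF yc y(3)] by auto
  define w where "w = (1/2) \<odot>\<^bsub>D\<^esub> (z \<oplus>\<^bsub>D\<^esub> star D z)"
  have w: "w \<in> carrier D" "star D w = w"
    using z by (auto simp: w_def D.star_smult D.star_add D.a_comm)
  have "p w = (1/2) \<odot>\<^bsub>Q\<^esub> (y \<oplus>\<^bsub>Q\<^esub> y)" using z y(2) by (simp add: w_def p.smult p.add p.star)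
  then have pw: "p w = y" using Q.half_add_half[OF yc] by simp
  have "nrm D w \<le> nrm D z"
    unfolding w_def using z D.nrm_add[of z "star D z"] by (simp add: D.nrm_smult D.nrm_star norm_divide)
  then have "nrm D (D.avg w) < e" using D.avg_nrm[OF w(1)] z(3) by linarith
  moreover have "p (D.avg w) = y" using p_avg[OF w(1)] pw Q.avg_of_fixed[OF y(1)] by simp
  ultimately show thesis using that[of "D.avg w"] D.avg_fixed[OF w(1)] D.avg_star[OF w] by simp
qed

text \<open>Arbitrary lifts \<open>c\<close> are averaged in the form
  \<open>\<beta> g (c (act (inv g) i))\<close>. Every summand has image \<open>x i\<close>, and
  applying \<open>\<beta> h\<close> relabels the sum while turning \<open>i\<close> into
  \<open>act h i\<close>.\<close>

lemma lift_family:
  fixes act :: "'g \<Rightarrow> 'i \<Rightarrow> 'i"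
  assumes x: "\<And>i. i \<in> I \<Longrightarrow> x i \<in> carrier Q"
    and act: "\<And>g i. g \<in> carrier G \<Longrightarrow> i \<in> I \<Longrightarrow> act g i \<in> I"
      "\<And>g h i. \<lbrakk>g \<in> carrier G; h \<in> carrier G; i \<in> I\<rbrakk> \<Longrightarrow> act (g \<otimes>\<^bsub>G\<^esub> h) i = act g (act h i)"
      "\<And>i. i \<in> I \<Longrightarrow> act \<one>\<^bsub>G\<^esub> i = i"
    and eq: "\<And>g i. g \<in> carrier G \<Longrightarrow> i \<in> I \<Longrightarrow> \<kappa> g (x i) = x (act g i)"
  obtains y where "\<And>i. i \<in> I \<Longrightarrow> y i \<in> carrier D" "\<And>i. i \<in> I \<Longrightarrow> p (y i) = x i"
    "\<And>g i. g \<in> carrier G \<Longrightarrow> i \<in> I \<Longrightarrow> \<beta> g (y i) = y (act g i)"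
proof -
  have "\<forall>i\<in>I. \<exists>c\<in>carrier D. p c = x i"
    using lift[OF x less_add_one] by blast
  then obtain c where c: "\<And>i. i \<in> I \<Longrightarrow> c i \<in> carrier D" "\<And>i. i \<in> I \<Longrightarrow> p (c i) = x i" by metis
  let ?n = "1 / of_nat (card (carrier G))"
  define y where "y i = ?n \<odot>\<^bsub>D\<^esub> (\<Oplus>\<^bsub>D\<^esub>g\<in>carrier G. \<beta> g (c (act (inv\<^bsub>G\<^esub> g) i)))" for i
  have cc: "\<beta> g (c (act (inv\<^bsub>G\<^esub> g) i)) \<in> carrier D" if "g \<in> carrier G" "i \<in> I" for g i
    using that c act(1) by simp
  show thesis
  proof (rule that[of y])
    fix i assume i: "i \<in> I"
    show "y i \<in> carrier D" using cc i by (simp add: y_def D.finsum_closed')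
    have "p (\<Oplus>\<^bsub>D\<^esub>g\<in>carrier G. \<beta> g (c (act (inv\<^bsub>G\<^esub> g) i))) = (\<Oplus>\<^bsub>Q\<^esub>g\<in>carrier G. p (\<beta> g (c (act (inv\<^bsub>G\<^esub> g) i))))"
      using cc i D.finite_G by (intro p.finsum) auto
    also have "\<dots> = (\<Oplus>\<^bsub>Q\<^esub>g\<in>carrier G. x i)"
    proof (rule Q.finsum_cong_simp)
      fix g assume g: "g \<in> carrier G"
      have "p (\<beta> g (c (act (inv\<^bsub>G\<^esub> g) i))) = \<kappa> g (x (act (inv\<^bsub>G\<^esub> g) i))"
        using g i c act(1) by (simp add: equivariant)
      also have "\<dots> = x (act g (act (inv\<^bsub>G\<^esub> g) i))" using g i act(1) by (simp add: eq)
      also have "act g (act (inv\<^bsub>G\<^esub> g) i) = act (g \<otimes>\<^bsub>G\<^esub> inv\<^bsub>G\<^esub> g) i"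
        by (rule act(2)[symmetric]) (use g i in auto)
      finally show "p (\<beta> g (c (act (inv\<^bsub>G\<^esub> g) i))) = x i" using g i act(3) by simp
    qed (use x i in simp)
    finally show "p (y i) = x i"
      using cc i Q.sum_G_scale[OF x[OF i]] by (simp add: y_def p.smult D.finsum_closed')
    fix h assume h: "h \<in> carrier G"
    have "\<beta> h (y i) = ?n \<odot>\<^bsub>D\<^esub> (\<Oplus>\<^bsub>D\<^esub>g\<in>carrier G. \<beta> h (\<beta> g (c (act (inv\<^bsub>G\<^esub> g) i))))"
      using cc h i D.finite_G by (simp add: y_def D.act_smult D.act_finsum D.finsum_closed')
    also have "(\<Oplus>\<^bsub>D\<^esub>g\<in>carrier G. \<beta> h (\<beta> g (c (act (inv\<^bsub>G\<^esub> g) i))))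
        = (\<Oplus>\<^bsub>D\<^esub>g\<in>carrier G. \<beta> (h \<otimes>\<^bsub>G\<^esub> g) (c (act (inv\<^bsub>G\<^esub> (h \<otimes>\<^bsub>G\<^esub> g)) (act h i))))"
    proof (rule D.finsum_cong_simp)
      fix g assume g: "g \<in> carrier G"
      have "act (inv\<^bsub>G\<^esub> (h \<otimes>\<^bsub>G\<^esub> g)) (act h i) = act (inv\<^bsub>G\<^esub> (h \<otimes>\<^bsub>G\<^esub> g) \<otimes>\<^bsub>G\<^esub> h) i"
        by (rule act(2)[symmetric]) (use g h i in auto)
      also have "inv\<^bsub>G\<^esub> (h \<otimes>\<^bsub>G\<^esub> g) \<otimes>\<^bsub>G\<^esub> h = inv\<^bsub>G\<^esub> g"
        using g h by (simp add: D.G.inv_mult_group D.G.m_assoc)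
      finally show "\<beta> h (\<beta> g (c (act (inv\<^bsub>G\<^esub> g) i))) = \<beta> (h \<otimes>\<^bsub>G\<^esub> g) (c (act (inv\<^bsub>G\<^esub> (h \<otimes>\<^bsub>G\<^esub> g)) (act h i)))"
        using g h i c act(1) by (simp add: D.act_mult_group)
    qed (use cc act(1) h i in simp)
    also have "\<dots> = (\<Oplus>\<^bsub>D\<^esub>g\<in>carrier G. \<beta> g (c (act (inv\<^bsub>G\<^esub> g) (act h i))))"
      by (rule D.sum_translate[OF h]) (use cc act(1) h i in simp)
    finally show "\<beta> h (y i) = y (act h i)" by (simp add: y_def)
  qed
qed

text \<open>A symmetry \<open>\<surd>2 c\<close> of the quotient is, up to the scalar \<open>- \<i>\<close>, the square of the unitary
  \<open>c + \<i> \<surd>(1 - c\<^sup>2)\<close>, and unitaries of this form lift because \<open>c\<close> lifts with norm below 1.\<close>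

lemma lift_symmetry:
  assumes c: "Q.fixed c" "star Q c = c" "c \<otimes>\<^bsub>Q\<^esub> c = (1/2) \<odot>\<^bsub>Q\<^esub> \<one>\<^bsub>Q\<^esub>"
    and e: "D.fixed e" "star D e = e" "e \<otimes>\<^bsub>D\<^esub> e = e"
    and comm: "p e \<otimes>\<^bsub>Q\<^esub> c = c \<otimes>\<^bsub>Q\<^esub> p e"
  obtains U where "D.fixed U" "star D U \<otimes>\<^bsub>D\<^esub> U = \<one>\<^bsub>D\<^esub>" "U \<otimes>\<^bsub>D\<^esub> e = e \<otimes>\<^bsub>D\<^esub> U"
    "p U \<otimes>\<^bsub>Q\<^esub> p e = complex_of_real (sqrt 2) \<odot>\<^bsub>Q\<^esub> (c \<otimes>\<^bsub>Q\<^esub> p e)"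
proof -
  have cc: "c \<in> carrier Q" and ec: "e \<in> carrier D" using c e Q.fixedD D.fixedD by auto
  \<comment> \<open>Scaling the symmetry to have square 1/2 pays off here: \<open>c\<close> has norm
    below 1, hence a fixed self-adjoint lift of norm below 1, to which the square root
    applies.\<close>
  have "(nrm Q c)\<^sup>2 \<le> 1/2"
    using Q.nrm_star_mult[OF cc] c(2,3) Q.nrm_one_le by (simp add: Q.nrm_smult norm_divide)
  then have "nrm Q c < 1" using Q.nrm_nonneg[OF cc]
    by (smt (verit) power2_eq_square mult_less_cancel_left1 one_power2 power_mono half_gt_zero_iff zero_less_one field_sum_of_halves)
  then obtain d where d: "D.fixed d" "star D d = d" "p d = c" "nrm D d < 1"
    using lift_fixed_selfadjoint[OF c(1,2)] by blast
  have dc: "d \<in> carrier D" using d D.fixedD by auto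
  \<comment> \<open>Only the image of \<open>d\<close> is known to commute with that of
    \<open>e\<close>. The compression makes \<open>U\<close> commute with \<open>e\<close> itself
    and keeps the norm below 1.\<close>
  define b where "b = e \<otimes>\<^bsub>D\<^esub> d \<otimes>\<^bsub>D\<^esub> e"
  have b: "b \<in> carrier D" "star D b = b" "D.fixed b"
    unfolding b_def using ec dc d e by (auto simp: D.star_mult D.m_assoc intro!: D.fixed_mult)
  have en: "nrm D e \<le> 1" using D.nrm_projection[OF ec e(2,3)] .
  have bn: "nrm D b < 1"
  proof -
    have "nrm D b \<le> nrm D (e \<otimes>\<^bsub>D\<^esub> d) * nrm D e" unfolding b_def using ec dc by (intro D.nrm_mult) auto
    also have "\<dots> \<le> nrm D (e \<otimes>\<^bsub>D\<^esub> d) * 1" using en ec dc by (intro mult_left_mono) (auto intro: D.nrm_nonneg)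
    also have "nrm D (e \<otimes>\<^bsub>D\<^esub> d) \<le> 1 * nrm D d"
      by (rule order_trans[OF D.nrm_mult mult_right_mono]) (use en ec dc D.nrm_nonneg in auto)
    finally show ?thesis using d by simp
  qed
  obtain s u where s: "s \<in> carrier D" "star D s = s" "b \<otimes>\<^bsub>D\<^esub> s = s \<otimes>\<^bsub>D\<^esub> b"
    and u: "u = b \<oplus>\<^bsub>D\<^esub> \<i> \<odot>\<^bsub>D\<^esub> s" "u \<in> carrier D" "star D u \<otimes>\<^bsub>D\<^esub> u = \<one>\<^bsub>D\<^esub>"
    and sq: "D.one_minus_sqrt (b \<otimes>\<^bsub>D\<^esub> b) (\<one>\<^bsub>D\<^esub> \<ominus>\<^bsub>D\<^esub> s)"
    by (rule D.selfadjoint_real_part_unitary[OF b(1,2) bn])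
  have s1: "s = \<one>\<^bsub>D\<^esub> \<ominus>\<^bsub>D\<^esub> (\<one>\<^bsub>D\<^esub> \<ominus>\<^bsub>D\<^esub> s)" using s(1) by (simp add: D.ring_nf)
  have sf: "D.fixed s"
    by (subst s1, intro D.fixed_diff D.fixed_one D.fixed_one_minus_sqrt[OF D.fixed_mult[OF b(3) b(3)] sq])
  have uf: "D.fixed u" unfolding u(1) by (intro D.fixed_add D.fixed_smult b sf)
  have be: "b \<otimes>\<^bsub>D\<^esub> e = b" "e \<otimes>\<^bsub>D\<^esub> b = b"
    unfolding b_def using ec dc e(3) by (simp_all add: D.m_assoc) (simp flip: D.m_assoc)
  have bbe: "(b \<otimes>\<^bsub>D\<^esub> b) \<otimes>\<^bsub>D\<^esub> e = e \<otimes>\<^bsub>D\<^esub> (b \<otimes>\<^bsub>D\<^esub> b)"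
    using b ec by (simp add: be D.m_assoc flip: D.m_assoc[of e b b])
  have "(\<one>\<^bsub>D\<^esub> \<ominus>\<^bsub>D\<^esub> s) \<otimes>\<^bsub>D\<^esub> e = e \<otimes>\<^bsub>D\<^esub> (\<one>\<^bsub>D\<^esub> \<ominus>\<^bsub>D\<^esub> s)"
    by (rule D.one_minus_sqrt_commute[OF _ sq ec bbe]) (use b in simp)
  then have "\<ominus>\<^bsub>D\<^esub> (s \<otimes>\<^bsub>D\<^esub> e) = \<ominus>\<^bsub>D\<^esub> (e \<otimes>\<^bsub>D\<^esub> s)"
    using s(1) ec by (simp add: D.minus_eq D.l_distr D.r_distr D.l_minus D.r_minus)
  from arg_cong[OF this, of "a_inv D"] have se: "s \<otimes>\<^bsub>D\<^esub> e = e \<otimes>\<^bsub>D\<^esub> s"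
    using s(1) ec by simp
  have ue: "u \<otimes>\<^bsub>D\<^esub> e = e \<otimes>\<^bsub>D\<^esub> u"
    unfolding u(1) using b s ec by (simp add: D.l_distr D.r_distr D.smult_mult_left D.smult_mult_right se be)
  define U where "U = (- \<i>) \<odot>\<^bsub>D\<^esub> (u \<otimes>\<^bsub>D\<^esub> u)"
  have Uc: "U \<in> carrier D" using u by (simp add: U_def)
  have Uf: "D.fixed U" unfolding U_def by (intro D.fixed_smult D.fixed_mult uf)
  have UU: "star D U \<otimes>\<^bsub>D\<^esub> U = \<one>\<^bsub>D\<^esub>"
  proof -
    have "star D U \<otimes>\<^bsub>D\<^esub> U = star D u \<otimes>\<^bsub>D\<^esub> (star D u \<otimes>\<^bsub>D\<^esub> u) \<otimes>\<^bsub>D\<^esub> u"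
      unfolding U_def using u(2) by (simp add: D.star_smult D.star_mult D.smult_mult_left D.smult_mult_right D.m_assoc)
    then show ?thesis using u by simp
  qed
  have Ue: "U \<otimes>\<^bsub>D\<^esub> e = e \<otimes>\<^bsub>D\<^esub> U"
  proof -
    have "(u \<otimes>\<^bsub>D\<^esub> u) \<otimes>\<^bsub>D\<^esub> e = u \<otimes>\<^bsub>D\<^esub> (e \<otimes>\<^bsub>D\<^esub> u)" using u(2) ec by (simp add: D.m_assoc ue)
    also have "\<dots> = e \<otimes>\<^bsub>D\<^esub> (u \<otimes>\<^bsub>D\<^esub> u)" using u(2) ec by (simp add: ue flip: D.m_assoc)
    finally show ?thesis unfolding U_def using u(2) ec by (simp add: D.smult_mult_left D.smult_mult_right)
  qed
  let ?r = "complex_of_real (sqrt (1/2))"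
  have rr: "?r * ?r = 1/2" by (simp flip: of_real_mult)
  define t where "t = p e"
  have t: "t \<in> carrier Q" "t \<otimes>\<^bsub>Q\<^esub> t = t" "t \<otimes>\<^bsub>Q\<^esub> c = c \<otimes>\<^bsub>Q\<^esub> t"
    using ec e(3) comm by (simp_all add: t_def flip: p.mult)
  have ctt: "t \<otimes>\<^bsub>Q\<^esub> (c \<otimes>\<^bsub>Q\<^esub> t) = c \<otimes>\<^bsub>Q\<^esub> t"
  proof -
    have "t \<otimes>\<^bsub>Q\<^esub> (c \<otimes>\<^bsub>Q\<^esub> t) = (t \<otimes>\<^bsub>Q\<^esub> c) \<otimes>\<^bsub>Q\<^esub> t" using t(1) cc by (simp add: Q.m_assoc)
    then show ?thesis using t cc by (simp add: Q.m_assoc)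
  qed
  have pb: "p b = c \<otimes>\<^bsub>Q\<^esub> t"
    using ec dc d(3) t cc ctt by (simp add: b_def p.mult Q.m_assoc flip: t_def)
  have pbt: "p b \<otimes>\<^bsub>Q\<^esub> t = c \<otimes>\<^bsub>Q\<^esub> t" unfolding pb using t cc by (simp add: Q.m_assoc)
  have cct: "c \<otimes>\<^bsub>Q\<^esub> (c \<otimes>\<^bsub>Q\<^esub> t) = (1/2) \<odot>\<^bsub>Q\<^esub> t"
    using t cc c(3) by (simp add: Q.smult_mult_left flip: Q.m_assoc)
  \<comment> \<open>On the corner of \<open>p e\<close> the square of \<open>b\<close> acts as 1/2,
    so the eigenvector form of the square root gives \<open>p s\<close> the value
    \<open>sqrt (1 - 1/2)\<close> there.\<close>
  have pbb: "p (b \<otimes>\<^bsub>D\<^esub> b) \<otimes>\<^bsub>Q\<^esub> t = complex_of_real (1/2) \<odot>\<^bsub>Q\<^esub> t"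
  proof -
    have "p (b \<otimes>\<^bsub>D\<^esub> b) \<otimes>\<^bsub>Q\<^esub> t = p b \<otimes>\<^bsub>Q\<^esub> (p b \<otimes>\<^bsub>Q\<^esub> t)"
      using b t(1) by (simp add: p.mult Q.m_assoc)
    also have "\<dots> = c \<otimes>\<^bsub>Q\<^esub> (t \<otimes>\<^bsub>Q\<^esub> (c \<otimes>\<^bsub>Q\<^esub> t))" unfolding pbt pb using t cc by (simp add: Q.m_assoc)
    finally show ?thesis by (simp add: ctt cct)
  qed
  have "D.one_minus_sqrt (b \<otimes>\<^bsub>D\<^esub> b) (\<one>\<^bsub>D\<^esub> \<ominus>\<^bsub>D\<^esub> s)" by (rule sq)
  then have "Q.one_minus_sqrt (p (b \<otimes>\<^bsub>D\<^esub> b)) (p (\<one>\<^bsub>D\<^esub> \<ominus>\<^bsub>D\<^esub> s))"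
    by (rule D.cstar_hom_one_minus_sqrt[OF p.unital_cstar_hom_axioms, rotated]) (use b in simp)
  then have "(\<one>\<^bsub>Q\<^esub> \<ominus>\<^bsub>Q\<^esub> p (\<one>\<^bsub>D\<^esub> \<ominus>\<^bsub>D\<^esub> s)) \<otimes>\<^bsub>Q\<^esub> t = complex_of_real (sqrt (1 - 1/2)) \<odot>\<^bsub>Q\<^esub> t"
    by (rule Q.one_minus_sqrt_scalar[rotated 1]) (use pbb t b in auto)
  moreover have "\<one>\<^bsub>Q\<^esub> \<ominus>\<^bsub>Q\<^esub> p (\<one>\<^bsub>D\<^esub> \<ominus>\<^bsub>D\<^esub> s) = p s" using arg_cong[OF s1, of p] s(1) by (simp add: p.diff)
  ultimately have pst: "p s \<otimes>\<^bsub>Q\<^esub> t = ?r \<odot>\<^bsub>Q\<^esub> t" by simp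
  have put: "p u \<otimes>\<^bsub>Q\<^esub> t = c \<otimes>\<^bsub>Q\<^esub> t \<oplus>\<^bsub>Q\<^esub> (\<i> * ?r) \<odot>\<^bsub>Q\<^esub> t"
    unfolding u(1) using b s t pst by (simp add: p.add p.smult Q.l_distr Q.smult_mult_left pbt)
  have puct: "p u \<otimes>\<^bsub>Q\<^esub> (c \<otimes>\<^bsub>Q\<^esub> t) = (1/2) \<odot>\<^bsub>Q\<^esub> t \<oplus>\<^bsub>Q\<^esub> (\<i> * ?r) \<odot>\<^bsub>Q\<^esub> (c \<otimes>\<^bsub>Q\<^esub> t)"
  proof -
    have "p u \<otimes>\<^bsub>Q\<^esub> (c \<otimes>\<^bsub>Q\<^esub> t) = (p u \<otimes>\<^bsub>Q\<^esub> t) \<otimes>\<^bsub>Q\<^esub> c" using u t cc by (simp add: Q.m_assoc)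
    also have "\<dots> = c \<otimes>\<^bsub>Q\<^esub> (t \<otimes>\<^bsub>Q\<^esub> c) \<oplus>\<^bsub>Q\<^esub> (\<i> * ?r) \<odot>\<^bsub>Q\<^esub> (t \<otimes>\<^bsub>Q\<^esub> c)"
      unfolding put using t(1) cc by (simp add: Q.l_distr Q.smult_mult_left Q.m_assoc)
    finally show ?thesis by (simp add: t cct)
  qed
  have puput: "p u \<otimes>\<^bsub>Q\<^esub> (p u \<otimes>\<^bsub>Q\<^esub> t) = p u \<otimes>\<^bsub>Q\<^esub> (c \<otimes>\<^bsub>Q\<^esub> t) \<oplus>\<^bsub>Q\<^esub> (\<i> * ?r) \<odot>\<^bsub>Q\<^esub> (p u \<otimes>\<^bsub>Q\<^esub> t)"
    using arg_cong[OF put, of "\<lambda>z. p u \<otimes>\<^bsub>Q\<^esub> z"] u(2) t(1) cc by (simp add: Q.r_distr Q.smult_mult_right)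
  \<comment> \<open>On the corner \<open>p u\<close> acts as \<open>c + i r\<close> with
    \<open>r = sqrt (1/2)\<close>. Since \<open>c^2 = r^2 = 1/2\<close>, the square is
    \<open>2 i r c\<close>, and the scalar \<open>- \<i>\<close> removes the phase.\<close>
  have "p U \<otimes>\<^bsub>Q\<^esub> t = (- \<i>) \<odot>\<^bsub>Q\<^esub> (p u \<otimes>\<^bsub>Q\<^esub> (p u \<otimes>\<^bsub>Q\<^esub> t))"
    unfolding U_def using u(2) t(1) by (simp add: p.smult p.mult Q.smult_mult_left Q.m_assoc)
  also have "p u \<otimes>\<^bsub>Q\<^esub> (p u \<otimes>\<^bsub>Q\<^esub> t) = ((1/2) \<odot>\<^bsub>Q\<^esub> t \<oplus>\<^bsub>Q\<^esub> (\<i> * ?r) \<odot>\<^bsub>Q\<^esub> (c \<otimes>\<^bsub>Q\<^esub> t))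
      \<oplus>\<^bsub>Q\<^esub> ((\<i> * ?r) \<odot>\<^bsub>Q\<^esub> (c \<otimes>\<^bsub>Q\<^esub> t) \<oplus>\<^bsub>Q\<^esub> (- (1/2)) \<odot>\<^bsub>Q\<^esub> t)"
  proof -
    have "\<i> * ?r * (\<i> * ?r) = - (1/2)" using rr by (simp add: algebra_simps)
    then show ?thesis unfolding puput unfolding puct put using t cc by (simp add: Q.smult_add_right)
  qed
  also have "\<dots> = ((1/2) \<odot>\<^bsub>Q\<^esub> t \<oplus>\<^bsub>Q\<^esub> (- (1/2)) \<odot>\<^bsub>Q\<^esub> t)
      \<oplus>\<^bsub>Q\<^esub> ((\<i> * ?r) \<odot>\<^bsub>Q\<^esub> (c \<otimes>\<^bsub>Q\<^esub> t) \<oplus>\<^bsub>Q\<^esub> (\<i> * ?r) \<odot>\<^bsub>Q\<^esub> (c \<otimes>\<^bsub>Q\<^esub> t))"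
    using t cc by (simp add: Q.a_ac)
  also have "\<dots> = (\<i> * ?r + \<i> * ?r) \<odot>\<^bsub>Q\<^esub> (c \<otimes>\<^bsub>Q\<^esub> t)"
    using t cc by (simp only: Q.smult_add_left[symmetric] Q.m_closed) simp
  also have "(- \<i>) \<odot>\<^bsub>Q\<^esub> \<dots> = complex_of_real (sqrt 2) \<odot>\<^bsub>Q\<^esub> (c \<otimes>\<^bsub>Q\<^esub> t)"
  proof -
    have "sqrt 2 = 2 * sqrt (1/2)" by (simp add: real_sqrt_divide real_div_sqrt)
    then have "(- \<i>) * (\<i> * ?r + \<i> * ?r) = complex_of_real (sqrt 2)" by (simp add: algebra_simps)
    then show ?thesis using t cc by simp
  qed
  finally have "p U \<otimes>\<^bsub>Q\<^esub> p e = complex_of_real (sqrt 2) \<odot>\<^bsub>Q\<^esub> (c \<otimes>\<^bsub>Q\<^esub> p e)" by (simp add: t_def)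
  with that[OF Uf UU Ue] show thesis .
qed

end

context finite_G_algebra
begin

text \<open>Every Newton iterate is permuted by the group like the original family, and limits are
  unique.\<close>

lemma perturb_equivariant:
  fixes e :: real and act :: "'g \<Rightarrow> 'i \<Rightarrow> 'i"
  assumes fin: "finite I" and y: "\<And>i. i \<in> I \<Longrightarrow> y i \<in> carrier A"
    and e: "\<And>i j. \<lbrakk>i \<in> I; j \<in> I\<rbrakk> \<Longrightarrow> nrm A (defect y i j) \<le> e" "0 \<le> e" "card I * e \<le> 1/2"
    and bij: "\<And>g. g \<in> carrier G \<Longrightarrow> bij_betw (act g) I I"
    and eq: "\<And>g i. \<lbrakk>g \<in> carrier G; i \<in> I\<rbrakk> \<Longrightarrow> \<alpha> g (y i) = y (act g i)"
  obtains r where "orthonormal I r" "\<And>i. i \<in> I \<Longrightarrow> conv (\<lambda>m. (newton I ^^ m) y i) (r i)"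
    "\<And>g i. \<lbrakk>g \<in> carrier G; i \<in> I\<rbrakk> \<Longrightarrow> \<alpha> g (r i) = r (act g i)"
proof -
  obtain r where r: "orthonormal I r" "\<And>i. i \<in> I \<Longrightarrow> conv (\<lambda>m. (newton I ^^ m) y i) (r i)"
    using newton_conv[of I y e, OF fin y e] by blast
  have "\<alpha> g (r i) = r (act g i)" if g: "g \<in> carrier G" and i: "i \<in> I" for g i
  proof (rule conv_unique)
    have ai: "act g i \<in> I" using bij[OF g] i by (auto simp: bij_betw_def)
    show "conv (\<lambda>m. (newton I ^^ m) y (act g i)) (r (act g i))" by (rule r(2)[OF ai])
    show "conv (\<lambda>m. (newton I ^^ m) y (act g i)) (\<alpha> g (r i))"
      using act_conv[OF g r(2)[OF i]]
      by (simp add: newton_equivariant[of I y g "act g", OF fin y g bij[OF g] eq[OF g] i])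
  qed
  with that[of r] r show thesis by blast
qed

end

lemma (in unital_cstar) newton_iterate_orthonormal:
  assumes "orthonormal I y" "i \<in> I" shows "(newton I ^^ m) y i = y i"
  using assms(2)
proof (induction m arbitrary: i)
  case (Suc m)
  have yc: "\<And>j. j \<in> I \<Longrightarrow> y j \<in> carrier A" using assms(1) by (simp add: orthonormal_def)
  have "(newton I ^^ Suc m) y i = newton I y i"
    using newton_cong[of I "(newton I ^^ m) y" y i] Suc yc by simp
  then show ?case using newton_orthonormal[OF assms(1) Suc.prems] by simp
qed simp

text \<open>The image of the family is already orthonormal, hence unchanged by the Newton step in
  the quotient; the correction therefore moves nothing there.\<close>

lemma (in equivariant_quotient) perturb_lift:
  fixes e :: real and act :: "'g \<Rightarrow> 'i \<Rightarrow> 'i"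
  assumes fin: "finite I" and y: "\<And>i. i \<in> I \<Longrightarrow> y i \<in> carrier D"
    and e: "\<And>i j. \<lbrakk>i \<in> I; j \<in> I\<rbrakk> \<Longrightarrow> nrm D (D.defect y i j) \<le> e" "0 \<le> e" "card I * e \<le> 1/2"
    and bij: "\<And>g. g \<in> carrier G \<Longrightarrow> bij_betw (act g) I I"
    and eq: "\<And>g i. \<lbrakk>g \<in> carrier G; i \<in> I\<rbrakk> \<Longrightarrow> \<beta> g (y i) = y (act g i)"
    and orth: "Q.orthonormal I (\<lambda>i. p (y i))"
  obtains r where "D.orthonormal I r" "\<And>i. i \<in> I \<Longrightarrow> p (r i) = p (y i)"
    "\<And>g i. \<lbrakk>g \<in> carrier G; i \<in> I\<rbrakk> \<Longrightarrow> \<beta> g (r i) = r (act g i)"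
proof -
  obtain r where r: "D.orthonormal I r" "\<And>i. i \<in> I \<Longrightarrow> D.conv (\<lambda>m. (D.newton I ^^ m) y i) (r i)"
    "\<And>g i. \<lbrakk>g \<in> carrier G; i \<in> I\<rbrakk> \<Longrightarrow> \<beta> g (r i) = r (act g i)"
    using D.perturb_equivariant[of I y e act, OF fin y e bij eq] by blast
  have "p (r i) = p (y i)" if i: "i \<in> I" for i
  proof -
    have "p ((D.newton I ^^ m) y i) = p (y i)" for m
      using p.newton_iterate[OF fin y i, where m = m] Q.newton_iterate_orthonormal[OF orth i, where m = m] by simp
    then have "Q.conv (\<lambda>_. p (y i)) (p (r i))" using p.conv[OF r(2)[OF i]] by simp
    then show ?thesis using Q.conv_unique[OF _ Q.conv_const] y[OF i] by simp
  qed
  with that[of r] r(1,3) show thesis by blast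
qed

section \<open>Quotient actions and limits of ideals\<close>

locale invariant_ideal = finite_G_algebra C G \<gamma> + cstar_ideal C J
  for C :: "'c cstar" (structure) and G :: "('g, 'm) monoid_scheme" and \<gamma> and J +
  assumes J_invariant: "invariant G \<gamma> J"
begin

abbreviation qact :: "'g \<Rightarrow> 'c set \<Rightarrow> 'c set" where "qact \<equiv> quotient_action C J \<gamma>"

lemma qact_cls: assumes g: "g \<in> carrier G" and x: "x \<in> carrier C" shows "qact g (cls x) = cls (\<gamma> g x)"
proof -
  have "cls (\<gamma> g y) = cls (\<gamma> g x)" if "y \<in> cls x" for y
  proof -
    have y: "y \<in> carrier C" "y \<ominus> x \<in> J" using that x by (auto simp: mem_cls)
    then have "\<gamma> g (y \<ominus> x) \<in> J" using J_invariant g by (auto simp: invariant_def)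
    then show ?thesis using y x g by (simp add: cls_eq_iff act_diff)
  qed
  then show ?thesis using Union_cls[OF x] x by (simp add: quotient_action_def)
qed

lemma qact_closed: "\<lbrakk>g \<in> carrier G; P \<in> carrier Q\<rbrakk> \<Longrightarrow> qact g P \<in> carrier Q"
  by (auto simp: carrier_Q qact_cls)

lemma qact_mult:
  assumes "g \<in> carrier G" "h \<in> carrier G" "P \<in> carrier Q"
  shows "qact (g \<otimes>\<^bsub>G\<^esub> h) P = qact g (qact h P)"
  using assms by (auto simp: carrier_Q qact_cls act_mult_group)

lemma qact_one: "P \<in> carrier Q \<Longrightarrow> qact \<one>\<^bsub>G\<^esub> P = P"
  by (auto simp: carrier_Q qact_cls act_one)

lemma qact_Bij: assumes g: "g \<in> carrier G" shows "qact g \<in> Bij (carrier Q)"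
proof -
  have "bij_betw (qact g) (carrier Q) (carrier Q)"
  proof (rule bij_betw_byWitness[where f' = "qact (inv\<^bsub>G\<^esub> g)"])
    show "\<forall>P\<in>carrier Q. qact (inv\<^bsub>G\<^esub> g) (qact g P) = P"
      using g by (simp add: qact_one flip: qact_mult)
    show "\<forall>P\<in>carrier Q. qact g (qact (inv\<^bsub>G\<^esub> g) P) = P"
      using g by (simp add: qact_one flip: qact_mult)
  qed (use g qact_closed in auto)
  then show ?thesis by (simp add: Bij_def quotient_action_def)
qed

lemma qact_hom: "g \<in> carrier G \<Longrightarrow> qact g \<in> cstar_hom Q Q"
  by (auto simp: cstar_hom_def carrier_Q qact_cls Q_mult Q_add Q_smult Q_star Q_one
      act_mult act_add act_smult act_star intro!: ring_hom_memI)

lemma qact_action: "qact \<in> hom G (cstar_Aut Q)"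
proof (rule homI)
  show "qact g \<in> carrier (cstar_Aut Q)" if "g \<in> carrier G" for g
    using that qact_Bij qact_hom by (simp add: cstar_Aut_def)
  fix g h assume gh: "g \<in> carrier G" "h \<in> carrier G"
  have "qact (g \<otimes>\<^bsub>G\<^esub> h) = compose (carrier Q) (qact g) (qact h)"
  proof (rule extensionalityI[of _ "carrier Q"])
    show "qact (g \<otimes>\<^bsub>G\<^esub> h) \<in> extensional (carrier Q)" by (simp add: quotient_action_def)
  qed (use gh qact_mult in \<open>auto simp: compose_def\<close>)
  then show "qact (g \<otimes>\<^bsub>G\<^esub> h) = qact g \<otimes>\<^bsub>cstar_Aut Q\<^esub> qact h"
    using gh qact_Bij by (simp add: cstar_Aut_def BijGroup_def)
qed

lemma Q_G_algebra: "finite_G_algebra Q G qact"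
  by (intro finite_G_algebra.intro finite_G_algebra_axioms.intro Q_cstar G.is_group qact_action finite_G)

lemma cls_equivariant_quotient: "equivariant_quotient C G \<gamma> Q qact cls"
proof (intro equivariant_quotient.intro equivariant_quotient_axioms.intro Q_G_algebra cls_hom)
  show "finite_G_algebra C G \<gamma>" by unfold_locales
  fix P e assume P: "P \<in> carrier Q" "nrm Q P < e"
  then obtain z where z: "z \<in> carrier C" "P = cls z" by (auto simp: carrier_Q)
  obtain x where x: "x \<in> carrier C" "cls x = P" "nrm C x < e"
    using Q_nrm_approx[OF z(1) P(2)[unfolded z(2)]] z(2) by auto
  then show "\<exists>x\<in>carrier C. cls x = P \<and> nrm C x < e" by blast
qed (simp add: qact_cls)

lemma quotient_map_equivariant_quotient:
  assumes I: "closed_ideal C I" "I \<subseteq> J" "invariant G \<gamma> I"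
  shows "equivariant_quotient (cstar_Quot C I) G (quotient_action C I \<gamma>) Q qact (quotient_map C J)"
proof -
  interpret I: invariant_ideal C G \<gamma> I
    by (intro invariant_ideal.intro invariant_ideal_axioms.intro cstar_ideal.intro
      cstar_ideal_axioms.intro finite_G_algebra_axioms I unital_cstar_axioms)
  note qm = quotient_map_cls[OF I(1,2)]
  show ?thesis
  proof (intro equivariant_quotient.intro equivariant_quotient_axioms.intro Q_G_algebra I.Q_G_algebra
      quotient_map_hom I)
    fix P g assume "g \<in> carrier G" "P \<in> carrier (cstar_Quot C I)"
    then show "quotient_map C J (I.qact g P) = qact g (quotient_map C J P)"
      by (auto simp: I.carrier_Q I.qact_cls qact_cls qm)
  next
    fix P e assume P: "P \<in> carrier Q" "nrm Q P < e"
    then obtain z where z: "z \<in> carrier C" "P = cls z" by (auto simp: carrier_Q)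
    obtain x where x: "x \<in> carrier C" "cls x = P" "nrm C x < e"
      using Q_nrm_approx[OF z(1) P(2)[unfolded z(2)]] z(2) by auto
    then have "nrm (cstar_Quot C I) (I.cls x) < e" using I.Q_nrm_le_self[OF x(1)] by linarith
    then show "\<exists>x\<in>carrier (cstar_Quot C I). quotient_map C J x = P \<and> nrm (cstar_Quot C I) x < e"
      using x qm I.cls_closed by blast
  qed
qed

end

section \<open>Increasing chains of invariant ideals\<close>

locale ideal_chain = finite_G_algebra C G \<gamma>
  for C :: "'c cstar" (structure) and G :: "('g, 'm) monoid_scheme" and \<gamma> +
  fixes Jn :: "nat \<Rightarrow> 'c set" and J :: "'c set"
  assumes chain_ideal: "\<And>n. closed_ideal C (Jn n)" and chain_invariant: "\<And>n. invariant G \<gamma> (Jn n)"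
    and chain_mono: "\<And>n. Jn n \<subseteq> Jn (Suc n)" and chain_limit: "J = cstar_top C closure_of (\<Union>n. Jn n)"
begin

lemma Jn_ideal: "cstar_ideal C (Jn n)"
  by (intro cstar_ideal.intro cstar_ideal_axioms.intro chain_ideal unital_cstar_axioms)

lemma Jn_mono: "m \<le> n \<Longrightarrow> Jn m \<subseteq> Jn n"
  using lift_Suc_mono_le[of Jn, OF chain_mono] by blast

lemma Jn_carrier: "x \<in> Jn n \<Longrightarrow> x \<in> carrier C"
  using chain_ideal by (auto simp: closed_ideal_def intro: ideal.Icarr)

lemma mem_limit:
  "x \<in> J \<longleftrightarrow> x \<in> carrier C \<and> (\<forall>e>0. \<exists>n. \<exists>y\<in>Jn n. nrm C (y \<ominus> x) < e)"
proof -
  have "(\<exists>y\<in>\<Union>n. Jn n. y \<in> met.mball x e) \<longleftrightarrow> (\<exists>n. \<exists>y\<in>Jn n. nrm C (y \<ominus> x) < e)"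
    if "x \<in> carrier C" for e
  proof -
    have "y \<in> met.mball x e \<longleftrightarrow> nrm C (y \<ominus> x) < e" if "y \<in> Jn n" for y n
      using Jn_carrier[OF that] \<open>x \<in> carrier C\<close>
      by (simp add: cdist_def nrm_minus_commute[of x y])
    then show ?thesis by blast
  qed
  then show ?thesis
    unfolding chain_limit cstar_top_def met.metric_closure_of by auto
qed

lemma Jn_subset: "Jn n \<subseteq> J"
proof
  fix x assume x: "x \<in> Jn n"
  then have "x \<in> carrier C" by (rule Jn_carrier)
  then have "nrm C (x \<ominus> x) < e" if "e > 0" for e using that by (simp add: minus_eq r_neg)
  then show "x \<in> J" using x \<open>x \<in> carrier C\<close> unfolding mem_limit by blast
qed

lemma limit_ideal: "closed_ideal C J"
  unfolding closed_ideal_def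
proof
  show "closedin (cstar_top C) J" unfolding chain_limit by simp
  have approx: "\<exists>n. \<exists>y\<in>Jn n. nrm C (y \<ominus> x) < e" if "x \<in> J" "e > 0" for x e
    using that by (simp add: mem_limit)
  have Jc: "x \<in> carrier C" if "x \<in> J" for x using that by (simp add: mem_limit)
  have add: "x \<oplus> y \<in> J" if xy: "x \<in> J" "y \<in> J" for x y
    unfolding mem_limit
  proof (intro conjI allI impI)
    fix e :: real assume e: "e > 0"
    obtain m x' where x': "x' \<in> Jn m" "nrm C (x' \<ominus> x) < e/2" using approx[OF xy(1), of "e/2"] e by auto
    obtain n y' where y': "y' \<in> Jn n" "nrm C (y' \<ominus> y) < e/2" using approx[OF xy(2), of "e/2"] e by auto
    interpret K: cstar_ideal C "Jn (max m n)" by (rule Jn_ideal)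
    have "x' \<in> Jn (max m n)" "y' \<in> Jn (max m n)" using x' y' Jn_mono[of m "max m n"] Jn_mono[of n "max m n"] by auto
    then have s: "x' \<oplus> y' \<in> Jn (max m n)" by simp
    have c: "x \<in> carrier C" "y \<in> carrier C" "x' \<in> carrier C" "y' \<in> carrier C"
      using Jc xy x' y' Jn_carrier by auto
    have "(x' \<oplus> y') \<ominus> (x \<oplus> y) = (x' \<ominus> x) \<oplus> (y' \<ominus> y)" using c by (simp add: minus_eq minus_add a_ac)
    then have "nrm C ((x' \<oplus> y') \<ominus> (x \<oplus> y)) < e"
      using nrm_add[of "x' \<ominus> x" "y' \<ominus> y"] c x' y' by simp
    with s show "\<exists>n. \<exists>z\<in>Jn n. nrm C (z \<ominus> (x \<oplus> y)) < e" by blast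
  qed (use xy Jc in simp)
  \<comment> \<open>Products from either side follow from this: a map that preserves every
    \<open>Jn n\<close> and is Lipschitz at \<open>x\<close> sends \<open>x\<close> into the
    closure. The factor \<open>B + 1\<close> avoids dividing by zero.\<close>
  have small: "w \<in> J" if w: "w \<in> carrier C" and B: "B \<ge> 0"
    and ap: "\<And>n z. z \<in> Jn n \<Longrightarrow> f z \<in> Jn n \<and> nrm C (f z \<ominus> w) \<le> B * nrm C (z \<ominus> x)" and x: "x \<in> J"
    for w B f x
    unfolding mem_limit
  proof (intro conjI allI impI)
    fix e :: real assume e: "e > 0"
    then have e': "e / (B + 1) > 0" using B by simp
    obtain n z where z: "z \<in> Jn n" "nrm C (z \<ominus> x) < e / (B + 1)" using approx[OF x e'] by auto
    have "nrm C (f z \<ominus> w) \<le> B * nrm C (z \<ominus> x)" using ap z by blast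
    also have "\<dots> \<le> (B + 1) * nrm C (z \<ominus> x)"
      using nrm_nonneg[of "z \<ominus> x"] Jn_carrier[OF z(1)] Jc[OF x] by (intro mult_right_mono) auto
    also have "\<dots> < e" using z(2) B by (simp add: pos_less_divide_eq mult.commute)
    finally show "\<exists>n. \<exists>z\<in>Jn n. nrm C (z \<ominus> w) < e" using ap[OF z(1)] by blast
  qed (rule w)
  have left: "a \<otimes> x \<in> J" if x: "x \<in> J" and a: "a \<in> carrier C" for a x
  proof (rule small[OF _ nrm_nonneg[OF a] _ x])
    show "a \<otimes> x \<in> carrier C" using a Jc[OF x] by simp
    fix n z assume z: "z \<in> Jn n"
    interpret K: cstar_ideal C "Jn n" by (rule Jn_ideal)
    have "a \<otimes> z \<ominus> a \<otimes> x = a \<otimes> (z \<ominus> x)"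
      using a Jc[OF x] Jn_carrier[OF z] by (simp add: minus_eq r_distr r_minus)
    then show "a \<otimes> z \<in> Jn n \<and> nrm C (a \<otimes> z \<ominus> a \<otimes> x) \<le> nrm C a * nrm C (z \<ominus> x)"
      using a Jc[OF x] Jn_carrier[OF z] K.I_l_closed[OF z a] by (simp add: nrm_mult)
  qed
  have right: "x \<otimes> a \<in> J" if x: "x \<in> J" and a: "a \<in> carrier C" for a x
  proof (rule small[OF _ nrm_nonneg[OF a] _ x])
    show "x \<otimes> a \<in> carrier C" using a Jc[OF x] by simp
    fix n z assume z: "z \<in> Jn n"
    interpret K: cstar_ideal C "Jn n" by (rule Jn_ideal)
    have "z \<otimes> a \<ominus> x \<otimes> a = (z \<ominus> x) \<otimes> a"
      using a Jc[OF x] Jn_carrier[OF z] by (simp add: minus_eq l_distr l_minus)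
    then show "z \<otimes> a \<in> Jn n \<and> nrm C (z \<otimes> a \<ominus> x \<otimes> a) \<le> nrm C a * nrm C (z \<ominus> x)"
      using a Jc[OF x] Jn_carrier[OF z] K.I_r_closed[OF z a] nrm_mult[of "z \<ominus> x" a]
      by (simp add: mult.commute)
  qed
  have zero: "\<zero> \<in> J"
    using Jn_subset[of 0] additive_subgroup.zero_closed[of "Jn 0" C] chain_ideal[of 0]
    by (auto simp: closed_ideal_def ideal_def)
  show "ideal J C"
  proof (rule idealI)
    show "ring C" by (rule ring_axioms)
    show "subgroup J (add_monoid C)"
    proof (rule group.subgroupI[OF a_group])
      show "J \<subseteq> carrier (add_monoid C)" using Jc by auto
      show "J \<noteq> {}" using zero by auto
      show "inv\<^bsub>add_monoid C\<^esub> a \<in> J" if "a \<in> J" for a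
      proof -
        have "\<ominus> a \<in> J" using left[OF that, of "\<ominus> \<one>"] Jc[OF that] by (simp add: l_minus)
        then show ?thesis by (simp add: a_inv_def)
      qed
      show "a \<otimes>\<^bsub>add_monoid C\<^esub> b \<in> J" if "a \<in> J" "b \<in> J" for a b using add that by simp
    qed
  qed (use left right in auto)
qed

lemma limit_invariant: "invariant G \<gamma> J"
  unfolding invariant_def
proof (intro ballI subsetI, elim imageE)
  fix g x w assume g: "g \<in> carrier G" and w: "w = \<gamma> g x" "x \<in> J"
  then have x: "x \<in> carrier C" by (simp add: mem_limit)
  show "w \<in> J"
    unfolding mem_limit
  proof (intro conjI allI impI)
    show "w \<in> carrier C" using g x w by simp
    fix e :: real assume "e > 0"
    then obtain n y where y: "y \<in> Jn n" "nrm C (y \<ominus> x) < e" using w(2) by (auto simp: mem_limit)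
    then have yc: "y \<in> carrier C" using Jn_carrier by auto
    have "nrm C (\<gamma> g y \<ominus> w) \<le> nrm C (y \<ominus> x)"
      using act_contractive[OF g, of "y \<ominus> x"] x yc g by (simp add: w act_diff)
    then have "nrm C (\<gamma> g y \<ominus> w) < e" using y(2) by linarith
    moreover have "\<gamma> g y \<in> Jn n" using chain_invariant[of n] g y by (auto simp: invariant_def)
    ultimately show "\<exists>n. \<exists>y\<in>Jn n. nrm C (y \<ominus> w) < e" by blast
  qed
qed

text \<open>An element of some \<open>Jn N\<close> near \<open>x\<close> belongs to all later
  ideals. This is how relations that hold in the limit quotient become approximate relations at a
  finite stage.\<close>

lemma limit_small:
  assumes x: "x \<in> J" and e: "e > 0"
  obtains N where "\<And>n. n \<ge> N \<Longrightarrow> nrm (cstar_Quot C (Jn n)) (Jn n +> x) < e"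
proof -
  obtain N y where y: "y \<in> Jn N" "nrm C (y \<ominus> x) < e" and xc: "x \<in> carrier C"
    using x e by (auto simp: mem_limit)
  have yc: "y \<in> carrier C" using y Jn_carrier by auto
  have "nrm (cstar_Quot C (Jn n)) (Jn n +> x) < e" if n: "n \<ge> N" for n
  proof -
    interpret K: cstar_ideal C "Jn n" by (rule Jn_ideal)
    have "y \<in> Jn n" using Jn_mono[OF n] y by auto
    moreover have "(x \<ominus> y) \<ominus> x = \<ominus> y" using xc yc by (simp add: ring_nf)
    ultimately have "x \<ominus> y \<in> K.cls x" using xc yc by (simp add: K.mem_cls)
    then have "nrm K.Q (K.cls x) \<le> nrm C (x \<ominus> y)" by (rule K.Q_nrm_le[OF xc])
    then show ?thesis using y(2) nrm_minus_commute[OF xc yc] by simp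
  qed
  then show thesis by (rule that)
qed

sublocale lim: invariant_ideal C G \<gamma> J
  by (intro invariant_ideal.intro invariant_ideal_axioms.intro cstar_ideal.intro
    cstar_ideal_axioms.intro finite_G_algebra_axioms limit_ideal limit_invariant unital_cstar_axioms)

lemma stage_quotient:
  "equivariant_quotient (cstar_Quot C (Jn n)) G (quotient_action C (Jn n) \<gamma>)
     (cstar_Quot C J) (quotient_action C J \<gamma>) (quotient_map C J)"
  by (rule lim.quotient_map_equivariant_quotient[OF chain_ideal Jn_subset chain_invariant])

text \<open>Equivariant lifts to \<open>C\<close> have their defects in \<open>J\<close>. Being
  finitely many, these are small at a common stage, where the Newton correction makes the family
  exact.\<close>

lemma lift_orthonormal:
  fixes act :: "'g \<Rightarrow> 'i \<Rightarrow> 'i"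
  assumes fin: "finite I"
    and x: "unital_cstar.orthonormal (cstar_Quot C J) I x"
    and act: "\<And>g i. g \<in> carrier G \<Longrightarrow> i \<in> I \<Longrightarrow> act g i \<in> I"
      "\<And>g h i. \<lbrakk>g \<in> carrier G; h \<in> carrier G; i \<in> I\<rbrakk> \<Longrightarrow> act (g \<otimes>\<^bsub>G\<^esub> h) i = act g (act h i)"
      "\<And>i. i \<in> I \<Longrightarrow> act \<one>\<^bsub>G\<^esub> i = i"
    and eq: "\<And>g i. g \<in> carrier G \<Longrightarrow> i \<in> I \<Longrightarrow> quotient_action C J \<gamma> g (x i) = x (act g i)"
  obtains n r where "unital_cstar.orthonormal (cstar_Quot C (Jn n)) I r"
    "\<And>i. i \<in> I \<Longrightarrow> quotient_map C J (r i) = x i"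
    "\<And>g i. g \<in> carrier G \<Longrightarrow> i \<in> I \<Longrightarrow> quotient_action C (Jn n) \<gamma> g (r i) = r (act g i)"
proof -
  interpret q: equivariant_quotient C G \<gamma> "cstar_Quot C J" "quotient_action C J \<gamma>" lim.cls
    by (rule lim.cls_equivariant_quotient)
  have xc: "x i \<in> carrier (cstar_Quot C J)" if "i \<in> I" for i
    using x that by (simp add: q.Q.orthonormal_def)
  have "\<exists>y. \<forall>i\<in>I. y i \<in> carrier C \<and> lim.cls (y i) = x i \<and> (\<forall>g\<in>carrier G. \<gamma> g (y i) = y (act g i))"
  proof (rule q.lift_family[of I x act])
    fix y assume "\<And>i. i \<in> I \<Longrightarrow> y i \<in> carrier C" "\<And>i. i \<in> I \<Longrightarrow> lim.cls (y i) = x i"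
      "\<And>g i. g \<in> carrier G \<Longrightarrow> i \<in> I \<Longrightarrow> \<gamma> g (y i) = y (act g i)"
    then show ?thesis by (intro exI[of _ y]) simp
  qed (use xc in \<open>simp\<close>, use act(1) in \<open>simp\<close>, use act(2) in \<open>simp\<close>, use act(3) in \<open>simp\<close>, use eq in \<open>simp\<close>)
  then obtain y where y: "\<And>i. i \<in> I \<Longrightarrow> y i \<in> carrier C" "\<And>i. i \<in> I \<Longrightarrow> lim.cls (y i) = x i"
    "\<And>g i. g \<in> carrier G \<Longrightarrow> i \<in> I \<Longrightarrow> \<gamma> g (y i) = y (act g i)" by blast
  \<comment> \<open>The summand 1 keeps the denominator positive for empty \<open>I\<close>, while
    \<open>card I * e\<close> stays at most 1/2.\<close>
  define e :: real where "e = 1 / (2 * real (card I) + 1)"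
  have e: "e > 0" "card I * e \<le> 1/2" by (auto simp: e_def field_simps)
  have dJ: "defect y i j \<in> J" if ij: "i \<in> I" "j \<in> I" for i j
  proof -
    have "lim.cls (defect y i j) = q.Q.defect x i j"
      using ij y by (simp add: defect_def q.Q.defect_def q.p.diff q.p.mult q.p.star)
    also have "\<dots> = \<zero>\<^bsub>cstar_Quot C J\<^esub>"
      using q.Q.defect_eq_zero_iff[of I x, OF xc] x ij by blast
    finally have eq0: "lim.cls (defect y i j) = lim.cls \<zero>" unfolding lim.Q_zero .
    have dc: "defect y i j \<in> carrier C" using y(1) ij by (simp add: defect_def)
    have "defect y i j \<ominus> \<zero> \<in> J" by (rule lim.cls_eq_iff[THEN iffD1, OF dc zero_closed eq0])
    then show ?thesis using dc by (simp add: minus_eq)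
  qed
  have "\<forall>k\<in>I \<times> I. \<exists>N. \<forall>n\<ge>N. nrm (cstar_Quot C (Jn n)) (Jn n +> defect y (fst k) (snd k)) < e"
  proof
    fix k assume k: "k \<in> I \<times> I"
    show "\<exists>N. \<forall>n\<ge>N. nrm (cstar_Quot C (Jn n)) (Jn n +> defect y (fst k) (snd k)) < e"
      by (rule limit_small[OF dJ e(1), of "fst k" "snd k"]) (use k in auto)
  qed
  then obtain N where N: "\<And>k n. k \<in> I \<times> I \<Longrightarrow> n \<ge> N k \<Longrightarrow>
      nrm (cstar_Quot C (Jn n)) (Jn n +> defect y (fst k) (snd k)) < e" by metis
  \<comment> \<open>Inserting 0 keeps the maximum defined when \<open>I\<close> is empty.\<close>
  define n where "n = Max (insert 0 (N ` (I \<times> I)))"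
  have n: "n \<ge> N k" if "k \<in> I \<times> I" for k
    using that fin unfolding n_def by (intro Max_ge) auto
  interpret K: invariant_ideal C G \<gamma> "Jn n"
    by (intro invariant_ideal.intro invariant_ideal_axioms.intro Jn_ideal chain_invariant finite_G_algebra_axioms)
  interpret k: unital_cstar_hom C "cstar_Quot C (Jn n)" K.cls by (rule K.cls_hom)
  interpret s: equivariant_quotient "cstar_Quot C (Jn n)" G "quotient_action C (Jn n) \<gamma>"
     "cstar_Quot C J" "quotient_action C J \<gamma>" "quotient_map C J"
    by (rule stage_quotient)
  define z where "z i = K.cls (y i)" for i
  have zx: "quotient_map C J (z i) = x i" if "i \<in> I" for i
    using lim.quotient_map_cls[OF chain_ideal Jn_subset] y that by (simp add: z_def)
  have "\<exists>r. k.B.orthonormal I r \<and> (\<forall>i\<in>I. quotient_map C J (r i) = x i \<and>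
      (\<forall>g\<in>carrier G. quotient_action C (Jn n) \<gamma> g (r i) = r (act g i)))"
  proof (rule s.perturb_lift[OF fin, of z e act])
    fix r assume "k.B.orthonormal I r" "\<And>i. i \<in> I \<Longrightarrow> quotient_map C J (r i) = quotient_map C J (z i)"
    "\<And>g i. g \<in> carrier G \<Longrightarrow> i \<in> I \<Longrightarrow> quotient_action C (Jn n) \<gamma> g (r i) = r (act g i)"
    then show ?thesis by (intro exI[of _ r]) (simp add: zx)
  next
    show "z i \<in> carrier (cstar_Quot C (Jn n))" if "i \<in> I" for i using that y by (simp add: z_def)
    show "nrm (cstar_Quot C (Jn n)) (k.B.defect z i j) \<le> e" if ij: "i \<in> I" "j \<in> I" for i j
    proof -
      have "k.B.defect z i j = K.cls (defect y i j)"
        using ij y by (simp add: z_def defect_def k.B.defect_def k.diff k.mult k.star)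
      then show ?thesis using N[of "(i, j)" n] n[of "(i, j)"] ij by simp
    qed
    show "quotient_action C (Jn n) \<gamma> g (z i) = z (act g i)" if "g \<in> carrier G" "i \<in> I" for g i
      using that y by (simp add: z_def K.qact_cls)
    show "bij_betw (act g) I I" if g: "g \<in> carrier G" for g
    proof (rule bij_betw_byWitness[where f' = "act (inv\<^bsub>G\<^esub> g)"])
      show "\<forall>a\<in>I. act (inv\<^bsub>G\<^esub> g) (act g a) = a" "\<forall>a\<in>I. act g (act (inv\<^bsub>G\<^esub> g) a) = a"
        using g act(3) by (simp_all flip: act(2))
    qed (use g act(1) in auto)
    show "q.Q.orthonormal I (\<lambda>i. quotient_map C J (z i))"
      using x zx by (simp add: q.Q.orthonormal_def)
  qed (use e in auto)
  then obtain r where r: "k.B.orthonormal I r" "\<forall>i\<in>I. quotient_map C J (r i) = x i \<and>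
      (\<forall>g\<in>carrier G. quotient_action C (Jn n) \<gamma> g (r i) = r (act g i))" by (elim exE conjE)
  show thesis by (rule that[OF r(1)]) (simp_all add: r(2))
qed

end

section \<open>Quasifree automorphisms\<close>

text \<open>The set where two homomorphisms agree is a closed unital subalgebra stable under
  \<open>star\<close>.\<close>

lemma (in unital_cstar_hom) eq_of_generators:
  assumes k: "unital_cstar_hom A B k" and gen: "generates_cstar A P"
    and eq: "\<And>x. x \<in> P \<Longrightarrow> h x = k x" and x: "x \<in> carrier A"
  shows "h x = k x"
proof -
  interpret k: unital_cstar_hom A B k by (rule k)
  define S where "S = {x \<in> carrier A. h x = k x}"
  have "closedin (cstar_top A) S"
    unfolding A.closedin_iff_conv
  proof (intro conjI allI impI)
    fix u l assume u: "range u \<subseteq> S" "A.conv u l"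
    have "h (u n) = k (u n)" for n using u(1) by (auto simp: S_def)
    then have "B.conv (\<lambda>n. h (u n)) (k l)" using k.conv[OF u(2)] by simp
    then have "h l = k l" by (rule B.conv_unique[OF conv[OF u(2)]])
    then show "l \<in> S" using u(2) by (simp add: S_def A.conv_def)
  qed (auto simp: S_def)
  moreover have "subring S A"
    by (rule A.subringI) (auto simp: S_def minus k.minus mult k.mult add k.add)
  ultimately have "unital_cstar_subalgebra A S"
    by (auto simp: unital_cstar_subalgebra_def S_def smult k.smult star k.star)
  moreover have "P \<subseteq> S" using gen eq by (auto simp: S_def generates_cstar_def)
  ultimately have "S = carrier A" using gen by (simp add: generates_cstar_def)
  then show ?thesis using x by (auto simp: S_def)
qed

text \<open>\<open>star A (s i) \<otimes> s j\<close> is recovered from the product of the two range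
  projections by multiplying with \<open>star A (s i)\<close> on the left and \<open>s j\<close> on
  the right. The perturbation results speak of the orthonormal form.\<close>

lemma (in unital_cstar) isometries_orthogonal_ranges_iff:
  "isometries_orthogonal_ranges A s \<longleftrightarrow> orthonormal UNIV s"
proof
  assume L: "isometries_orthogonal_ranges A s"
  have c: "s i \<in> carrier A" "star A (s i) \<otimes> s i = \<one>" for i
    using L by (auto simp: isometries_orthogonal_ranges_def)
  have "star A (s i) \<otimes> s j = \<zero>" if "i \<noteq> j" for i j
  proof -
    have "star A (s i) \<otimes> s j = (star A (s i) \<otimes> s i) \<otimes> (star A (s i) \<otimes> s j) \<otimes> (star A (s j) \<otimes> s j)"
      using c(1) by (simp add: c(2))
    also have "\<dots> = star A (s i) \<otimes> ((s i \<otimes> star A (s i)) \<otimes> (s j \<otimes> star A (s j))) \<otimes> s j"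
      using c(1) by (simp add: m_assoc)
    also have "\<dots> = \<zero>" using L that c(1) by (simp add: isometries_orthogonal_ranges_def)
    finally show ?thesis .
  qed
  then show "orthonormal UNIV s" using c by (simp add: orthonormal_def)
next
  assume R: "orthonormal UNIV s"
  have c: "s i \<in> carrier A" "star A (s i) \<otimes> s j = (if i = j then \<one> else \<zero>)" for i j
    using R by (auto simp: orthonormal_def)
  have "(s i \<otimes> star A (s i)) \<otimes> (s j \<otimes> star A (s j)) = \<zero>" if "i \<noteq> j" for i j
  proof -
    have "(s i \<otimes> star A (s i)) \<otimes> (s j \<otimes> star A (s j)) = s i \<otimes> (star A (s i) \<otimes> s j) \<otimes> star A (s j)"
      using c(1) by (simp add: m_assoc)
    then show ?thesis using c(1) that by (simp add: c(2))
  qed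
  then show "isometries_orthogonal_ranges A s"
    using c by (simp add: isometries_orthogonal_ranges_def)
qed

section \<open>Square-summable sequences\<close>

lemma l2_add: assumes "x \<in> l2" "y \<in> l2" shows "(\<lambda>n. x n + y n) \<in> l2"
proof -
  have s: "summable (\<lambda>n. 2 * (cmod (x n))\<^sup>2 + 2 * (cmod (y n))\<^sup>2)"
    using assms by (auto simp: l2_def intro!: summable_add summable_mult)
  have b: "(cmod (x n + y n))\<^sup>2 \<le> 2 * (cmod (x n))\<^sup>2 + 2 * (cmod (y n))\<^sup>2" for n
  proof -
    have "(cmod (x n + y n))\<^sup>2 \<le> (cmod (x n) + cmod (y n))\<^sup>2"
      by (intro power_mono norm_triangle_ineq) simp
    also have "\<dots> \<le> 2 * (cmod (x n))\<^sup>2 + 2 * (cmod (y n))\<^sup>2"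
      using sum_squares_bound[of "cmod (x n)" "cmod (y n)"] by (simp add: power2_sum)
    finally show ?thesis .
  qed
  have "summable (\<lambda>n. (cmod (x n + y n))\<^sup>2)"
    by (rule summable_comparison_test'[OF s, of 0]) (simp add: b)
  then show ?thesis by (simp add: l2_def)
qed

lemma l2_scale: "x \<in> l2 \<Longrightarrow> (\<lambda>n. c * x n) \<in> l2"
  by (auto simp: l2_def norm_mult power_mult_distrib intro!: summable_mult)

lemma l2_finite_support: "(\<lambda>j. if j < n then x j else 0) \<in> l2" for n :: nat
proof -
  have "summable (\<lambda>j. (cmod (if j < n then x j else 0))\<^sup>2)"
    by (rule summable_finite[of "{..<n}"]) auto
  then show ?thesis by (simp add: l2_def)
qed

lemma l2_basis_mem: "l2_basis k \<in> l2"
proof -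
  have "summable (\<lambda>n. (cmod (l2_basis k n))\<^sup>2)"
    by (rule summable_finite[of "{k}"]) (auto simp: l2_basis_def)
  then show ?thesis by (simp add: l2_def)
qed

lemma l2_inner_summable: assumes "x \<in> l2" "y \<in> l2" shows "summable (\<lambda>n. x n * cnj (y n))"
proof (rule summable_comparison_test')
  show "summable (\<lambda>n. (cmod (x n))\<^sup>2 + (cmod (y n))\<^sup>2)"
    using assms by (auto simp: l2_def intro!: summable_add)
  show "norm (x n * cnj (y n)) \<le> (cmod (x n))\<^sup>2 + (cmod (y n))\<^sup>2" if "n \<ge> 0" for n
  proof -
    have "0 \<le> cmod (x n) * cmod (y n)" by simp
    then show ?thesis
      using sum_squares_bound[of "cmod (x n)" "cmod (y n)"] unfolding norm_mult complex_mod_cnj by linarith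
  qed
qed

section \<open>The copy of l2 spanned by an orthonormal sequence\<close>

locale orthonormal_sequence = unital_cstar A for A :: "'a cstar" (structure) +
  fixes s :: "nat \<Rightarrow> 'a"
  assumes s: "orthonormal UNIV s"
begin

lemma s_closed [simp]: "s j \<in> carrier A" using s by (simp add: orthonormal_def)

lemma s_star_s: "star A (s i) \<otimes> s j = (if i = j then \<one> else \<zero>)" using s by (simp add: orthonormal_def)

definition psum :: "(nat \<Rightarrow> complex) \<Rightarrow> nat \<Rightarrow> 'a" where
  "psum c n = (\<Oplus>j\<in>{..<n}. c j \<odot> s j)"

lemma psum_closed [simp]: "psum c n \<in> carrier A"
  by (simp add: psum_def finsum_closed')

lemma psum_0 [simp]: "psum c 0 = \<zero>"
  by (simp add: psum_def)

lemma psum_Suc: "psum c (Suc n) = c n \<odot> s n \<oplus> psum c n"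
  by (simp add: psum_def lessThan_Suc)

lemma psum_add: "psum (\<lambda>j. c j + d j) n = psum c n \<oplus> psum d n"
  by (induction n) (simp_all add: psum_Suc smult_add_left a_ac)

lemma psum_scale: "psum (\<lambda>j. a * c j) n = a \<odot> psum c n"
  by (induction n) (simp_all add: psum_Suc smult_add_right)

lemma psum_cong: "(\<And>j. j < n \<Longrightarrow> c j = d j) \<Longrightarrow> psum c n = psum d n"
  by (induction n) (simp_all add: psum_Suc)

lemma s_star_psum: "star A (s k) \<otimes> psum c n = (if k < n then c k else 0) \<odot> \<one>"
  by (induction n) (auto simp: psum_Suc r_distr smult_mult_right s_star_s less_Suc_eq)

lemma psum_star_psum: "star A (psum c n) \<otimes> psum d n = (\<Sum>j<n. cnj (c j) * d j) \<odot> \<one>"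
proof (induction n)
  case (Suc n)
  have 1: "star A (psum c n) \<otimes> s n = \<zero>"
    using arg_cong[OF s_star_psum[of n c n], of "star A"] by (simp add: star_mult)
  have "star A (psum c (Suc n)) \<otimes> psum d (Suc n)
      = (cnj (c n) * d n) \<odot> \<one> \<oplus> (\<Sum>j<n. cnj (c j) * d j) \<odot> \<one>"
    by (simp add: psum_Suc star_add star_smult l_distr r_distr smult_mult_left smult_mult_right
      s_star_s s_star_psum 1 Suc.IH mult.commute)
  then show ?case by (simp add: smult_add_left a_comm)
qed simp

text \<open>Pythagoras: for a sum \<open>x\<close> over orthonormal elements,
  \<open>star A x \<otimes> x\<close> is the sum of the squared moduli times \<open>\<one>\<close>.
  The zero algebra leaves only an inequality.\<close>

lemma psum_diff_nrm:
  assumes "m \<le> n" shows "(nrm A (psum c n \<ominus> psum c m))\<^sup>2 \<le> (\<Sum>j=m..<n. (cmod (c j))\<^sup>2)"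
proof -
  define d where "d j = (if j < m then 0 else c j)" for j
  have eq: "psum d n \<oplus> psum c m = psum c n" using assms
  proof (induction n rule: dec_induct)
    case base
    have "psum d m = psum (\<lambda>j. 0 * c j) m" by (rule psum_cong) (simp add: d_def)
    then show ?case by (simp only: psum_scale) simp
  next
    case (step n)
    then show ?case by (simp add: psum_Suc d_def a_assoc)
  qed
  have "psum c n \<ominus> psum c m = psum d n"
    unfolding eq[symmetric] by (simp add: minus_eq a_assoc r_neg)
  then have "(nrm A (psum c n \<ominus> psum c m))\<^sup>2 = nrm A ((\<Sum>j<n. cnj (d j) * d j) \<odot> \<one>)"
    using nrm_star_mult[of "psum d n"] by (simp add: psum_star_psum)
  also have "\<dots> \<le> cmod (\<Sum>j<n. cnj (d j) * d j) * 1"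
    unfolding nrm_smult[OF one_closed] by (rule mult_left_mono[OF nrm_one_le]) simp
  also have "\<dots> \<le> (\<Sum>j<n. cmod (cnj (d j) * d j))" by (simp add: sum_norm_le)
  also have "\<dots> = (\<Sum>j=m..<n. (cmod (c j))\<^sup>2)"
    by (rule sum.mono_neutral_cong_right) (auto simp: d_def norm_mult power2_eq_square)
  finally show ?thesis .
qed

lemma psum_conv: assumes c: "c \<in> l2" obtains x where "conv (psum c) x"
proof -
  have sum: "summable (\<lambda>n. (cmod (c n))\<^sup>2)" using c by (simp add: l2_def)
  have "met.MCauchy (psum c)"
    unfolding met.MCauchy_def
  proof (intro conjI allI impI)
    fix e :: real assume e: "e > 0"
    then have "e\<^sup>2 > 0" by simp
    then obtain N where N: "\<And>m n. m \<ge> N \<Longrightarrow> norm (\<Sum>j=m..<n. (cmod (c j))\<^sup>2) < e\<^sup>2"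
      using sum unfolding summable_Cauchy by blast
    have near: "nrm A (psum c n \<ominus> psum c m) < e" if "m \<ge> N" "m \<le> n" for m n
    proof -
      have "(nrm A (psum c n \<ominus> psum c m))\<^sup>2 < e\<^sup>2"
        using psum_diff_nrm[OF that(2), of c] N[OF that(1), of n] by (simp add: sum_nonneg)
      then show ?thesis using power2_less_imp_less[of "nrm A (psum c n \<ominus> psum c m)" e] e by simp
    qed
    show "\<exists>N. \<forall>n n'. N \<le> n \<longrightarrow> N \<le> n' \<longrightarrow> cdist A (psum c n) (psum c n') < e"
    proof (intro exI[of _ N] allI impI)
      fix n n' assume n: "N \<le> n" "N \<le> n'"
      show "cdist A (psum c n) (psum c n') < e"
      proof (cases "n \<le> n'")
        case True
        then show ?thesis using near[OF n(1) True] by (simp add: cdist_def nrm_minus_commute[of "psum c n"])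
      next
        case False
        then show ?thesis using near[of n' n] n by (simp add: cdist_def)
      qed
    qed
  qed auto
  then obtain x where "limitin met.mtopology (psum c) x sequentially"
    using complete by (auto simp: met.mcomplete_def)
  then have "conv (psum c) x" by (simp add: conv_iff_limitin cstar_top_def)
  then show thesis by (rule that)
qed

definition S :: "(nat \<Rightarrow> complex) \<Rightarrow> 'a" where "S c = (SOME x. conv (psum c) x)"

lemma S_conv: assumes "c \<in> l2" shows "conv (psum c) (S c)"
proof -
  obtain x where "conv (psum c) x" by (rule psum_conv[OF assms])
  then show ?thesis unfolding S_def by (rule someI)
qed

lemma S_closed: "c \<in> l2 \<Longrightarrow> S c \<in> carrier A"
  using S_conv by (simp add: conv_def)

lemma S_add: "\<lbrakk>c \<in> l2; d \<in> l2\<rbrakk> \<Longrightarrow> S (\<lambda>j. c j + d j) = S c \<oplus> S d"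
  using conv_unique[OF S_conv[OF l2_add] conv_add[OF S_conv S_conv, unfolded psum_add[symmetric]]] by simp

lemma psum_scale': "psum (\<lambda>j. a * c j) = (\<lambda>n. a \<odot> psum c n)"
  by (rule ext) (rule psum_scale)

lemma S_scale: "c \<in> l2 \<Longrightarrow> S (\<lambda>j. a * c j) = a \<odot> S c"
  by (rule conv_unique[OF S_conv[OF l2_scale]]) (auto simp: psum_scale' intro: conv_smult S_conv)

lemma S_finite_support: "S (\<lambda>j. if j < n then c j else 0) = psum c n"
proof (rule conv_eventually_const[OF S_conv[OF l2_finite_support]])
  fix m assume "m \<ge> n"
  then show "psum (\<lambda>j. if j < n then c j else 0) m = psum c n"
  proof (induction m rule: dec_induct)
    case base show ?case by (rule psum_cong) simp
  qed (simp add: psum_Suc)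
qed

lemma S_basis: "S (l2_basis k) = s k"
proof -
  have b: "l2_basis k k = 1" "\<And>j. j \<noteq> k \<Longrightarrow> l2_basis k j = 0" by (simp_all add: l2_basis_def)
  show ?thesis
  proof (rule conv_eventually_const[OF S_conv[OF l2_basis_mem]])
  fix m assume "m \<ge> Suc k"
  then show "psum (l2_basis k) m = s k"
  proof (induction m rule: dec_induct)
    case base
    have "psum (l2_basis k) k = psum (\<lambda>j. 0 * l2_basis k j) k"
      by (rule psum_cong) (simp add: b)
    then have "psum (l2_basis k) k = \<zero>" unfolding psum_scale by simp
    then show ?case by (simp add: psum_Suc b)
  next
    case (step m)
    then show ?case by (simp add: psum_Suc b)
  qed
qed
qed

lemma conv_scalar: assumes "a \<longlonglongrightarrow> l" shows "conv (\<lambda>n. a n \<odot> \<one>) (l \<odot> \<one>)"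
proof (rule conv_bound)
  show "nrm A (a n \<odot> \<one> \<ominus> l \<odot> \<one>) \<le> cmod (a n - l) * nrm A \<one>" for n
    by (simp flip: smult_diff_left add: nrm_smult)
  have "(\<lambda>n. cmod (a n - l)) \<longlonglongrightarrow> 0" using assms by (simp add: LIM_zero tendsto_norm_zero)
  then show "(\<lambda>n. cmod (a n - l) * nrm A \<one>) \<longlonglongrightarrow> 0" by (rule tendsto_mult_left_zero)
qed auto

text \<open>The arguments of \<open>l2_inner\<close> are swapped because it is conjugate linear in
  the second one, whereas \<open>star A\<close> sits on the left.\<close>

lemma S_star_S: assumes c: "c \<in> l2" and d: "d \<in> l2" shows "star A (S c) \<otimes> S d = l2_inner d c \<odot> \<one>"
proof (rule conv_unique[OF conv_mult[OF conv_star[OF S_conv[OF c]] S_conv[OF d]]])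
  have "(\<lambda>n. d n * cnj (c n)) sums l2_inner d c"
    unfolding l2_inner_def using l2_inner_summable[OF d c] by (rule summable_sums)
  then have "(\<lambda>n. \<Sum>j<n. cnj (c j) * d j) \<longlonglongrightarrow> l2_inner d c" by (simp add: sums_def mult.commute)
  then show "conv (\<lambda>n. star A (psum c n) \<otimes> psum d n) (l2_inner d c \<odot> \<one>)"
    unfolding psum_star_psum by (rule conv_scalar)
qed

lemma l2_inner_basis: "l2_inner (l2_basis i) (l2_basis j) = (if i = j then 1 else 0)"
proof -
  have "(\<lambda>n. l2_basis i n * cnj (l2_basis j n)) = (\<lambda>n. if n = i then (if i = j then 1 else 0) else 0)"
    by (auto simp: l2_basis_def)
  then show ?thesis unfolding l2_inner_def
    using sums_unique[OF sums_single[of i "\<lambda>_. if i = j then 1 else (0::complex)"]] by simp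
qed

lemma unitary_mem: "u \<in> l2_unitaries \<Longrightarrow> x \<in> l2 \<Longrightarrow> u x \<in> l2"
  by (auto simp: l2_unitaries_def Bij_def bij_betw_def)

lemma unitary_orthonormal: assumes u: "u \<in> l2_unitaries" shows "orthonormal UNIV (\<lambda>k. S (u (l2_basis k)))"
  unfolding orthonormal_def
proof (intro conjI ballI)
  fix i j
  note m = unitary_mem[OF u l2_basis_mem]
  show "S (u (l2_basis i)) \<in> carrier A" by (rule S_closed[OF m])
  have "l2_inner (u (l2_basis j)) (u (l2_basis i)) = l2_inner (l2_basis j) (l2_basis i)"
    using u l2_basis_mem by (simp add: l2_unitaries_def)
  then show "star A (S (u (l2_basis i))) \<otimes> S (u (l2_basis j)) = (if i = j then \<one> else \<zero>)"
    by (simp add: S_star_S[OF m m] l2_inner_basis)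
qed

text \<open>Linearity gives the claim on finite sums. Since \<open>u\<close> preserves inner
  products, \<open>S (u d)\<close> and \<open>S d\<close> have equal norm, so convergence of the
  partial sums transfers. This identifies the composite of two quasifree homomorphisms on the
  generators.\<close>

lemma hom_S:
  assumes u: "u \<in> l2_unitaries" and h: "unital_cstar_hom A A h" and hs: "\<And>k. h (s k) = S (u (l2_basis k))"
    and c: "c \<in> l2"
  shows "h (S c) = S (u c)"
proof -
  interpret h: unital_cstar_hom A A h by (rule h)
  let ?c = "\<lambda>n j. if j < n then c j else 0"
  have uadd: "u (\<lambda>n. x n + y n) = (\<lambda>n. u x n + u y n)" if "x \<in> l2" "y \<in> l2" for x y
    using u that by (simp add: l2_unitaries_def)
  have uscale: "u (\<lambda>n. a * x n) = (\<lambda>n. a * u x n)" if "x \<in> l2" for a x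
    using u that by (simp add: l2_unitaries_def)
  note um = unitary_mem[OF u]
  have ps: "h (psum c n) = S (u (?c n))" for n
  proof (induction n)
    case 0
    \<comment> \<open>The empty sum is rewritten as a multiple by 0, so that the scaling rule for
      \<open>u\<close> applies.\<close>
    have "u (?c 0) = u (\<lambda>j. 0 * c j)" by simp
    then have "S (u (?c 0)) = 0 \<odot> S (u c)" by (simp only: uscale[OF c] S_scale[OF um[OF c]])
    then show ?case using S_closed[OF um[OF c]] by simp
  next
    case (Suc n)
    have "?c (Suc n) = (\<lambda>j. c n * l2_basis n j + ?c n j)" by (auto simp: l2_basis_def less_Suc_eq)
    then have "S (u (?c (Suc n))) = S (\<lambda>j. c n * u (l2_basis n) j + u (?c n) j)"
      by (simp only: uadd[OF l2_scale[OF l2_basis_mem] l2_finite_support] uscale[OF l2_basis_mem])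
    also have "\<dots> = c n \<odot> S (u (l2_basis n)) \<oplus> S (u (?c n))"
      by (simp only: S_add[OF l2_scale[OF um[OF l2_basis_mem]] um[OF l2_finite_support]] S_scale[OF um[OF l2_basis_mem]])
    also have "\<dots> = h (psum c (Suc n))" by (simp add: psum_Suc h.add h.smult hs Suc.IH)
    finally show ?case by simp
  qed
  have "nrm A (h (psum c n) \<ominus> S (u c)) = nrm A (psum c n \<ominus> S c)" for n
  proof -
    define d where "d j = ?c n j + (-1) * c j" for j
    have dl: "d \<in> l2" unfolding d_def by (rule l2_add[OF l2_finite_support l2_scale[OF c]])
    have Sd: "S d = psum c n \<ominus> S c"
      unfolding d_def using S_closed[OF c]
      by (simp only: S_add[OF l2_finite_support l2_scale[OF c]] S_scale[OF c] S_finite_support scale_minus1 minus_eq)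
    have "u d = (\<lambda>j. u (?c n) j + (-1) * u c j)"
      unfolding d_def by (simp only: uadd[OF l2_finite_support l2_scale[OF c]] uscale[OF c])
    then have Sud: "S (u d) = h (psum c n) \<ominus> S (u c)"
      using S_closed[OF um[OF c]]
      by (simp only: S_add[OF um[OF l2_finite_support] l2_scale[OF um[OF c]]] S_scale[OF um[OF c]] ps scale_minus1 minus_eq)
    have "star A (S (u d)) \<otimes> S (u d) = star A (S d) \<otimes> S d"
      using u dl by (simp add: S_star_S um l2_unitaries_def)
    then have "nrm A (S (u d)) = nrm A (S d)"
      by (rule nrm_eq_of_star_mult_eq[OF S_closed[OF um[OF dl]] S_closed[OF dl]])
    then show ?thesis by (simp add: Sd Sud)
  qed
  then have "conv (\<lambda>n. h (psum c n)) (S (u c))"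
    using S_conv[OF c] S_closed[OF um[OF c]] by (simp add: conv_def)
  then show ?thesis by (rule conv_unique[OF h.conv[OF S_conv[OF c]]])
qed

end

lemma unital_cstar_hom_comp:
  assumes "unital_cstar_hom A B h" "unital_cstar_hom B C k"
  shows "unital_cstar_hom A C (k \<circ> h)"
  using assms cstar_hom_comp
  by (auto simp: unital_cstar_hom_def unital_cstar_hom_axioms_def)

text \<open>\<open>gamma_infinity\<close> is a definite description, so existence and uniqueness
  must be settled before anything is known about \<open>\<alpha> g\<close>. Existence comes from the
  universal property, and bijectivity from the homomorphism that belongs to the inverse group
  element. What the rest of the proof keeps is that each translate of a generator is a norm limit of
  linear combinations of generators.\<close>

theorem quasifree_limit:
  assumes A: "Cuntz_infinity A s" and q: "quasifree_action G A s \<alpha>" and g: "g \<in> carrier G"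
  shows "\<exists>c. unital_cstar.conv A (\<lambda>n. \<Oplus>\<^bsub>A\<^esub>j\<in>{..<n}. c j \<odot>\<^bsub>A\<^esub> s j) (\<alpha> g (s k))"
proof -
  interpret A: unital_cstar A using A by (simp add: Cuntz_infinity_def)
  have orth: "A.orthonormal UNIV s" and gen: "generates_cstar A (range s)"
    using A A.isometries_orthogonal_ranges_iff by (auto simp: Cuntz_infinity_def)
  interpret o: orthonormal_sequence A s by unfold_locales (rule orth)
  obtain \<rho> where \<rho>: "\<rho> \<in> hom G U_infinity" "\<And>g. g \<in> carrier G \<Longrightarrow> \<alpha> g = gamma_infinity A s (\<rho> g)"
    and G: "group G"
    using q by (auto simp: quasifree_action_def unital_G_algebra_def)
  interpret G: group G by (rule G)
  have \<rho>u: "\<rho> h \<in> l2_unitaries" if "h \<in> carrier G" for h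
    using \<rho>(1) that by (auto simp: hom_def U_infinity_def)
  have \<rho>B: "\<rho> h \<in> Bij l2" if "h \<in> carrier G" for h using \<rho>u[OF that] by (simp add: l2_unitaries_def)
  have \<rho>m: "\<rho> (h \<otimes>\<^bsub>G\<^esub> h') x = \<rho> h (\<rho> h' x)" if "h \<in> carrier G" "h' \<in> carrier G" "x \<in> l2" for h h' x
  proof -
    have "\<rho> (h \<otimes>\<^bsub>G\<^esub> h') = compose l2 (\<rho> h) (\<rho> h')"
      using \<rho>(1) \<rho>B that by (simp add: hom_def U_infinity_def BijGroup_def)
    then show ?thesis using that by (simp add: compose_def)
  qed
  have \<rho>1: "\<rho> \<one>\<^bsub>G\<^esub> x = x" if x: "x \<in> l2" for x
  proof -
    have "\<rho> \<one>\<^bsub>G\<^esub> (\<rho> \<one>\<^bsub>G\<^esub> x) = \<rho> \<one>\<^bsub>G\<^esub> x" using \<rho>m[of "\<one>\<^bsub>G\<^esub>" "\<one>\<^bsub>G\<^esub>" x] x by simp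
    moreover have "inj_on (\<rho> \<one>\<^bsub>G\<^esub>) l2" using \<rho>B[of "\<one>\<^bsub>G\<^esub>"] by (simp add: Bij_def bij_betw_def)
    moreover have "\<rho> \<one>\<^bsub>G\<^esub> x \<in> l2" using o.unitary_mem[OF \<rho>u x] by simp
    ultimately show ?thesis using x by (simp add: inj_on_def)
  qed
  have "\<forall>h. \<exists>f. h \<in> carrier G \<longrightarrow> f \<in> cstar_hom A A \<and> (\<forall>k. f (s k) = o.S (\<rho> h (l2_basis k)))"
  proof
    fix h
    show "\<exists>f. h \<in> carrier G \<longrightarrow> f \<in> cstar_hom A A \<and> (\<forall>k. f (s k) = o.S (\<rho> h (l2_basis k)))"
    proof (cases "h \<in> carrier G")
      case True
      have iso: "isometries_orthogonal_ranges A (\<lambda>k. o.S (\<rho> h (l2_basis k)))"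
        unfolding A.isometries_orthogonal_ranges_iff by (rule o.unitary_orthonormal[OF \<rho>u[OF True]])
      obtain f where "f \<in> cstar_hom A A" "\<forall>k. f (s k) = o.S (\<rho> h (l2_basis k))"
        using Cuntz_infinity_universal[OF A A.unital_cstar_axioms iso] by (elim bexE)
      then show ?thesis by blast
    qed simp
  qed
  then obtain F where F: "\<And>h. h \<in> carrier G \<Longrightarrow> F h \<in> cstar_hom A A"
    "\<And>h k. h \<in> carrier G \<Longrightarrow> F h (s k) = o.S (\<rho> h (l2_basis k))" by metis
  have Fh: "unital_cstar_hom A A (F h)" if "h \<in> carrier G" for h
    using F(1)[OF that] by (intro unital_cstar_hom.intro unital_cstar_hom_axioms.intro A.unital_cstar_axioms)
  have id_h: "unital_cstar_hom A A (\<lambda>x. x)"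
    by (intro unital_cstar_hom.intro unital_cstar_hom_axioms.intro A.unital_cstar_axioms)
      (auto simp: cstar_hom_def ring_hom_def)
  \<comment> \<open>The composite of the homomorphisms for \<open>h\<close> and its inverse fixes
    all generators, hence is the identity.\<close>
  have FF: "F h (F h' x) = x"
    if h: "h \<in> carrier G" "h' \<in> carrier G" "h \<otimes>\<^bsub>G\<^esub> h' = \<one>\<^bsub>G\<^esub>" and x: "x \<in> carrier A" for h h' x
  proof -
    have "(F h \<circ> F h') x = x"
    proof (rule unital_cstar_hom.eq_of_generators[OF unital_cstar_hom_comp[OF Fh[OF h(2)] Fh[OF h(1)]] id_h gen _ x])
      fix y assume "y \<in> range s"
      then obtain k where k: "y = s k" by auto
      have "F h (F h' (s k)) = o.S (\<rho> h (\<rho> h' (l2_basis k)))"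
        by (simp add: F(2)[OF h(2)] o.hom_S[OF \<rho>u[OF h(1)] Fh[OF h(1)] F(2)[OF h(1)]
          o.unitary_mem[OF \<rho>u[OF h(2)] l2_basis_mem]])
      also have "\<dots> = s k"
        using \<rho>m[OF h(1,2) l2_basis_mem[of k]] h(3) \<rho>1[OF l2_basis_mem[of k]] by (simp add: o.S_basis)
      finally show "(F h \<circ> F h') y = y" by (simp add: k)
    qed
    then show ?thesis by simp
  qed
  \<comment> \<open>Members of \<open>cstar_Aut A\<close> are extensional, hence the
    restriction.\<close>
  define f where "f = restrict (F g) (carrier A)"
  have fc: "f x = F g x" if "x \<in> carrier A" for x using that by (simp add: f_def)
  have gi: "inv\<^bsub>G\<^esub> g \<in> carrier G" using g by simp
  have Fcl: "F h x \<in> carrier A" if "h \<in> carrier G" "x \<in> carrier A" for h x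
    using cstar_homD(1)[OF F(1)[OF that(1)] that(2)] .
  have "bij_betw f (carrier A) (carrier A)"
    by (rule bij_betw_byWitness[where f' = "F (inv\<^bsub>G\<^esub> g)"])
      (use FF[OF gi g] FF[OF g gi] g gi Fcl in \<open>auto simp: fc\<close>)
  moreover have "f \<in> cstar_hom A A"
  proof -
    interpret Fg: unital_cstar_hom A A "F g" by (rule Fh[OF g])
    show ?thesis
      by (auto simp: cstar_hom_def fc Fg.mult Fg.add Fg.smult Fg.star intro!: ring_hom_memI)
  qed
  ultimately have fAut: "f \<in> carrier (cstar_Aut A)"
    by (simp add: cstar_Aut_def Bij_def f_def)
  let ?P = "\<lambda>\<phi>. \<phi> \<in> carrier (cstar_Aut A) \<and>
     (\<forall>k. limitin (cstar_top A) (\<lambda>n. \<Oplus>\<^bsub>A\<^esub>j\<in>{..<n}. \<rho> g (l2_basis k) j \<odot>\<^bsub>A\<^esub> s j) (\<phi> (s k)) sequentially)"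
  have lim: "(limitin (cstar_top A) (\<lambda>n. \<Oplus>\<^bsub>A\<^esub>j\<in>{..<n}. \<rho> g (l2_basis k) j \<odot>\<^bsub>A\<^esub> s j) x sequentially)
      \<longleftrightarrow> x = o.S (\<rho> g (l2_basis k))" for k x
  proof -
    have "limitin (cstar_top A) (\<lambda>n. \<Oplus>\<^bsub>A\<^esub>j\<in>{..<n}. \<rho> g (l2_basis k) j \<odot>\<^bsub>A\<^esub> s j) x sequentially
        \<longleftrightarrow> A.conv (o.psum (\<rho> g (l2_basis k))) x"
      unfolding o.psum_def[abs_def] by (rule A.conv_iff_limitin[symmetric]) (simp add: A.finsum_closed')
    also have "\<dots> \<longleftrightarrow> x = o.S (\<rho> g (l2_basis k))"
      using o.S_conv[OF o.unitary_mem[OF \<rho>u[OF g] l2_basis_mem[of k]]] A.conv_unique by blast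
    finally show ?thesis .
  qed
  have "?P f" using fAut by (simp add: lim fc F(2)[OF g])
  moreover have "\<phi> = f" if \<phi>: "?P \<phi>" for \<phi>
  proof (rule extensionalityI[of _ "carrier A"])
    have hom: "\<phi> \<in> cstar_hom A A" and ext: "\<phi> \<in> extensional (carrier A)"
      using \<phi> by (auto simp: cstar_Aut_def Bij_def)
    show "\<phi> \<in> extensional (carrier A)" by (rule ext)
    show "f \<in> extensional (carrier A)" by (simp add: f_def)
    have \<phi>h: "unital_cstar_hom A A \<phi>"
      using hom by (intro unital_cstar_hom.intro unital_cstar_hom_axioms.intro A.unital_cstar_axioms)
    fix x assume x: "x \<in> carrier A"
    have "\<phi> x = F g x"
      by (rule unital_cstar_hom.eq_of_generators[OF \<phi>h Fh[OF g] gen _ x])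
        (use \<phi> in \<open>auto simp: lim F(2)[OF g]\<close>)
    then show "\<phi> x = f x" using x by (simp add: fc)
  qed
  ultimately have "gamma_infinity A s (\<rho> g) = f"
    unfolding gamma_infinity_def by (rule the_equality)
  then have "\<alpha> g (s k) = o.S (\<rho> g (l2_basis k))" by (simp add: \<rho>(2)[OF g] fc F(2)[OF g])
  then have "A.conv (o.psum (\<rho> g (l2_basis k))) (\<alpha> g (s k))"
    using o.S_conv[OF o.unitary_mem[OF \<rho>u[OF g] l2_basis_mem[of k]]] by simp
  then show ?thesis unfolding o.psum_def[abs_def] by blast
qed

text \<open>Absorption for the inverse of \<open>g\<close>, after taking adjoints and applying
  \<open>\<alpha> g\<close>, reads \<open>q \<otimes> \<alpha> g q = q\<close>.\<close>

lemma (in finite_G_algebra) fixed_of_absorbing: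
  assumes q: "q \<in> carrier A" "star A q = q"
    and absorb: "\<And>g. g \<in> carrier G \<Longrightarrow> q \<otimes> \<alpha> g q = \<alpha> g q"
  shows "fixed q"
proof (rule fixedI[OF q(1)])
  fix g assume g: "g \<in> carrier G"
  have i: "inv\<^bsub>G\<^esub> g \<in> carrier G" using g by simp
  have s: "star A (\<alpha> (inv\<^bsub>G\<^esub> g) q) = \<alpha> (inv\<^bsub>G\<^esub> g) q" using act_star[OF i q(1)] q(2) by simp
  have "\<alpha> (inv\<^bsub>G\<^esub> g) q \<otimes> q = \<alpha> (inv\<^bsub>G\<^esub> g) q"
    using arg_cong[OF absorb[OF i], of "star A"] q i by (simp add: star_mult s)
  from arg_cong[OF this, of "\<alpha> g"] have "q \<otimes> \<alpha> g q = q"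
    using q g i by (simp add: act_mult act_inv')
  then show "\<alpha> g q = q" using absorb[OF g] by simp
qed

section \<open>The Cuntz algebra with a quasifree action\<close>

text \<open>Keeps of quasifreeness only the limit property. The zero algebra is set aside so that
  scalars can be read off from multiples of \<open>\<one>\<close>.\<close>

locale cuntz_action = finite_G_algebra A G \<alpha> + orthonormal_sequence A s
  for A :: "'a cstar" (structure) and G :: "('g, 'm) monoid_scheme" and \<alpha> and s +
  assumes cuntz: "Cuntz_infinity A s"
    and limit: "\<And>g k. g \<in> carrier G \<Longrightarrow> \<exists>c. conv (psum c) (\<alpha> g (s k))"
    and nonzero: "\<one> \<noteq> \<zero>"
begin

text \<open>The algebraic span of all translates, not its closure: each element then lies in a
  single finite block, which makes the final limit eventually constant.\<close>

inductive_set H :: "'a set" where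
  gen: "g \<in> carrier G \<Longrightarrow> \<alpha> g (s k) \<in> H"
| add: "x \<in> H \<Longrightarrow> y \<in> H \<Longrightarrow> x \<oplus> y \<in> H"
| scale: "x \<in> H \<Longrightarrow> c \<odot> x \<in> H"

lemma H_carrier [simp]: "x \<in> H \<Longrightarrow> x \<in> carrier A"
  by (induction rule: H.induct) simp_all

lemma s_mem_H: "s k \<in> H"
  using H.gen[of "\<one>\<^bsub>G\<^esub>" k] by (simp add: act_one)

lemma H_act: assumes "g \<in> carrier G" "x \<in> H" shows "\<alpha> g x \<in> H"
  using assms(2)
proof (induction rule: H.induct)
  case (gen h k)
  then show ?case using H.gen[of "g \<otimes>\<^bsub>G\<^esub> h" k] assms(1) by (simp add: act_mult_group)
qed (use assms(1) in \<open>simp_all add: act_add act_smult H.add H.scale\<close>)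

lemma H_zero: "\<zero> \<in> H"
  using H.scale[OF s_mem_H, of 0] by simp

lemma H_diff: "\<lbrakk>x \<in> H; y \<in> H\<rbrakk> \<Longrightarrow> x \<ominus> y \<in> H"
  using H.add[OF _ H.scale[of y "-1"]] by (simp add: minus_eq scale_minus1)

text \<open>Pairing \<open>s i\<close> with a translate gives a scalar because its pairings with the
  partial sums are constantly \<open>c i\<close> from index \<open>Suc i\<close> on. A translate on
  the left is moved to the right by applying the automorphism, and both arguments extend by
  linearity.\<close>

lemma H_scalar: assumes x: "x \<in> H" and y: "y \<in> H" shows "\<exists>c. star A x \<otimes> y = c \<odot> \<one>"
proof -
  have base: "\<exists>c. star A (s i) \<otimes> \<alpha> h (s j) = c \<odot> \<one>" if h: "h \<in> carrier G" for h i j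
  proof -
    obtain c where c: "conv (psum c) (\<alpha> h (s j))" using limit[OF h] by blast
    have "star A (s i) \<otimes> \<alpha> h (s j) = c i \<odot> \<one>"
      by (rule conv_eventually_const[OF conv_mult_left[OF c], of "star A (s i)" "Suc i"])
        (simp_all add: s_star_psum)
    then show ?thesis by blast
  qed
  have left: "\<exists>c. star A (\<alpha> g (s i)) \<otimes> y = c \<odot> \<one>" if g: "g \<in> carrier G" for g i
    using y
  proof (induction rule: H.induct)
    case (gen h j)
    have i: "inv\<^bsub>G\<^esub> g \<in> carrier G" using g by simp
    obtain c where c: "star A (s i) \<otimes> \<alpha> (inv\<^bsub>G\<^esub> g \<otimes>\<^bsub>G\<^esub> h) (s j) = c \<odot> \<one>"
      using base[of "inv\<^bsub>G\<^esub> g \<otimes>\<^bsub>G\<^esub> h" i j] i gen by auto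
    have "star A (\<alpha> g (s i)) \<otimes> \<alpha> h (s j) = \<alpha> g (star A (s i) \<otimes> \<alpha> (inv\<^bsub>G\<^esub> g \<otimes>\<^bsub>G\<^esub> h) (s j))"
      using g i gen by (simp add: act_mult act_star act_mult_group act_inv')
    also have "\<dots> = c \<odot> \<one>" unfolding c using g by (simp add: act_smult)
    finally show ?case by blast
  next
    case (add x z)
    then obtain c d where "star A (\<alpha> g (s i)) \<otimes> x = c \<odot> \<one>" "star A (\<alpha> g (s i)) \<otimes> z = d \<odot> \<one>" by blast
    then have "star A (\<alpha> g (s i)) \<otimes> (x \<oplus> z) = (c + d) \<odot> \<one>"
      using add.hyps g by (simp add: r_distr smult_add_left)
    then show ?case by blast
  next
    case (scale x d)
    then obtain c where "star A (\<alpha> g (s i)) \<otimes> x = c \<odot> \<one>" by blast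
    then have "star A (\<alpha> g (s i)) \<otimes> (d \<odot> x) = (d * c) \<odot> \<one>"
      using scale.hyps g by (simp add: smult_mult_right)
    then show ?case by blast
  qed
  show ?thesis
    using x
  proof (induction rule: H.induct)
    case (gen h j)
    then show ?case by (rule left)
  next
    case (add x z)
    then obtain c d where "star A x \<otimes> y = c \<odot> \<one>" "star A z \<otimes> y = d \<odot> \<one>" by blast
    then have "star A (x \<oplus> z) \<otimes> y = (c + d) \<odot> \<one>"
      using add.hyps y by (simp add: star_add l_distr smult_add_left)
    then show ?case by blast
  next
    case (scale x d)
    then obtain c where "star A x \<otimes> y = c \<odot> \<one>" by blast
    then have "star A (d \<odot> x) \<otimes> y = (cnj d * c) \<odot> \<one>"
      using scale.hyps y by (simp add: star_smult smult_mult_left)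
    then show ?case by blast
  qed
qed

text \<open>The inner product of \<open>H\<close>, conjugate linear in the first argument; the
  chosen scalar is unique because the algebra is nonzero.\<close>

definition ip :: "'a \<Rightarrow> 'a \<Rightarrow> complex" where "ip x y = (SOME c. star A x \<otimes> y = c \<odot> \<one>)"

lemma ip: "\<lbrakk>x \<in> H; y \<in> H\<rbrakk> \<Longrightarrow> star A x \<otimes> y = ip x y \<odot> \<one>"
  unfolding ip_def by (rule someI_ex) (rule H_scalar)

text \<open>Pairing with \<open>s j\<close> extracts a coefficient and is dominated by the tail of a
  convergent series. This decay is what leaves room outside every finite block.\<close>

lemma s_vanish: assumes "x \<in> H" shows "(\<lambda>j. nrm A (star A (s j) \<otimes> x)) \<longlonglongrightarrow> 0"
  using assms
proof (induction rule: H.induct)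
  case (gen g k)
  obtain c where c: "conv (psum c) (\<alpha> g (s k))" using limit[OF gen] by blast
  let ?x = "\<alpha> g (s k)"
  have le: "nrm A (star A (s j) \<otimes> ?x) \<le> nrm A (psum c j \<ominus> ?x)" for j
  proof -
    \<comment> \<open>\<open>psum c j\<close> stops before the index \<open>j\<close>, so it is
      orthogonal to \<open>s j\<close>.\<close>
    have "star A (s j) \<otimes> (psum c j \<ominus> ?x) = \<ominus> (star A (s j) \<otimes> ?x)"
      using gen s_star_psum[of j c j] by (simp add: minus_eq r_distr r_minus)
    then have "nrm A (star A (s j) \<otimes> ?x) = nrm A (star A (s j) \<otimes> (psum c j \<ominus> ?x))" using gen by simp
    also have "\<dots> \<le> nrm A (star A (s j)) * nrm A (psum c j \<ominus> ?x)" using gen by (intro nrm_mult) auto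
    also have "\<dots> \<le> 1 * nrm A (psum c j \<ominus> ?x)"
      using gen nrm_isometry[of "s j"] by (intro mult_right_mono) (auto simp: nrm_star s_star_s nrm_nonneg)
    finally show ?thesis by simp
  qed
  show ?case
    by (rule tendsto_sandwich[OF _ _ tendsto_const, of _ _ _ "\<lambda>j. nrm A (psum c j \<ominus> ?x)"])
      (use c gen le in \<open>auto simp: conv_def nrm_nonneg\<close>)
next
  case (add x y)
  have "(\<lambda>j. nrm A (star A (s j) \<otimes> x) + nrm A (star A (s j) \<otimes> y)) \<longlonglongrightarrow> 0"
    using add.IH by (rule tendsto_add_zero)
  then show ?case
    by (rule tendsto_sandwich[OF _ _ tendsto_const, rotated 2])
      (use add.hyps in \<open>auto simp: nrm_nonneg r_distr nrm_add\<close>)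
next
  case (scale x c)
  have "(\<lambda>j. cmod c * nrm A (star A (s j) \<otimes> x)) \<longlonglongrightarrow> 0"
    using scale.IH by (rule tendsto_mult_right_zero)
  then show ?case using scale.hyps by (simp add: smult_mult_right nrm_smult)
qed

subsection \<open>Finite orthonormal sets in \<open>H\<close>\<close>

definition onset :: "'a set \<Rightarrow> bool" where
  "onset B \<longleftrightarrow> finite B \<and> B \<subseteq> H \<and> orthonormal B (\<lambda>b. b)"

definition proj :: "'a set \<Rightarrow> 'a" where
  "proj B = (\<Oplus>b\<in>B. b \<otimes> star A b)"

definition subsp :: "'a set \<Rightarrow> bool" where
  "subsp W \<longleftrightarrow> (\<forall>x\<in>W. \<forall>y\<in>W. x \<oplus> y \<in> W) \<and> (\<forall>c. \<forall>x\<in>W. c \<odot> x \<in> W)"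

lemma onset_mem: "onset B \<Longrightarrow> b \<in> B \<Longrightarrow> b \<in> H" "onset B \<Longrightarrow> finite B"
  by (auto simp: onset_def)

lemma onset_star: "\<lbrakk>onset B; b \<in> B; b' \<in> B\<rbrakk> \<Longrightarrow> star A b \<otimes> b' = (if b = b' then \<one> else \<zero>)"
  by (simp add: onset_def orthonormal_def)

lemma orthonormal_subset: "orthonormal B f \<Longrightarrow> B' \<subseteq> B \<Longrightarrow> orthonormal B' f"
  unfolding orthonormal_def by blast

lemma onset_subset: "onset B \<Longrightarrow> B' \<subseteq> B \<Longrightarrow> onset B'"
  by (auto simp: onset_def intro: finite_subset orthonormal_subset)

lemma proj_closed [simp]: "onset B \<Longrightarrow> proj B \<in> carrier A"
  by (simp add: proj_def finsum_closed' onset_mem)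

lemma proj_star: "onset B \<Longrightarrow> star A (proj B) = proj B"
  unfolding proj_def
  by (subst star_finsum) (auto simp: onset_mem star_mult intro!: finsum_cong_simp)

lemma proj_mult: "\<lbrakk>onset B; x \<in> carrier A\<rbrakk> \<Longrightarrow> proj B \<otimes> x = (\<Oplus>b\<in>B. b \<otimes> (star A b \<otimes> x))"
  unfolding proj_def
  by (subst finsum_mult) (auto simp: onset_mem m_assoc intro!: finsum_cong_simp)

lemma proj_mem: assumes "onset B" "b \<in> B" shows "proj B \<otimes> b = b"
proof -
  have "proj B \<otimes> b = (\<Oplus>c\<in>B. c \<otimes> (star A c \<otimes> b))" using assms by (simp add: proj_mult onset_mem)
  also have "\<dots> = b \<otimes> (star A b \<otimes> b)"
    by (rule finsum_delta) (use assms in \<open>auto simp: onset_mem onset_star\<close>)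
  finally show ?thesis using assms by (simp add: onset_star onset_mem)
qed

lemma proj_subset: assumes "onset B'" "B \<subseteq> B'" shows "proj B' \<otimes> proj B = proj B"
proof -
  have B: "onset B" using onset_subset assms by blast
  have "proj B' \<otimes> proj B = (\<Oplus>b\<in>B. proj B' \<otimes> (b \<otimes> star A b))"
    unfolding proj_def[of B] using B assms by (intro mult_finsum) (auto simp: onset_mem)
  also have "\<dots> = proj B"
    unfolding proj_def[of B]
  proof (rule finsum_cong_simp)
    fix b assume b: "b \<in> B"
    then have "proj B' \<otimes> (b \<otimes> star A b) = (proj B' \<otimes> b) \<otimes> star A b"
      using assms B by (simp add: m_assoc onset_mem)
    then show "proj B' \<otimes> (b \<otimes> star A b) = b \<otimes> star A b" using proj_mem[of B' b] assms b by auto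
  qed (use B in \<open>simp add: onset_mem\<close>)
  finally show ?thesis .
qed

lemma proj_mono:
  assumes "onset B'" "B \<subseteq> B'" "x \<in> carrier A" "proj B \<otimes> x = x" shows "proj B' \<otimes> x = x"
proof -
  have B: "onset B" using onset_subset assms by blast
  have "proj B' \<otimes> (proj B \<otimes> x) = (proj B' \<otimes> proj B) \<otimes> x" using assms B by (simp add: m_assoc)
  then show ?thesis using assms by (simp add: proj_subset)
qed

lemma subsp_sum:
  assumes W: "subsp W" "w \<in> W" "W \<subseteq> carrier A" and B: "finite B" "\<And>b. b \<in> B \<Longrightarrow> f b \<in> W"
  shows "(\<Oplus>b\<in>B. f b) \<in> W"
  using B
proof (induction B rule: finite_induct)
  case empty
  have "0 \<odot> w \<in> W" using W by (simp add: subsp_def)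
  then show ?case using W by auto
next
  case (insert b B)
  have "(\<Oplus>b\<in>insert b B. f b) = f b \<oplus> (\<Oplus>b\<in>B. f b)"
    using insert W(3) by (intro finsum_insert) auto
  then show ?case using insert W(1) by (simp add: subsp_def)
qed

lemma subsp_H: "subsp H" by (auto simp: subsp_def H.add H.scale)

text \<open>On \<open>H\<close> the coefficients \<open>star A b \<otimes> x\<close> are scalars, so
  multiplication by \<open>proj B\<close> is the orthogonal projection onto the span of
  \<open>B\<close>.\<close>

lemma proj_subsp:
  assumes "onset B" "subsp W" "B \<subseteq> W" "x \<in> W" "W \<subseteq> H" shows "proj B \<otimes> x \<in> W"
proof -
  have xH: "x \<in> H" using assms by auto
  have "proj B \<otimes> x = (\<Oplus>b\<in>B. ip b x \<odot> b)"
    unfolding proj_mult[OF assms(1) H_carrier[OF xH]]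
    using assms(1) xH by (intro finsum_cong_simp) (auto simp: ip onset_mem smult_mult_right)
  also have "\<dots> \<in> W"
    using assms H_carrier by (intro subsp_sum[OF assms(2,4)]) (auto simp: onset_mem subsp_def)
  finally show ?thesis .
qed

lemma proj_H: "onset B \<Longrightarrow> x \<in> H \<Longrightarrow> proj B \<otimes> x \<in> H"
  using proj_subsp[OF _ subsp_H] by (simp add: onset_def)

text \<open>The scalar \<open>ip y y\<close> has a real square root by the scalar case of
  positivity. Both scalings are returned, so that \<open>b\<close> and \<open>y\<close> lie in the
  same subspaces.\<close>

lemma normalize:
  assumes y: "y \<in> H" "y \<noteq> \<zero>"
  obtains b c d where "b \<in> H" "star A b \<otimes> b = \<one>" "b = c \<odot> y" "y = d \<odot> b"
proof -
  define r where "r = Re (ip y y)"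
  have "Im (ip y y) = 0 \<and> 0 \<le> Re (ip y y)"
    by (rule star_mult_scalar_nonneg[of y]) (use y nonzero in \<open>simp_all add: ip\<close>)
  then have r: "ip y y = complex_of_real r" "0 \<le> r" by (simp_all add: r_def complex_eq_iff)
  have "r \<noteq> 0"
  proof
    assume "r = 0"
    then have "star A y \<otimes> y = \<zero>" using r y by (simp add: ip)
    then show False using eq_zero_of_star_mult[of y] y by simp
  qed
  then have r0: "r > 0" using r by simp
  define c where "c = complex_of_real (1 / sqrt r)"
  have "1 / sqrt r * (1 / sqrt r * r) = r / (sqrt r * sqrt r)" by simp
  also have "\<dots> = 1" using r0 by simp
  finally have rr: "1 / sqrt r * (1 / sqrt r * r) = 1" .
  have cc: "c * (c * complex_of_real r) = 1"
    unfolding c_def of_real_mult[symmetric] rr by simp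
  have cn: "cnj c = c" by (simp add: c_def)
  have "star A (c \<odot> y) \<otimes> (c \<odot> y) = (c * (c * ip y y)) \<odot> \<one>"
    using y by (simp add: star_smult smult_mult_left smult_mult_right ip cn)
  then have 1: "star A (c \<odot> y) \<otimes> (c \<odot> y) = \<one>" unfolding r(1) cc by simp
  have 2: "y = complex_of_real (sqrt r) \<odot> (c \<odot> y)" using y r0 by (simp add: c_def)
  show thesis by (rule that[OF H.scale[OF y(1)] 1 refl 2])
qed

text \<open>The last clause keeps the new vectors inside every subspace that contains the data. This
  minimality later shows that invariant data have an invariant span.\<close>

lemma gram_schmidt_step:
  assumes B: "onset B" and x: "x \<in> H"
  shows "\<exists>B'. onset B' \<and> B \<subseteq> B' \<and> proj B' \<otimes> x = x
    \<and> (\<forall>W. subsp W \<longrightarrow> W \<subseteq> H \<longrightarrow> B \<subseteq> W \<longrightarrow> x \<in> W \<longrightarrow> B' \<subseteq> W)"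
proof (cases "proj B \<otimes> x = x")
  case True
  then show ?thesis using B by blast
next
  case False
  have xc: "x \<in> carrier A" using x by simp
  define y where "y = x \<ominus> proj B \<otimes> x"
  have yH: "y \<in> H" unfolding y_def using B x by (intro H_diff proj_H) auto
  then have yc: "y \<in> carrier A" by simp
  have yx: "y \<oplus> proj B \<otimes> x = x" using xc B by (simp add: y_def minus_eq a_assoc l_neg)
  have "y \<noteq> \<zero>"
  proof
    assume "y = \<zero>"
    then show False using yx False xc B by simp
  qed
  then obtain b c d where b: "b \<in> H" "star A b \<otimes> b = \<one>" "b = c \<odot> y" "y = d \<odot> b"
    by (rule normalize[OF yH])
  have pp: "proj B \<otimes> (proj B \<otimes> x) = proj B \<otimes> x"
    using m_assoc[OF proj_closed[OF B] proj_closed[OF B] xc] proj_subset[OF B subset_refl] by simp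
  have py: "proj B \<otimes> y = \<zero>"
    unfolding y_def using B xc by (simp add: minus_eq r_distr r_minus pp r_neg)
  then have pb: "proj B \<otimes> b = \<zero>" unfolding b(3) using B yc by (simp add: smult_mult_right)
  have bp: "star A b \<otimes> proj B = \<zero>"
    using arg_cong[OF pb, of "star A"] B b(1) by (simp add: star_mult proj_star)
  have orth: "star A a \<otimes> b = \<zero>" if a: "a \<in> B" for a
  proof -
    have "star A a \<otimes> b = star A (proj B \<otimes> a) \<otimes> b" using proj_mem[OF B a] by simp
    also have "\<dots> = star A a \<otimes> (proj B \<otimes> b)"
      using B a b(1) onset_mem by (simp add: star_mult proj_star m_assoc)
    finally show ?thesis using pb B a onset_mem by simp
  qed
  have orth': "star A b \<otimes> a = \<zero>" if a: "a \<in> B" for a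
    using arg_cong[OF orth[OF a], of "star A"] b(1) a B onset_mem by (simp add: star_mult)
  have bB: "b \<notin> B" using orth[of b] b(2) nonzero by auto
  have B': "onset (insert b B)"
    using B b(1,2) orth orth' bB by (auto simp: onset_def orthonormal_def)
  have "proj (insert b B) = b \<otimes> star A b \<oplus> proj B"
    unfolding proj_def using B bB b(1) by (intro finsum_insert) (auto simp: onset_mem)
  then have "proj (insert b B) \<otimes> x = b \<otimes> (star A b \<otimes> (y \<oplus> proj B \<otimes> x)) \<oplus> proj B \<otimes> x"
    using B b(1) xc yx by (simp add: l_distr m_assoc)
  also have "star A b \<otimes> (y \<oplus> proj B \<otimes> x) = star A b \<otimes> y \<oplus> (star A b \<otimes> proj B) \<otimes> x"
    using B b(1) xc yc by (simp add: r_distr m_assoc)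
  also have "star A b \<otimes> y = d \<odot> \<one>"
    using arg_cong[OF b(4), of "\<lambda>z. star A b \<otimes> z"] b(1,2) by (simp add: smult_mult_right)
  also have "d \<odot> \<one> \<oplus> (star A b \<otimes> proj B) \<otimes> x = d \<odot> \<one>" using bp xc by simp
  also have "b \<otimes> (d \<odot> \<one>) = y" using b(1) b(4)[symmetric] by (simp add: smult_mult_right)
  finally have "proj (insert b B) \<otimes> x = x" using yx by simp
  moreover have "insert b B \<subseteq> W" if W: "subsp W" "W \<subseteq> H" "B \<subseteq> W" "x \<in> W" for W
  proof -
    have "proj B \<otimes> x \<in> W" by (rule proj_subsp[OF B W(1,3,4,2)])
    then have "x \<oplus> (-1) \<odot> (proj B \<otimes> x) \<in> W" using W by (simp add: subsp_def)
    then have "y \<in> W" using B xc by (simp add: y_def minus_eq scale_minus1)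
    then show ?thesis using W b(3) by (simp add: subsp_def)
  qed
  ultimately show ?thesis using B' by blast
qed

lemma gram_schmidt:
  assumes B: "onset B" and Z: "finite Z" "Z \<subseteq> H"
  shows "\<exists>B'. onset B' \<and> B \<subseteq> B' \<and> (\<forall>x\<in>Z. proj B' \<otimes> x = x)
    \<and> (\<forall>W. subsp W \<longrightarrow> W \<subseteq> H \<longrightarrow> B \<subseteq> W \<longrightarrow> Z \<subseteq> W \<longrightarrow> B' \<subseteq> W)"
  using Z
proof (induction Z rule: finite_induct)
  case empty then show ?case using B by blast
next
  case (insert x Z)
  then obtain B1 where B1: "onset B1" "B \<subseteq> B1" "\<forall>x\<in>Z. proj B1 \<otimes> x = x"
    "\<forall>W. subsp W \<longrightarrow> W \<subseteq> H \<longrightarrow> B \<subseteq> W \<longrightarrow> Z \<subseteq> W \<longrightarrow> B1 \<subseteq> W" by auto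
  obtain B2 where B2: "onset B2" "B1 \<subseteq> B2" "proj B2 \<otimes> x = x"
    "\<forall>W. subsp W \<longrightarrow> W \<subseteq> H \<longrightarrow> B1 \<subseteq> W \<longrightarrow> x \<in> W \<longrightarrow> B2 \<subseteq> W"
    using gram_schmidt_step[OF B1(1), of x] insert.prems by auto
  have "proj B2 \<otimes> z = z" if "z \<in> Z" for z
    using proj_mono[OF B2(1,2), of z] B1(3) that insert.prems by auto
  then have "\<forall>z\<in>insert x Z. proj B2 \<otimes> z = z" using B2(3) by simp
  moreover have "\<forall>W. subsp W \<longrightarrow> W \<subseteq> H \<longrightarrow> B \<subseteq> W \<longrightarrow> insert x Z \<subseteq> W \<longrightarrow> B2 \<subseteq> W"
    using B1(4) B2(4) by simp
  moreover have "B \<subseteq> B2" using B1(2) B2(2) by simp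
  ultimately show ?case using B2(1) by blast
qed

text \<open>Invariance of the span of \<open>B\<close>, expressed through its projection because the
  basis itself is in general not permuted by the group.\<close>

definition good :: "'a set \<Rightarrow> bool" where "good B \<longleftrightarrow> onset B \<and> fixed (proj B)"

lemma good_empty: "good {}"
  by (simp add: good_def onset_def orthonormal_def proj_def fixed_zero)

text \<open>All translates of \<open>Z\<close> are orthonormalized together. The vectors whose
  translates are absorbed by \<open>proj B'\<close> form a subspace \<open>W\<close> containing the
  data, so minimality of Gram-Schmidt puts \<open>B'\<close> into \<open>W\<close>, and absorption
  makes the projection fixed.\<close>

lemma good_extend:
  assumes B: "good B" and Z: "finite Z" "Z \<subseteq> H"
  shows "\<exists>B'. good B' \<and> B \<subseteq> B' \<and> (\<forall>x\<in>Z. proj B' \<otimes> x = x)"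
proof -
  have B0: "onset B" "fixed (proj B)" using B by (auto simp: good_def)
  define Z' where "Z' = (\<Union>g\<in>carrier G. \<alpha> g ` Z)"
  have Z': "finite Z'" "Z' \<subseteq> H" unfolding Z'_def using Z finite_G H_act by auto
  from gram_schmidt[OF B0(1) Z'] obtain B' where gs: "onset B' \<and> B \<subseteq> B' \<and> (\<forall>x\<in>Z'. proj B' \<otimes> x = x)
    \<and> (\<forall>W. subsp W \<longrightarrow> W \<subseteq> H \<longrightarrow> B \<subseteq> W \<longrightarrow> Z' \<subseteq> W \<longrightarrow> B' \<subseteq> W)" ..
  have B': "onset B'" "B \<subseteq> B'" "\<And>x. x \<in> Z' \<Longrightarrow> proj B' \<otimes> x = x"
    "\<And>W. subsp W \<Longrightarrow> W \<subseteq> H \<Longrightarrow> B \<subseteq> W \<Longrightarrow> Z' \<subseteq> W \<Longrightarrow> B' \<subseteq> W"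
    using gs by simp_all
  define W where "W = {w \<in> H. \<forall>g\<in>carrier G. proj B' \<otimes> \<alpha> g w = \<alpha> g w}"
  have "B' \<subseteq> W"
  proof (rule B'(4))
    show "subsp W"
      unfolding subsp_def W_def using B'(1)
      by (auto simp: H.add H.scale act_add act_smult r_distr smult_mult_right)
    show "W \<subseteq> H" by (auto simp: W_def)
    show "B \<subseteq> W"
    proof
      fix b assume b: "b \<in> B"
      have bH: "b \<in> H" using onset_mem(1)[OF B0(1) b] .
      have "proj B' \<otimes> \<alpha> g b = \<alpha> g b" if g: "g \<in> carrier G" for g
      proof (rule proj_mono[OF B'(1,2)])
        show "\<alpha> g b \<in> carrier A" using g bH by simp
        have "proj B \<otimes> \<alpha> g b = \<alpha> g (proj B \<otimes> b)"
          using g bH B0 fixedD(2)[OF B0(2) g] by (simp add: act_mult)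
        then show "proj B \<otimes> \<alpha> g b = \<alpha> g b" using proj_mem[OF B0(1) b] by simp
      qed
      then show "b \<in> W" using bH by (simp add: W_def)
    qed
    show "Z' \<subseteq> W"
    proof
      fix w assume w: "w \<in> Z'"
      then obtain h x where hx: "h \<in> carrier G" "x \<in> Z" "w = \<alpha> h x" by (auto simp: Z'_def)
      have "\<alpha> g w \<in> Z'" if "g \<in> carrier G" for g
      proof -
        have "\<alpha> g w = \<alpha> (g \<otimes>\<^bsub>G\<^esub> h) x" using that hx Z by (auto simp: act_mult_group)
        then show ?thesis using that hx unfolding Z'_def by blast
      qed
      then show "w \<in> W" using w Z'(2) B'(3) by (auto simp: W_def)
    qed
  qed
  then have inv: "proj B' \<otimes> \<alpha> g b = \<alpha> g b" if "b \<in> B'" "g \<in> carrier G" for b g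
    using that by (auto simp: W_def)
  have "fixed (proj B')"
  proof (rule fixed_of_absorbing[OF proj_closed[OF B'(1)] proj_star[OF B'(1)]])
    fix g assume g: "g \<in> carrier G"
    have e: "\<alpha> g (proj B') = (\<Oplus>b\<in>B'. \<alpha> g b \<otimes> star A (\<alpha> g b))"
      unfolding proj_def using g B'(1)
      by (subst act_finsum[OF g]) (auto simp: onset_mem act_mult act_star intro!: finsum_cong_simp)
    have "proj B' \<otimes> \<alpha> g (proj B') = (\<Oplus>b\<in>B'. proj B' \<otimes> (\<alpha> g b \<otimes> star A (\<alpha> g b)))"
      unfolding e using g B'(1) by (intro mult_finsum) (auto simp: onset_mem)
    also have "\<dots> = (\<Oplus>b\<in>B'. \<alpha> g b \<otimes> star A (\<alpha> g b))"
    proof (rule finsum_cong_simp)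
      fix b assume b: "b \<in> B'"
      then have "proj B' \<otimes> (\<alpha> g b \<otimes> star A (\<alpha> g b)) = (proj B' \<otimes> \<alpha> g b) \<otimes> star A (\<alpha> g b)"
        using g B'(1) by (simp add: m_assoc onset_mem)
      then show "proj B' \<otimes> (\<alpha> g b \<otimes> star A (\<alpha> g b)) = \<alpha> g b \<otimes> star A (\<alpha> g b)" using inv[OF b g] by simp
    qed (use g B'(1) in \<open>simp add: onset_mem\<close>)
    finally show "proj B' \<otimes> \<alpha> g (proj B') = \<alpha> g (proj B')" by (simp add: e)
  qed
  moreover have "proj B' \<otimes> x = x" if "x \<in> Z" for x
  proof -
    have "\<alpha> \<one>\<^bsub>G\<^esub> x = x" using Z that by (auto simp: act_one)
    then have "x \<in> Z'" unfolding Z'_def using that by (metis UN_I G.one_closed image_eqI)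
    then show ?thesis by (rule B'(3))
  qed
  ultimately show ?thesis using B'(1,2) by (auto simp: good_def)
qed

text \<open>Otherwise \<open>proj B\<close> would fix every generator, and each \<open>s j\<close>,
  of norm 1, would be a sum of a fixed finite number of components whose norms tend to 0.\<close>

lemma fresh_unit:
  assumes B: "good B" obtains e where "e \<in> H" "star A e \<otimes> e = \<one>" "proj B \<otimes> e = \<zero>"
proof -
  have B0: "onset B" using B by (simp add: good_def)
  have "\<exists>j. proj B \<otimes> s j \<noteq> s j"
  proof (rule ccontr)
    assume "\<not> ?thesis"
    then have all: "proj B \<otimes> s j = s j" for j by blast
    have le: "1 \<le> (\<Sum>b\<in>B. nrm A (star A (s j) \<otimes> b))" for j
    proof -
      have "(nrm A (s j))\<^sup>2 = 1" using nrm_star_mult[of "s j"] nrm_one[OF nonzero] by (simp add: s_star_s)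
      then have "1 = nrm A (s j)" using nrm_nonneg[of "s j"] by (simp add: power2_eq_1_iff)
      also have "\<dots> = nrm A (\<Oplus>b\<in>B. b \<otimes> (star A b \<otimes> s j))"
        using all[of j] proj_mult[OF B0, of "s j"] by simp
      also have "\<dots> \<le> (\<Sum>b\<in>B. nrm A (b \<otimes> (star A b \<otimes> s j)))"
        using B0 by (intro nrm_finsum_le) (auto simp: onset_mem)
      also have "\<dots> \<le> (\<Sum>b\<in>B. nrm A (star A (s j) \<otimes> b))"
      proof (rule sum_mono)
        fix b assume b: "b \<in> B"
        then have bc: "b \<in> carrier A" "star A b \<otimes> b = \<one>" using B0 by (auto simp: onset_mem onset_star)
        have "nrm A (b \<otimes> (star A b \<otimes> s j)) \<le> 1 * nrm A (star A b \<otimes> s j)"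
          by (rule order_trans[OF nrm_mult mult_right_mono])
            (use bc nrm_isometry[of b] in \<open>auto simp: nrm_nonneg\<close>)
        also have "nrm A (star A b \<otimes> s j) = nrm A (star A (s j) \<otimes> b)"
          using nrm_star[of "star A (s j) \<otimes> b"] bc by (simp add: star_mult)
        finally show "nrm A (b \<otimes> (star A b \<otimes> s j)) \<le> nrm A (star A (s j) \<otimes> b)" by simp
      qed
      finally show ?thesis .
    qed
    have "(\<lambda>j. \<Sum>b\<in>B. nrm A (star A (s j) \<otimes> b)) \<longlonglongrightarrow> (\<Sum>b\<in>B. 0)"
      using B0 by (intro tendsto_sum s_vanish) (auto simp: onset_mem)
    then have "1 \<le> (\<Sum>b\<in>B. (0::real))" by (rule LIMSEQ_le_const) (use le in blast)
    then show False by simp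
  qed
  then obtain j where j: "proj B \<otimes> s j \<noteq> s j" by blast
  define y where "y = s j \<ominus> proj B \<otimes> s j"
  have yH: "y \<in> H" unfolding y_def using B0 s_mem_H by (intro H_diff proj_H) auto
  have "y \<noteq> \<zero>" using j B0 by (auto simp: y_def)
  then obtain e c d where e: "e \<in> H" "star A e \<otimes> e = \<one>" "e = c \<odot> y" by (rule normalize[OF yH])
  have pp: "proj B \<otimes> (proj B \<otimes> s j) = proj B \<otimes> s j"
    using m_assoc[OF proj_closed[OF B0] proj_closed[OF B0] s_closed[of j]] proj_subset[OF B0 subset_refl] by simp
  have "proj B \<otimes> y = \<zero>"
    unfolding y_def using B0 by (simp add: minus_eq r_distr r_minus pp r_neg)
  then have "proj B \<otimes> e = \<zero>" unfolding e(3) using B0 yH by (simp add: smult_mult_right)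
  then show thesis by (rule that[OF e(1,2)])
qed

text \<open>Each new block absorbs the next generator, which exhausts \<open>H\<close>, and the
  previous unit vector \<open>e k\<close>, which makes \<open>e (Suc k)\<close> orthogonal to all
  translates of \<open>e k\<close>. These vectors are the room reserved outside the blocks.\<close>

lemma blocks:
  obtains B e where "\<And>k. good (B k)" "\<And>k. B k \<subseteq> B (Suc k)" "B 0 = {}"
    "\<And>k. e k \<in> H" "\<And>k. star A (e k) \<otimes> e k = \<one>" "\<And>k. proj (B k) \<otimes> e k = \<zero>"
    "\<And>k. proj (B (Suc k)) \<otimes> e k = e k" "\<And>k. proj (B (Suc k)) \<otimes> s k = s k"
proof -
  let ?P = "\<lambda>k (p :: 'a set \<times> 'a). good (fst p) \<and> snd p \<in> H \<and> star A (snd p) \<otimes> snd p = \<one>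
    \<and> proj (fst p) \<otimes> snd p = \<zero> \<and> (k = 0 \<longrightarrow> fst p = {})"
  let ?R = "\<lambda>k (p :: 'a set \<times> 'a) (q :: 'a set \<times> 'a). fst p \<subseteq> fst q \<and> proj (fst q) \<otimes> snd p = snd p \<and> proj (fst q) \<otimes> s k = s k"
  have "\<exists>f. \<forall>k. ?P k (f k) \<and> ?R k (f k) (f (Suc k))"
  proof (rule dependent_nat_choice)
    obtain e where "e \<in> H" "star A e \<otimes> e = \<one>" "proj {} \<otimes> e = \<zero>" by (rule fresh_unit[OF good_empty])
    then show "\<exists>p. ?P 0 p" using good_empty by (intro exI[of _ "({}, e)"]) simp
  next
    fix p :: "'a set \<times> 'a" and k :: nat assume p: "?P k p"
    obtain B' where B': "good B'" "fst p \<subseteq> B'" "\<forall>x\<in>{s k, snd p}. proj B' \<otimes> x = x"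
      using good_extend[of "fst p" "{s k, snd p}"] p s_mem_H by auto
    obtain e where "e \<in> H" "star A e \<otimes> e = \<one>" "proj B' \<otimes> e = \<zero>" by (rule fresh_unit[OF B'(1)])
    then show "\<exists>q. ?P (Suc k) q \<and> ?R k p q" using B' by (intro exI[of _ "(B', e)"]) simp
  qed
  then obtain f where f: "\<And>k. ?P k (f k)" "\<And>k. ?R k (f k) (f (Suc k))" by blast
  show thesis
    by (rule that[of "\<lambda>k. fst (f k)" "\<lambda>k. snd (f k)"]) (use f in simp_all)
qed

text \<open>Translates are absorbed together with their generator because the projections are fixed,
  and sums because the blocks increase.\<close>

lemma H_exhausted:
  assumes B: "\<And>k. good (B k)" "\<And>k. B k \<subseteq> B (Suc k)" "\<And>k. proj (B (Suc k)) \<otimes> s k = s k"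
    and x: "x \<in> H"
  shows "\<exists>k. proj (B k) \<otimes> x = x"
  using x
proof (induction rule: H.induct)
  case (gen g k)
  have "fixed (proj (B (Suc k)))" "onset (B (Suc k))" using B(1)[of "Suc k"] by (auto simp: good_def)
  then have "proj (B (Suc k)) \<otimes> \<alpha> g (s k) = \<alpha> g (proj (B (Suc k)) \<otimes> s k)"
    using gen fixedD(2)[OF _ gen] by (simp add: act_mult)
  then show ?case using B(3)[of k] by auto
next
  case (add x y)
  then obtain k l where kl: "proj (B k) \<otimes> x = x" "proj (B l) \<otimes> y = y" by blast
  have mono: "B i \<subseteq> B j" if "i \<le> j" for i j using lift_Suc_mono_le[of B, OF B(2) that] .
  have on: "onset (B (max k l))" using B(1) by (simp add: good_def)
  have "proj (B (max k l)) \<otimes> x = x" "proj (B (max k l)) \<otimes> y = y"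
    using proj_mono[OF on mono[of k "max k l"], of x] proj_mono[OF on mono[of l "max k l"], of y]
      kl add.hyps by simp_all
  then have "proj (B (max k l)) \<otimes> (x \<oplus> y) = x \<oplus> y" using on add.hyps by (simp add: r_distr)
  then show ?case by blast
next
  case (scale x c)
  then obtain k where "proj (B k) \<otimes> x = x" by blast
  moreover have "onset (B k)" using B(1) by (simp add: good_def)
  ultimately have "proj (B k) \<otimes> (c \<odot> x) = c \<odot> x" using scale.hyps by (simp add: smult_mult_right)
  then show ?case by blast
qed

end

context cuntz_action
begin

subsection \<open>A vector with orthogonal translates\<close>

text \<open>Automorphisms instead of group elements: the action may have a kernel, whose elements
  cannot produce orthogonal translates.\<close>

definition \<Gamma> :: "('a \<Rightarrow> 'a) set" where "\<Gamma> = \<alpha> ` carrier G"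

definition tr :: "'g \<Rightarrow> ('a \<Rightarrow> 'a) \<Rightarrow> 'a \<Rightarrow> 'a" where "tr g \<gamma> = compose (carrier A) (\<alpha> g) \<gamma>"

lemma tr_act: "\<lbrakk>g \<in> carrier G; h \<in> carrier G\<rbrakk> \<Longrightarrow> tr g (\<alpha> h) = \<alpha> (g \<otimes>\<^bsub>G\<^esub> h)"
  using action act_Bij by (simp add: tr_def hom_def cstar_Aut_def BijGroup_def)

lemma finite_\<Gamma>: "finite \<Gamma>" using finite_G by (simp add: \<Gamma>_def)

lemma \<Gamma>_one: "\<alpha> \<one>\<^bsub>G\<^esub> \<in> \<Gamma>" by (simp add: \<Gamma>_def)

lemma \<Gamma>_closed [simp]: "\<gamma> \<in> \<Gamma> \<Longrightarrow> x \<in> carrier A \<Longrightarrow> \<gamma> x \<in> carrier A"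
  by (auto simp: \<Gamma>_def)

lemma tr_mem: "g \<in> carrier G \<Longrightarrow> \<gamma> \<in> \<Gamma> \<Longrightarrow> tr g \<gamma> \<in> \<Gamma>"
  by (auto simp: \<Gamma>_def tr_act)

lemma tr_mult: "\<lbrakk>g \<in> carrier G; h \<in> carrier G; \<gamma> \<in> \<Gamma>\<rbrakk> \<Longrightarrow> tr (g \<otimes>\<^bsub>G\<^esub> h) \<gamma> = tr g (tr h \<gamma>)"
  by (auto simp: \<Gamma>_def tr_act G.m_assoc)

lemma tr_one: "\<gamma> \<in> \<Gamma> \<Longrightarrow> tr \<one>\<^bsub>G\<^esub> \<gamma> = \<gamma>"
  by (auto simp: \<Gamma>_def tr_act)

lemma tr_apply: "\<lbrakk>\<gamma> \<in> \<Gamma>; x \<in> carrier A\<rbrakk> \<Longrightarrow> \<alpha> g (\<gamma> x) = tr g \<gamma> x"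
  by (simp add: tr_def compose_def)

lemma tr_bij: assumes g: "g \<in> carrier G" shows "bij_betw (tr g) \<Gamma> \<Gamma>"
proof (rule bij_betw_byWitness[where f' = "tr (inv\<^bsub>G\<^esub> g)"])
  show "\<forall>\<gamma>\<in>\<Gamma>. tr (inv\<^bsub>G\<^esub> g) (tr g \<gamma>) = \<gamma>" "\<forall>\<gamma>\<in>\<Gamma>. tr g (tr (inv\<^bsub>G\<^esub> g) \<gamma>) = \<gamma>"
    using g by (simp_all add: tr_one flip: tr_mult)
qed (use g tr_mem in auto)

lemma act_eq_iff:
  assumes "g \<in> carrier G" "h \<in> carrier G"
  shows "\<alpha> g = \<alpha> h \<longleftrightarrow> \<alpha> (inv\<^bsub>G\<^esub> g \<otimes>\<^bsub>G\<^esub> h) = \<alpha> \<one>\<^bsub>G\<^esub>"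
proof
  assume "\<alpha> g = \<alpha> h"
  then have "tr (inv\<^bsub>G\<^esub> g) (\<alpha> h) = tr (inv\<^bsub>G\<^esub> g) (\<alpha> g)" by simp
  then show "\<alpha> (inv\<^bsub>G\<^esub> g \<otimes>\<^bsub>G\<^esub> h) = \<alpha> \<one>\<^bsub>G\<^esub>" using assms by (simp add: tr_act)
next
  assume "\<alpha> (inv\<^bsub>G\<^esub> g \<otimes>\<^bsub>G\<^esub> h) = \<alpha> \<one>\<^bsub>G\<^esub>"
  then have "tr g (\<alpha> (inv\<^bsub>G\<^esub> g \<otimes>\<^bsub>G\<^esub> h)) = tr g (\<alpha> \<one>\<^bsub>G\<^esub>)" by simp
  then have "\<alpha> (g \<otimes>\<^bsub>G\<^esub> (inv\<^bsub>G\<^esub> g \<otimes>\<^bsub>G\<^esub> h)) = \<alpha> g" using assms by (simp add: tr_act)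
  moreover have "g \<otimes>\<^bsub>G\<^esub> (inv\<^bsub>G\<^esub> g \<otimes>\<^bsub>G\<^esub> h) = h" using assms by (simp flip: G.m_assoc)
  ultimately show "\<alpha> g = \<alpha> h" by simp
qed

definition homog :: "'a \<Rightarrow> bool" where
  "homog u \<longleftrightarrow> u \<in> carrier A \<and> star A u \<otimes> u = \<one> \<and> (\<forall>h\<in>carrier G. \<exists>c. star A u \<otimes> \<alpha> h u = c \<odot> \<one>)"

text \<open>The overlap of the product is \<open>star A v \<otimes> (star A u \<otimes> \<alpha> h
  u) \<otimes> \<alpha> h v\<close>, from which the inner scalar can be pulled out. So overlaps
  multiply, and products of homogeneous isometries can combine the smallness of both
  factors.\<close>

lemma homog_mult:
  assumes u: "homog u" and v: "homog v"
  shows "homog (u \<otimes> v)"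
    and "h \<in> carrier G \<Longrightarrow> nrm A (star A (u \<otimes> v) \<otimes> \<alpha> h (u \<otimes> v)) \<le> nrm A (star A u \<otimes> \<alpha> h u) * nrm A (star A v \<otimes> \<alpha> h v)"
proof -
  have c: "u \<in> carrier A" "v \<in> carrier A" and uu: "star A u \<otimes> u = \<one>" "star A v \<otimes> v = \<one>"
    using u v by (auto simp: homog_def)
  have e: "\<exists>c d. star A u \<otimes> \<alpha> h u = c \<odot> \<one> \<and> star A v \<otimes> \<alpha> h v = d \<odot> \<one>
      \<and> star A (u \<otimes> v) \<otimes> \<alpha> h (u \<otimes> v) = (c * d) \<odot> \<one>" if h: "h \<in> carrier G" for h
  proof -
    obtain c where c1: "star A u \<otimes> \<alpha> h u = c \<odot> \<one>" using u h unfolding homog_def by blast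
    obtain d where d1: "star A v \<otimes> \<alpha> h v = d \<odot> \<one>" using v h unfolding homog_def by blast
    note cd = c1 d1
    have "star A (u \<otimes> v) \<otimes> \<alpha> h (u \<otimes> v) = star A v \<otimes> (star A u \<otimes> \<alpha> h u) \<otimes> \<alpha> h v"
      using c h by (simp add: star_mult act_mult m_assoc)
    also have "\<dots> = (c * d) \<odot> \<one>"
      unfolding cd(1) using c h by (simp add: smult_mult_left smult_mult_right cd(2))
    finally show ?thesis using cd by blast
  qed
  have "star A (u \<otimes> v) \<otimes> (u \<otimes> v) = star A v \<otimes> (star A u \<otimes> u) \<otimes> v"
    using c by (simp add: star_mult m_assoc)
  then have "star A (u \<otimes> v) \<otimes> (u \<otimes> v) = \<one>" using c uu by simp
  then show "homog (u \<otimes> v)" using c e unfolding homog_def by blast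
  show "nrm A (star A (u \<otimes> v) \<otimes> \<alpha> h (u \<otimes> v)) \<le> nrm A (star A u \<otimes> \<alpha> h u) * nrm A (star A v \<otimes> \<alpha> h v)"
    if h: "h \<in> carrier G"
  proof -
    obtain c d where cd: "star A u \<otimes> \<alpha> h u = c \<odot> \<one>" "star A v \<otimes> \<alpha> h v = d \<odot> \<one>"
      "star A (u \<otimes> v) \<otimes> \<alpha> h (u \<otimes> v) = (c * d) \<odot> \<one>" using e[OF h] by blast
    show ?thesis unfolding cd using nrm_one[OF nonzero] by (simp add: nrm_smult norm_mult)
  qed
qed

lemma homog_nrm: assumes "homog u" "h \<in> carrier G" shows "nrm A (star A u \<otimes> \<alpha> h u) \<le> 1"
proof -
  have u: "u \<in> carrier A" "nrm A u \<le> 1" using assms(1) nrm_isometry by (auto simp: homog_def)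
  have "nrm A (star A u \<otimes> \<alpha> h u) \<le> nrm A (star A u) * nrm A (\<alpha> h u)"
    using u assms(2) by (intro nrm_mult) auto
  also have "\<dots> \<le> 1 * 1"
    using u assms(2) act_contractive[OF assms(2) u(1)] by (intro mult_mono) (auto simp: nrm_star nrm_nonneg)
  finally show ?thesis by simp
qed

lemma ip_unit: assumes x: "x \<in> H" "star A x \<otimes> x = \<one>" shows "ip x x = 1"
proof -
  have "ip x x \<odot> \<one> = 1 \<odot> \<one>" unfolding ip[OF x(1) x(1), symmetric] x(2) by simp
  then show ?thesis by (rule smult_one_inj[OF nonzero, THEN iffD1])
qed

lemma ip_act_bound: "\<lbrakk>x \<in> H; star A x \<otimes> x = \<one>; h \<in> carrier G\<rbrakk> \<Longrightarrow> cmod (ip x (\<alpha> h x)) \<le> 1"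
  using homog_nrm[of x h] ip[OF _ H_act] nrm_one[OF nonzero]
  by (auto simp: homog_def nrm_smult)

text \<open>The sum \<open>U\<^sub>M = \<Sum>i<M. x\<^sup>i \<eta>\<close> has orthogonal terms, so its overlap with its translate is a geometric
  series in the overlap of \<open>x\<close> with its translate; the latter is not 1 if \<open>x\<close> moves.\<close>

lemma almost_orthogonal_translate:
  assumes g: "g \<in> carrier G" "\<alpha> g \<noteq> \<alpha> \<one>\<^bsub>G\<^esub>" and e: "e > 0"
  shows "\<exists>u. homog u \<and> nrm A (star A u \<otimes> \<alpha> g u) \<le> e"
proof -
  have gen: "generates_cstar A (range s)" using cuntz by (simp add: Cuntz_infinity_def)
  have "\<exists>j. \<alpha> g (s j) \<noteq> s j"
  proof (rule ccontr)
    assume "\<not> ?thesis"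
    then have eq: "\<alpha> g x = \<alpha> \<one>\<^bsub>G\<^esub> x" if "x \<in> range s" for x using that by (auto simp: act_one)
    have "\<alpha> g x = \<alpha> \<one>\<^bsub>G\<^esub> x" if "x \<in> carrier A" for x
      by (rule unital_cstar_hom.eq_of_generators[OF act_hom[OF g(1)] act_hom[OF G.one_closed] gen eq that])
    moreover have "\<alpha> g \<in> extensional (carrier A)" "\<alpha> \<one>\<^bsub>G\<^esub> \<in> extensional (carrier A)"
      using act_Bij[OF g(1)] act_Bij[OF G.one_closed] by (auto simp: Bij_def)
    ultimately have "\<alpha> g = \<alpha> \<one>\<^bsub>G\<^esub>" by (intro extensionalityI[of _ "carrier A"]) auto
    then show False using g(2) by simp
  qed
  then obtain j where j: "\<alpha> g (s j) \<noteq> s j" by blast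
  define x where "x = s j"
  have x: "x \<in> H" "star A x \<otimes> x = \<one>" by (simp_all add: x_def s_mem_H s_star_s)
  \<comment> \<open>The vector \<open>\<eta>\<close> chosen next is orthogonal to an invariant block
    containing \<open>x\<close>, hence so are its translates; this kills the mixed terms of the
    recursion.\<close>
  obtain B where B: "good B" "proj B \<otimes> x = x" using good_extend[OF good_empty, of "{x}"] x by auto
  obtain \<eta> where \<eta>: "\<eta> \<in> H" "star A \<eta> \<otimes> \<eta> = \<one>" "proj B \<otimes> \<eta> = \<zero>" by (rule fresh_unit[OF B(1)])
  have Bc: "proj B \<in> carrier A" "star A (proj B) = proj B" "\<And>h. h \<in> carrier G \<Longrightarrow> \<alpha> h (proj B) = proj B"
    using B(1) proj_star fixedD by (auto simp: good_def)
  have x\<eta>: "star A x \<otimes> \<alpha> h \<eta> = \<zero>" if h: "h \<in> carrier G" for h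
  proof -
    have "star A x \<otimes> \<alpha> h \<eta> = star A (proj B \<otimes> x) \<otimes> \<alpha> h \<eta>" using B by simp
    also have "\<dots> = star A x \<otimes> \<alpha> h (proj B \<otimes> \<eta>)"
      using x(1) \<eta>(1) h Bc by (simp add: star_mult act_mult m_assoc)
    finally show ?thesis using \<eta> x h by simp
  qed
  have \<eta>x: "star A \<eta> \<otimes> \<alpha> h x = \<zero>" if h: "h \<in> carrier G" for h
  proof -
    have "star A \<eta> \<otimes> \<alpha> h x = \<alpha> h (star A (\<alpha> (inv\<^bsub>G\<^esub> h) \<eta>) \<otimes> x)"
      using x(1) \<eta>(1) h by (simp add: act_mult act_star act_inv')
    also have "star A (\<alpha> (inv\<^bsub>G\<^esub> h) \<eta>) \<otimes> x = star A (star A x \<otimes> \<alpha> (inv\<^bsub>G\<^esub> h) \<eta>)"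
      using x(1) \<eta>(1) h by (simp add: star_mult)
    also have "\<dots> = \<zero>" using x\<eta>[of "inv\<^bsub>G\<^esub> h"] h by simp
    finally show ?thesis using h by simp
  qed
  define U where "U = rec_nat \<zero> (\<lambda>(M::nat) u. \<eta> \<oplus> x \<otimes> u)"
  have U: "U 0 = \<zero>" "U (Suc M) = \<eta> \<oplus> x \<otimes> U M" for M by (simp_all add: U_def)
  have Uc: "U M \<in> carrier A" for M using x(1) \<eta>(1) by (induction M) (simp_all add: U)
  \<comment> \<open>\<open>f h M\<close> is the scalar overlap of \<open>U M\<close> with its
    translate under \<open>h\<close>. For the unit of the group it equals \<open>M\<close>, so
    \<open>U M\<close> divided by \<open>sqrt M\<close> is an isometry.\<close>
  define f where "f h = rec_nat 0 (\<lambda>(M::nat) z. ip \<eta> (\<alpha> h \<eta>) + ip x (\<alpha> h x) * z)" for h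
  have f: "f h 0 = 0" "f h (Suc M) = ip \<eta> (\<alpha> h \<eta>) + ip x (\<alpha> h x) * f h M" for h M by (simp_all add: f_def)
  have Uf: "star A (U M) \<otimes> \<alpha> h (U M) = f h M \<odot> \<one>" if h: "h \<in> carrier G" for h M
  proof (induction M)
    case (Suc M)
    note c = x(1)[THEN H_carrier] \<eta>(1)[THEN H_carrier] Uc[of M]
    have 1: "star A \<eta> \<otimes> (\<alpha> h x \<otimes> \<alpha> h (U M)) = \<zero>"
      using \<eta>x[OF h] c h by (simp flip: m_assoc)
    have 2: "star A x \<otimes> (\<alpha> h x \<otimes> \<alpha> h (U M)) = ip x (\<alpha> h x) \<odot> \<alpha> h (U M)"
      using ip[OF x(1) H_act[OF h x(1)]] c h by (simp add: smult_mult_left flip: m_assoc)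
    have "star A (U (Suc M)) \<otimes> \<alpha> h (U (Suc M))
      = (star A \<eta> \<otimes> \<alpha> h \<eta> \<oplus> star A \<eta> \<otimes> (\<alpha> h x \<otimes> \<alpha> h (U M)))
        \<oplus> (star A (U M) \<otimes> (star A x \<otimes> \<alpha> h \<eta>) \<oplus> star A (U M) \<otimes> (star A x \<otimes> (\<alpha> h x \<otimes> \<alpha> h (U M))))"
      using c h by (simp add: U star_add star_mult act_add act_mult l_distr r_distr m_assoc a_ac)
    also have "\<dots> = ip \<eta> (\<alpha> h \<eta>) \<odot> \<one> \<oplus> (ip x (\<alpha> h x) * f h M) \<odot> \<one>"
      unfolding 1 2 x\<eta>[OF h] using c h by (simp add: smult_mult_right Suc.IH ip[OF \<eta>(1) H_act[OF h \<eta>(1)]])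
    finally show ?case by (simp add: f smult_add_left)
  qed (use h in \<open>simp add: U f\<close>)
  have ip1: "ip y (\<alpha> \<one>\<^bsub>G\<^esub> y) = 1" if "y \<in> H" "star A y \<otimes> y = \<one>" for y
    using ip[OF that(1) that(1)] that smult_one_inj[OF nonzero, of "ip y y" 1] by (simp add: act_one)
  have f1: "f \<one>\<^bsub>G\<^esub> M = of_nat M" for M
    by (induction M) (simp_all add: f ip1 x \<eta>)
  define l where "l = ip x (\<alpha> g x)"
  define m where "m = ip \<eta> (\<alpha> g \<eta>)"
  have lm: "cmod l \<le> 1" "cmod m \<le> 1"
    unfolding l_def m_def using ip_act_bound x \<eta> g(1) by auto
  \<comment> \<open>Overlap 1 of two isometries forces them to be equal, but \<open>x\<close> was
    chosen to be moved by \<open>g\<close>.\<close>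
  have l1: "l \<noteq> 1"
  proof
    assume "l = 1"
    then have 1: "star A x \<otimes> \<alpha> g x = \<one>" using ip[OF x(1) H_act[OF g(1) x(1)]] by (simp add: l_def)
    note c = x(1)[THEN H_carrier]
    have 2: "star A (\<alpha> g x) \<otimes> x = \<one>" using arg_cong[OF 1, of "star A"] c g by (simp add: star_mult)
    have 3: "star A (\<alpha> g x) \<otimes> \<alpha> g x = \<one>" using arg_cong[OF x(2), of "\<alpha> g"] c g by (simp add: act_mult act_star)
    have "star A (\<alpha> g x \<ominus> x) \<otimes> (\<alpha> g x \<ominus> x)
        = (star A (\<alpha> g x) \<otimes> \<alpha> g x \<ominus> star A (\<alpha> g x) \<otimes> x) \<ominus> (star A x \<otimes> \<alpha> g x \<ominus> star A x \<otimes> x)"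
      using c g by (simp add: star_add star_minus ring_nf)
    also have "\<dots> = \<zero>" unfolding 1 2 3 x(2) by (simp add: minus_eq r_neg)
    finally have 4: "star A (\<alpha> g x \<ominus> x) \<otimes> (\<alpha> g x \<ominus> x) = \<zero>" .
    have "\<alpha> g x \<ominus> x = \<zero>" by (rule eq_zero_of_star_mult[OF _ 4]) (use c g in simp)
    then have "\<alpha> g x = x" using c g by simp
    then show False using j by (simp add: x_def)
  qed
  have fg: "f g M * (1 - l) = m * (1 - l ^ M)" for M
  proof (induction M)
    case (Suc M)
    have "f g (Suc M) * (1 - l) = m * (1 - l) + l * (f g M * (1 - l))"
      by (simp add: f algebra_simps flip: l_def m_def)
    also have "\<dots> = m * (1 - l ^ Suc M)" unfolding Suc.IH by (simp add: algebra_simps)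
    finally show ?case .
  qed (simp add: f)
  \<comment> \<open>The bound does not depend on \<open>M\<close>, whereas the normalization divides
    the overlap by \<open>M\<close>.\<close>
  have fb: "cmod (f g M) \<le> 2 / cmod (1 - l)" for M
  proof -
    have "cmod (f g M) * cmod (1 - l) = cmod m * cmod (1 - l ^ M)"
      using arg_cong[OF fg[of M], of cmod] by (simp add: norm_mult)
    also have "\<dots> \<le> 1 * (1 + 1)"
    proof (rule mult_mono)
      have "cmod (l ^ M) \<le> 1" using lm by (simp add: norm_power power_le_one)
      then show "cmod (1 - l ^ M) \<le> 1 + 1" using norm_triangle_ineq4[of 1 "l ^ M"] by simp
    qed (use lm in auto)
    finally show ?thesis using l1 by (simp add: pos_le_divide_eq)
  qed
  obtain M :: nat where M: "M > 2 / cmod (1 - l) / e" using reals_Archimedean2[of "2 / cmod (1 - l) / e"] ..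
  have "2 / cmod (1 - l) / e > 0" using l1 e by simp
  then have M0: "M > 0" using M by (cases M) auto
  define c where "c = complex_of_real (1 / sqrt M)"
  define u where "u = c \<odot> U M"
  have cc: "cnj c * c = 1 / of_nat M"
  proof -
    have cn: "cnj c = c" by (simp add: c_def)
    have "1 / sqrt M * (1 / sqrt M) = 1 / (sqrt M * sqrt M)" by (simp only: times_divide_times_eq mult_1_left)
    also have "sqrt (real M) * sqrt (real M) = real M" by (simp only: real_sqrt_mult_self abs_of_nat)
    finally have r: "1 / sqrt M * (1 / sqrt M) = 1 / M" .
    show ?thesis
      unfolding cn unfolding c_def of_real_mult[symmetric] r
      by (simp only: of_real_divide of_real_1 of_real_of_nat_eq)
  qed
  have uu: "star A u \<otimes> \<alpha> h u = (f h M / of_nat M) \<odot> \<one>" if h: "h \<in> carrier G" for h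
  proof -
    have "star A u \<otimes> \<alpha> h u = (cnj c * c) \<odot> (star A (U M) \<otimes> \<alpha> h (U M))"
      unfolding u_def using Uc h by (simp add: star_smult act_smult smult_mult_left smult_mult_right mult.commute)
    then show ?thesis by (simp add: Uf[OF h] cc)
  qed
  have "u \<in> carrier A" using Uc by (simp add: u_def)
  moreover have "star A u \<otimes> u = \<one>"
    using uu[OF G.one_closed] M0 Uc by (simp add: f1 act_one u_def)
  ultimately have "homog u" using uu unfolding homog_def by blast
  moreover have "nrm A (star A u \<otimes> \<alpha> g u) \<le> e"
  proof -
    have "nrm A (star A u \<otimes> \<alpha> g u) = cmod (f g M) / M"
      unfolding uu[OF g(1)] using nrm_one[OF nonzero] by (simp add: nrm_smult norm_divide)
    also have "\<dots> \<le> 2 / cmod (1 - l) / M" using fb by (intro divide_right_mono) auto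
    also have "\<dots> \<le> e"
    proof -
      have "2 / cmod (1 - l) < real M * e" by (rule pos_divide_less_eq[OF e, THEN iffD1, OF M])
      then have "2 / cmod (1 - l) \<le> e * real M" by (simp only: mult.commute less_imp_le)
      moreover have "0 < real M" using M0 by simp
      ultimately show ?thesis by (simp only: pos_divide_le_eq)
    qed
    finally show ?thesis .
  qed
  ultimately show ?thesis by blast
qed

text \<open>The isometries for the individual group elements are multiplied. Overlaps never exceed
  1, so no factor spoils what the others achieve.\<close>

lemma almost_regular:
  assumes T: "finite T" "T \<subseteq> {g \<in> carrier G. \<alpha> g \<noteq> \<alpha> \<one>\<^bsub>G\<^esub>}" and e: "e > 0"
  shows "\<exists>v. homog v \<and> (\<forall>g\<in>T. nrm A (star A v \<otimes> \<alpha> g v) \<le> e)"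
  using T
proof (induction T rule: finite_induct)
  case empty
  have "star A \<one> \<otimes> \<alpha> h \<one> = 1 \<odot> \<one>" if "h \<in> carrier G" for h using that by simp
  then have "homog \<one>" unfolding homog_def by (metis one_closed star_one r_one)
  then show ?case by blast
next
  case (insert g T)
  then obtain v where v: "homog v" "\<forall>g\<in>T. nrm A (star A v \<otimes> \<alpha> g v) \<le> e" by auto
  have g: "g \<in> carrier G" "\<alpha> g \<noteq> \<alpha> \<one>\<^bsub>G\<^esub>" using insert.prems by auto
  obtain u where u: "homog u" "nrm A (star A u \<otimes> \<alpha> g u) \<le> e"
    using almost_orthogonal_translate[OF g e] by blast
  have "nrm A (star A (u \<otimes> v) \<otimes> \<alpha> h (u \<otimes> v)) \<le> e" if h: "h \<in> insert g T" for h
  proof -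
    have hG: "h \<in> carrier G" using h insert.prems by auto
    have nn: "0 \<le> nrm A (star A u \<otimes> \<alpha> h u)" "0 \<le> nrm A (star A v \<otimes> \<alpha> h v)"
      using u v hG by (auto simp: homog_def nrm_nonneg)
    have "nrm A (star A u \<otimes> \<alpha> h u) * nrm A (star A v \<otimes> \<alpha> h v) \<le> e"
    proof (cases "h = g")
      case True
      then show ?thesis using mult_mono[OF u(2) homog_nrm[OF v(1) hG]] nn e by simp
    next
      case False
      then have "nrm A (star A v \<otimes> \<alpha> h v) \<le> e" using v(2) h by auto
      then show ?thesis using mult_mono[OF homog_nrm[OF u(1) hG]] nn e by fastforce
    qed
    then show ?thesis using homog_mult(2)[OF u(1) v(1) hG] by linarith
  qed
  then show ?case using homog_mult(1)[OF u(1) v(1)] by blast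
qed

text \<open>The translates of an almost regular isometry form an almost orthonormal family permuted
  by the group. After the equivariant correction, its member at the identity has exactly orthogonal
  translates.\<close>

lemma regular_exists:
  "\<exists>v\<in>carrier A. \<forall>g\<in>carrier G. star A v \<otimes> \<alpha> g v = (if \<alpha> g = \<alpha> \<one>\<^bsub>G\<^esub> then \<one> else \<zero>)"
proof -
  define e :: real where "e = 1 / (2 * real (card \<Gamma>) + 1)"
  have e: "e > 0" "card \<Gamma> * e \<le> 1/2" by (auto simp: e_def field_simps)
  define T where "T = {g \<in> carrier G. \<alpha> g \<noteq> \<alpha> \<one>\<^bsub>G\<^esub>}"
  have "finite T" using finite_G by (simp add: T_def)
  then obtain v where v: "homog v" "\<forall>g\<in>T. nrm A (star A v \<otimes> \<alpha> g v) \<le> e"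
    using almost_regular[of T e] e(1) unfolding T_def by blast
  have vc: "v \<in> carrier A" "star A v \<otimes> v = \<one>" using v(1) by (auto simp: homog_def)
  have small: "nrm A (defect (\<lambda>\<gamma>. \<gamma> v) \<gamma> \<delta>) \<le> e" if \<gamma>: "\<gamma> \<in> \<Gamma>" and \<delta>: "\<delta> \<in> \<Gamma>" for \<gamma> \<delta>
  proof -
    obtain g h where gh: "g \<in> carrier G" "h \<in> carrier G" "\<gamma> = \<alpha> g" "\<delta> = \<alpha> h"
      using \<gamma> \<delta> by (auto simp: \<Gamma>_def)
    let ?k = "inv\<^bsub>G\<^esub> g \<otimes>\<^bsub>G\<^esub> h"
    have k: "?k \<in> carrier G" using gh by simp
    have "g \<otimes>\<^bsub>G\<^esub> ?k = h" using gh by (simp flip: G.m_assoc)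
    then have hk: "\<alpha> h v = \<alpha> g (\<alpha> ?k v)" using act_mult_group[OF gh(1) k vc(1)] by simp
    have eq: "star A (\<gamma> v) \<otimes> \<delta> v = \<alpha> g (star A v \<otimes> \<alpha> ?k v)"
      unfolding gh(3,4) hk using gh k vc by (simp add: act_mult act_star)
    show ?thesis
    proof (cases "\<gamma> = \<delta>")
      case True
      have "star A (\<gamma> v) \<otimes> \<delta> v = \<one>"
        using arg_cong[OF vc(2), of "\<alpha> g"] vc(1) gh True by (simp add: act_mult act_star)
      then show ?thesis using True e by (simp add: defect_def minus_eq r_neg)
    next
      case False
      then have "\<alpha> ?k \<noteq> \<alpha> \<one>\<^bsub>G\<^esub>" using act_eq_iff[OF gh(1,2)] gh by simp
      then have le: "nrm A (star A v \<otimes> \<alpha> ?k v) \<le> e" using v(2) k by (simp add: T_def)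
      have cl: "star A v \<otimes> \<alpha> ?k v \<in> carrier A" using vc k by simp
      have "defect (\<lambda>\<gamma>. \<gamma> v) \<gamma> \<delta> = \<ominus> \<alpha> g (star A v \<otimes> \<alpha> ?k v)"
        unfolding defect_def eq using False gh cl by (simp add: minus_eq)
      then have "nrm A (defect (\<lambda>\<gamma>. \<gamma> v) \<gamma> \<delta>) = nrm A (\<alpha> g (star A v \<otimes> \<alpha> ?k v))" using gh cl by simp
      then show ?thesis using act_contractive[OF gh(1) cl] le by simp
    qed
  qed
  have "\<exists>r. orthonormal \<Gamma> r \<and> (\<forall>g\<in>carrier G. \<forall>\<gamma>\<in>\<Gamma>. \<alpha> g (r \<gamma>) = r (tr g \<gamma>))"
  proof (rule perturb_equivariant[of \<Gamma> "\<lambda>\<gamma>. \<gamma> v" e tr])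
    show "finite \<Gamma>" by (rule finite_\<Gamma>)
    show "\<gamma> v \<in> carrier A" if "\<gamma> \<in> \<Gamma>" for \<gamma> using that vc by simp
    show "bij_betw (tr g) \<Gamma> \<Gamma>" if "g \<in> carrier G" for g using that by (rule tr_bij)
    show "\<alpha> g (\<gamma> v) = tr g \<gamma> v" if "g \<in> carrier G" "\<gamma> \<in> \<Gamma>" for g \<gamma> using that vc by (simp add: tr_apply)
    fix r assume "orthonormal \<Gamma> r" "\<And>g i. g \<in> carrier G \<Longrightarrow> i \<in> \<Gamma> \<Longrightarrow> \<alpha> g (r i) = r (tr g i)"
    then show ?thesis by (intro exI[of _ r]) simp
  qed (use small e in auto)
  then obtain r where r: "orthonormal \<Gamma> r" "\<forall>g\<in>carrier G. \<forall>\<gamma>\<in>\<Gamma>. \<alpha> g (r \<gamma>) = r (tr g \<gamma>)" by (elim exE conjE)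
  have "star A (r (\<alpha> \<one>\<^bsub>G\<^esub>)) \<otimes> \<alpha> g (r (\<alpha> \<one>\<^bsub>G\<^esub>)) = (if \<alpha> g = \<alpha> \<one>\<^bsub>G\<^esub> then \<one> else \<zero>)"
    if g: "g \<in> carrier G" for g
  proof -
    have 1: "\<alpha> g (r (\<alpha> \<one>\<^bsub>G\<^esub>)) = r (\<alpha> g)" using r(2) g \<Gamma>_one by (simp add: tr_act)
    have "\<alpha> g \<in> \<Gamma>" using g by (simp add: \<Gamma>_def)
    then have 2: "star A (r (\<alpha> \<one>\<^bsub>G\<^esub>)) \<otimes> r (\<alpha> g) = (if \<alpha> \<one>\<^bsub>G\<^esub> = \<alpha> g then \<one> else \<zero>)"
      using r(1) \<Gamma>_one unfolding orthonormal_def by blast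
    show ?thesis unfolding 1 2 by auto
  qed
  moreover have "r (\<alpha> \<one>\<^bsub>G\<^esub>) \<in> carrier A" using r(1) \<Gamma>_one by (simp add: orthonormal_def)
  ultimately show ?thesis by (intro bexI[of _ "r (\<alpha> \<one>\<^bsub>G\<^esub>)"]) simp_all
qed

section \<open>Fixed isometries built from the regular vector\<close>

definition reg :: 'a where
  "reg = (SOME v. v \<in> carrier A \<and> (\<forall>g\<in>carrier G. star A v \<otimes> \<alpha> g v = (if \<alpha> g = \<alpha> \<one>\<^bsub>G\<^esub> then \<one> else \<zero>)))"

lemma reg_closed [simp]: "reg \<in> carrier A"
  and reg_translate: "g \<in> carrier G \<Longrightarrow> star A reg \<otimes> \<alpha> g reg = (if \<alpha> g = \<alpha> \<one>\<^bsub>G\<^esub> then \<one> else \<zero>)"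
proof -
  have "reg \<in> carrier A \<and> (\<forall>g\<in>carrier G. star A reg \<otimes> \<alpha> g reg = (if \<alpha> g = \<alpha> \<one>\<^bsub>G\<^esub> then \<one> else \<zero>))"
    unfolding reg_def by (rule someI_ex) (use regular_exists in blast)
  then show "reg \<in> carrier A"
    and "g \<in> carrier G \<Longrightarrow> star A reg \<otimes> \<alpha> g reg = (if \<alpha> g = \<alpha> \<one>\<^bsub>G\<^esub> then \<one> else \<zero>)" by blast+
qed

text \<open>\<open>x\<close> contributes only the scalar \<open>ip x (\<alpha> k x)\<close>, so
  orthogonality for distinct automorphisms comes from \<open>reg\<close>; for equal ones the scalar
  is \<open>ip x x = 1\<close>.\<close>

lemma reg_orthonormal:
  assumes x: "x \<in> H" "star A x \<otimes> x = \<one>"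
  shows "orthonormal \<Gamma> (\<lambda>\<gamma>. \<gamma> (x \<otimes> reg))"
  unfolding orthonormal_def
proof (intro conjI ballI)
  fix \<gamma> \<delta> assume "\<gamma> \<in> \<Gamma>" "\<delta> \<in> \<Gamma>"
  then obtain g h where gh: "g \<in> carrier G" "h \<in> carrier G" "\<gamma> = \<alpha> g" "\<delta> = \<alpha> h" by (auto simp: \<Gamma>_def)
  let ?k = "inv\<^bsub>G\<^esub> g \<otimes>\<^bsub>G\<^esub> h"
  have xc: "x \<in> carrier A" using x by simp
  have k: "?k \<in> carrier G" using gh by simp
  have gk: "g \<otimes>\<^bsub>G\<^esub> ?k = h" using gh by (simp flip: G.m_assoc)
  have hk: "\<alpha> h y = \<alpha> g (\<alpha> ?k y)" if "y \<in> carrier A" for y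
    using act_mult_group[OF gh(1) k that] gk by simp
  have "star A (\<gamma> (x \<otimes> reg)) \<otimes> \<delta> (x \<otimes> reg) = \<alpha> g (star A reg \<otimes> (star A x \<otimes> \<alpha> ?k x) \<otimes> \<alpha> ?k reg)"
    unfolding gh(3,4) hk[OF m_closed[OF xc reg_closed]]
    using gh(1,2) k xc by (simp add: act_mult act_star star_mult m_assoc)
  also have "star A reg \<otimes> (star A x \<otimes> \<alpha> ?k x) \<otimes> \<alpha> ?k reg = ip x (\<alpha> ?k x) \<odot> (star A reg \<otimes> \<alpha> ?k reg)"
    unfolding ip[OF x(1) H_act[OF k x(1)]] using k by (simp add: smult_mult_left smult_mult_right)
  also have "\<alpha> g \<dots> = (if \<gamma> = \<delta> then \<one> else \<zero>)"
  proof (cases "\<gamma> = \<delta>")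
    case True
    then have "\<alpha> g = \<alpha> h" by (simp only: gh(3,4))
    then have k1: "\<alpha> ?k = \<alpha> \<one>\<^bsub>G\<^esub>" by (rule act_eq_iff[OF gh(1,2), THEN iffD1])
    have "ip x (\<alpha> ?k x) = 1" unfolding k1 act_one[OF xc] by (rule ip_unit[OF x])
    moreover have "star A reg \<otimes> \<alpha> ?k reg = \<one>" using reg_translate[OF k] by (simp only: k1 refl if_True)
    ultimately show ?thesis using True gh(1) by simp
  next
    case False
    then have "\<alpha> g \<noteq> \<alpha> h" by (simp only: gh(3,4) not_False_eq_True)
    then have "\<alpha> ?k \<noteq> \<alpha> \<one>\<^bsub>G\<^esub>" unfolding act_eq_iff[OF gh(1,2)] .
    then have "star A reg \<otimes> \<alpha> ?k reg = \<zero>" unfolding reg_translate[OF k] by simp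
    then show ?thesis using False gh(1) by simp
  qed
  finally show "star A (\<gamma> (x \<otimes> reg)) \<otimes> \<delta> (x \<otimes> reg) = (if \<gamma> = \<delta> then \<one> else \<zero>)" .
qed (use x in simp)

lemma reg_cross:
  assumes "x \<in> carrier A" "y \<in> carrier A" "\<And>g. g \<in> carrier G \<Longrightarrow> star A x \<otimes> \<alpha> g y = \<zero>" "\<gamma> \<in> \<Gamma>"
  shows "star A x \<otimes> \<gamma> (y \<otimes> reg) = \<zero>"
  using assms by (auto simp: \<Gamma>_def act_mult simp flip: m_assoc)

definition nf :: complex where "nf = complex_of_real (1 / sqrt (real (card \<Gamma>)))"

lemma nf: "cnj nf = nf" "nf * (nf * of_nat (card \<Gamma>)) = 1"
proof -
  have c: "card \<Gamma> > 0" using finite_\<Gamma> \<Gamma>_one by (auto simp: card_gt_0_iff)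
  show "cnj nf = nf" by (simp add: nf_def)
  define r where "r = sqrt (real (card \<Gamma>))"
  have r: "r > 0" "r * r = real (card \<Gamma>)" using c by (simp_all add: r_def)
  have "1 / r * (1 / r * real (card \<Gamma>)) = 1" unfolding r(2)[symmetric] using r(1) by simp
  from arg_cong[OF this, of complex_of_real] show "nf * (nf * of_nat (card \<Gamma>)) = 1"
    unfolding nf_def r_def by (simp only: of_real_mult of_real_of_nat_eq of_real_1)
qed

text \<open>For a unit vector \<open>x\<close> of \<open>H\<close> this is the normalized sum over
  an orbit of orthogonal isometries. It yields a fixed isometry even if \<open>H\<close> itself
  contains no nonzero fixed vector.\<close>

definition zeta :: "'a \<Rightarrow> 'a" where "zeta x = nf \<odot> (\<Oplus>\<gamma>\<in>\<Gamma>. \<gamma> (x \<otimes> reg))"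

lemma zeta_closed [simp]: "x \<in> carrier A \<Longrightarrow> zeta x \<in> carrier A"
  by (simp add: zeta_def finsum_closed')

lemma zeta_cross:
  assumes "x \<in> carrier A" "y \<in> carrier A" "\<And>g. g \<in> carrier G \<Longrightarrow> star A x \<otimes> \<alpha> g y = \<zero>"
  shows "star A x \<otimes> zeta y = \<zero>"
proof -
  have "star A x \<otimes> (\<Oplus>\<gamma>\<in>\<Gamma>. \<gamma> (y \<otimes> reg)) = (\<Oplus>\<gamma>\<in>\<Gamma>. star A x \<otimes> \<gamma> (y \<otimes> reg))"
    using assms finite_\<Gamma> by (intro mult_finsum) auto
  also have "\<dots> = \<zero>" using reg_cross[OF assms] by (intro finsum_zero') auto
  finally show ?thesis using assms by (simp add: zeta_def smult_mult_right finsum_closed')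
qed

end

context unital_cstar
begin

lemma normalized_sum_isometry:
  assumes fin: "finite I" and r: "orthonormal I r" and c: "cnj c = c" "c * (c * of_nat (card I)) = 1"
  shows "star A (c \<odot> (\<Oplus>i\<in>I. r i)) \<otimes> (c \<odot> (\<Oplus>i\<in>I. r i)) = \<one>"
proof -
  have rc: "r i \<in> carrier A" if "i \<in> I" for i using r that by (simp add: orthonormal_def)
  have 1: "star A (r i) \<otimes> (\<Oplus>j\<in>I. r j) = \<one>" if i: "i \<in> I" for i
  proof -
    have "star A (r i) \<otimes> (\<Oplus>j\<in>I. r j) = (\<Oplus>j\<in>I. star A (r i) \<otimes> r j)"
      using i rc fin by (intro mult_finsum) auto
    also have "\<dots> = star A (r i) \<otimes> r i"
      by (rule finsum_delta[OF fin i]) (use rc r i in \<open>auto simp: orthonormal_def\<close>)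
    finally show ?thesis using r i by (simp add: orthonormal_def)
  qed
  have "star A (\<Oplus>i\<in>I. r i) = (\<Oplus>i\<in>I. star A (r i))" using rc fin by (intro star_finsum) auto
  then have "star A (\<Oplus>i\<in>I. r i) \<otimes> (\<Oplus>i\<in>I. r i) = (\<Oplus>i\<in>I. star A (r i) \<otimes> (\<Oplus>j\<in>I. r j))"
    using rc fin by (simp add: finsum_mult finsum_closed')
  also have "\<dots> = (\<Oplus>i\<in>I. \<one>)" using 1 by (intro finsum_cong_simp) auto
  also have "\<dots> = of_nat (card I) \<odot> \<one>" by (rule finsum_const_smult[OF fin one_closed])
  finally have 2: "star A (\<Oplus>i\<in>I. r i) \<otimes> (\<Oplus>i\<in>I. r i) = of_nat (card I) \<odot> \<one>" .
  have S: "(\<Oplus>i\<in>I. r i) \<in> carrier A" using rc by (rule finsum_closed')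
  have "star A (c \<odot> (\<Oplus>i\<in>I. r i)) \<otimes> (c \<odot> (\<Oplus>i\<in>I. r i)) = (c * c) \<odot> (star A (\<Oplus>i\<in>I. r i) \<otimes> (\<Oplus>i\<in>I. r i))"
    using S c(1) by (simp add: star_smult smult_mult_left smult_mult_right)
  then show ?thesis using c(2) by (simp add: 2 mult.assoc)
qed

lemma normalized_sum_cross:
  assumes "finite I" "\<And>i. i \<in> I \<Longrightarrow> r i \<in> carrier A" "x \<in> carrier A" "\<And>i. i \<in> I \<Longrightarrow> x \<otimes> r i = \<zero>"
  shows "x \<otimes> (c \<odot> (\<Oplus>i\<in>I. r i)) = \<zero>"
proof -
  have "x \<otimes> (\<Oplus>i\<in>I. r i) = (\<Oplus>i\<in>I. x \<otimes> r i)" using assms by (intro mult_finsum) auto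
  also have "\<dots> = \<zero>" using assms by (intro finsum_zero') auto
  finally show ?thesis using assms by (simp add: smult_mult_right finsum_closed')
qed

end

lemma (in finite_G_algebra) normalized_sum_fixed:
  assumes fin: "finite I" and r: "\<And>i. i \<in> I \<Longrightarrow> r i \<in> carrier A"
    and bij: "\<And>g. g \<in> carrier G \<Longrightarrow> bij_betw (act g) I I"
    and eq: "\<And>g i. \<lbrakk>g \<in> carrier G; i \<in> I\<rbrakk> \<Longrightarrow> \<alpha> g (r i) = r (act g i)"
  shows "fixed (c \<odot> (\<Oplus>i\<in>I. r i))"
proof (intro fixed_smult fixedI)
  show "(\<Oplus>i\<in>I. r i) \<in> carrier A" using r by (rule finsum_closed')
  fix g assume g: "g \<in> carrier G"
  have actI: "act g i \<in> I" if "i \<in> I" for i using bij[OF g] that by (auto simp: bij_betw_def)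
  have "\<alpha> g (\<Oplus>i\<in>I. r i) = (\<Oplus>i\<in>I. \<alpha> g (r i))" using g r fin by (intro act_finsum) auto
  also have "\<dots> = (\<Oplus>i\<in>I. r (act g i))" using g eq r actI by (intro finsum_cong_simp) auto
  also have "\<dots> = (\<Oplus>i\<in>act g ` I. r i)"
    using bij[OF g] r by (intro finsum_reindex[symmetric]) (auto simp: bij_betw_def)
  finally show "\<alpha> g (\<Oplus>i\<in>I. r i) = (\<Oplus>i\<in>I. r i)" using bij[OF g] by (simp add: bij_betw_def)
qed

context cuntz_action
begin

lemma zeta_fixed: "x \<in> carrier A \<Longrightarrow> fixed (zeta x)"
  unfolding zeta_def
  by (rule normalized_sum_fixed[of _ _ tr]) (auto simp: finite_\<Gamma> tr_bij tr_apply)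

lemma zeta_isometry: "\<lbrakk>x \<in> H; star A x \<otimes> x = \<one>\<rbrakk> \<Longrightarrow> star A (zeta x) \<otimes> zeta x = \<one>"
  unfolding zeta_def by (rule normalized_sum_isometry[OF finite_\<Gamma> reg_orthonormal nf])

text \<open>The one-sided cross relation is applied twice with an adjoint in between; translating by
  \<open>h\<close> reduces the inner condition to the hypothesis.\<close>

lemma zeta_orthogonal:
  assumes x: "x \<in> carrier A" and y: "y \<in> carrier A" and xy: "\<And>g. g \<in> carrier G \<Longrightarrow> star A x \<otimes> \<alpha> g y = \<zero>"
  shows "star A (zeta x) \<otimes> zeta y = \<zero>"
proof (rule zeta_cross)
  fix g assume g: "g \<in> carrier G"
  have "star A (\<alpha> g y) \<otimes> zeta x = \<zero>"
  proof (rule zeta_cross)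
    fix h assume h: "h \<in> carrier G"
    have i: "inv\<^bsub>G\<^esub> h \<otimes>\<^bsub>G\<^esub> g \<in> carrier G" using g h by simp
    have gg: "h \<otimes>\<^bsub>G\<^esub> (inv\<^bsub>G\<^esub> h \<otimes>\<^bsub>G\<^esub> g) = g" using g h by (simp flip: G.m_assoc)
    have "\<alpha> h (\<alpha> (inv\<^bsub>G\<^esub> h \<otimes>\<^bsub>G\<^esub> g) y) = \<alpha> g y" using act_mult_group[OF h i y] gg by simp
    then have "star A (\<alpha> g y) \<otimes> \<alpha> h x = \<alpha> h (star A (\<alpha> (inv\<^bsub>G\<^esub> h \<otimes>\<^bsub>G\<^esub> g) y) \<otimes> x)"
      using h i x y by (simp add: act_mult act_star)
    also have "star A (\<alpha> (inv\<^bsub>G\<^esub> h \<otimes>\<^bsub>G\<^esub> g) y) \<otimes> x = star A (star A x \<otimes> \<alpha> (inv\<^bsub>G\<^esub> h \<otimes>\<^bsub>G\<^esub> g) y)"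
      using i x y by (simp add: star_mult)
    finally show "star A (\<alpha> g y) \<otimes> \<alpha> h x = \<zero>" using xy[OF i] h by simp
  qed (use g x y in auto)
  from arg_cong[OF this, of "star A"] show "star A (zeta x) \<otimes> \<alpha> g y = \<zero>" using g x y by (simp add: star_mult)
qed (use x y in auto)

end

section \<open>Rotating orthonormal families\<close>

context unital_cstar
begin

text \<open>For an orthonormal family this is the range projection. It is also applied to orthogonal
  elements of squared norm 2, where it is twice a projection.\<close>

definition frame :: "'i set \<Rightarrow> ('i \<Rightarrow> 'a) \<Rightarrow> 'a" where
  "frame I f = (\<Oplus>i\<in>I. f i \<otimes> star A (f i))"

lemma frame_closed: "(\<And>i. i \<in> I \<Longrightarrow> f i \<in> carrier A) \<Longrightarrow> frame I f \<in> carrier A"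
  by (simp add: frame_def finsum_closed')

lemma frame_star:
  assumes "finite I" "\<And>i. i \<in> I \<Longrightarrow> f i \<in> carrier A" shows "star A (frame I f) = frame I f"
  unfolding frame_def using assms
  by (subst star_finsum) (auto simp: star_mult intro!: finsum_cong_simp)

lemma frame_mult:
  assumes "finite I" "\<And>i. i \<in> I \<Longrightarrow> f i \<in> carrier A" "x \<in> carrier A"
  shows "frame I f \<otimes> x = (\<Oplus>i\<in>I. f i \<otimes> (star A (f i) \<otimes> x))"
  unfolding frame_def using assms
  by (subst finsum_mult) (auto simp: m_assoc intro!: finsum_cong_simp)

lemma frame_left_zero:
  assumes "finite I" "\<And>i. i \<in> I \<Longrightarrow> f i \<in> carrier A" "x \<in> carrier A" "\<And>i. i \<in> I \<Longrightarrow> x \<otimes> f i = \<zero>"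
  shows "x \<otimes> frame I f = \<zero>"
proof -
  have "x \<otimes> frame I f = (\<Oplus>i\<in>I. x \<otimes> (f i \<otimes> star A (f i)))"
    unfolding frame_def using assms by (intro mult_finsum) auto
  also have "\<dots> = \<zero>"
  proof (rule finsum_zero')
    fix i assume i: "i \<in> I"
    have "x \<otimes> (f i \<otimes> star A (f i)) = (x \<otimes> f i) \<otimes> star A (f i)" using i assms(2,3) by (simp add: m_assoc)
    then show "x \<otimes> (f i \<otimes> star A (f i)) = \<zero>" using assms(2)[OF i] assms(4)[OF i] by simp
  qed
  finally show ?thesis .
qed

end

context finite_G_algebra
begin

text \<open>The scalar \<open>c\<close> will be 1 for orthonormal families and 2 for the differences
  \<open>u i - v i\<close>. Dividing by it reduces the first claim to
  \<open>fixed_of_absorbing\<close>.\<close>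

lemma frame_absorbing:
  assumes fin: "finite I" and f: "\<And>i. i \<in> I \<Longrightarrow> f i \<in> carrier A" and c: "cnj c = c" "c \<noteq> 0"
    and absorb: "\<And>g i. \<lbrakk>g \<in> carrier G; i \<in> I\<rbrakk> \<Longrightarrow> frame I f \<otimes> \<alpha> g (f i) = c \<odot> \<alpha> g (f i)"
  shows "fixed (frame I f)" and "frame I f \<otimes> frame I f = c \<odot> frame I f"
proof -
  let ?q = "frame I f"
  have q: "?q \<in> carrier A" "star A ?q = ?q" using f by (auto intro: frame_closed frame_star[OF fin])
  have abs: "?q \<otimes> \<alpha> g ?q = c \<odot> \<alpha> g ?q" if g: "g \<in> carrier G" for g
  proof -
    have 1: "\<alpha> g ?q = (\<Oplus>i\<in>I. \<alpha> g (f i) \<otimes> star A (\<alpha> g (f i)))"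
      unfolding frame_def using g f fin
      by (subst act_finsum[OF g]) (auto simp: act_mult act_star intro!: finsum_cong_simp)
    have "?q \<otimes> \<alpha> g ?q = (\<Oplus>i\<in>I. ?q \<otimes> (\<alpha> g (f i) \<otimes> star A (\<alpha> g (f i))))"
      unfolding 1 using g f fin q by (intro mult_finsum) auto
    also have "\<dots> = (\<Oplus>i\<in>I. c \<odot> (\<alpha> g (f i) \<otimes> star A (\<alpha> g (f i))))"
    proof (rule finsum_cong_simp)
      fix i assume i: "i \<in> I"
      have "?q \<otimes> (\<alpha> g (f i) \<otimes> star A (\<alpha> g (f i))) = (?q \<otimes> \<alpha> g (f i)) \<otimes> star A (\<alpha> g (f i))"
        using i g f q by (simp add: m_assoc)
      also have "\<dots> = c \<odot> (\<alpha> g (f i) \<otimes> star A (\<alpha> g (f i)))"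
        unfolding absorb[OF g i] using i g f by (simp add: smult_mult_left)
      finally show "?q \<otimes> (\<alpha> g (f i) \<otimes> star A (\<alpha> g (f i))) = c \<odot> (\<alpha> g (f i) \<otimes> star A (\<alpha> g (f i)))" .
    qed (use g f in simp)
    also have "\<dots> = c \<odot> \<alpha> g ?q" unfolding 1 using g f fin by (intro smult_finsum[symmetric]) auto
    finally show ?thesis .
  qed
  show "?q \<otimes> ?q = c \<odot> ?q" using abs[OF G.one_closed] unfolding act_one[OF q(1)] .
  have "fixed ((1 / c) \<odot> ?q)"
  proof (rule fixed_of_absorbing)
    fix g assume g: "g \<in> carrier G"
    have "((1 / c) \<odot> ?q) \<otimes> \<alpha> g ((1 / c) \<odot> ?q) = (1 / c * (1 / c)) \<odot> (?q \<otimes> \<alpha> g ?q)"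
      using q(1) g by (simp add: act_smult smult_mult_left smult_mult_right)
    then show "((1 / c) \<odot> ?q) \<otimes> \<alpha> g ((1 / c) \<odot> ?q) = \<alpha> g ((1 / c) \<odot> ?q)"
      unfolding abs[OF g] using q(1) g c by (simp add: act_smult)
  qed (use q c in \<open>simp_all add: star_smult\<close>)
  from fixed_smult[OF this, of c] show "fixed ?q" using q(1) c by simp
qed

text \<open>\<open>q\<close> is twice the projection onto the span of the \<open>u i - v i\<close>,
  so \<open>\<one> \<ominus> q\<close> is the symmetry that exchanges \<open>u i\<close> with
  \<open>v i\<close>. By \<open>coeff\<close> both families transform with the same matrix, so this
  span is invariant and the symmetry fixed. The factor \<open>k = 1 / sqrt 2\<close> brings it into
  the form that lifts.\<close>

lemma reflection:
  assumes fin: "finite I" and u: "orthonormal I u" and v: "orthonormal I v"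
    and uv: "\<And>i j. \<lbrakk>i \<in> I; j \<in> I\<rbrakk> \<Longrightarrow> star A (u i) \<otimes> v j = \<zero>"
    and coeff: "\<And>g i. \<lbrakk>g \<in> carrier G; i \<in> I\<rbrakk> \<Longrightarrow>
      \<exists>a. \<alpha> g (u i) = (\<Oplus>j\<in>I. a j \<odot> u j) \<and> \<alpha> g (v i) = (\<Oplus>j\<in>I. a j \<odot> v j)"
  obtains c where "fixed c" "star A c = c" "c \<otimes> c = (1/2) \<odot> \<one>"
    "\<And>i. i \<in> I \<Longrightarrow> complex_of_real (sqrt 2) \<odot> (c \<otimes> u i) = v i"
    "\<And>y. \<lbrakk>y \<in> carrier A; star A y = y; \<forall>i\<in>I. y \<otimes> u i = \<zero> \<and> y \<otimes> v i = \<zero>\<rbrakk> \<Longrightarrow> y \<otimes> c = c \<otimes> y"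
proof -
  have uc: "u i \<in> carrier A" and vc: "v i \<in> carrier A" if "i \<in> I" for i
    using u v that by (simp_all add: orthonormal_def)
  have uu: "star A (u i) \<otimes> u j = (if i = j then \<one> else \<zero>)"
    and vv: "star A (v i) \<otimes> v j = (if i = j then \<one> else \<zero>)" if "i \<in> I" "j \<in> I" for i j
    using u v that by (simp_all add: orthonormal_def)
  have vu: "star A (v i) \<otimes> u j = \<zero>" if "i \<in> I" "j \<in> I" for i j
    using arg_cong[OF uv[OF that(2,1)], of "star A"] uc vc that by (simp add: star_mult)
  define f where "f i = u i \<ominus> v i" for i
  have fc: "f i \<in> carrier A" if "i \<in> I" for i using uc vc that by (simp add: f_def)
  define q where "q = frame I f"
  have q: "q \<in> carrier A" "star A q = q" unfolding q_def using fc by (auto intro: frame_closed frame_star[OF fin])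
  have star_f: "star A (f i) \<otimes> x = star A (u i) \<otimes> x \<ominus> star A (v i) \<otimes> x" if "i \<in> I" "x \<in> carrier A" for i x
    using uc vc that by (simp add: f_def star_add star_minus minus_eq l_distr l_minus)
  have qu: "q \<otimes> u j = f j" if j: "j \<in> I" for j
  proof -
    have d: "star A (f i) \<otimes> u j = (if i = j then \<one> else \<zero>)" if "i \<in> I" for i
      unfolding star_f[OF that uc[OF j]] vu[OF that j] uu[OF that j] by (simp add: minus_eq)
    have "q \<otimes> u j = (\<Oplus>i\<in>I. f i \<otimes> (star A (f i) \<otimes> u j))"
      unfolding q_def using fc uc[OF j] by (intro frame_mult[OF fin])
    also have "\<dots> = f j \<otimes> (star A (f j) \<otimes> u j)"
      by (rule finsum_delta[OF fin j]) (use d fc in auto)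
    finally show ?thesis using d[OF j] fc[OF j] by simp
  qed
  have qv: "q \<otimes> v j = \<ominus> f j" if j: "j \<in> I" for j
  proof -
    have d: "star A (f i) \<otimes> v j = (if i = j then \<ominus> \<one> else \<zero>)" if "i \<in> I" for i
      unfolding star_f[OF that vc[OF j]] uv[OF that j] vv[OF that j] by (simp add: minus_eq)
    have "q \<otimes> v j = (\<Oplus>i\<in>I. f i \<otimes> (star A (f i) \<otimes> v j))"
      unfolding q_def using fc vc[OF j] by (intro frame_mult[OF fin])
    also have "\<dots> = f j \<otimes> (star A (f j) \<otimes> v j)"
      by (rule finsum_delta[OF fin j]) (use d fc in auto)
    finally show ?thesis using d[OF j] fc[OF j] by (simp add: r_minus)
  qed
  have two: "2 \<odot> x = x \<oplus> x" if "x \<in> carrier A" for x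
    using smult_add_left[OF that, of 1 1] that by simp
  have qf: "q \<otimes> f j = 2 \<odot> f j" if j: "j \<in> I" for j
  proof -
    have "q \<otimes> f j = q \<otimes> u j \<ominus> q \<otimes> v j"
      unfolding f_def using q uc[OF j] vc[OF j] by (simp add: minus_eq r_distr r_minus)
    then show ?thesis unfolding qu[OF j] qv[OF j] two[OF fc[OF j]] using fc[OF j] by (simp add: minus_eq)
  qed
  have absorb: "q \<otimes> \<alpha> g (f i) = 2 \<odot> \<alpha> g (f i)" if g: "g \<in> carrier G" and i: "i \<in> I" for g i
  proof -
    obtain a where a: "\<alpha> g (u i) = (\<Oplus>j\<in>I. a j \<odot> u j)" "\<alpha> g (v i) = (\<Oplus>j\<in>I. a j \<odot> v j)"
      using coeff[OF g i] by (elim exE conjE)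
    have "\<alpha> g (f i) = (\<Oplus>j\<in>I. a j \<odot> u j) \<ominus> (\<Oplus>j\<in>I. a j \<odot> v j)"
      unfolding f_def act_diff[OF g uc[OF i] vc[OF i]] a ..
    also have "\<dots> = (\<Oplus>j\<in>I. a j \<odot> u j \<ominus> a j \<odot> v j)" using uc vc by (intro finsum_diff[symmetric] fin) auto
    also have "\<dots> = (\<Oplus>j\<in>I. a j \<odot> f j)"
      using uc vc by (intro finsum_cong_simp) (auto simp: f_def smult_diff_right)
    finally have 1: "\<alpha> g (f i) = (\<Oplus>j\<in>I. a j \<odot> f j)" .
    have "q \<otimes> (\<Oplus>j\<in>I. a j \<odot> f j) = (\<Oplus>j\<in>I. q \<otimes> (a j \<odot> f j))" using q fc by (intro mult_finsum fin) auto
    also have "\<dots> = (\<Oplus>j\<in>I. 2 \<odot> (a j \<odot> f j))"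
      using q fc qf by (intro finsum_cong_simp) (auto simp: smult_mult_right mult.commute)
    also have "\<dots> = 2 \<odot> (\<Oplus>j\<in>I. a j \<odot> f j)" using fc by (intro smult_finsum[symmetric] fin) auto
    finally show ?thesis unfolding 1 .
  qed
  have qfix: "fixed q" and qq: "q \<otimes> q = 2 \<odot> q"
    using frame_absorbing[of I f 2, OF fin fc] absorb unfolding q_def by auto
  define k where "k = complex_of_real (1 / sqrt 2)"
  define r where "r = sqrt (2::real)"
  have r: "r > 0" "r * r = 2" by (simp_all add: r_def)
  have kr: "k = complex_of_real (1 / r)" by (simp add: k_def r_def)
  have "1 / r * (1 / r) = 1 / (r * r)" "r * (1 / r) = 1" using r(1) by simp_all
  then have k: "k * k = 1/2" "complex_of_real r * k = 1" "cnj k = k"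
    unfolding kr of_real_mult[symmetric] r(2) by simp_all
  define c where "c = k \<odot> (\<one> \<ominus> q)"
  have oq: "\<one> \<ominus> q \<in> carrier A" using q by simp
  show thesis
  proof (rule that)
    show "fixed c" unfolding c_def using qfix fixed_one by (intro fixed_smult fixed_diff)
    show "star A c = c" unfolding c_def using q k(3) by (simp add: star_smult star_diff)
    have "(\<one> \<ominus> q) \<otimes> (\<one> \<ominus> q) = \<one> \<ominus> q \<ominus> q \<oplus> q \<otimes> q" using q(1) by (simp add: ring_nf)
    also have "\<dots> = \<one>" unfolding qq two[OF q(1)] using q(1) by (simp add: ring_nf)
    finally have s: "(\<one> \<ominus> q) \<otimes> (\<one> \<ominus> q) = \<one>" .
    show "c \<otimes> c = (1/2) \<odot> \<one>"
      unfolding c_def using oq by (simp add: smult_mult_left smult_mult_right s k(1))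
  next
    fix i assume i: "i \<in> I"
    have "(\<one> \<ominus> q) \<otimes> u i = u i \<ominus> f i" using q uc[OF i] qu[OF i] by (simp add: minus_eq l_distr l_minus)
    also have "\<dots> = v i" unfolding f_def using uc[OF i] vc[OF i] by algebra
    finally have "c \<otimes> u i = k \<odot> v i" unfolding c_def using oq uc[OF i] by (simp add: smult_mult_left)
    then show "complex_of_real (sqrt 2) \<odot> (c \<otimes> u i) = v i" using vc[OF i] k(2) by (simp add: r_def)
  next
    fix y assume y: "y \<in> carrier A" "star A y = y"
      and "\<forall>i\<in>I. y \<otimes> u i = \<zero> \<and> y \<otimes> v i = \<zero>"
    then have yu: "y \<otimes> u i = \<zero>" and yv: "y \<otimes> v i = \<zero>" if "i \<in> I" for i
      using that by simp_all
    have "y \<otimes> f i = \<zero>" if "i \<in> I" for i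
      unfolding f_def using y(1) uc[OF that] vc[OF that] yu[OF that] yv[OF that] by (simp add: minus_eq r_distr r_minus)
    then have yq: "y \<otimes> q = \<zero>" unfolding q_def using fc y(1) by (intro frame_left_zero fin)
    have qy: "q \<otimes> y = \<zero>" using arg_cong[OF yq, of "star A"] y q by (simp add: star_mult)
    show "y \<otimes> c = c \<otimes> y"
      unfolding c_def using y(1) q(1) by (simp add: smult_mult_left smult_mult_right minus_eq l_distr r_distr l_minus r_minus yq qy)
  qed
qed

end

text \<open>Lifts the reflection in the complement of \<open>N\<close>, which will be the projection
  onto what is already lifted. The image of \<open>N\<close> annihilates both families and so
  commutes with the reflection. Commutation of \<open>U\<close> with \<open>N\<close> will keep the
  new part orthogonal to the old one.\<close>

lemma (in equivariant_quotient) rotate: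
  assumes fin: "finite I" and t: "\<And>i. i \<in> I \<Longrightarrow> t i \<in> carrier D"
    and N: "D.fixed N" "star D N = N" "N \<otimes>\<^bsub>D\<^esub> N = N" and Nt: "\<And>i. i \<in> I \<Longrightarrow> N \<otimes>\<^bsub>D\<^esub> t i = \<zero>\<^bsub>D\<^esub>"
    and u: "Q.orthonormal I (\<lambda>i. p (t i))" and v: "Q.orthonormal I v"
    and uv: "\<And>i j. \<lbrakk>i \<in> I; j \<in> I\<rbrakk> \<Longrightarrow> star Q (p (t i)) \<otimes>\<^bsub>Q\<^esub> v j = \<zero>\<^bsub>Q\<^esub>"
    and Nv: "\<And>i. i \<in> I \<Longrightarrow> p N \<otimes>\<^bsub>Q\<^esub> v i = \<zero>\<^bsub>Q\<^esub>"
    and coeff: "\<And>g i. \<lbrakk>g \<in> carrier G; i \<in> I\<rbrakk> \<Longrightarrow> \<exists>a. \<kappa> g (p (t i)) = (\<Oplus>\<^bsub>Q\<^esub>j\<in>I. a j \<odot>\<^bsub>Q\<^esub> p (t j))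
      \<and> \<kappa> g (v i) = (\<Oplus>\<^bsub>Q\<^esub>j\<in>I. a j \<odot>\<^bsub>Q\<^esub> v j)"
  obtains U where "D.fixed U" "star D U \<otimes>\<^bsub>D\<^esub> U = \<one>\<^bsub>D\<^esub>" "U \<otimes>\<^bsub>D\<^esub> N = N \<otimes>\<^bsub>D\<^esub> U"
    "\<And>i. i \<in> I \<Longrightarrow> p U \<otimes>\<^bsub>Q\<^esub> p (t i) = v i"
proof -
  have Nc: "N \<in> carrier D" using N(1) by (rule D.fixedD)
  obtain c where c: "Q.fixed c" "star Q c = c" "c \<otimes>\<^bsub>Q\<^esub> c = (1/2) \<odot>\<^bsub>Q\<^esub> \<one>\<^bsub>Q\<^esub>"
    "\<And>i. i \<in> I \<Longrightarrow> complex_of_real (sqrt 2) \<odot>\<^bsub>Q\<^esub> (c \<otimes>\<^bsub>Q\<^esub> p (t i)) = v i"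
    and comm: "\<And>y. \<lbrakk>y \<in> carrier Q; star Q y = y; \<forall>i\<in>I. y \<otimes>\<^bsub>Q\<^esub> p (t i) = \<zero>\<^bsub>Q\<^esub> \<and> y \<otimes>\<^bsub>Q\<^esub> v i = \<zero>\<^bsub>Q\<^esub>\<rbrakk>
      \<Longrightarrow> y \<otimes>\<^bsub>Q\<^esub> c = c \<otimes>\<^bsub>Q\<^esub> y"
  proof (rule Q.reflection[OF fin u v uv coeff])
    fix c assume c: "Q.fixed c" "star Q c = c" "c \<otimes>\<^bsub>Q\<^esub> c = (1/2) \<odot>\<^bsub>Q\<^esub> \<one>\<^bsub>Q\<^esub>"
      "\<And>i. i \<in> I \<Longrightarrow> complex_of_real (sqrt 2) \<odot>\<^bsub>Q\<^esub> (c \<otimes>\<^bsub>Q\<^esub> p (t i)) = v i"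
      "\<And>y. \<lbrakk>y \<in> carrier Q; star Q y = y; \<forall>i\<in>I. y \<otimes>\<^bsub>Q\<^esub> p (t i) = \<zero>\<^bsub>Q\<^esub> \<and> y \<otimes>\<^bsub>Q\<^esub> v i = \<zero>\<^bsub>Q\<^esub>\<rbrakk>
        \<Longrightarrow> y \<otimes>\<^bsub>Q\<^esub> c = c \<otimes>\<^bsub>Q\<^esub> y"
    show thesis by (rule that[OF c(1-3)]) (use c(4,5) in auto)
  qed auto
  have cc: "c \<in> carrier Q" using c(1) by (rule Q.fixedD)
  have pN: "p N \<otimes>\<^bsub>Q\<^esub> c = c \<otimes>\<^bsub>Q\<^esub> p N"
  proof (rule comm)
    show "star Q (p N) = p N" using p.star[OF Nc] N(2) by simp
    have "p N \<otimes>\<^bsub>Q\<^esub> p (t i) = \<zero>\<^bsub>Q\<^esub>" if "i \<in> I" for i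
      using p.mult[OF Nc t[OF that]] Nt[OF that] by simp
    then show "\<forall>i\<in>I. p N \<otimes>\<^bsub>Q\<^esub> p (t i) = \<zero>\<^bsub>Q\<^esub> \<and> p N \<otimes>\<^bsub>Q\<^esub> v i = \<zero>\<^bsub>Q\<^esub>" using Nv by simp
  qed (use Nc in simp)
  define e where "e = \<one>\<^bsub>D\<^esub> \<ominus>\<^bsub>D\<^esub> N"
  have ec: "e \<in> carrier D" using Nc by (simp add: e_def)
  have e1: "D.fixed e" unfolding e_def by (intro D.fixed_diff D.fixed_one N(1))
  have e2: "star D e = e" unfolding e_def using Nc N(2) by (simp add: D.star_diff)
  have e3: "e \<otimes>\<^bsub>D\<^esub> e = e" unfolding e_def using Nc N(3) by (simp add: D.ring_nf)
  have et: "e \<otimes>\<^bsub>D\<^esub> t i = t i" if "i \<in> I" for i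
    unfolding e_def using Nc t[OF that] Nt[OF that] by (simp add: D.minus_eq D.l_distr D.l_minus)
  have pe: "p e = \<one>\<^bsub>Q\<^esub> \<ominus>\<^bsub>Q\<^esub> p N" unfolding e_def using Nc by (simp add: p.diff)
  have e4: "p e \<otimes>\<^bsub>Q\<^esub> c = c \<otimes>\<^bsub>Q\<^esub> p e"
    unfolding pe using Nc cc pN by (simp add: Q.minus_eq Q.l_distr Q.r_distr Q.l_minus Q.r_minus)
  obtain U where U: "D.fixed U" "star D U \<otimes>\<^bsub>D\<^esub> U = \<one>\<^bsub>D\<^esub>" "U \<otimes>\<^bsub>D\<^esub> e = e \<otimes>\<^bsub>D\<^esub> U"
    "p U \<otimes>\<^bsub>Q\<^esub> p e = complex_of_real (sqrt 2) \<odot>\<^bsub>Q\<^esub> (c \<otimes>\<^bsub>Q\<^esub> p e)"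
    by (rule lift_symmetry[OF c(1-3) e1 e2 e3 e4])
  have Uc: "U \<in> carrier D" using U(1) by (rule D.fixedD)
  show thesis
  proof (rule that[OF U(1,2)])
    have N_e: "N = \<one>\<^bsub>D\<^esub> \<ominus>\<^bsub>D\<^esub> e" unfolding e_def using Nc by (simp add: D.ring_nf)
    show "U \<otimes>\<^bsub>D\<^esub> N = N \<otimes>\<^bsub>D\<^esub> U"
      unfolding N_e using U(3) Uc ec by (simp add: D.minus_eq D.l_distr D.r_distr D.l_minus D.r_minus)
    fix i assume i: "i \<in> I"
    have pt: "p (t i) = p e \<otimes>\<^bsub>Q\<^esub> p (t i)" using p.mult[OF ec t[OF i]] et[OF i] by simp
    have "p U \<otimes>\<^bsub>Q\<^esub> p (t i) = (p U \<otimes>\<^bsub>Q\<^esub> p e) \<otimes>\<^bsub>Q\<^esub> p (t i)"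
      by (subst pt) (use Uc ec t[OF i] in \<open>simp add: Q.m_assoc\<close>)
    also have "\<dots> = complex_of_real (sqrt 2) \<odot>\<^bsub>Q\<^esub> (c \<otimes>\<^bsub>Q\<^esub> (p e \<otimes>\<^bsub>Q\<^esub> p (t i)))"
      unfolding U(4) using cc ec t[OF i] by (simp add: Q.smult_mult_left Q.m_assoc)
    also have "\<dots> = v i" unfolding pt[symmetric] by (rule c(4)[OF i])
    finally show "p U \<otimes>\<^bsub>Q\<^esub> p (t i) = v i" .
  qed
qed

section \<open>Lifting a homomorphism from the Cuntz algebra\<close>

context cuntz_action
begin

lemma good_onset: "good B \<Longrightarrow> onset B" by (simp add: good_def)

lemma proj_act:
  assumes "good B" "g \<in> carrier G" "x \<in> carrier A" shows "proj B \<otimes> \<alpha> g x = \<alpha> g (proj B \<otimes> x)"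
proof -
  have "fixed (proj B)" "onset B" using assms(1) by (auto simp: good_def)
  then show ?thesis using assms(2,3) fixedD(2)[of "proj B" g] by (simp add: act_mult)
qed

lemma proj_left_zero:
  assumes B: "onset B" and x: "x \<in> carrier A" "proj B \<otimes> x = x" and y: "y \<in> carrier A" "proj B \<otimes> y = \<zero>"
  shows "star A x \<otimes> y = \<zero>"
proof -
  have "star A (proj B \<otimes> x) \<otimes> y = star A x \<otimes> (proj B \<otimes> y)"
    using B x(1) y(1) by (simp add: star_mult proj_star m_assoc)
  then show ?thesis unfolding x(2) y(2) using x(1) by simp
qed

lemma proj_cross:
  assumes B: "good B" and x: "x \<in> carrier A" "proj B \<otimes> x = x" and y: "y \<in> carrier A" "proj B \<otimes> y = \<zero>"
    and g: "g \<in> carrier G"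
  shows "star A x \<otimes> \<alpha> g y = \<zero>"
  by (rule proj_left_zero[OF good_onset[OF B] x]) (use g y proj_act[OF B g y(1)] in simp_all)

lemma proj_zeta: assumes B: "good B" and y: "y \<in> carrier A" "proj B \<otimes> y = \<zero>" shows "proj B \<otimes> zeta y = \<zero>"
proof -
  have o: "onset B" using B by (rule good_onset)
  have "star A (proj B) \<otimes> zeta y = \<zero>"
  proof (rule zeta_cross)
    show "star A (proj B) \<otimes> \<alpha> g y = \<zero>" if "g \<in> carrier G" for g
      unfolding proj_star[OF o] proj_act[OF B that y(1)] y(2) using that by simp
  qed (use o y in simp_all)
  then show ?thesis unfolding proj_star[OF o] .
qed

lemma ip_eqI: assumes "x \<in> H" "y \<in> H" "star A x \<otimes> y = c \<odot> \<one>" shows "ip x y = c"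
proof -
  have "ip x y \<odot> \<one> = c \<odot> \<one>" unfolding ip[OF assms(1,2), symmetric] by (rule assms(3))
  then show ?thesis by (rule smult_one_inj[OF nonzero, THEN iffD1])
qed

lemma proj_expand:
  assumes B: "onset B" and x: "x \<in> H" shows "proj B \<otimes> x = (\<Oplus>b\<in>B. ip b x \<odot> b)"
  unfolding proj_mult[OF B H_carrier[OF x]]
  using B x by (intro finsum_cong_simp) (auto simp: ip onset_mem smult_mult_right)

lemma proj_idem: "onset B \<Longrightarrow> proj B \<otimes> proj B = proj B"
  by (rule proj_subset[OF _ subset_refl])

text \<open>Depends on the function alone, since several group elements may induce the same
  automorphism.\<close>

definition inverse_act :: "('a \<Rightarrow> 'a) \<Rightarrow> 'a \<Rightarrow> 'a" where
  "inverse_act \<gamma> = inv_into (carrier A) \<gamma>"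

lemma inverse_act: assumes g: "g \<in> carrier G" and x: "x \<in> carrier A" shows "inverse_act (\<alpha> g) x = \<alpha> (inv\<^bsub>G\<^esub> g) x"
  unfolding inverse_act_def
proof (rule inv_into_f_eq)
  show "inj_on (\<alpha> g) (carrier A)" using act_Bij[OF g] by (simp add: Bij_def bij_betw_def)
qed (use g x in \<open>simp_all add: act_inv'\<close>)

lemma inverse_act_props:
  assumes "\<gamma> \<in> \<Gamma>"
  shows "x \<in> carrier A \<Longrightarrow> inverse_act \<gamma> x \<in> carrier A"
    and "\<lbrakk>x \<in> carrier A; y \<in> carrier A\<rbrakk> \<Longrightarrow> inverse_act \<gamma> (x \<oplus> y) = inverse_act \<gamma> x \<oplus> inverse_act \<gamma> y"
    and "x \<in> carrier A \<Longrightarrow> inverse_act \<gamma> (c \<odot> x) = c \<odot> inverse_act \<gamma> x"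
    and "\<lbrakk>x \<in> H; y \<in> H\<rbrakk> \<Longrightarrow> star A (inverse_act \<gamma> x) \<otimes> inverse_act \<gamma> y = ip x y \<odot> \<one>"
    and "\<lbrakk>g \<in> carrier G; x \<in> carrier A\<rbrakk> \<Longrightarrow> inverse_act (tr g \<gamma>) (\<alpha> g x) = inverse_act \<gamma> x"
proof -
  obtain h where h: "h \<in> carrier G" "\<gamma> = \<alpha> h" using assms by (auto simp: \<Gamma>_def)
  have i: "inv\<^bsub>G\<^esub> h \<in> carrier G" using h by simp
  note e = inverse_act[OF h(1)]
  show "x \<in> carrier A \<Longrightarrow> inverse_act \<gamma> x \<in> carrier A" using i by (simp add: h(2) e)
  show "\<lbrakk>x \<in> carrier A; y \<in> carrier A\<rbrakk> \<Longrightarrow> inverse_act \<gamma> (x \<oplus> y) = inverse_act \<gamma> x \<oplus> inverse_act \<gamma> y"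
    using i by (simp add: h(2) e act_add)
  show "x \<in> carrier A \<Longrightarrow> inverse_act \<gamma> (c \<odot> x) = c \<odot> inverse_act \<gamma> x"
    using i by (simp add: h(2) e act_smult)
  show "star A (inverse_act \<gamma> x) \<otimes> inverse_act \<gamma> y = ip x y \<odot> \<one>" if xy: "x \<in> H" "y \<in> H"
  proof -
    have "star A (inverse_act \<gamma> x) \<otimes> inverse_act \<gamma> y = \<alpha> (inv\<^bsub>G\<^esub> h) (star A x \<otimes> y)"
      using i xy by (simp add: h(2) e act_mult act_star)
    then show ?thesis unfolding ip[OF xy] using i by (simp add: act_smult)
  qed
  show "inverse_act (tr g \<gamma>) (\<alpha> g x) = inverse_act \<gamma> x" if gx: "g \<in> carrier G" "x \<in> carrier A"
  proof -
    have gh: "g \<otimes>\<^bsub>G\<^esub> h \<in> carrier G" "\<alpha> g x \<in> carrier A" using gx h by simp_all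
    have "inverse_act (tr g \<gamma>) (\<alpha> g x) = \<alpha> (inv\<^bsub>G\<^esub> (g \<otimes>\<^bsub>G\<^esub> h)) (\<alpha> g x)"
      unfolding h(2) tr_act[OF gx(1) h(1)] by (rule inverse_act[OF gh])
    also have "inv\<^bsub>G\<^esub> (g \<otimes>\<^bsub>G\<^esub> h) = inv\<^bsub>G\<^esub> h \<otimes>\<^bsub>G\<^esub> inv\<^bsub>G\<^esub> g"
      using gx h by (simp add: G.inv_mult_group)
    also have "\<alpha> (inv\<^bsub>G\<^esub> h \<otimes>\<^bsub>G\<^esub> inv\<^bsub>G\<^esub> g) (\<alpha> g x) = \<alpha> (inv\<^bsub>G\<^esub> h) x"
      using gx h by (simp add: act_mult_group act_inv)
    also have "\<dots> = inverse_act \<gamma> x" unfolding h(2) by (rule e[OF gx(2), symmetric])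
    finally show ?thesis .
  qed
qed

end

lemma (in unital_cstar) orthonormal_combination:
  assumes fin: "finite I" and r: "orthonormal I r"
    and a: "\<And>i. i \<in> I \<Longrightarrow> a i \<in> carrier A" and b: "\<And>i. i \<in> I \<Longrightarrow> b i \<in> carrier A"
  shows "star A (\<Oplus>i\<in>I. r i \<otimes> a i) \<otimes> (\<Oplus>i\<in>I. r i \<otimes> b i) = (\<Oplus>i\<in>I. star A (a i) \<otimes> b i)"
proof -
  have rc: "r i \<in> carrier A" if "i \<in> I" for i using r that by (simp add: orthonormal_def)
  have 1: "star A (r i) \<otimes> (\<Oplus>j\<in>I. r j \<otimes> b j) = b i" if i: "i \<in> I" for i
  proof -
    have rr: "star A (r i) \<otimes> (r j \<otimes> b j) = (if i = j then b j else \<zero>)" if j: "j \<in> I" for j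
    proof -
      have "star A (r i) \<otimes> (r j \<otimes> b j) = (star A (r i) \<otimes> r j) \<otimes> b j" using rc i j b by (simp add: m_assoc)
      then show ?thesis using r i j b by (simp add: orthonormal_def)
    qed
    have "star A (r i) \<otimes> (\<Oplus>j\<in>I. r j \<otimes> b j) = (\<Oplus>j\<in>I. star A (r i) \<otimes> (r j \<otimes> b j))"
      using i rc b by (intro mult_finsum fin) auto
    also have "\<dots> = star A (r i) \<otimes> (r i \<otimes> b i)"
      by (rule finsum_delta[OF fin i]) (use rc b rr i in auto)
    finally show ?thesis using rr[OF i] by simp
  qed
  have R: "(\<Oplus>j\<in>I. r j \<otimes> b j) \<in> carrier A" using rc b by (intro finsum_closed') auto
  have "star A (\<Oplus>i\<in>I. r i \<otimes> a i) = (\<Oplus>i\<in>I. star A (a i) \<otimes> star A (r i))"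
    using rc a by (subst star_finsum[OF fin]) (auto simp: star_mult intro!: finsum_cong_simp)
  then have "star A (\<Oplus>i\<in>I. r i \<otimes> a i) \<otimes> (\<Oplus>i\<in>I. r i \<otimes> b i)
      = (\<Oplus>i\<in>I. (star A (a i) \<otimes> star A (r i)) \<otimes> (\<Oplus>j\<in>I. r j \<otimes> b j))"
    using rc a R by (simp add: finsum_mult[OF fin])
  also have "\<dots> = (\<Oplus>i\<in>I. star A (a i) \<otimes> b i)"
    using rc a b R by (intro finsum_cong_simp) (auto simp: m_assoc 1)
  finally show ?thesis .
qed

text \<open>\<open>D\<close> is one stage, chosen once and for all. The copies labelled
  \<open>True\<close> have prescribed images and become the first reserved isometry; those labelled
  \<open>False\<close> supply isometries of \<open>D\<close> that the group permutes by
  translation.\<close>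

locale cuntz_lifting = cuntz_action A G \<alpha> s + equivariant_quotient D G \<beta> Q \<kappa> p + phi: unital_cstar_hom A Q \<phi>
  for A :: "'a cstar" (structure) and G :: "('g, 'm) monoid_scheme" and \<alpha> s
    and D :: "'d cstar" and \<beta> and Q :: "'q cstar" and \<kappa> p \<phi> +
  fixes B :: "nat \<Rightarrow> 'a set" and e :: "nat \<Rightarrow> 'a" and r :: "('a \<Rightarrow> 'a) \<times> bool \<Rightarrow> 'd"
  assumes phi_act: "\<lbrakk>g \<in> carrier G; x \<in> carrier A\<rbrakk> \<Longrightarrow> \<phi> (\<alpha> g x) = \<kappa> g (\<phi> x)"
    and B: "good (B k)" "B k \<subseteq> B (Suc k)" "B 0 = {}"
    and e: "e k \<in> H" "star A (e k) \<otimes> e k = \<one>" "proj (B k) \<otimes> e k = \<zero>" "proj (B (Suc k)) \<otimes> e k = e k"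
    and s_absorbed: "proj (B (Suc k)) \<otimes> s k = s k"
    and r: "D.orthonormal (\<Gamma> \<times> UNIV) r"
    and r_act: "\<lbrakk>g \<in> carrier G; \<gamma> \<in> \<Gamma>\<rbrakk> \<Longrightarrow> \<beta> g (r (\<gamma>, b)) = r (tr g \<gamma>, b)"
    and r_lift: "\<gamma> \<in> \<Gamma> \<Longrightarrow> p (r (\<gamma>, True)) = \<phi> (\<gamma> (e 1 \<otimes> reg))"
begin

section \<open>Auxiliary isometries and a copy of \<open>H\<close> in the stage algebra\<close>

lemma r_closed [simp]: "\<gamma> \<in> \<Gamma> \<Longrightarrow> r (\<gamma>, b) \<in> carrier D"
  using r by (simp add: D.orthonormal_def)

lemma r_orthonormal: "D.orthonormal \<Gamma> (\<lambda>\<gamma>. r (\<gamma>, b))"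
  using r by (simp add: D.orthonormal_def)

lemma r_star: "\<lbrakk>\<gamma> \<in> \<Gamma>; \<delta> \<in> \<Gamma>\<rbrakk> \<Longrightarrow> star D (r (\<gamma>, False)) \<otimes>\<^bsub>D\<^esub> r (\<delta>, True) = \<zero>\<^bsub>D\<^esub>"
  using r by (simp add: D.orthonormal_def)

definition z :: "bool \<Rightarrow> 'd" where "z b = nf \<odot>\<^bsub>D\<^esub> (\<Oplus>\<^bsub>D\<^esub>\<gamma>\<in>\<Gamma>. r (\<gamma>, b))"

lemma z_fixed: "D.fixed (z b)"
  unfolding z_def by (rule D.normalized_sum_fixed[of _ _ tr]) (auto simp: finite_\<Gamma> tr_bij r_act)

lemma z_closed [simp]: "z b \<in> carrier D" using z_fixed by (rule D.fixedD)

lemma z_isometry: "star D (z b) \<otimes>\<^bsub>D\<^esub> z b = \<one>\<^bsub>D\<^esub>"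
  unfolding z_def by (rule D.normalized_sum_isometry[OF finite_\<Gamma> r_orthonormal nf])

lemma z_r: "\<gamma> \<in> \<Gamma> \<Longrightarrow> star D (z True) \<otimes>\<^bsub>D\<^esub> r (\<gamma>, False) = \<zero>\<^bsub>D\<^esub>"
proof -
  assume g: "\<gamma> \<in> \<Gamma>"
  have "star D (r (\<gamma>, False)) \<otimes>\<^bsub>D\<^esub> z True = \<zero>\<^bsub>D\<^esub>"
    unfolding z_def by (rule D.normalized_sum_cross[OF finite_\<Gamma>]) (use g r_star in auto)
  from arg_cong[OF this, of "star D"] show ?thesis using g by (simp add: D.star_mult)
qed

lemma z_cross: "star D (z True) \<otimes>\<^bsub>D\<^esub> z False = \<zero>\<^bsub>D\<^esub>"
  by (subst (2) z_def, rule D.normalized_sum_cross[OF finite_\<Gamma>]) (auto simp: z_r)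

lemma z_lift: "p (z True) = \<phi> (zeta (e 1))"
proof -
  have "p (\<Oplus>\<^bsub>D\<^esub>\<gamma>\<in>\<Gamma>. r (\<gamma>, True)) = (\<Oplus>\<^bsub>Q\<^esub>\<gamma>\<in>\<Gamma>. p (r (\<gamma>, True)))" by (rule p.finsum[OF finite_\<Gamma>]) simp
  also have "\<dots> = (\<Oplus>\<^bsub>Q\<^esub>\<gamma>\<in>\<Gamma>. \<phi> (\<gamma> (e 1 \<otimes> reg)))" using e(1) by (intro Q.finsum_cong_simp) (auto simp: r_lift)
  also have "\<dots> = \<phi> (\<Oplus>\<gamma>\<in>\<Gamma>. \<gamma> (e 1 \<otimes> reg))" using e(1) by (intro phi.finsum[symmetric] finite_\<Gamma>) simp
  finally show ?thesis
    unfolding z_def zeta_def using e(1) by (simp add: p.smult phi.smult D.finsum_closed' finsum_closed')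
qed

text \<open>Powers of \<open>z False\<close> followed by \<open>z True\<close>: the usual way to
  obtain infinitely many isometries with orthogonal ranges from two of them. All of them are
  fixed.\<close>

definition y :: "nat \<Rightarrow> 'd" where "y = rec_nat (z True) (\<lambda>_ u. z False \<otimes>\<^bsub>D\<^esub> u)"

lemma y_simps: "y 0 = z True" "y (Suc j) = z False \<otimes>\<^bsub>D\<^esub> y j" by (simp_all add: y_def)

lemma y_fixed: "D.fixed (y j)"
  by (induction j) (simp_all add: y_simps z_fixed D.fixed_mult)

lemma y_closed [simp]: "y j \<in> carrier D" using y_fixed by (rule D.fixedD)

lemma y_star: "star D (y i) \<otimes>\<^bsub>D\<^esub> y j = (if i = j then \<one>\<^bsub>D\<^esub> else \<zero>\<^bsub>D\<^esub>)"
proof (induction i arbitrary: j)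
  case 0
  show ?case
  proof (cases j)
    case (Suc n)
    have "star D (z True) \<otimes>\<^bsub>D\<^esub> (z False \<otimes>\<^bsub>D\<^esub> y n) = (star D (z True) \<otimes>\<^bsub>D\<^esub> z False) \<otimes>\<^bsub>D\<^esub> y n"
      by (simp add: D.m_assoc)
    then show ?thesis using Suc by (simp add: y_simps z_cross)
  qed (simp add: y_simps z_isometry)
next
  case (Suc i)
  show ?case
  proof (cases j)
    case 0
    have "star D (z False) \<otimes>\<^bsub>D\<^esub> z True = \<zero>\<^bsub>D\<^esub>"
      using arg_cong[OF z_cross, of "star D"] by (simp add: D.star_mult)
    then show ?thesis using 0 by (simp add: y_simps D.star_mult D.m_assoc)
  next
    case (Suc n)
    have "star D (z False \<otimes>\<^bsub>D\<^esub> y i) \<otimes>\<^bsub>D\<^esub> (z False \<otimes>\<^bsub>D\<^esub> y n)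
        = star D (y i) \<otimes>\<^bsub>D\<^esub> ((star D (z False) \<otimes>\<^bsub>D\<^esub> z False) \<otimes>\<^bsub>D\<^esub> y n)"
      by (simp add: D.star_mult D.m_assoc)
    then show ?thesis using Suc \<open>\<And>j. star D (y i) \<otimes>\<^bsub>D\<^esub> y j = _\<close> by (simp add: y_simps z_isometry)
  qed
qed

text \<open>A homomorphic image of \<open>A\<close> inside the fixed points of \<open>D\<close>,
  whose image in \<open>Q\<close> is not controlled.\<close>

definition Y :: "'a \<Rightarrow> 'd" where "Y = (SOME h. h \<in> cstar_hom A D \<and> (\<forall>j. h (s j) = y j))"

lemma Y_spec: "Y \<in> cstar_hom A D \<and> (\<forall>j. Y (s j) = y j)"
proof -
  have "isometries_orthogonal_ranges D y"
    unfolding D.isometries_orthogonal_ranges_iff by (simp add: D.orthonormal_def y_star)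
  from Cuntz_infinity_universal[OF cuntz D.unital_cstar_axioms this]
  have "\<exists>h. h \<in> cstar_hom A D \<and> (\<forall>j. h (s j) = y j)" unfolding Bex_def .
  then show ?thesis unfolding Y_def by (rule someI_ex)
qed

sublocale Y: unital_cstar_hom A D Y
  by unfold_locales (use Y_spec in blast)

lemma gen: "generates_cstar A (range s)" using cuntz by (simp add: Cuntz_infinity_def)

lemma Y_fixed: assumes x: "x \<in> carrier A" shows "D.fixed (Y x)"
proof (rule D.fixedI)
  fix g assume g: "g \<in> carrier G"
  have "(\<beta> g \<circ> Y) x = Y x"
  proof (rule unital_cstar_hom.eq_of_generators[OF unital_cstar_hom_comp[OF Y.unital_cstar_hom_axioms D.act_hom[OF g]]
        Y.unital_cstar_hom_axioms gen _ x])
    show "(\<beta> g \<circ> Y) x = Y x" if "x \<in> range s" for x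
      using that Y_spec D.fixedD(2)[OF y_fixed g] by auto
  qed
  then show "\<beta> g (Y x) = Y x" by simp
qed (use x in simp)

text \<open>Absorption of \<open>H\<close> by the regular representation. The isometries
  \<open>r (\<gamma>, False)\<close> are translated by the group while the factors
  \<open>Y (inverse_act \<gamma> x)\<close> are fixed, so an equivariant copy of \<open>H\<close>
  arises although \<open>Y\<close> has only fixed values.\<close>

definition T :: "'a \<Rightarrow> 'd" where
  "T x = nf \<odot>\<^bsub>D\<^esub> (\<Oplus>\<^bsub>D\<^esub>\<gamma>\<in>\<Gamma>. r (\<gamma>, False) \<otimes>\<^bsub>D\<^esub> Y (inverse_act \<gamma> x))"

lemma T_summand: "\<lbrakk>x \<in> carrier A; \<gamma> \<in> \<Gamma>\<rbrakk> \<Longrightarrow> r (\<gamma>, False) \<otimes>\<^bsub>D\<^esub> Y (inverse_act \<gamma> x) \<in> carrier D"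
  by (simp add: inverse_act_props(1))

lemma T_closed [simp]: "x \<in> carrier A \<Longrightarrow> T x \<in> carrier D"
  by (simp add: T_def D.finsum_closed' T_summand)

lemma T_add: assumes x: "x \<in> carrier A" "x' \<in> carrier A" shows "T (x \<oplus> x') = T x \<oplus>\<^bsub>D\<^esub> T x'"
proof -
  have "(\<Oplus>\<^bsub>D\<^esub>\<gamma>\<in>\<Gamma>. r (\<gamma>, False) \<otimes>\<^bsub>D\<^esub> Y (inverse_act \<gamma> (x \<oplus> x')))
      = (\<Oplus>\<^bsub>D\<^esub>\<gamma>\<in>\<Gamma>. r (\<gamma>, False) \<otimes>\<^bsub>D\<^esub> Y (inverse_act \<gamma> x) \<oplus>\<^bsub>D\<^esub> r (\<gamma>, False) \<otimes>\<^bsub>D\<^esub> Y (inverse_act \<gamma> x'))"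
    using x by (intro D.finsum_cong_simp) (auto simp: inverse_act_props Y.add D.r_distr)
  also have "\<dots> = (\<Oplus>\<^bsub>D\<^esub>\<gamma>\<in>\<Gamma>. r (\<gamma>, False) \<otimes>\<^bsub>D\<^esub> Y (inverse_act \<gamma> x))
      \<oplus>\<^bsub>D\<^esub> (\<Oplus>\<^bsub>D\<^esub>\<gamma>\<in>\<Gamma>. r (\<gamma>, False) \<otimes>\<^bsub>D\<^esub> Y (inverse_act \<gamma> x'))"
    using x T_summand by (intro D.finsum_add) auto
  finally show ?thesis using x by (simp add: T_def D.smult_add_right D.finsum_closed' T_summand)
qed

lemma T_smult: assumes x: "x \<in> carrier A" shows "T (c \<odot> x) = c \<odot>\<^bsub>D\<^esub> T x"
proof -
  have "(\<Oplus>\<^bsub>D\<^esub>\<gamma>\<in>\<Gamma>. r (\<gamma>, False) \<otimes>\<^bsub>D\<^esub> Y (inverse_act \<gamma> (c \<odot> x)))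
      = (\<Oplus>\<^bsub>D\<^esub>\<gamma>\<in>\<Gamma>. c \<odot>\<^bsub>D\<^esub> (r (\<gamma>, False) \<otimes>\<^bsub>D\<^esub> Y (inverse_act \<gamma> x)))"
    using x by (intro D.finsum_cong_simp) (auto simp: inverse_act_props Y.smult D.smult_mult_right)
  also have "\<dots> = c \<odot>\<^bsub>D\<^esub> (\<Oplus>\<^bsub>D\<^esub>\<gamma>\<in>\<Gamma>. r (\<gamma>, False) \<otimes>\<^bsub>D\<^esub> Y (inverse_act \<gamma> x))"
    using x T_summand by (intro D.smult_finsum[symmetric] finite_\<Gamma>) auto
  finally show ?thesis using x by (simp add: T_def D.finsum_closed' T_summand mult.commute)
qed

text \<open>The group moves only the label of \<open>r\<close>. Replacing \<open>\<gamma>\<close> by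
  \<open>tr g \<gamma>\<close> and \<open>x\<close> by \<open>\<alpha> g x\<close> leaves
  \<open>inverse_act \<gamma> x\<close> unchanged.\<close>

lemma T_act: assumes g: "g \<in> carrier G" and x: "x \<in> carrier A" shows "\<beta> g (T x) = T (\<alpha> g x)"
proof -
  let ?f = "\<lambda>\<gamma>. r (\<gamma>, False) \<otimes>\<^bsub>D\<^esub> Y (inverse_act \<gamma> (\<alpha> g x))"
  have gx: "\<alpha> g x \<in> carrier A" using g x by simp
  have b: "bij_betw (tr g) \<Gamma> \<Gamma>" using g by (rule tr_bij)
  have "\<beta> g (\<Oplus>\<^bsub>D\<^esub>\<gamma>\<in>\<Gamma>. r (\<gamma>, False) \<otimes>\<^bsub>D\<^esub> Y (inverse_act \<gamma> x))
      = (\<Oplus>\<^bsub>D\<^esub>\<gamma>\<in>\<Gamma>. \<beta> g (r (\<gamma>, False) \<otimes>\<^bsub>D\<^esub> Y (inverse_act \<gamma> x)))"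
    using T_summand[OF x] by (intro D.act_finsum[OF g] finite_\<Gamma>) auto
  also have "\<dots> = (\<Oplus>\<^bsub>D\<^esub>\<gamma>\<in>\<Gamma>. ?f (tr g \<gamma>))"
  proof (rule D.finsum_cong_simp)
    fix \<gamma> assume \<gamma>: "\<gamma> \<in> \<Gamma>"
    have c: "inverse_act \<gamma> x \<in> carrier A" using inverse_act_props(1)[OF \<gamma> x] .
    have "\<beta> g (r (\<gamma>, False) \<otimes>\<^bsub>D\<^esub> Y (inverse_act \<gamma> x)) = r (tr g \<gamma>, False) \<otimes>\<^bsub>D\<^esub> Y (inverse_act \<gamma> x)"
      using D.act_mult[OF g r_closed[OF \<gamma>] Y.closed[OF c]] D.fixedD(2)[OF Y_fixed[OF c] g] r_act[OF g \<gamma>] by simp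
    then show "\<beta> g (r (\<gamma>, False) \<otimes>\<^bsub>D\<^esub> Y (inverse_act \<gamma> x)) = ?f (tr g \<gamma>)"
      unfolding inverse_act_props(5)[OF \<gamma> g x] .
    show "?f (tr g \<gamma>) \<in> carrier D" by (rule T_summand[OF gx tr_mem[OF g \<gamma>]])
  qed
  also have "\<dots> = (\<Oplus>\<^bsub>D\<^esub>\<gamma>\<in>tr g ` \<Gamma>. ?f \<gamma>)"
    using b T_summand[OF gx] by (intro D.finsum_reindex[symmetric]) (auto simp: bij_betw_def)
  finally show ?thesis
    using g x b by (simp add: T_def D.act_smult D.finsum_closed' T_summand bij_betw_def)
qed

text \<open>Orthogonality of the \<open>r (\<gamma>, False)\<close> leaves one and the same term for
  each automorphism, and the normalization cancels their number.\<close>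

lemma T_star: assumes x: "x \<in> H" "x' \<in> H" shows "star D (T x) \<otimes>\<^bsub>D\<^esub> T x' = ip x x' \<odot>\<^bsub>D\<^esub> \<one>\<^bsub>D\<^esub>"
proof -
  let ?S = "\<lambda>x. \<Oplus>\<^bsub>D\<^esub>\<gamma>\<in>\<Gamma>. r (\<gamma>, False) \<otimes>\<^bsub>D\<^esub> Y (inverse_act \<gamma> x)"
  have S: "?S x \<in> carrier D" "?S x' \<in> carrier D" using x by (auto intro!: D.finsum_closed' T_summand)
  have "star D (?S x) \<otimes>\<^bsub>D\<^esub> ?S x'
      = (\<Oplus>\<^bsub>D\<^esub>\<gamma>\<in>\<Gamma>. star D (Y (inverse_act \<gamma> x)) \<otimes>\<^bsub>D\<^esub> Y (inverse_act \<gamma> x'))"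
    using x by (intro D.orthonormal_combination[OF finite_\<Gamma> r_orthonormal]) (auto simp: inverse_act_props(1))
  also have "\<dots> = (\<Oplus>\<^bsub>D\<^esub>\<gamma>\<in>\<Gamma>. ip x x' \<odot>\<^bsub>D\<^esub> \<one>\<^bsub>D\<^esub>)"
  proof (rule D.finsum_cong_simp)
    fix \<gamma> assume \<gamma>: "\<gamma> \<in> \<Gamma>"
    have c: "inverse_act \<gamma> x \<in> carrier A" "inverse_act \<gamma> x' \<in> carrier A"
      using inverse_act_props(1)[OF \<gamma>] x by auto
    have "star D (Y (inverse_act \<gamma> x)) \<otimes>\<^bsub>D\<^esub> Y (inverse_act \<gamma> x') = Y (star A (inverse_act \<gamma> x) \<otimes> inverse_act \<gamma> x')"
      using c by (simp add: Y.mult Y.star)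
    then show "star D (Y (inverse_act \<gamma> x)) \<otimes>\<^bsub>D\<^esub> Y (inverse_act \<gamma> x') = ip x x' \<odot>\<^bsub>D\<^esub> \<one>\<^bsub>D\<^esub>"
      unfolding inverse_act_props(4)[OF \<gamma> x] by (simp add: Y.smult)
  qed simp
  also have "\<dots> = of_nat (card \<Gamma>) \<odot>\<^bsub>D\<^esub> (ip x x' \<odot>\<^bsub>D\<^esub> \<one>\<^bsub>D\<^esub>)" by (rule D.finsum_const_smult[OF finite_\<Gamma>]) simp
  finally have 1: "star D (?S x) \<otimes>\<^bsub>D\<^esub> ?S x' = (of_nat (card \<Gamma>) * ip x x') \<odot>\<^bsub>D\<^esub> \<one>\<^bsub>D\<^esub>" by simp
  have "star D (T x) \<otimes>\<^bsub>D\<^esub> T x' = (nf * nf) \<odot>\<^bsub>D\<^esub> (star D (?S x) \<otimes>\<^bsub>D\<^esub> ?S x')"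
    unfolding T_def using S nf(1) by (simp add: D.star_smult D.smult_mult_left D.smult_mult_right)
  also have "\<dots> = (nf * (nf * of_nat (card \<Gamma>)) * ip x x') \<odot>\<^bsub>D\<^esub> \<one>\<^bsub>D\<^esub>" unfolding 1 by (simp add: mult.assoc)
  finally show ?thesis by (simp add: nf(2))
qed

text \<open>The left factors in \<open>T\<close> are copies labelled \<open>False\<close>, so the
  range of \<open>z True\<close> stays free for the next reserved isometry.\<close>

lemma z_T: assumes x: "x \<in> carrier A" shows "star D (z True) \<otimes>\<^bsub>D\<^esub> T x = \<zero>\<^bsub>D\<^esub>"
  unfolding T_def
proof (rule D.normalized_sum_cross[OF finite_\<Gamma>])
  show "star D (z True) \<in> carrier D" by simp
  fix \<gamma> assume \<gamma>: "\<gamma> \<in> \<Gamma>"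
  then have c: "Y (inverse_act \<gamma> x) \<in> carrier D" using x by (simp add: inverse_act_props(1))
  show "r (\<gamma>, False) \<otimes>\<^bsub>D\<^esub> Y (inverse_act \<gamma> x) \<in> carrier D" by (rule T_summand[OF x \<gamma>])

  have "star D (z True) \<otimes>\<^bsub>D\<^esub> (r (\<gamma>, False) \<otimes>\<^bsub>D\<^esub> Y (inverse_act \<gamma> x))
      = (star D (z True) \<otimes>\<^bsub>D\<^esub> r (\<gamma>, False)) \<otimes>\<^bsub>D\<^esub> Y (inverse_act \<gamma> x)"
    using \<gamma> c by (simp add: D.m_assoc)
  then show "star D (z True) \<otimes>\<^bsub>D\<^esub> (r (\<gamma>, False) \<otimes>\<^bsub>D\<^esub> Y (inverse_act \<gamma> x)) = \<zero>\<^bsub>D\<^esub>"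
    unfolding z_r[OF \<gamma>] using c by simp
qed

end

lemma (in unital_cstar) finsum_option:
  assumes fin: "finite C" and F: "F None \<in> carrier A" "\<And>c. c \<in> C \<Longrightarrow> F (Some c) \<in> carrier A"
  shows "(\<Oplus>j\<in>insert None (Some ` C). F j) = F None \<oplus> (\<Oplus>c\<in>C. F (Some c))"
proof -
  have "(\<Oplus>j\<in>insert None (Some ` C). F j) = F None \<oplus> (\<Oplus>j\<in>Some ` C. F j)"
    using fin F by (intro finsum_insert) auto
  also have "(\<Oplus>j\<in>Some ` C. F j) = (\<Oplus>c\<in>C. F (Some c))" using F by (intro finsum_reindex) auto
  finally show ?thesis .
qed

section \<open>Lifting one block after the other\<close>

context cuntz_lifting
begin

definition lin :: "('a \<Rightarrow> 'd) \<Rightarrow> bool" where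
  "lin f \<longleftrightarrow> (\<forall>x\<in>H. f x \<in> carrier D) \<and> (\<forall>x\<in>H. \<forall>x'\<in>H. f (x \<oplus> x') = f x \<oplus>\<^bsub>D\<^esub> f x')
    \<and> (\<forall>c. \<forall>x\<in>H. f (c \<odot> x) = c \<odot>\<^bsub>D\<^esub> f x)"

lemma linD:
  assumes "lin f"
  shows "x \<in> H \<Longrightarrow> f x \<in> carrier D" "\<lbrakk>x \<in> H; x' \<in> H\<rbrakk> \<Longrightarrow> f (x \<oplus> x') = f x \<oplus>\<^bsub>D\<^esub> f x'"
    "x \<in> H \<Longrightarrow> f (c \<odot> x) = c \<odot>\<^bsub>D\<^esub> f x"
  using assms by (simp_all add: lin_def)

lemma lin_zero: assumes "lin f" shows "f \<zero> = \<zero>\<^bsub>D\<^esub>"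
  using linD(3)[OF assms s_mem_H, of 0 0] linD(1)[OF assms s_mem_H, of 0] by simp

lemma lin_diff: assumes f: "lin f" and x: "x \<in> H" "x' \<in> H" shows "f (x \<ominus> x') = f x \<ominus>\<^bsub>D\<^esub> f x'"
proof -
  have "x \<ominus> x' = x \<oplus> (-1) \<odot> x'" using x by (simp add: minus_eq scale_minus1)
  then have "f (x \<ominus> x') = f x \<oplus>\<^bsub>D\<^esub> (-1) \<odot>\<^bsub>D\<^esub> f x'"
    using linD[OF f] x by (simp add: H.scale)
  then show ?thesis using linD(1)[OF f] x by (simp add: D.minus_eq D.scale_minus1)
qed

lemma lin_finsum:
  assumes f: "lin f" and fin: "finite I" and b: "\<And>i. i \<in> I \<Longrightarrow> b i \<in> H"
  shows "f (\<Oplus>i\<in>I. b i) = (\<Oplus>\<^bsub>D\<^esub>i\<in>I. f (b i))"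
  using fin b
proof (induction I rule: finite_induct)
  case empty
  then show ?case using lin_zero[OF f] by simp
next
  case (insert i I)
  have 1: "(\<Oplus>j\<in>insert i I. b j) = b i \<oplus> (\<Oplus>j\<in>I. b j)" using insert by (intro finsum_insert) auto
  have 2: "(\<Oplus>\<^bsub>D\<^esub>j\<in>insert i I. f (b j)) = f (b i) \<oplus>\<^bsub>D\<^esub> (\<Oplus>\<^bsub>D\<^esub>j\<in>I. f (b j))"
    using insert linD(1)[OF f] by (intro D.finsum_insert) auto
  have "(\<Oplus>j\<in>I. b j) \<in> H"
    using insert.prems insert.hyps by (intro subsp_sum[OF subsp_H s_mem_H]) auto
  then show ?case unfolding 1 2 using insert linD(2)[OF f] by simp
qed

lemma lin_proj:
  assumes f: "lin f" and C: "onset C" and x: "x \<in> H"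
  shows "f (proj C \<otimes> x) = (\<Oplus>\<^bsub>D\<^esub>b\<in>C. ip b x \<odot>\<^bsub>D\<^esub> f b)"
proof -
  have C': "finite C" "\<And>b. b \<in> C \<Longrightarrow> b \<in> H" using onset_mem[OF C] by auto
  have "f (proj C \<otimes> x) = (\<Oplus>\<^bsub>D\<^esub>b\<in>C. f (ip b x \<odot> b))"
    unfolding proj_expand[OF C x] using C' by (intro lin_finsum[OF f]) (auto simp: H.scale)
  also have "\<dots> = (\<Oplus>\<^bsub>D\<^esub>b\<in>C. ip b x \<odot>\<^bsub>D\<^esub> f b)"
    using C' linD[OF f] by (intro D.finsum_cong_simp) auto
  finally show ?thesis .
qed

lemma lin_T: assumes w: "w \<in> carrier D" shows "lin (\<lambda>x. w \<otimes>\<^bsub>D\<^esub> T x)"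
  unfolding lin_def using w by (simp add: T_add T_smult D.r_distr D.smult_mult_right)

text \<open>A stage of the construction: \<open>f\<close> lifts \<open>\<phi>\<close> on the range of \<open>proj (B k)\<close>, and \<open>w\<close> is a fixed
  isometry that leaves room for the next block.\<close>

definition stage :: "nat \<Rightarrow> ('a \<Rightarrow> 'd) \<Rightarrow> 'd \<Rightarrow> bool" where
  "stage k f w \<longleftrightarrow> lin f \<and> (\<forall>g\<in>carrier G. \<forall>x\<in>H. \<beta> g (f x) = f (\<alpha> g x))
    \<and> (\<forall>x\<in>H. \<forall>x'\<in>H. star D (f x) \<otimes>\<^bsub>D\<^esub> f x' = ip x (proj (B k) \<otimes> x') \<odot>\<^bsub>D\<^esub> \<one>\<^bsub>D\<^esub>)
    \<and> (\<forall>x\<in>H. p (f x) = \<phi> (proj (B k) \<otimes> x))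
    \<and> D.fixed w \<and> star D w \<otimes>\<^bsub>D\<^esub> w = \<one>\<^bsub>D\<^esub> \<and> (\<forall>x\<in>H. star D w \<otimes>\<^bsub>D\<^esub> f x = \<zero>\<^bsub>D\<^esub>)
    \<and> p w = \<phi> (zeta (e (Suc k)))"

lemma stageD:
  assumes "stage k f w"
  shows "lin f" "\<lbrakk>g \<in> carrier G; x \<in> H\<rbrakk> \<Longrightarrow> \<beta> g (f x) = f (\<alpha> g x)"
    "\<lbrakk>x \<in> H; x' \<in> H\<rbrakk> \<Longrightarrow> star D (f x) \<otimes>\<^bsub>D\<^esub> f x' = ip x (proj (B k) \<otimes> x') \<odot>\<^bsub>D\<^esub> \<one>\<^bsub>D\<^esub>"
    "x \<in> H \<Longrightarrow> p (f x) = \<phi> (proj (B k) \<otimes> x)"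
    "D.fixed w" "star D w \<otimes>\<^bsub>D\<^esub> w = \<one>\<^bsub>D\<^esub>" "x \<in> H \<Longrightarrow> star D w \<otimes>\<^bsub>D\<^esub> f x = \<zero>\<^bsub>D\<^esub>"
    "p w = \<phi> (zeta (e (Suc k)))"
  using assms by (simp_all add: stage_def)

lemma onset_B: "onset (B k)" using B(1) by (rule good_onset)

text \<open>The reserve of stage \<open>k\<close> lies over \<open>e (Suc k)\<close>, so that its
  image is orthogonal to the block lifted next; this is why the copies labelled \<open>True\<close>
  were taken over \<open>e 1\<close>.\<close>

lemma stage_zero: "stage 0 (\<lambda>_. \<zero>\<^bsub>D\<^esub>) (z True)"
proof -
  have P: "proj (B 0) = \<zero>" by (simp add: B(3) proj_def)
  have "ip x (proj (B 0) \<otimes> x') = 0" if "x \<in> H" "x' \<in> H" for x x'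
    unfolding P using that by (intro ip_eqI) (simp_all add: H_zero)
  then show ?thesis
    unfolding stage_def lin_def using z_lift P by (simp add: z_fixed z_isometry)
qed

text \<open>\<open>f\<close> factors through \<open>proj (B k)\<close>, because the Gram identity
  gives norm 0 on the complement. So the frame of \<open>f\<close> over \<open>B k\<close> acts as
  the identity on every value of \<open>f\<close>, translates included, which makes it fixed and
  idempotent.\<close>

lemma stage_frame:
  assumes st: "stage k f w"
  shows "x \<in> H \<Longrightarrow> D.frame (B k) f \<otimes>\<^bsub>D\<^esub> f x = f x"
    and "D.fixed (D.frame (B k) f)" "star D (D.frame (B k) f) = D.frame (B k) f"
    and "D.frame (B k) f \<otimes>\<^bsub>D\<^esub> D.frame (B k) f = D.frame (B k) f"
    and "D.frame (B k) f \<otimes>\<^bsub>D\<^esub> w = \<zero>\<^bsub>D\<^esub>" "p (D.frame (B k) f) = \<phi> (proj (B k))"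
proof -
  note f = stageD[OF st]
  let ?P = "proj (B k)" and ?N = "D.frame (B k) f"
  have o: "onset (B k)" by (rule onset_B)
  have fin: "finite (B k)" and bH: "\<And>b. b \<in> B k \<Longrightarrow> b \<in> H" using onset_mem[OF o] by auto
  have fc: "\<And>b. b \<in> B k \<Longrightarrow> f b \<in> carrier D" using linD(1)[OF f(1)] bH by simp
  have PH: "?P \<otimes> x \<in> H" if "x \<in> H" for x using proj_H[OF o that] .
  have PP: "?P \<otimes> (?P \<otimes> x) = ?P \<otimes> x" if "x \<in> H" for x
    using m_assoc[of ?P ?P x] proj_idem[OF o] o that by simp
  have fP: "f (?P \<otimes> x) = f x" if x: "x \<in> H" for x
  proof -
    define d where "d = x \<ominus> ?P \<otimes> x"
    have dH: "d \<in> H" unfolding d_def using x PH by (intro H_diff)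
    have "?P \<otimes> d = \<zero>" unfolding d_def using x o PP[OF x] by (simp add: minus_eq r_distr r_minus r_neg)
    then have "ip d (?P \<otimes> d) = 0" using dH by (intro ip_eqI) (simp_all add: H_zero)
    then have "star D (f d) \<otimes>\<^bsub>D\<^esub> f d = \<zero>\<^bsub>D\<^esub>" using f(3)[OF dH dH] by simp
    then have "f d = \<zero>\<^bsub>D\<^esub>" by (rule D.eq_zero_of_star_mult[OF linD(1)[OF f(1) dH]])
    then have "f x \<ominus>\<^bsub>D\<^esub> f (?P \<otimes> x) = \<zero>\<^bsub>D\<^esub>" unfolding d_def lin_diff[OF f(1) x PH[OF x]] .
    then show ?thesis using linD(1)[OF f(1)] x PH[OF x] by simp
  qed
  show Nf: "?N \<otimes>\<^bsub>D\<^esub> f x = f x" if x: "x \<in> H" for x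
  proof -
    have "?N \<otimes>\<^bsub>D\<^esub> f x = (\<Oplus>\<^bsub>D\<^esub>b\<in>B k. f b \<otimes>\<^bsub>D\<^esub> (star D (f b) \<otimes>\<^bsub>D\<^esub> f x))"
      using fc linD(1)[OF f(1) x] by (intro D.frame_mult[OF fin])
    also have "\<dots> = (\<Oplus>\<^bsub>D\<^esub>b\<in>B k. ip b (?P \<otimes> x) \<odot>\<^bsub>D\<^esub> f b)"
      using fc bH x by (intro D.finsum_cong_simp) (auto simp: f(3) D.smult_mult_right)
    also have "\<dots> = f (?P \<otimes> (?P \<otimes> x))" by (rule lin_proj[OF f(1) o PH[OF x], symmetric])
    also have "\<dots> = f x" unfolding PP[OF x] by (rule fP[OF x])
    finally show ?thesis .
  qed
  show "star D ?N = ?N" by (rule D.frame_star[OF fin fc])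
  have absorb: "?N \<otimes>\<^bsub>D\<^esub> \<beta> g (f b) = 1 \<odot>\<^bsub>D\<^esub> \<beta> g (f b)" if g: "g \<in> carrier G" and b: "b \<in> B k" for g b
    unfolding f(2)[OF g bH[OF b]] Nf[OF H_act[OF g bH[OF b]]] using linD(1)[OF f(1) H_act[OF g bH[OF b]]] by simp
  have Nc: "?N \<in> carrier D" using fc by (rule D.frame_closed)
  show "D.fixed ?N" by (rule D.frame_absorbing(1)[OF fin fc _ _ absorb]) simp_all
  have "?N \<otimes>\<^bsub>D\<^esub> ?N = 1 \<odot>\<^bsub>D\<^esub> ?N" by (rule D.frame_absorbing(2)[OF fin fc _ _ absorb]) simp_all
  then show "?N \<otimes>\<^bsub>D\<^esub> ?N = ?N" using Nc by simp
  have wc: "w \<in> carrier D" using f(5) by (rule D.fixedD)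
  have "star D (f b) \<otimes>\<^bsub>D\<^esub> w = \<zero>\<^bsub>D\<^esub>" if b: "b \<in> B k" for b
    using arg_cong[OF f(7)[OF bH[OF b]], of "star D"] fc[OF b] wc by (simp add: D.star_mult)
  then have fw: "(\<Oplus>\<^bsub>D\<^esub>b\<in>B k. f b \<otimes>\<^bsub>D\<^esub> (star D (f b) \<otimes>\<^bsub>D\<^esub> w)) = \<zero>\<^bsub>D\<^esub>"
    using fc by (intro D.finsum_zero') simp
  have "?N \<otimes>\<^bsub>D\<^esub> w = (\<Oplus>\<^bsub>D\<^esub>b\<in>B k. f b \<otimes>\<^bsub>D\<^esub> (star D (f b) \<otimes>\<^bsub>D\<^esub> w))"
    using fc wc by (intro D.frame_mult[OF fin])
  then show "?N \<otimes>\<^bsub>D\<^esub> w = \<zero>\<^bsub>D\<^esub>" unfolding fw .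
  have "p ?N = (\<Oplus>\<^bsub>Q\<^esub>b\<in>B k. p (f b \<otimes>\<^bsub>D\<^esub> star D (f b)))"
    unfolding D.frame_def using fc by (intro p.finsum[OF fin]) simp
  also have "\<dots> = (\<Oplus>\<^bsub>Q\<^esub>b\<in>B k. \<phi> (b \<otimes> star A b))"
  proof (rule Q.finsum_cong_simp)
    fix b assume b: "b \<in> B k"
    have pb: "p (f b) = \<phi> b" using f(4)[OF bH[OF b]] proj_mem[OF o b] by simp
    show "p (f b \<otimes>\<^bsub>D\<^esub> star D (f b)) = \<phi> (b \<otimes> star A b)"
      using fc[OF b] bH[OF b] by (simp add: p.mult p.star pb phi.mult phi.star)
  qed (use bH in simp)
  also have "\<dots> = \<phi> ?P" unfolding proj_def using bH by (intro phi.finsum[symmetric] fin) simp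
  finally show "p ?N = \<phi> ?P" .
qed

text \<open>The projection of the new part of a block is the difference of two fixed projections, so
  the new part is invariant by itself.\<close>

lemma block_proj:
  fixes k defines "C \<equiv> B (Suc k) - B k"
  shows "good C" "proj (B (Suc k)) = proj (B k) \<oplus> proj C" "proj (B k) \<otimes> proj C = \<zero>" "proj C \<otimes> proj (B k) = \<zero>"
proof -
  note o = onset_B[of k] onset_B[of "Suc k"]
  have oC: "onset C" unfolding C_def by (rule onset_subset[OF o(2)]) blast
  have "B (Suc k) = B k \<union> C" unfolding C_def using B(2)[of k] by blast
  moreover have "(\<Oplus>b\<in>B k \<union> C. b \<otimes> star A b) = (\<Oplus>b\<in>B k. b \<otimes> star A b) \<oplus> (\<Oplus>b\<in>C. b \<otimes> star A b)"
    using onset_mem[OF o(1)] onset_mem[OF oC] by (intro finsum_Un_disjoint) (auto simp: C_def)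
  ultimately show sum: "proj (B (Suc k)) = proj (B k) \<oplus> proj C" by (simp add: proj_def)
  have c: "proj (B k) \<in> carrier A" "proj C \<in> carrier A" using o oC by simp_all
  have "proj C = proj (B (Suc k)) \<ominus> proj (B k)" unfolding sum using c by (simp add: ring_nf)
  moreover have "fixed (proj (B (Suc k)) \<ominus> proj (B k))" using B(1) by (intro fixed_diff) (simp_all add: good_def)
  ultimately show "good C" using oC by (simp add: good_def)
  have "proj (B k) \<oplus> proj C \<otimes> proj (B k) = proj (B (Suc k)) \<otimes> proj (B k)"
    unfolding sum using c proj_idem[OF o(1)] by (simp add: l_distr)
  also have "\<dots> = proj (B k) \<oplus> \<zero>" using proj_subset[OF o(2) B(2)] c by simp
  finally show 1: "proj C \<otimes> proj (B k) = \<zero>" using c by (simp only: add.l_cancel m_closed zero_closed)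
  from arg_cong[OF 1, of "star A"] show "proj (B k) \<otimes> proj C = \<zero>"
    using c by (simp add: star_mult proj_star o oC)
qed

text \<open>Vanishing under a block projection passes to smaller blocks. Collected here is what the
  next step asks for: the current reserve is orthogonal to the block about to be lifted, and the
  next reserve to both.\<close>

lemma zeta_block:
  "proj (B k) \<otimes> zeta (e k) = \<zero>" "proj (B k) \<otimes> zeta (e (Suc k)) = \<zero>" "proj (B k) \<otimes> zeta (e (Suc (Suc k))) = \<zero>"
  "star A (zeta (e k)) \<otimes> zeta (e k) = \<one>" "star A (zeta (e k)) \<otimes> zeta (e (Suc k)) = \<zero>"
proof -
  have mono: "proj (B j) \<otimes> proj (B (Suc j)) = proj (B j)" for j
    using arg_cong[OF proj_subset[OF onset_B B(2)[of j]], of "star A"]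
    by (simp add: star_mult proj_star onset_B)
  have ec: "e j \<in> carrier A" for j using e(1) by simp
  have z: "proj (B j) \<otimes> zeta (e j) = \<zero>" for j by (rule proj_zeta[OF B(1) ec e(3)])
  have down: "proj (B j) \<otimes> x = \<zero>" if "proj (B (Suc j)) \<otimes> x = \<zero>" "x \<in> carrier A" for j x
  proof -
    have "proj (B j) \<otimes> x = proj (B j) \<otimes> (proj (B (Suc j)) \<otimes> x)"
      using mono[of j] that(2) by (simp add: onset_B flip: m_assoc)
    then show ?thesis using that onset_B by simp
  qed
  show "proj (B k) \<otimes> zeta (e k) = \<zero>" by (rule z)
  show "proj (B k) \<otimes> zeta (e (Suc k)) = \<zero>" by (rule down[OF z zeta_closed[OF ec]])
  show "proj (B k) \<otimes> zeta (e (Suc (Suc k))) = \<zero>" by (rule down[OF down[OF z zeta_closed[OF ec]] zeta_closed[OF ec]])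
  show "star A (zeta (e k)) \<otimes> zeta (e k) = \<one>" by (rule zeta_isometry[OF e(1,2)])
  show "star A (zeta (e k)) \<otimes> zeta (e (Suc k)) = \<zero>"
    by (rule zeta_orthogonal[OF ec ec proj_cross[OF B(1) ec e(4) ec e(3)]])
qed

text \<open>Multiplying \<open>T\<close> by the reserve \<open>w\<close> gives a copy of the new
  block orthogonal to \<open>f\<close>, but with the wrong image in \<open>Q\<close>; rotating by
  \<open>U\<close> moves this image to the one that \<open>\<phi>\<close> prescribes.
  \<open>U\<close> is applied to the new part only, because it is not known to act as the identity
  on the old one.\<close>

lemma stage_step:
  assumes st: "stage k f w"
  shows "\<exists>f' w'. stage (Suc k) f' w' \<and> (\<forall>x\<in>H. proj (B k) \<otimes> x = x \<longrightarrow> f' x = f x)"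
proof -
  note f = stageD[OF st] and N = stage_frame[OF st]
  let ?P = "proj (B k)" and ?N = "D.frame (B k) f"
  define C where "C = B (Suc k) - B k"
  note bp = block_proj[of k, folded C_def]
  define R where "R = proj C"
  have oC: "onset C" using bp(1) by (rule good_onset)
  have finC: "finite C" and CH: "\<And>b. b \<in> C \<Longrightarrow> b \<in> H" using onset_mem[OF oC] by auto
  have Cc: "b \<in> carrier A" if "b \<in> C" for b using CH[OF that] by simp
  have Pc: "?P \<in> carrier A" and Rc: "R \<in> carrier A" and Rs: "star A R = R"
    using onset_B oC by (simp_all add: R_def proj_star)
  have RR: "R \<otimes> R = R" unfolding R_def by (rule proj_idem[OF oC])
  have RH: "R \<otimes> x \<in> H" if "x \<in> H" for x unfolding R_def by (rule proj_H[OF oC that])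
  have Rb: "R \<otimes> b = b" if "b \<in> C" for b unfolding R_def by (rule proj_mem[OF oC that])
  have Ract: "R \<otimes> \<alpha> g x = \<alpha> g (R \<otimes> x)" if "g \<in> carrier G" "x \<in> carrier A" for g x
    unfolding R_def by (rule proj_act[OF bp(1) that])
  have Pb: "?P \<otimes> b = \<zero>" if b: "b \<in> C" for b
  proof -
    have "?P \<otimes> (R \<otimes> b) = (?P \<otimes> R) \<otimes> b" using Pc Rc Cc[OF b] by (simp add: m_assoc)
    then show ?thesis unfolding Rb[OF b] using bp(3) Cc[OF b] by (simp add: R_def)
  qed
  have P'b: "proj (B (Suc k)) \<otimes> b = b" if b: "b \<in> C" for b
    unfolding bp(2) using Pb[OF b] Rb[OF b] Pc Rc Cc[OF b] by (simp add: l_distr R_def)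
  let ?z = "zeta (e (Suc k))" and ?z' = "zeta (e (Suc (Suc k)))"
  have zc: "?z \<in> carrier A" "?z' \<in> carrier A" using e(1) by simp_all
  have bz: "star A b \<otimes> ?z = \<zero>" "star A b \<otimes> ?z' = \<zero>" if b: "b \<in> C" for b
    using proj_left_zero[OF onset_B Cc[OF b] P'b[OF b] zc(1) zeta_block(1)]
      proj_left_zero[OF onset_B Cc[OF b] P'b[OF b] zc(2) zeta_block(2)] by simp_all
  have zb: "star A ?z \<otimes> b = \<zero>" "star A ?z' \<otimes> b = \<zero>" if b: "b \<in> C" for b
    using arg_cong[OF bz(1)[OF b], of "star A"] arg_cong[OF bz(2)[OF b], of "star A"] Cc[OF b] zc
    by (simp_all add: star_mult)
  have bb: "star A b \<otimes> c = (if b = c then \<one> else \<zero>)" if "b \<in> C" "c \<in> C" for b c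
    by (rule onset_star[OF oC that])
  have ipb: "ip b c = (if b = c then 1 else 0)" if "b \<in> C" "c \<in> C" for b c
    by (rule ip_eqI[OF CH[OF that(1)] CH[OF that(2)]]) (use bb[OF that] in simp)
  have wc: "w \<in> carrier D" using f(5) by (rule D.fixedD)
  have ww: "star D (w \<otimes>\<^bsub>D\<^esub> a) \<otimes>\<^bsub>D\<^esub> (w \<otimes>\<^bsub>D\<^esub> b) = star D a \<otimes>\<^bsub>D\<^esub> b" if "a \<in> carrier D" "b \<in> carrier D" for a b
  proof -
    have "star D (w \<otimes>\<^bsub>D\<^esub> a) \<otimes>\<^bsub>D\<^esub> (w \<otimes>\<^bsub>D\<^esub> b) = star D a \<otimes>\<^bsub>D\<^esub> ((star D w \<otimes>\<^bsub>D\<^esub> w) \<otimes>\<^bsub>D\<^esub> b)"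
      using wc that by (simp add: D.star_mult D.m_assoc)
    then show ?thesis unfolding f(6) using that by simp
  qed
  define h where "h x = w \<otimes>\<^bsub>D\<^esub> T x" for x
  have hl: "lin h" unfolding h_def by (rule lin_T[OF wc])
  have hc: "x \<in> H \<Longrightarrow> h x \<in> carrier D" for x using linD(1)[OF hl] .
  have hh: "star D (h x) \<otimes>\<^bsub>D\<^esub> h x' = ip x x' \<odot>\<^bsub>D\<^esub> \<one>\<^bsub>D\<^esub>" if "x \<in> H" "x' \<in> H" for x x'
    unfolding h_def using that by (simp add: ww T_star)
  have hact: "\<beta> g (h x) = h (\<alpha> g x)" if "g \<in> carrier G" "x \<in> H" for g x
    unfolding h_def using that wc D.fixedD(2)[OF f(5) that(1)] by (simp add: D.act_mult T_act)
  have zT: "star D (T x) \<otimes>\<^bsub>D\<^esub> z True = \<zero>\<^bsub>D\<^esub>" if "x \<in> H" for x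
    using arg_cong[OF z_T[OF H_carrier[OF that]], of "star D"] that by (simp add: D.star_mult)
  \<comment> \<open>\<open>None\<close> stands for the next reserve, carved out of the range of
    \<open>w\<close>. It is rotated together with the block because its image is prescribed as
    well.\<close>
  define t where "t = case_option (w \<otimes>\<^bsub>D\<^esub> z True) h"
  define v where "v = case_option (\<phi> ?z') \<phi>"
  have tv: "t None = w \<otimes>\<^bsub>D\<^esub> z True" "t (Some b) = h b" "v None = \<phi> ?z'" "v (Some b) = \<phi> b" for b
    by (simp_all add: t_def v_def)
  let ?I = "insert None (Some ` C)"
  have fin: "finite ?I" using finC by simp
  have tc: "t i \<in> carrier D" if "i \<in> ?I" for i using that wc CH by (auto simp: tv hc)
  have vc: "v i \<in> carrier Q" if "i \<in> ?I" for i using that zc Cc by (auto simp: tv)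
  have tt: "star D (t i) \<otimes>\<^bsub>D\<^esub> t j = (if i = j then \<one>\<^bsub>D\<^esub> else \<zero>\<^bsub>D\<^esub>)" if "i \<in> ?I" "j \<in> ?I" for i j
  proof -
    have 1: "star D (w \<otimes>\<^bsub>D\<^esub> z True) \<otimes>\<^bsub>D\<^esub> h b = \<zero>\<^bsub>D\<^esub>" "star D (h b) \<otimes>\<^bsub>D\<^esub> (w \<otimes>\<^bsub>D\<^esub> z True) = \<zero>\<^bsub>D\<^esub>" if "b \<in> C" for b
      unfolding h_def using CH[OF that] by (simp_all add: ww z_T zT)
    have 2: "star D (w \<otimes>\<^bsub>D\<^esub> z True) \<otimes>\<^bsub>D\<^esub> (w \<otimes>\<^bsub>D\<^esub> z True) = \<one>\<^bsub>D\<^esub>" by (simp add: ww z_isometry)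
    have 3: "star D (h b) \<otimes>\<^bsub>D\<^esub> h c = (if b = c then \<one>\<^bsub>D\<^esub> else \<zero>\<^bsub>D\<^esub>)" if "b \<in> C" "c \<in> C" for b c
      unfolding hh[OF CH[OF that(1)] CH[OF that(2)]] ipb[OF that] by simp
    show ?thesis using that 1 2 3 by (auto simp: tv split: if_splits)
  qed
  have u: "Q.orthonormal ?I (\<lambda>i. p (t i))"
    unfolding Q.orthonormal_def
  proof (intro conjI ballI)
    fix i j assume ij: "i \<in> ?I" "j \<in> ?I"
    have "star Q (p (t i)) \<otimes>\<^bsub>Q\<^esub> p (t j) = p (star D (t i) \<otimes>\<^bsub>D\<^esub> t j)"
      using tc[OF ij(1)] tc[OF ij(2)] by (simp add: p.mult p.star)
    then show "star Q (p (t i)) \<otimes>\<^bsub>Q\<^esub> p (t j) = (if i = j then \<one>\<^bsub>Q\<^esub> else \<zero>\<^bsub>Q\<^esub>)"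
      unfolding tt[OF ij] by simp
  qed (use tc in simp)
  have phi_star: "star Q (\<phi> x) \<otimes>\<^bsub>Q\<^esub> \<phi> x' = \<phi> (star A x \<otimes> x')" if "x \<in> carrier A" "x' \<in> carrier A" for x x'
    using that by (simp add: phi.mult phi.star)
  have vo: "Q.orthonormal ?I v"
    unfolding Q.orthonormal_def
  proof (intro conjI ballI)
    fix i j assume ij: "i \<in> ?I" "j \<in> ?I"
    have 2: "star A ?z' \<otimes> ?z' = \<one>" by (rule zeta_block(4))
    show "star Q (v i) \<otimes>\<^bsub>Q\<^esub> v j = (if i = j then \<one>\<^bsub>Q\<^esub> else \<zero>\<^bsub>Q\<^esub>)"
      using ij zc Cc by (auto simp: tv phi_star bb bz zb 2 split: if_splits)
  qed (use vc in simp)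
  have zv: "star Q (\<phi> ?z) \<otimes>\<^bsub>Q\<^esub> v j = \<zero>\<^bsub>Q\<^esub>" if "j \<in> ?I" for j
    using that zc Cc by (auto simp: tv phi_star zb zeta_block(5))
  have tw: "\<exists>a\<in>carrier D. t i = w \<otimes>\<^bsub>D\<^esub> a" if i: "i \<in> ?I" for i
  proof (cases i)
    case None
    then show ?thesis by (intro bexI[of _ "z True"]) (simp_all add: tv)
  next
    case (Some b)
    then have "b \<in> C" using i by auto
    then show ?thesis using Some Cc by (intro bexI[of _ "T b"]) (simp_all add: tv h_def)
  qed
  \<comment> \<open>All \<open>t i\<close> lie in the range of \<open>w\<close>, whose image is
    \<open>\<phi> ?z\<close>, so the claim reduces to orthogonality of the current reserve to the
    new block and to the next reserve.\<close>
  have uv: "star Q (p (t i)) \<otimes>\<^bsub>Q\<^esub> v j = \<zero>\<^bsub>Q\<^esub>" if ij: "i \<in> ?I" "j \<in> ?I" for i j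
  proof -
    obtain a where a: "a \<in> carrier D" "t i = w \<otimes>\<^bsub>D\<^esub> a" using tw[OF ij(1)] ..
    have "star Q (p (t i)) \<otimes>\<^bsub>Q\<^esub> v j = star Q (p a) \<otimes>\<^bsub>Q\<^esub> (star Q (\<phi> ?z) \<otimes>\<^bsub>Q\<^esub> v j)"
      unfolding a(2) using a(1) wc vc[OF ij(2)] zc by (simp add: p.mult Q.star_mult Q.m_assoc f(8))
    then show ?thesis unfolding zv[OF ij(2)] using a(1) by simp
  qed
  have Nc: "?N \<in> carrier D" using N(2) by (rule D.fixedD)
  have Nt: "?N \<otimes>\<^bsub>D\<^esub> t i = \<zero>\<^bsub>D\<^esub>" if i: "i \<in> ?I" for i
  proof -
    obtain a where a: "a \<in> carrier D" "t i = w \<otimes>\<^bsub>D\<^esub> a" using tw[OF i] ..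
    have "?N \<otimes>\<^bsub>D\<^esub> t i = (?N \<otimes>\<^bsub>D\<^esub> w) \<otimes>\<^bsub>D\<^esub> a" unfolding a(2) using a(1) wc Nc by (simp add: D.m_assoc)
    then show ?thesis unfolding N(5) using a(1) by simp
  qed
  have Nv: "p ?N \<otimes>\<^bsub>Q\<^esub> v i = \<zero>\<^bsub>Q\<^esub>" if "i \<in> ?I" for i
  proof -
    have 1: "\<phi> ?P \<otimes>\<^bsub>Q\<^esub> \<phi> x = \<phi> (?P \<otimes> x)" if "x \<in> carrier A" for x using that Pc by (simp add: phi.mult)
    show ?thesis unfolding N(6) using that zc Cc by (auto simp: tv 1 Pb zeta_block(3))
  qed
  have hR: "p (h (R \<otimes> x)) = (\<Oplus>\<^bsub>Q\<^esub>b\<in>C. ip b x \<odot>\<^bsub>Q\<^esub> p (h b))" if x: "x \<in> H" for x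
  proof -
    have "p (h (R \<otimes> x)) = (\<Oplus>\<^bsub>Q\<^esub>b\<in>C. p (ip b x \<odot>\<^bsub>D\<^esub> h b))"
      unfolding R_def lin_proj[OF hl oC x] using hc CH by (intro p.finsum finC) simp
    also have "\<dots> = (\<Oplus>\<^bsub>Q\<^esub>b\<in>C. ip b x \<odot>\<^bsub>Q\<^esub> p (h b))"
      using hc CH by (intro Q.finsum_cong_simp) (auto simp: p.smult)
    finally show ?thesis .
  qed
  have phiR: "\<phi> (R \<otimes> x) = (\<Oplus>\<^bsub>Q\<^esub>b\<in>C. ip b x \<odot>\<^bsub>Q\<^esub> \<phi> b)" if x: "x \<in> H" for x
  proof -
    have "\<phi> (R \<otimes> x) = (\<Oplus>\<^bsub>Q\<^esub>b\<in>C. \<phi> (ip b x \<odot> b))"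
      unfolding R_def proj_expand[OF oC x] using Cc by (intro phi.finsum finC) simp
    also have "\<dots> = (\<Oplus>\<^bsub>Q\<^esub>b\<in>C. ip b x \<odot>\<^bsub>Q\<^esub> \<phi> b)"
      using Cc by (intro Q.finsum_cong_simp) (auto simp: phi.smult)
    finally show ?thesis .
  qed
  \<comment> \<open>On \<open>Some\<close> indices both families transform by the matrix
    \<open>ip c (\<alpha> g b)\<close> of the action on the new block; the \<open>None\<close>
    members are fixed.\<close>
  have coeff: "\<exists>a. \<kappa> g (p (t i)) = (\<Oplus>\<^bsub>Q\<^esub>j\<in>?I. a j \<odot>\<^bsub>Q\<^esub> p (t j)) \<and> \<kappa> g (v i) = (\<Oplus>\<^bsub>Q\<^esub>j\<in>?I. a j \<odot>\<^bsub>Q\<^esub> v j)"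
    if g: "g \<in> carrier G" and i: "i \<in> ?I" for g i
  proof (cases i)
    case None
    let ?a = "\<lambda>j :: 'a option. if j = None then 1 else 0 :: complex"
    have wz: "D.fixed (w \<otimes>\<^bsub>D\<^esub> z True)" by (intro D.fixed_mult f(5) z_fixed)
    have 1: "\<kappa> g (p (t i)) = p (t None)" unfolding None
      using equivariant[OF g tc[of None]] D.fixedD(2)[OF wz g] by (simp add: tv)
    have 2: "\<kappa> g (v i) = v None" unfolding None
      using phi_act[OF g zc(2)] fixedD(2)[OF zeta_fixed[OF H_carrier[OF e(1)]] g] by (simp add: tv)
    have "(\<Oplus>\<^bsub>Q\<^esub>j\<in>?I. ?a j \<odot>\<^bsub>Q\<^esub> x j) = x None" if x: "\<And>j. j \<in> ?I \<Longrightarrow> x j \<in> carrier Q" for x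
    proof -
      have "(\<Oplus>\<^bsub>Q\<^esub>j\<in>?I. ?a j \<odot>\<^bsub>Q\<^esub> x j) = ?a None \<odot>\<^bsub>Q\<^esub> x None"
        by (rule Q.finsum_delta[OF fin]) (use x in auto)
      then show ?thesis using x[of None] by simp
    qed
    then show ?thesis unfolding 1 2 using tc vc by (intro exI[of _ ?a]) simp
  next
    case (Some b)
    then have b: "b \<in> C" using i by auto
    have gH: "\<alpha> g b \<in> H" using H_act[OF g CH[OF b]] .
    have Rg: "R \<otimes> \<alpha> g b = \<alpha> g b" using Ract[OF g Cc[OF b]] Rb[OF b] by simp
    let ?a = "case_option 0 (\<lambda>c. ip c (\<alpha> g b))"
    have a: "(\<Oplus>\<^bsub>Q\<^esub>j\<in>?I. ?a j \<odot>\<^bsub>Q\<^esub> x j) = (\<Oplus>\<^bsub>Q\<^esub>c\<in>C. ip c (\<alpha> g b) \<odot>\<^bsub>Q\<^esub> x (Some c))"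
      if x: "\<And>j. j \<in> ?I \<Longrightarrow> x j \<in> carrier Q" for x
    proof -
      have "(\<Oplus>\<^bsub>Q\<^esub>j\<in>?I. ?a j \<odot>\<^bsub>Q\<^esub> x j) = ?a None \<odot>\<^bsub>Q\<^esub> x None \<oplus>\<^bsub>Q\<^esub> (\<Oplus>\<^bsub>Q\<^esub>c\<in>C. ?a (Some c) \<odot>\<^bsub>Q\<^esub> x (Some c))"
        using x by (intro Q.finsum_option finC) auto
      moreover have "(\<Oplus>\<^bsub>Q\<^esub>c\<in>C. ip c (\<alpha> g b) \<odot>\<^bsub>Q\<^esub> x (Some c)) \<in> carrier Q" using x by (intro Q.finsum_closed') auto
      ultimately show ?thesis using x[of None] by simp
    qed
    have "\<kappa> g (p (t i)) = p (h (R \<otimes> \<alpha> g b))"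
      unfolding Some Rg using equivariant[OF g hc[OF CH[OF b]]] hact[OF g CH[OF b]] by (simp add: tv)
    also have "\<dots> = (\<Oplus>\<^bsub>Q\<^esub>j\<in>?I. ?a j \<odot>\<^bsub>Q\<^esub> p (t j))"
      unfolding hR[OF gH] by (subst a) (use tc in \<open>simp_all add: tv\<close>)
    finally have 1: "\<kappa> g (p (t i)) = (\<Oplus>\<^bsub>Q\<^esub>j\<in>?I. ?a j \<odot>\<^bsub>Q\<^esub> p (t j))" .
    have "\<kappa> g (v i) = \<phi> (R \<otimes> \<alpha> g b)" unfolding Some Rg using phi_act[OF g Cc[OF b]] by (simp add: tv)
    also have "\<dots> = (\<Oplus>\<^bsub>Q\<^esub>j\<in>?I. ?a j \<odot>\<^bsub>Q\<^esub> v j)"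
      unfolding phiR[OF gH] by (subst a) (use vc in \<open>simp_all add: tv\<close>)
    finally show ?thesis using 1 by (intro exI[of _ ?a]) simp
  qed
  obtain U where U: "D.fixed U" "star D U \<otimes>\<^bsub>D\<^esub> U = \<one>\<^bsub>D\<^esub>" "U \<otimes>\<^bsub>D\<^esub> ?N = ?N \<otimes>\<^bsub>D\<^esub> U"
    and Ut: "\<And>i. i \<in> ?I \<Longrightarrow> p U \<otimes>\<^bsub>Q\<^esub> p (t i) = v i"
  proof (rule rotate[OF fin tc N(2,3,4) Nt u vo uv Nv coeff])
    fix U assume U: "D.fixed U" "star D U \<otimes>\<^bsub>D\<^esub> U = \<one>\<^bsub>D\<^esub>" "U \<otimes>\<^bsub>D\<^esub> ?N = ?N \<otimes>\<^bsub>D\<^esub> U"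
      "\<And>i. i \<in> ?I \<Longrightarrow> p U \<otimes>\<^bsub>Q\<^esub> p (t i) = v i"
    show thesis by (rule that[OF U(1-3)]) (rule U(4))
  qed
  have Uc: "U \<in> carrier D" using U(1) by (rule D.fixedD)
  have UU: "star D (U \<otimes>\<^bsub>D\<^esub> a) \<otimes>\<^bsub>D\<^esub> (U \<otimes>\<^bsub>D\<^esub> b) = star D a \<otimes>\<^bsub>D\<^esub> b" if "a \<in> carrier D" "b \<in> carrier D" for a b
  proof -
    have "star D (U \<otimes>\<^bsub>D\<^esub> a) \<otimes>\<^bsub>D\<^esub> (U \<otimes>\<^bsub>D\<^esub> b) = star D a \<otimes>\<^bsub>D\<^esub> ((star D U \<otimes>\<^bsub>D\<^esub> U) \<otimes>\<^bsub>D\<^esub> b)"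
      using Uc that by (simp add: D.star_mult D.m_assoc)
    then show ?thesis unfolding U(2) using that by simp
  qed
  \<comment> \<open>\<open>U\<close> commutes with the frame \<open>?N\<close>, which annihilates
    \<open>w\<close>, so rotated elements stay orthogonal to all values of \<open>f\<close>.\<close>
  have Uwf: "star D (U \<otimes>\<^bsub>D\<^esub> (w \<otimes>\<^bsub>D\<^esub> a)) \<otimes>\<^bsub>D\<^esub> f x = \<zero>\<^bsub>D\<^esub>" if a: "a \<in> carrier D" and x: "x \<in> H" for a x
  proof -
    have fx: "f x \<in> carrier D" using linD(1)[OF f(1) x] .
    have "?N \<otimes>\<^bsub>D\<^esub> (U \<otimes>\<^bsub>D\<^esub> (w \<otimes>\<^bsub>D\<^esub> a)) = (?N \<otimes>\<^bsub>D\<^esub> U) \<otimes>\<^bsub>D\<^esub> (w \<otimes>\<^bsub>D\<^esub> a)" using Nc Uc wc a by (simp add: D.m_assoc)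
    also have "\<dots> = U \<otimes>\<^bsub>D\<^esub> ((?N \<otimes>\<^bsub>D\<^esub> w) \<otimes>\<^bsub>D\<^esub> a)" unfolding U(3)[symmetric] using Nc Uc wc a by (simp add: D.m_assoc)
    also have "\<dots> = \<zero>\<^bsub>D\<^esub>" unfolding N(5) using Uc a by simp
    finally have 1: "?N \<otimes>\<^bsub>D\<^esub> (U \<otimes>\<^bsub>D\<^esub> (w \<otimes>\<^bsub>D\<^esub> a)) = \<zero>\<^bsub>D\<^esub>" .
    have "star D (U \<otimes>\<^bsub>D\<^esub> (w \<otimes>\<^bsub>D\<^esub> a)) \<otimes>\<^bsub>D\<^esub> f x = star D (U \<otimes>\<^bsub>D\<^esub> (w \<otimes>\<^bsub>D\<^esub> a)) \<otimes>\<^bsub>D\<^esub> (?N \<otimes>\<^bsub>D\<^esub> f x)"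
      unfolding N(1)[OF x] ..
    also have "\<dots> = star D (?N \<otimes>\<^bsub>D\<^esub> (U \<otimes>\<^bsub>D\<^esub> (w \<otimes>\<^bsub>D\<^esub> a))) \<otimes>\<^bsub>D\<^esub> f x"
      using D.star_mult[of ?N "U \<otimes>\<^bsub>D\<^esub> (w \<otimes>\<^bsub>D\<^esub> a)"] N(3) Nc Uc wc a fx by (simp add: D.m_assoc)
    finally show ?thesis unfolding 1 using fx by simp
  qed
  \<comment> \<open>\<open>R\<close> restricts the copy of \<open>H\<close> to the new block, so
    that nothing is added on the old one.\<close>
  define m where "m x = U \<otimes>\<^bsub>D\<^esub> h (R \<otimes> x)" for x
  define f' where "f' x = f x \<oplus>\<^bsub>D\<^esub> m x" for x
  define w' where "w' = U \<otimes>\<^bsub>D\<^esub> (w \<otimes>\<^bsub>D\<^esub> z True)"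
  have fc: "f x \<in> carrier D" if "x \<in> H" for x using linD(1)[OF f(1) that] .
  have mc: "m x \<in> carrier D" if "x \<in> H" for x unfolding m_def using Uc hc[OF RH[OF that]] by simp
  have mf: "star D (m x) \<otimes>\<^bsub>D\<^esub> f x' = \<zero>\<^bsub>D\<^esub>" if "x \<in> H" "x' \<in> H" for x x'
    unfolding m_def h_def using RH[OF that(1)] by (intro Uwf that(2)) simp
  have fm: "star D (f x') \<otimes>\<^bsub>D\<^esub> m x = \<zero>\<^bsub>D\<^esub>" if "x \<in> H" "x' \<in> H" for x x'
    using arg_cong[OF mf[OF that], of "star D"] mc[OF that(1)] fc[OF that(2)] by (simp add: D.star_mult)
  have mm: "star D (m x) \<otimes>\<^bsub>D\<^esub> m x' = ip (R \<otimes> x) (R \<otimes> x') \<odot>\<^bsub>D\<^esub> \<one>\<^bsub>D\<^esub>" if "x \<in> H" "x' \<in> H" for x x'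
    unfolding m_def using UU[OF hc hc, OF RH[OF that(1)] RH[OF that(2)]] hh[OF RH[OF that(1)] RH[OF that(2)]] by simp
  have wc': "w \<otimes>\<^bsub>D\<^esub> z True \<in> carrier D" using wc by simp
  have wf': "star D w' \<otimes>\<^bsub>D\<^esub> f x = \<zero>\<^bsub>D\<^esub>" if "x \<in> H" for x unfolding w'_def by (rule Uwf[OF z_closed that])
  have wm': "star D w' \<otimes>\<^bsub>D\<^esub> m x = \<zero>\<^bsub>D\<^esub>" if x: "x \<in> H" for x
    unfolding w'_def m_def UU[OF wc' hc[OF RH[OF x]]] unfolding h_def
    using RH[OF x] by (simp add: ww z_T)
  have w'c: "w' \<in> carrier D" unfolding w'_def using Uc wc' by simp
  have "stage (Suc k) f' w'"
    unfolding stage_def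
  proof (intro conjI ballI)
    have mlin: "m (x \<oplus> x') = m x \<oplus>\<^bsub>D\<^esub> m x'" "m (c \<odot> x) = c \<odot>\<^bsub>D\<^esub> m x" if "x \<in> H" "x' \<in> H" for x x' c
    proof -
      have xc: "x \<in> carrier A" "x' \<in> carrier A" using that by simp_all
      have 1: "R \<otimes> (x \<oplus> x') = R \<otimes> x \<oplus> R \<otimes> x'" "R \<otimes> (c \<odot> x) = c \<odot> (R \<otimes> x)"
        using xc Rc by (simp_all add: r_distr smult_mult_right)
      show "m (x \<oplus> x') = m x \<oplus>\<^bsub>D\<^esub> m x'" "m (c \<odot> x) = c \<odot>\<^bsub>D\<^esub> m x"
        unfolding m_def 1 using linD(2,3)[OF hl] RH[OF that(1)] RH[OF that(2)] hc Uc
        by (simp_all add: D.r_distr D.smult_mult_right)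
    qed
    show "lin f'"
      unfolding lin_def f'_def
    proof (intro conjI ballI allI)
      fix x x' assume x: "x \<in> H" "x' \<in> H"
      show "f (x \<oplus> x') \<oplus>\<^bsub>D\<^esub> m (x \<oplus> x') = f x \<oplus>\<^bsub>D\<^esub> m x \<oplus>\<^bsub>D\<^esub> (f x' \<oplus>\<^bsub>D\<^esub> m x')"
        unfolding linD(2)[OF f(1) x] mlin(1)[OF x] using fc x mc by (simp add: D.a_ac)
    next
      fix c x assume x: "x \<in> H"
      show "f (c \<odot> x) \<oplus>\<^bsub>D\<^esub> m (c \<odot> x) = c \<odot>\<^bsub>D\<^esub> (f x \<oplus>\<^bsub>D\<^esub> m x)"
        unfolding linD(3)[OF f(1) x] mlin(2)[OF x x] using fc x mc by (simp add: D.smult_add_right)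
    qed (use fc mc in simp)
    show "\<beta> g (f' x) = f' (\<alpha> g x)" if g: "g \<in> carrier G" and x: "x \<in> H" for g x
    proof -
      have "\<beta> g (m x) = m (\<alpha> g x)"
        unfolding m_def Ract[OF g H_carrier[OF x]]
        using D.act_mult[OF g Uc hc[OF RH[OF x]]] D.fixedD(2)[OF U(1) g] hact[OF g RH[OF x]] by simp
      then show ?thesis unfolding f'_def using D.act_add[OF g fc[OF x] mc[OF x]] f(2)[OF g x] by simp
    qed
    show "star D (f' x) \<otimes>\<^bsub>D\<^esub> f' x' = ip x (proj (B (Suc k)) \<otimes> x') \<odot>\<^bsub>D\<^esub> \<one>\<^bsub>D\<^esub>" if x: "x \<in> H" "x' \<in> H" for x x'
    proof -
      have xc: "x \<in> carrier A" "x' \<in> carrier A" using x by simp_all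
      have "star A (R \<otimes> x) \<otimes> (R \<otimes> x') = star A x \<otimes> ((R \<otimes> R) \<otimes> x')"
        using xc Rc Rs by (simp add: star_mult m_assoc)
      then have 1: "star A (R \<otimes> x) \<otimes> (R \<otimes> x') = star A x \<otimes> (R \<otimes> x')" unfolding RR .
      have "star A x \<otimes> (proj (B (Suc k)) \<otimes> x') = star A x \<otimes> (?P \<otimes> x') \<oplus> star A (R \<otimes> x) \<otimes> (R \<otimes> x')"
        unfolding 1 bp(2) R_def[symmetric] using xc Pc Rc by (simp add: l_distr r_distr)
      also have "\<dots> = (ip x (?P \<otimes> x') + ip (R \<otimes> x) (R \<otimes> x')) \<odot> \<one>"
        unfolding ip[OF x(1) proj_H[OF onset_B x(2)]] ip[OF RH[OF x(1)] RH[OF x(2)]] by (simp add: smult_add_left)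
      finally have 2: "ip x (proj (B (Suc k)) \<otimes> x') = ip x (?P \<otimes> x') + ip (R \<otimes> x) (R \<otimes> x')"
        by (rule ip_eqI[OF x(1) proj_H[OF onset_B x(2)]])
      have "star D (f' x) \<otimes>\<^bsub>D\<^esub> f' x' = (star D (f x) \<otimes>\<^bsub>D\<^esub> f x' \<oplus>\<^bsub>D\<^esub> star D (f x) \<otimes>\<^bsub>D\<^esub> m x')
          \<oplus>\<^bsub>D\<^esub> (star D (m x) \<otimes>\<^bsub>D\<^esub> f x' \<oplus>\<^bsub>D\<^esub> star D (m x) \<otimes>\<^bsub>D\<^esub> m x')"
        unfolding f'_def using fc x mc by (simp add: D.star_add D.l_distr D.r_distr D.a_ac)
      then show ?thesis unfolding mf[OF x] fm[OF x(2,1)] mm[OF x] f(3)[OF x] 2 by (simp add: D.smult_add_left)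
    qed
    show "p (f' x) = \<phi> (proj (B (Suc k)) \<otimes> x)" if x: "x \<in> H" for x
    proof -
      have "p (m x) = (\<Oplus>\<^bsub>Q\<^esub>b\<in>C. p U \<otimes>\<^bsub>Q\<^esub> (ip b x \<odot>\<^bsub>Q\<^esub> p (h b)))"
        unfolding m_def p.mult[OF Uc hc[OF RH[OF x]]] hR[OF x] using Uc hc CH by (intro Q.mult_finsum finC) auto
      also have "\<dots> = (\<Oplus>\<^bsub>Q\<^esub>b\<in>C. ip b x \<odot>\<^bsub>Q\<^esub> \<phi> b)"
      proof (rule Q.finsum_cong_simp)
        fix b assume b: "b \<in> C"
        have "p U \<otimes>\<^bsub>Q\<^esub> p (h b) = \<phi> b" using Ut[of "Some b"] b by (simp add: tv)
        then show "p U \<otimes>\<^bsub>Q\<^esub> (ip b x \<odot>\<^bsub>Q\<^esub> p (h b)) = ip b x \<odot>\<^bsub>Q\<^esub> \<phi> b"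
          using Uc hc[OF CH[OF b]] by (simp add: Q.smult_mult_right)
      qed (use Cc in simp)
      also have "\<dots> = \<phi> (R \<otimes> x)" by (rule phiR[OF x, symmetric])
      finally have "p (f' x) = \<phi> (?P \<otimes> x) \<oplus>\<^bsub>Q\<^esub> \<phi> (R \<otimes> x)"
        unfolding f'_def p.add[OF fc[OF x] mc[OF x]] f(4)[OF x] by simp
      also have "\<dots> = \<phi> (proj (B (Suc k)) \<otimes> x)"
        unfolding bp(2) R_def[symmetric] using Pc Rc x by (simp add: l_distr phi.add)
      finally show ?thesis .
    qed
    show "D.fixed w'" unfolding w'_def by (intro D.fixed_mult U(1) f(5) z_fixed)
    show "star D w' \<otimes>\<^bsub>D\<^esub> w' = \<one>\<^bsub>D\<^esub>" unfolding w'_def UU[OF wc' wc'] by (simp add: ww z_isometry)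
    show "star D w' \<otimes>\<^bsub>D\<^esub> f' x = \<zero>\<^bsub>D\<^esub>" if x: "x \<in> H" for x
      unfolding f'_def using wf'[OF x] wm'[OF x] w'c fc[OF x] mc[OF x] by (simp add: D.r_distr)
    show "p w' = \<phi> (zeta (e (Suc (Suc k))))"
      unfolding w'_def p.mult[OF Uc wc'] using Ut[of None] by (simp add: tv)
  qed
  \<comment> \<open>Vectors of the old block are killed by \<open>R\<close>, so earlier values are
    never revised.\<close>
  moreover have "f' x = f x" if x: "x \<in> H" "?P \<otimes> x = x" for x
  proof -
    have "R \<otimes> (?P \<otimes> x) = (R \<otimes> ?P) \<otimes> x" using Rc Pc x(1) by (simp add: m_assoc)
    then have "R \<otimes> x = \<zero>" unfolding x(2) using bp(4) x(1) by (simp add: R_def)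
    then have "m x = \<zero>\<^bsub>D\<^esub>" unfolding m_def using lin_zero[OF hl] Uc by simp
    then show ?thesis unfolding f'_def using fc[OF x(1)] by simp
  qed
  ultimately show ?thesis by (intro exI[of _ f'] exI[of _ w']) simp
qed

end

section \<open>Passing to the limit over the blocks\<close>

context cuntz_lifting
begin

lemma stages:
  "\<exists>F W. \<forall>k. stage k (F k) (W k) \<and> (\<forall>x\<in>H. proj (B k) \<otimes> x = x \<longrightarrow> F (Suc k) x = F k x)"
proof -
  let ?P = "\<lambda>k (q :: ('a \<Rightarrow> 'd) \<times> 'd). stage k (fst q) (snd q)"
  let ?R = "\<lambda>k (q :: ('a \<Rightarrow> 'd) \<times> 'd) (q' :: ('a \<Rightarrow> 'd) \<times> 'd). \<forall>x\<in>H. proj (B k) \<otimes> x = x \<longrightarrow> fst q' x = fst q x"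
  have "\<exists>f. \<forall>k. ?P k (f k) \<and> ?R k (f k) (f (Suc k))"
  proof (rule dependent_nat_choice)
    show "\<exists>q. ?P 0 q" using stage_zero by (intro exI[of _ "(\<lambda>_. \<zero>\<^bsub>D\<^esub>, z True)"]) simp
  next
    fix q :: "('a \<Rightarrow> 'd) \<times> 'd" and k :: nat assume "?P k q"
    from stage_step[OF this] obtain f' w' where
      "stage (Suc k) f' w' \<and> (\<forall>x\<in>H. proj (B k) \<otimes> x = x \<longrightarrow> f' x = fst q x)" by (elim exE)
    then show "\<exists>q'. ?P (Suc k) q' \<and> ?R k q q'" by (intro exI[of _ "(f', w')"]) simp
  qed
  then obtain f where "\<forall>k. ?P k (f k) \<and> ?R k (f k) (f (Suc k))" ..
  then show ?thesis by (intro exI[of _ "\<lambda>k. fst (f k)"] exI[of _ "\<lambda>k. snd (f k)"]) simp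
qed

text \<open>Each \<open>x\<close> lies in the span of some block, and from there on the stages agree
  on it, so the limit is eventually constant and needs no estimate. Identities are checked at one
  level common to all elements involved.\<close>

lemma lift_on_H:
  "\<exists>f. lin f \<and> (\<forall>g\<in>carrier G. \<forall>x\<in>H. \<beta> g (f x) = f (\<alpha> g x))
    \<and> (\<forall>x\<in>H. \<forall>x'\<in>H. star D (f x) \<otimes>\<^bsub>D\<^esub> f x' = ip x x' \<odot>\<^bsub>D\<^esub> \<one>\<^bsub>D\<^esub>) \<and> (\<forall>x\<in>H. p (f x) = \<phi> x)"
proof -
  obtain F W where FW: "\<forall>k. stage k (F k) (W k) \<and> (\<forall>x\<in>H. proj (B k) \<otimes> x = x \<longrightarrow> F (Suc k) x = F k x)"
    using stages by (elim exE)
  then have st: "stage k (F k) (W k)" and ext: "x \<in> H \<Longrightarrow> proj (B k) \<otimes> x = x \<Longrightarrow> F (Suc k) x = F k x" for k x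
    by simp_all
  have mono: "proj (B j) \<otimes> x = x" if "k \<le> j" "x \<in> H" "proj (B k) \<otimes> x = x" for j k x
    using proj_mono[OF onset_B lift_Suc_mono_le[of B, OF B(2) that(1)], of x] that(2,3) by simp
  have const: "F j x = F k x" if "k \<le> j" "x \<in> H" "proj (B k) \<otimes> x = x" for j k x
    using that(1)
  proof (induction j rule: dec_induct)
    case (step j)
    then show ?case using ext[OF that(2) mono[OF _ that(2,3)], of j] by simp
  qed simp
  define f where "f x = F (SOME k. proj (B k) \<otimes> x = x) x" for x
  have lev: "\<exists>K. \<forall>j\<ge>K. proj (B j) \<otimes> x = x \<and> f x = F j x" if x: "x \<in> H" for x
  proof -
    define k where "k = (SOME k. proj (B k) \<otimes> x = x)"
    have k: "proj (B k) \<otimes> x = x"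
      using someI_ex[OF H_exhausted[OF B(1,2) s_absorbed x]] unfolding k_def .
    have fk: "f x = F k x" unfolding f_def k_def ..
    show ?thesis
    proof (intro exI[of _ k] allI impI conjI)
      fix j assume j: "k \<le> j"
      show "proj (B j) \<otimes> x = x" by (rule mono[OF j x k])
      show "f x = F j x" unfolding fk by (rule const[OF j x k, symmetric])
    qed
  qed
  have two: "\<exists>j. proj (B j) \<otimes> x = x \<and> f x = F j x \<and> proj (B j) \<otimes> x' = x' \<and> f x' = F j x' \<and> proj (B j) \<otimes> x'' = x'' \<and> f x'' = F j x''"
    if x: "x \<in> H" "x' \<in> H" "x'' \<in> H" for x x' x''
  proof -
    obtain a b c where "\<forall>j\<ge>a. proj (B j) \<otimes> x = x \<and> f x = F j x" "\<forall>j\<ge>b. proj (B j) \<otimes> x' = x' \<and> f x' = F j x'"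
      "\<forall>j\<ge>c. proj (B j) \<otimes> x'' = x'' \<and> f x'' = F j x''"
      using lev[OF x(1)] lev[OF x(2)] lev[OF x(3)] by (elim exE)
    then show ?thesis by (intro exI[of _ "max a (max b c)"]) simp
  qed
  have "lin f"
    unfolding lin_def
  proof (intro conjI ballI allI)
    fix x x' assume x: "x \<in> H" "x' \<in> H"
    obtain j where j: "proj (B j) \<otimes> x = x \<and> f x = F j x \<and> proj (B j) \<otimes> x' = x' \<and> f x' = F j x'
        \<and> proj (B j) \<otimes> (x \<oplus> x') = x \<oplus> x' \<and> f (x \<oplus> x') = F j (x \<oplus> x')"
      using two[OF x H.add[OF x]] ..
    then show "f (x \<oplus> x') = f x \<oplus>\<^bsub>D\<^esub> f x'" using linD(2)[OF stageD(1)[OF st[of j]] x] by simp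
  next
    fix c x assume x: "x \<in> H"
    obtain j where j: "proj (B j) \<otimes> x = x \<and> f x = F j x \<and> proj (B j) \<otimes> x = x \<and> f x = F j x
        \<and> proj (B j) \<otimes> (c \<odot> x) = c \<odot> x \<and> f (c \<odot> x) = F j (c \<odot> x)"
      using two[OF x x H.scale[OF x]] ..
    then show "f (c \<odot> x) = c \<odot>\<^bsub>D\<^esub> f x" using linD(3)[OF stageD(1)[OF st[of j]] x] by simp
  next
    fix x assume x: "x \<in> H"
    show "f x \<in> carrier D" unfolding f_def by (rule linD(1)[OF stageD(1)[OF st] x])
  qed
  moreover have "\<beta> g (f x) = f (\<alpha> g x)" if g: "g \<in> carrier G" and x: "x \<in> H" for g x
  proof -
    obtain j where j: "proj (B j) \<otimes> x = x \<and> f x = F j x \<and> proj (B j) \<otimes> x = x \<and> f x = F j x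
        \<and> proj (B j) \<otimes> \<alpha> g x = \<alpha> g x \<and> f (\<alpha> g x) = F j (\<alpha> g x)"
      using two[OF x x H_act[OF g x]] ..
    then show ?thesis using stageD(2)[OF st[of j] g x] by simp
  qed
  moreover have "star D (f x) \<otimes>\<^bsub>D\<^esub> f x' = ip x x' \<odot>\<^bsub>D\<^esub> \<one>\<^bsub>D\<^esub> \<and> p (f x) = \<phi> x" if x: "x \<in> H" "x' \<in> H" for x x'
  proof -
    obtain j where j: "proj (B j) \<otimes> x = x \<and> f x = F j x \<and> proj (B j) \<otimes> x' = x' \<and> f x' = F j x'
        \<and> proj (B j) \<otimes> x = x \<and> f x = F j x"
      using two[OF x x(1)] ..
    then show ?thesis using stageD(3)[OF st[of j] x] stageD(4)[OF st[of j] x(1)] by simp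
  qed
  ultimately show ?thesis by (intro exI[of _ f] conjI ballI) simp_all
qed

text \<open>The values of \<open>f\<close> on the generators satisfy the Cuntz relations, which
  yields \<open>\<psi>\<close>. At first \<open>\<psi>\<close> and \<open>f\<close> agree only on
  finite combinations of generators; the bound \<open>nrm D (f x) \<le> nrm A x\<close> extends this
  to the translates of generators, which are limits of such combinations. Equivariance and the image
  can then be compared on generators.\<close>

theorem lift_exists:
  "\<exists>\<psi>\<in>equivariant_hom G A \<alpha> D \<beta>. \<forall>a\<in>carrier A. p (\<psi> a) = \<phi> a"
proof -
  obtain f where "lin f \<and> (\<forall>g\<in>carrier G. \<forall>x\<in>H. \<beta> g (f x) = f (\<alpha> g x))
    \<and> (\<forall>x\<in>H. \<forall>x'\<in>H. star D (f x) \<otimes>\<^bsub>D\<^esub> f x' = ip x x' \<odot>\<^bsub>D\<^esub> \<one>\<^bsub>D\<^esub>) \<and> (\<forall>x\<in>H. p (f x) = \<phi> x)"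
    using lift_on_H ..
  then have f: "lin f" "\<And>g x. g \<in> carrier G \<Longrightarrow> x \<in> H \<Longrightarrow> \<beta> g (f x) = f (\<alpha> g x)"
    "\<And>x x'. x \<in> H \<Longrightarrow> x' \<in> H \<Longrightarrow> star D (f x) \<otimes>\<^bsub>D\<^esub> f x' = ip x x' \<odot>\<^bsub>D\<^esub> \<one>\<^bsub>D\<^esub>"
    "\<And>x. x \<in> H \<Longrightarrow> p (f x) = \<phi> x" by simp_all
  note fc = linD(1)[OF f(1)]
  have nrm_f: "nrm D (f x) \<le> nrm A x" if x: "x \<in> H" for x
  proof -
    have "(nrm D (f x))\<^sup>2 = cmod (ip x x) * nrm D \<one>\<^bsub>D\<^esub>"
      using D.nrm_star_mult[OF fc[OF x]] by (simp add: f(3)[OF x x] D.nrm_smult)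
    also have "\<dots> \<le> cmod (ip x x) * 1" by (intro mult_left_mono D.nrm_one_le) simp
    also have "\<dots> = (nrm A x)\<^sup>2"
      using nrm_star_mult[OF H_carrier[OF x]] nrm_one[OF nonzero] by (simp add: ip[OF x x] nrm_smult)
    finally show ?thesis by (rule power2_le_imp_le) (use x in \<open>simp add: nrm_nonneg\<close>)
  qed
  have "star D (f (s i)) \<otimes>\<^bsub>D\<^esub> f (s j) = (if i = j then \<one>\<^bsub>D\<^esub> else \<zero>\<^bsub>D\<^esub>)" for i j
  proof -
    have "ip (s i) (s j) = (if i = j then 1 else 0)" by (rule ip_eqI) (simp_all add: s_mem_H s_star_s)
    then show ?thesis using f(3)[OF s_mem_H s_mem_H, of i j] by simp
  qed
  then have "isometries_orthogonal_ranges D (\<lambda>j. f (s j))"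
    unfolding D.isometries_orthogonal_ranges_iff by (simp add: D.orthonormal_def fc s_mem_H)
  from Cuntz_infinity_universal[OF cuntz D.unital_cstar_axioms this]
  obtain \<psi> where \<psi>: "\<psi> \<in> cstar_hom A D" "\<forall>j. \<psi> (s j) = f (s j)" ..
  interpret psi: unital_cstar_hom A D \<psi> by unfold_locales (rule \<psi>(1))
  have psum_H: "psum c n \<in> H" for c n
    by (induction n) (simp_all add: H_zero psum_Suc H.add H.scale s_mem_H)
  have psi_psum: "\<psi> (psum c n) = f (psum c n)" for c n
  proof (induction n)
    case (Suc n)
    then show ?case
      using \<psi>(2) linD(2)[OF f(1) H.scale[OF s_mem_H] psum_H] linD(3)[OF f(1) s_mem_H]
      by (simp add: psum_Suc psi.add psi.smult)
  qed (simp add: lin_zero[OF f(1)])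
  have psi_act: "\<psi> (\<alpha> g (s k)) = f (\<alpha> g (s k))" if g: "g \<in> carrier G" for g k
  proof -
    let ?x = "\<alpha> g (s k)"
    have xH: "?x \<in> H" using g by (rule H.gen)
    obtain c where c: "conv (psum c) ?x" using limit[OF g] ..
    have "D.conv (\<lambda>n. \<psi> (psum c n)) (f ?x)"
    proof (rule D.conv_bound[where b = "\<lambda>n. nrm A (psum c n \<ominus> ?x)"])
      show "(\<lambda>n. nrm A (psum c n \<ominus> ?x)) \<longlonglongrightarrow> 0" using c by (simp add: conv_def)
      show "nrm D (\<psi> (psum c n) \<ominus>\<^bsub>D\<^esub> f ?x) \<le> nrm A (psum c n \<ominus> ?x)" for n
        unfolding psi_psum lin_diff[OF f(1) psum_H xH, symmetric] by (rule nrm_f[OF H_diff[OF psum_H xH]])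
    qed (use fc[OF xH] in simp_all)
    then show ?thesis by (rule D.conv_unique[OF psi.conv[OF c]])
  qed
  have "\<psi> (\<alpha> g x) = \<beta> g (\<psi> x)" if g: "g \<in> carrier G" and x: "x \<in> carrier A" for g x
  proof -
    have "(\<psi> \<circ> \<alpha> g) x = (\<beta> g \<circ> \<psi>) x"
    proof (rule unital_cstar_hom.eq_of_generators[OF unital_cstar_hom_comp[OF act_hom[OF g] psi.unital_cstar_hom_axioms]
          unital_cstar_hom_comp[OF psi.unital_cstar_hom_axioms D.act_hom[OF g]] gen _ x])
      fix x assume "x \<in> range s"
      then obtain k where "x = s k" ..
      then show "(\<psi> \<circ> \<alpha> g) x = (\<beta> g \<circ> \<psi>) x"
        using psi_act[OF g, of k] f(2)[OF g s_mem_H, of k] \<psi>(2) by simp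
    qed
    then show ?thesis by simp
  qed
  moreover have "p (\<psi> x) = \<phi> x" if x: "x \<in> carrier A" for x
  proof -
    have "(p \<circ> \<psi>) x = \<phi> x"
    proof (rule unital_cstar_hom.eq_of_generators[OF unital_cstar_hom_comp[OF psi.unital_cstar_hom_axioms
          p.unital_cstar_hom_axioms] phi.unital_cstar_hom_axioms gen _ x])
      fix x assume "x \<in> range s"
      then obtain k where "x = s k" ..
      then show "(p \<circ> \<psi>) x = \<phi> x" using f(4)[OF s_mem_H, of k] \<psi>(2) by simp
    qed
    then show ?thesis by simp
  qed
  ultimately show ?thesis using \<psi>(1) by (intro bexI[of _ \<psi>]) (simp_all add: equivariant_hom_def)
qed

end

section \<open>Equivariant semiprojectivity\<close>

context ideal_chain
begin

text \<open>\<open>\<one>\<close> lies in \<open>J\<close>, so its norm is below 1 at some stage.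
  The unit of a nonzero C*-algebra has norm 1, so that stage is the zero algebra and the zero map is
  a unital lift.\<close>

lemma lift_zero:
  assumes zero: "\<one>\<^bsub>cstar_Quot C J\<^esub> = \<zero>\<^bsub>cstar_Quot C J\<^esub>" and phi: "unital_cstar_hom A (cstar_Quot C J) \<phi>"
  shows "\<exists>n. \<exists>\<psi> \<in> equivariant_hom G A \<alpha> (cstar_Quot C (Jn n)) (quotient_action C (Jn n) \<gamma>).
    \<forall>a\<in>carrier A. quotient_map C J (\<psi> a) = \<phi> a"
proof -
  interpret phi: unital_cstar_hom A "cstar_Quot C J" \<phi> by (rule phi)
  have "lim.cls \<one> = lim.cls \<zero>" using zero unfolding lim.Q_one lim.Q_zero .
  then have "\<one> \<ominus> \<zero> \<in> J" by (rule lim.cls_eq_iff[THEN iffD1, OF one_closed zero_closed])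
  then have "\<one> \<in> J" by (simp add: minus_eq)
  then have "\<exists>n. nrm (cstar_Quot C (Jn n)) (Jn n +> \<one>) < 1"
  proof (rule limit_small[OF _ zero_less_one])
    fix N assume N: "\<And>n. N \<le> n \<Longrightarrow> nrm (cstar_Quot C (Jn n)) (Jn n +> \<one>) < 1"
    show ?thesis using N[OF order_refl] ..
  qed
  then obtain n where n: "nrm (cstar_Quot C (Jn n)) (Jn n +> \<one>) < 1" ..
  interpret K: invariant_ideal C G \<gamma> "Jn n"
    by (intro invariant_ideal.intro invariant_ideal_axioms.intro Jn_ideal chain_invariant finite_G_algebra_axioms)
  interpret q: equivariant_quotient "cstar_Quot C (Jn n)" G "quotient_action C (Jn n) \<gamma>"
     "cstar_Quot C J" "quotient_action C J \<gamma>" "quotient_map C J"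
    by (rule stage_quotient)
  have one: "\<one>\<^bsub>K.Q\<^esub> = \<zero>\<^bsub>K.Q\<^esub>"
  proof (rule ccontr)
    assume "\<not> ?thesis"
    then have "nrm K.Q \<one>\<^bsub>K.Q\<^esub> = 1" by (rule q.D.nrm_one)
    then show False using n by (simp add: K.Q_one)
  qed
  have triv: "x = \<zero>\<^bsub>K.Q\<^esub>" if "x \<in> carrier K.Q" for x
    using q.D.r_one[OF that] that unfolding one by simp
  have trivQ: "x = \<zero>\<^bsub>cstar_Quot C J\<^esub>" if "x \<in> carrier (cstar_Quot C J)" for x
    using phi.B.r_one[OF that] that unfolding zero by simp
  have "(\<lambda>_. \<zero>\<^bsub>K.Q\<^esub>) \<in> equivariant_hom G A \<alpha> K.Q K.qact"
    unfolding equivariant_hom_def cstar_hom_def ring_hom_def by (simp add: one q.D.act_zero)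
  moreover have "quotient_map C J \<zero>\<^bsub>K.Q\<^esub> = \<phi> a" if "a \<in> carrier A" for a
    using trivQ[OF phi.closed[OF that]] by simp
  ultimately show ?thesis by (intro exI[of _ n] bexI[of _ "\<lambda>_. \<zero>\<^bsub>K.Q\<^esub>"]) simp_all
qed

text \<open>A single application of \<open>lift_orthonormal\<close> fixes \<open>n\<close>;
  everything afterwards happens over this one stage.\<close>

lemma lift_cuntz:
  fixes A :: "'x cstar"
  assumes A: "cuntz_action A G \<alpha> s" and phi: "unital_cstar_hom A (cstar_Quot C J) \<phi>"
    and equi: "\<And>g a. \<lbrakk>g \<in> carrier G; a \<in> carrier A\<rbrakk> \<Longrightarrow> \<phi> (\<alpha> g a) = quotient_action C J \<gamma> g (\<phi> a)"
  shows "\<exists>n. \<exists>\<psi> \<in> equivariant_hom G A \<alpha> (cstar_Quot C (Jn n)) (quotient_action C (Jn n) \<gamma>).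
    \<forall>a\<in>carrier A. quotient_map C J (\<psi> a) = \<phi> a"
proof -
  interpret A: cuntz_action A G \<alpha> s by (rule A)
  interpret phi: unital_cstar_hom A "cstar_Quot C J" \<phi> by (rule phi)
  obtain B e where B: "\<And>k. A.good (B k)" "\<And>k. B k \<subseteq> B (Suc k)" "B 0 = {}"
    and e: "\<And>k. e k \<in> A.H" "\<And>k. star A (e k) \<otimes>\<^bsub>A\<^esub> e k = \<one>\<^bsub>A\<^esub>" "\<And>k. A.proj (B k) \<otimes>\<^bsub>A\<^esub> e k = \<zero>\<^bsub>A\<^esub>"
      "\<And>k. A.proj (B (Suc k)) \<otimes>\<^bsub>A\<^esub> e k = e k" and s_abs: "\<And>k. A.proj (B (Suc k)) \<otimes>\<^bsub>A\<^esub> s k = s k"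
  proof (rule A.blocks)
    fix B e assume a: "\<And>k. A.good (B k)" "\<And>k. B k \<subseteq> B (Suc k)" "B 0 = {}"
      "\<And>k. e k \<in> A.H" "\<And>k. star A (e k) \<otimes>\<^bsub>A\<^esub> e k = \<one>\<^bsub>A\<^esub>" "\<And>k. A.proj (B k) \<otimes>\<^bsub>A\<^esub> e k = \<zero>\<^bsub>A\<^esub>"
      "\<And>k. A.proj (B (Suc k)) \<otimes>\<^bsub>A\<^esub> e k = e k" "\<And>k. A.proj (B (Suc k)) \<otimes>\<^bsub>A\<^esub> s k = s k"
    show thesis by (rule that) (rule a)+
  qed
  \<comment> \<open>\<open>e 1\<close> is what stage 0 asks for. \<open>e 2\<close> is orthogonal to
    the invariant span of \<open>B 2\<close>, which contains \<open>e 1\<close>, so all translates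
    of the two vectors are orthogonal.\<close>
  define d where "d b = e (if b then 1 else 2)" for b
  have dH: "d b \<in> A.H" and d1: "star A (d b) \<otimes>\<^bsub>A\<^esub> d b = \<one>\<^bsub>A\<^esub>" for b by (simp_all add: d_def e)
  have dc: "d b \<in> carrier A" for b using dH by simp
  have cross: "star A (d True) \<otimes>\<^bsub>A\<^esub> \<alpha> g (d False) = \<zero>\<^bsub>A\<^esub>" if g: "g \<in> carrier G" for g
    by (rule A.proj_cross[OF B(1)[of 2] dc _ dc _ g]) (use e(3)[of 2] e(4)[of 1] in \<open>simp_all add: d_def numeral_2_eq_2\<close>)
  define I where "I = A.\<Gamma> \<times> (UNIV :: bool set)"
  define x where "x i = fst i (d (snd i) \<otimes>\<^bsub>A\<^esub> A.reg)" for i :: "('x \<Rightarrow> 'x) \<times> bool"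
  have xc: "x i \<in> carrier A" if "i \<in> I" for i using that dc by (auto simp: x_def I_def)
  have tf: "star A (x (\<gamma>1, True)) \<otimes>\<^bsub>A\<^esub> x (\<gamma>2, False) = \<zero>\<^bsub>A\<^esub>" if \<gamma>: "\<gamma>1 \<in> A.\<Gamma>" "\<gamma>2 \<in> A.\<Gamma>" for \<gamma>1 \<gamma>2
  proof -
    obtain h where h: "h \<in> carrier G" "\<gamma>1 = \<alpha> h" using \<gamma>(1) by (auto simp: A.\<Gamma>_def)
    have 1: "star A (\<alpha> h (d True \<otimes>\<^bsub>A\<^esub> A.reg)) \<otimes>\<^bsub>A\<^esub> \<alpha> g (d False) = \<zero>\<^bsub>A\<^esub>" if g: "g \<in> carrier G" for g
    proof -
      have i: "inv\<^bsub>G\<^esub> h \<otimes>\<^bsub>G\<^esub> g \<in> carrier G" using g h by simp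
      have gg: "h \<otimes>\<^bsub>G\<^esub> (inv\<^bsub>G\<^esub> h \<otimes>\<^bsub>G\<^esub> g) = g" using g h by (simp flip: G.m_assoc)
      have 2: "\<alpha> g (d False) = \<alpha> h (\<alpha> (inv\<^bsub>G\<^esub> h \<otimes>\<^bsub>G\<^esub> g) (d False))"
        using A.act_mult_group[OF h(1) i dc] gg by simp
      have "star A (\<alpha> h (d True \<otimes>\<^bsub>A\<^esub> A.reg)) \<otimes>\<^bsub>A\<^esub> \<alpha> g (d False)
          = \<alpha> h (star A A.reg \<otimes>\<^bsub>A\<^esub> (star A (d True) \<otimes>\<^bsub>A\<^esub> \<alpha> (inv\<^bsub>G\<^esub> h \<otimes>\<^bsub>G\<^esub> g) (d False)))"
        unfolding 2 using dc h(1) i by (simp add: A.act_mult A.act_star A.star_mult A.m_assoc)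
      then show ?thesis unfolding cross[OF i] using h(1) by simp
    qed
    show ?thesis
      unfolding x_def h(2) fst_conv snd_conv by (rule A.reg_cross[OF _ dc 1 \<gamma>(2)]) (use h(1) dc in simp_all)
  qed
  have ft: "star A (x (\<gamma>1, False)) \<otimes>\<^bsub>A\<^esub> x (\<gamma>2, True) = \<zero>\<^bsub>A\<^esub>" if \<gamma>: "\<gamma>1 \<in> A.\<Gamma>" "\<gamma>2 \<in> A.\<Gamma>" for \<gamma>1 \<gamma>2
    using arg_cong[OF tf[OF \<gamma>(2,1)], of "star A"] xc \<gamma> by (simp add: A.star_mult I_def)
  have bb: "star A (x (\<gamma>1, b)) \<otimes>\<^bsub>A\<^esub> x (\<gamma>2, b) = (if \<gamma>1 = \<gamma>2 then \<one>\<^bsub>A\<^esub> else \<zero>\<^bsub>A\<^esub>)"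
    if "\<gamma>1 \<in> A.\<Gamma>" "\<gamma>2 \<in> A.\<Gamma>" for \<gamma>1 \<gamma>2 b
    using A.reg_orthonormal[OF dH d1, of b] that by (simp add: A.orthonormal_def x_def)
  have xx: "star A (x i) \<otimes>\<^bsub>A\<^esub> x j = (if i = j then \<one>\<^bsub>A\<^esub> else \<zero>\<^bsub>A\<^esub>)" if ij: "i \<in> I" "j \<in> I" for i j
  proof -
    define \<gamma>1 \<gamma>2 b1 b2 where "\<gamma>1 = fst i" "\<gamma>2 = fst j" "b1 = snd i" "b2 = snd j"
    then have ie: "i = (\<gamma>1, b1)" "j = (\<gamma>2, b2)" by simp_all
    have \<gamma>: "\<gamma>1 \<in> A.\<Gamma>" "\<gamma>2 \<in> A.\<Gamma>" using ij unfolding ie by (simp_all add: I_def)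
    show ?thesis unfolding ie using bb[OF \<gamma>] tf[OF \<gamma>] ft[OF \<gamma>] by (cases b1; cases b2) simp_all
  qed
  have orth: "phi.B.orthonormal I (\<lambda>i. \<phi> (x i))"
    unfolding phi.B.orthonormal_def
  proof (intro conjI ballI)
    fix i j assume ij: "i \<in> I" "j \<in> I"
    have "star (cstar_Quot C J) (\<phi> (x i)) \<otimes>\<^bsub>cstar_Quot C J\<^esub> \<phi> (x j) = \<phi> (star A (x i) \<otimes>\<^bsub>A\<^esub> x j)"
      using xc[OF ij(1)] xc[OF ij(2)] by (simp add: phi.mult phi.star)
    then show "star (cstar_Quot C J) (\<phi> (x i)) \<otimes>\<^bsub>cstar_Quot C J\<^esub> \<phi> (x j)
        = (if i = j then \<one>\<^bsub>cstar_Quot C J\<^esub> else \<zero>\<^bsub>cstar_Quot C J\<^esub>)"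
      unfolding xx[OF ij] by simp
  qed (use xc in simp)
  define act where "act g i = (A.tr g (fst i), snd i)" for g and i :: "('x \<Rightarrow> 'x) \<times> bool"
  have "\<exists>n r. unital_cstar.orthonormal (cstar_Quot C (Jn n)) I r \<and> (\<forall>i\<in>I. quotient_map C J (r i) = \<phi> (x i))
     \<and> (\<forall>g\<in>carrier G. \<forall>i\<in>I. quotient_action C (Jn n) \<gamma> g (r i) = r (act g i))"
  proof (rule lift_orthonormal[OF _ orth, of act])
    show "finite I" by (simp add: I_def A.finite_\<Gamma>)
    have fI: "fst i \<in> A.\<Gamma>" if "i \<in> I" for i using that by (simp add: I_def mem_Times_iff)
    show "act g i \<in> I" if "g \<in> carrier G" "i \<in> I" for g i
      using A.tr_mem[OF that(1) fI[OF that(2)]] by (simp add: act_def I_def)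
    show "act (g \<otimes>\<^bsub>G\<^esub> h) i = act g (act h i)" if "g \<in> carrier G" "h \<in> carrier G" "i \<in> I" for g h i
      unfolding act_def fst_conv snd_conv A.tr_mult[OF that(1,2) fI[OF that(3)]] ..
    show "act \<one>\<^bsub>G\<^esub> i = i" if "i \<in> I" for i
      unfolding act_def A.tr_one[OF fI[OF that]] by (rule prod.collapse)
    show "quotient_action C J \<gamma> g (\<phi> (x i)) = \<phi> (x (act g i))" if "g \<in> carrier G" "i \<in> I" for g i
    proof -
      have "\<alpha> g (x i) = x (act g i)"
        unfolding x_def act_def fst_conv snd_conv
        by (rule A.tr_apply[OF fI[OF that(2)] A.m_closed[OF dc A.reg_closed]])
      then show ?thesis using equi[OF that(1) xc[OF that(2)]] by (simp only:)
    qed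
    fix n r assume "unital_cstar.orthonormal (cstar_Quot C (Jn n)) I r"
      "\<And>i. i \<in> I \<Longrightarrow> quotient_map C J (r i) = \<phi> (x i)"
      "\<And>g i. g \<in> carrier G \<Longrightarrow> i \<in> I \<Longrightarrow> quotient_action C (Jn n) \<gamma> g (r i) = r (act g i)"
    then show ?thesis by (intro exI[of _ n] exI[of _ r] conjI ballI)
  qed
  then obtain n r where r: "unital_cstar.orthonormal (cstar_Quot C (Jn n)) I r"
    "\<forall>i\<in>I. quotient_map C J (r i) = \<phi> (x i)"
    "\<forall>g\<in>carrier G. \<forall>i\<in>I. quotient_action C (Jn n) \<gamma> g (r i) = r (act g i)" by (elim exE conjE)
  have L: "cuntz_lifting A G \<alpha> s (cstar_Quot C (Jn n)) (quotient_action C (Jn n) \<gamma>)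
     (cstar_Quot C J) (quotient_action C J \<gamma>) (quotient_map C J) \<phi> B e r"
  proof (rule cuntz_lifting.intro[OF A stage_quotient phi], rule cuntz_lifting_axioms.intro, goal_cases)
    case 1 then show ?case by (rule equi)
  next
    case 2 show ?case by (rule B)
  next
    case 3 show ?case by (rule B)
  next
    case 4 show ?case by (rule B)
  next
    case 5 show ?case by (rule e)
  next
    case 6 show ?case by (rule e)
  next
    case 7 show ?case by (rule e)
  next
    case 8 show ?case by (rule e)
  next
    case 9 show ?case by (rule s_abs)
  next
    case 10 show ?case using r(1) by (simp add: I_def)
  next
    case (11 g \<delta> b)
    then show ?case using r(3) by (simp add: I_def act_def)
  next
    case (12 \<delta>)
    then show ?case using r(2) by (simp add: I_def x_def d_def)
  qed
  show ?thesis by (rule exI[of _ n]) (rule cuntz_lifting.lift_exists[OF L])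
qed

end

theorem theorem4p16:
  fixes G :: "('g, 'm) monoid_scheme"
    and A :: "'a cstar"
    and s :: "nat \<Rightarrow> 'a"
    and \<alpha> :: "'g \<Rightarrow> 'a \<Rightarrow> 'a"
  assumes "group G" and "finite (carrier G)"
    and "Cuntz_infinity A s"
    and "quasifree_action G A s \<alpha>"
  shows "equivariantly_semiprojective TYPE('c) G A \<alpha>"
proof -
  have GA: "unital_G_algebra G A \<alpha>" using assms(4) by (simp add: quasifree_action_def)
  interpret A: finite_G_algebra A G \<alpha>
    using GA assms(2)
    by (intro finite_G_algebra.intro finite_G_algebra_axioms.intro) (simp_all add: unital_G_algebra_def)
  interpret o: orthonormal_sequence A s
    using assms(3) by unfold_locales (simp add: Cuntz_infinity_def A.isometries_orthogonal_ranges_iff)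
  have main: "\<exists>n. \<exists>\<psi> \<in> equivariant_hom G A \<alpha> (cstar_Quot C (Jn n)) (quotient_action C (Jn n) \<gamma>).
      \<forall>a\<in>carrier A. quotient_map C J (\<psi> a) = \<phi> a"
    if C: "unital_G_algebra G C \<gamma>" and Jn: "\<forall>n. closed_ideal C (Jn n) \<and> invariant G \<gamma> (Jn n)"
      "\<forall>n. Jn n \<subseteq> Jn (Suc n)" and J: "J = cstar_top C closure_of (\<Union>n. Jn n)"
      and \<phi>: "\<phi> \<in> equivariant_hom G A \<alpha> (cstar_Quot C J) (quotient_action C J \<gamma>)"
    for C :: "'c cstar" and \<gamma> Jn J \<phi>
  proof -
    interpret C: finite_G_algebra C G \<gamma>
      using C assms(2)
      by (intro finite_G_algebra.intro finite_G_algebra_axioms.intro) (simp_all add: unital_G_algebra_def)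
    interpret C: ideal_chain C G \<gamma> Jn J
      by unfold_locales (use Jn J in simp_all)
    have phi: "unital_cstar_hom A (cstar_Quot C J) \<phi>"
      using \<phi> C.lim.Q_cstar A.unital_cstar_axioms
      by (simp add: equivariant_hom_def unital_cstar_hom_def unital_cstar_hom_axioms_def)
    interpret phi: unital_cstar_hom A "cstar_Quot C J" \<phi> by (rule phi)
    show ?thesis
    \<comment> \<open>Showing that \<open>A\<close> is nonzero would take a concrete model of the
      Cuntz relations; the zero algebra is treated directly instead.\<close>
    proof (cases "\<one>\<^bsub>A\<^esub> = \<zero>\<^bsub>A\<^esub>")
      case True
      have "\<one>\<^bsub>cstar_Quot C J\<^esub> = \<zero>\<^bsub>cstar_Quot C J\<^esub>" using arg_cong[OF True, of \<phi>] by simp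
      then show ?thesis by (rule C.lift_zero[OF _ phi])
    next
      case False
      interpret c: cuntz_action A G \<alpha> s
      proof unfold_locales
        show "Cuntz_infinity A s" by (rule assms(3))
        show "\<exists>c. A.conv (o.psum c) (\<alpha> g (s k))" if "g \<in> carrier G" for g k
          using quasifree_limit[OF assms(3,4) that, of k] unfolding o.psum_def[abs_def] .
        show "\<one>\<^bsub>A\<^esub> \<noteq> \<zero>\<^bsub>A\<^esub>" by (rule False)
      qed
      show ?thesis
        by (rule C.lift_cuntz[OF c.cuntz_action_axioms phi]) (use \<phi> in \<open>simp add: equivariant_hom_def\<close>)
    qed
  qed
  show ?thesis unfolding equivariantly_semiprojective_def by (intro conjI allI impI GA, rule main)
qed

end
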